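(* Let $H_0$ be a maximal accumulative operator on a complex separable Hilbert space, $0\le V=V^*\in S^1$, and define $H=H_0-iV$. Let $$\xi(\lambda)=\frac1\pi\lim_{\varepsilon\to0^+}\arg\big({\det}_{H/H_0}(\lambda+i\varepsilon)\big)\quad\text{for a.e. }\lambda\in\mathbb{R}.$$ Then $$ {\det}_{H/H_0}(z)=\big|{\det}_{H/H_0}(i)\big|\exp\left((A)\int_{\mathbb{R}}\frac{1+z\lambda}{\lambda-z}\,\xi(\lambda)\,\frac{d\lambda}{1+\lambda^2}\right),\quad z\in\mathbb{C}_+, $$ where the $A$-integral is that of the function $\lambda\mapsto\frac{1+z\lambda}{\lambda-z}\xi(\lambda)$, considered as an element of the space $(A)L^1\big(\mathbb{R},\frac{d\lambda}{1+\lambda^2}\big)$.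
   Context: $\mathbb{C}_+=\{z\in\mathbb{C}:\mathrm{Im}(z)>0\}$; $S^1$ is the trace class. A closed densely defined operator $A$ is accumulative if $\mathrm{Im}\langle Ah,h\rangle\le0$ for every $h$ in its domain; it is maximal accumulative if it has no proper accumulative extension, which guarantees that $\mathbb{C}_+$ is contained in its resolvent set. The perturbation determinant is the Fredholm determinant ${\det}_{H/H_0}(z)=\det\big((H-z)(H_0-z)^{-1}\big)=\det\big(I-iV(H_0-z)^{-1}\big)$, $z\in\mathbb{C}_+$. It has no zeros in $\mathbb{C}_+$, and $\arg({\det}_{H/H_0}(z))$ denotes $\mathrm{Im}\log({\det}_{H/H_0}(z))$, where $\log({\det}_{H/H_0})$ is the analytic branch on $\mathbb{C}_+$ with $\log({\det}_{H/H_0}(iy))\to0$ as $y\to+\infty$. $A$-integral: for a $\sigma$-finite measure space $(X,\mathcal{A},\mu)$, $L^1_{w,0}(X,\mu)$ is the set of all measurable (complex-valued) functions $f$ satisfying $\mu\{x:|f(x)|>t\}=o(1/t)$ as $t\to\infty$ and as $t\to0^+$ (for finite $\mu$ the condition as $t\to0^+$ is automatic). A function $f$ is $A$-integrable if $f\in L^1_{w,0}(X,\mu)$ and the limit $$(A)\int_Xf(x)\,d\mu(x):=\lim_{b\to0,\ B\to\infty}\int_{\{y\in X:\,b\le|f(y)|\le B\}}f(x)\,d\mu(x)$$ exists; $(A)L^1(X,\mu)$ is the set of all $A$-integrable functions. *)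

theory Defs
  imports "HOL-Analysis.Analysis"
begin

section \<open>Complex Hilbert spaces\<close>

text \<open>Inner products are linear in the first argument.  Positive definiteness is contained
  in the last axiom, since the norm of the superclass is positive definite.\<close>

class complex_inner = real_normed_vector +
  fixes scaleC :: "complex \<Rightarrow> 'a \<Rightarrow> 'a" (infixr "*\<^sub>C" 75)
    and cinner :: "'a \<Rightarrow> 'a \<Rightarrow> complex"
  assumes scaleC_add_right: "a *\<^sub>C (x + y) = a *\<^sub>C x + a *\<^sub>C y"
    and scaleC_add_left: "(a + b) *\<^sub>C x = a *\<^sub>C x + b *\<^sub>C x"
    and scaleC_scaleC: "a *\<^sub>C b *\<^sub>C x = (a * b) *\<^sub>C x"
    and scaleR_scaleC: "r *\<^sub>R x = complex_of_real r *\<^sub>C x"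
    and cinner_commute: "cinner x y = cnj (cinner y x)"
    and cinner_add_left: "cinner (x + y) z = cinner x z + cinner y z"
    and cinner_scaleC_left: "cinner (a *\<^sub>C x) y = a * cinner x y"
    and cinner_self: "cinner x x = complex_of_real ((norm x)\<^sup>2)"

class complex_hilbert = complex_inner + complete_space

instantiation complex :: complex_hilbert
begin

definition scaleC_complex :: "complex \<Rightarrow> complex \<Rightarrow> complex"
  where "scaleC_complex a x = a * x"

definition cinner_complex :: "complex \<Rightarrow> complex \<Rightarrow> complex"
  where "cinner_complex x y = x * cnj y"

instance
proof
  fix a b x y z :: complex and r :: real
  show "a *\<^sub>C (x + y) = a *\<^sub>C x + a *\<^sub>C y"
    unfolding scaleC_complex_def by (rule distrib_left)
  show "(a + b) *\<^sub>C x = a *\<^sub>C x + b *\<^sub>C x"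
    unfolding scaleC_complex_def by (rule distrib_right)
  show "a *\<^sub>C b *\<^sub>C x = (a * b) *\<^sub>C x"
    unfolding scaleC_complex_def by (rule mult.assoc [symmetric])
  show "r *\<^sub>R x = complex_of_real r *\<^sub>C x"
    unfolding scaleC_complex_def by (rule scaleR_conv_of_real)
  show "cinner x y = cnj (cinner y x)"
    unfolding cinner_complex_def by simp
  show "cinner (x + y) z = cinner x z + cinner y z"
    unfolding cinner_complex_def by (rule distrib_right)
  show "cinner (a *\<^sub>C x) y = a * cinner x y"
    unfolding cinner_complex_def scaleC_complex_def by (rule mult.assoc)
  show "cinner x x = complex_of_real ((norm x)\<^sup>2)"
    unfolding cinner_complex_def by (rule complex_norm_square [symmetric])
qed

end

definition orthonormal :: "'h::complex_inner set \<Rightarrow> bool"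
  where "orthonormal B \<longleftrightarrow> (\<forall>x\<in>B. \<forall>y\<in>B. cinner x y = (if x = y then 1 else 0))"

definition orthonormal_basis :: "'h::complex_inner set \<Rightarrow> bool"
  where "orthonormal_basis B \<longleftrightarrow>
    orthonormal B \<and> (\<forall>x. (\<forall>e\<in>B. cinner x e = 0) \<longrightarrow> x = 0)"

lemma orthonormal_basis_exists: "\<exists>B::'h::complex_inner set. orthonormal_basis B"
proof -
  have "\<exists>M\<in>Collect orthonormal. \<forall>X\<in>Collect orthonormal. M \<subseteq> X \<longrightarrow> X = (M :: 'h set)"
  proof (rule subset_Zorn)
    fix C :: "'h set set"
    assume C: "subset.chain (Collect orthonormal) C"
    have "orthonormal (\<Union>C)"
      unfolding orthonormal_def
    proof (intro ballI)
      fix x y assume "x \<in> \<Union>C" "y \<in> \<Union>C"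
      then obtain X Y where XY: "X \<in> C" "Y \<in> C" "x \<in> X" "y \<in> Y" by blast
      then have "X \<subseteq> Y \<or> Y \<subseteq> X" "orthonormal X" "orthonormal Y"
        using C unfolding subset_chain_def by blast+
      with XY show "cinner x y = (if x = y then 1 else 0)"
        unfolding orthonormal_def by blast
    qed
    then show "\<exists>U\<in>Collect orthonormal. \<forall>X\<in>C. X \<subseteq> U" by blast
  qed
  then obtain M :: "'h set" where M: "orthonormal M"
    and max: "\<And>X. orthonormal X \<Longrightarrow> M \<subseteq> X \<Longrightarrow> X = M" by blast
  have "x = 0" if x: "\<forall>e\<in>M. cinner x e = 0" for x
  proof (rule ccontr)
    assume nz: "x \<noteq> 0"
    define u where "u = complex_of_real (1 / norm x) *\<^sub>C x"
    have "norm u = 1"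
      using nz unfolding u_def scaleR_scaleC [symmetric] by simp
    then have uu: "cinner u u = 1" by (simp add: cinner_self)
    have ue: "cinner u e = 0" if "e \<in> M" for e
      using x that by (simp add: u_def cinner_scaleC_left)
    then have eu: "cinner e u = 0" if "e \<in> M" for e
      using that cinner_commute[of e u] by simp
    have "u \<notin> M" using ue uu by force
    moreover have "orthonormal (insert u M)"
      using M uu ue eu \<open>u \<notin> M\<close> unfolding orthonormal_def by auto
    ultimately show False using max by blast
  qed
  with M show ?thesis unfolding orthonormal_basis_def by blast
qed

text \<open>Traces and determinants are computed in one fixed orthonormal basis.  For the operators
  they are applied to, the values do not depend on this choice.\<close>

definition some_basis :: "'h::complex_inner set"
  where "some_basis = (SOME B. orthonormal_basis B)"

lemma orthonormal_basis_some_basis: "orthonormal_basis (some_basis :: 'h::complex_inner set)"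
  unfolding some_basis_def by (rule someI_ex) (rule orthonormal_basis_exists)


section \<open>Bounded operators, trace class, Fredholm determinant\<close>

definition bounded_op :: "('h::complex_inner \<Rightarrow> 'h) \<Rightarrow> bool"
  where "bounded_op T \<longleftrightarrow> bounded_linear T \<and> (\<forall>a x. T (a *\<^sub>C x) = a *\<^sub>C T x)"

definition selfadjoint_op :: "('h::complex_inner \<Rightarrow> 'h) \<Rightarrow> bool"
  where "selfadjoint_op T \<longleftrightarrow> bounded_op T \<and> (\<forall>x y. cinner (T x) y = cinner x (T y))"

definition positive_op :: "('h::complex_inner \<Rightarrow> 'h) \<Rightarrow> bool"
  where "positive_op T \<longleftrightarrow> selfadjoint_op T \<and> (\<forall>x. 0 \<le> Re (cinner (T x) x))"

text \<open>\<open>P\<close> is the absolute value \<open>\<bar>T\<bar>\<close>, i.e. the positive operator with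
  \<open>P\<^sup>2 = T\<^sup>*T\<close>.\<close>

definition is_abs_op :: "('h::complex_inner \<Rightarrow> 'h) \<Rightarrow> ('h \<Rightarrow> 'h) \<Rightarrow> bool"
  where "is_abs_op P T \<longleftrightarrow>
    positive_op P \<and> (\<forall>x y. cinner (P (P x)) y = cinner (T x) (T y))"

definition trace_class :: "('h::complex_hilbert \<Rightarrow> 'h) \<Rightarrow> bool"
  where "trace_class T \<longleftrightarrow> bounded_op T \<and>
    (\<exists>P. is_abs_op P T \<and> (\<lambda>e. Re (cinner (P e) e)) summable_on some_basis)"

text \<open>The determinant of the matrix \<open>(\<langle>T e, f\<rangle>)\<close>, \<open>e, f \<in> F\<close>, by the Leibniz formula.\<close>

definition minor :: "('h::complex_inner \<Rightarrow> 'h) \<Rightarrow> 'h set \<Rightarrow> complex"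
  where "minor T F =
    (\<Sum>p | p permutes F. of_int (sign p) * (\<Prod>e\<in>F. cinner (T e) (p e)))"

text \<open>The trace of the \<open>k\<close>-th exterior power of \<open>T\<close>: the vectors
  \<open>e\<^sub>1 \<and> \<dots> \<and> e\<^sub>k\<close>, one for each \<open>k\<close>-element subset of an orthonormal basis, form an orthonormal
  basis of the exterior power, and the diagonal matrix entries are the principal minors.\<close>

definition trace_exterior_power :: "nat \<Rightarrow> ('h::complex_hilbert \<Rightarrow> 'h) \<Rightarrow> complex"
  where "trace_exterior_power k T =
    (\<Sum>\<^sub>\<infinity>F\<in>{F. F \<subseteq> some_basis \<and> finite F \<and> card F = k}. minor T F)"

text \<open>The argument is \<open>S = I + T\<close> with \<open>T\<close> of trace class, and
  \<open>det (I + T) = \<Sum>\<^sub>k tr (\<Lambda>\<^sup>k T)\<close>.\<close>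

definition fredholm_det :: "('h::complex_hilbert \<Rightarrow> 'h) \<Rightarrow> complex"
  where "fredholm_det S = (\<Sum>k. trace_exterior_power k (\<lambda>x. S x - x))"


section \<open>Unbounded operators\<close>

text \<open>An unbounded operator is a domain \<open>D\<close> together with a function whose values outside
  \<open>D\<close> are irrelevant.\<close>

definition linear_op_on :: "'h::complex_inner set \<Rightarrow> ('h \<Rightarrow> 'h) \<Rightarrow> bool"
  where "linear_op_on D A \<longleftrightarrow>
    0 \<in> D \<and> (\<forall>x\<in>D. \<forall>y\<in>D. x + y \<in> D \<and> A (x + y) = A x + A y) \<and>
    (\<forall>a. \<forall>x\<in>D. a *\<^sub>C x \<in> D \<and> A (a *\<^sub>C x) = a *\<^sub>C A x)"

definition accumulative :: "'h::complex_hilbert set \<Rightarrow> ('h \<Rightarrow> 'h) \<Rightarrow> bool"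
  where "accumulative D A \<longleftrightarrow>
    linear_op_on D A \<and> closure D = UNIV \<and> closed ((\<lambda>h. (h, A h)) ` D) \<and>
    (\<forall>h\<in>D. Im (cinner (A h) h) \<le> 0)"

definition maximal_accumulative :: "'h::complex_hilbert set \<Rightarrow> ('h \<Rightarrow> 'h) \<Rightarrow> bool"
  where "maximal_accumulative D A \<longleftrightarrow> accumulative D A \<and>
    (\<forall>D' A'. accumulative D' A' \<and> D \<subseteq> D' \<and> (\<forall>h\<in>D. A' h = A h) \<longrightarrow> D' = D)"

text \<open>Only meaningful if \<open>z\<close> is in the resolvent set of \<open>(D, A)\<close>.\<close>

definition resolvent_op :: "'h::complex_inner set \<Rightarrow> ('h \<Rightarrow> 'h) \<Rightarrow> complex \<Rightarrow> 'h \<Rightarrow> 'h"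
  where "resolvent_op D A z = inv_into D (\<lambda>h. A h - z *\<^sub>C h)"


section \<open>The perturbation determinant\<close>

definition upper_half_plane :: "complex set"
  where "upper_half_plane = {z. 0 < Im z}"

text \<open>\<open>D\<close> is the common domain of \<open>H\<close> and \<open>H\<^sub>0\<close>.\<close>

definition perturbation_det ::
    "'h::complex_hilbert set \<Rightarrow> ('h \<Rightarrow> 'h) \<Rightarrow> ('h \<Rightarrow> 'h) \<Rightarrow> complex \<Rightarrow> complex"
  where "perturbation_det D H H0 z =
    fredholm_det (\<lambda>x. H (resolvent_op D H0 z x) - z *\<^sub>C resolvent_op D H0 z x)"

definition is_normalized_log :: "(complex \<Rightarrow> complex) \<Rightarrow> (complex \<Rightarrow> complex) \<Rightarrow> bool"
  where "is_normalized_log f L \<longleftrightarrow>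
    L holomorphic_on upper_half_plane \<and> (\<forall>z\<in>upper_half_plane. exp (L z) = f z) \<and>
    ((\<lambda>y. L (Complex 0 y)) \<longlongrightarrow> 0) at_top"

text \<open>A normalized logarithm is unique on the upper half-plane, where alone it is used.\<close>

definition normalized_log :: "(complex \<Rightarrow> complex) \<Rightarrow> complex \<Rightarrow> complex"
  where "normalized_log f = (SOME L. is_normalized_log f L)"

definition boundary_arg :: "(complex \<Rightarrow> complex) \<Rightarrow> real \<Rightarrow> real"
  where "boundary_arg f lam =
    Lim (at_right 0) (\<lambda>\<epsilon>. Im (normalized_log f (Complex lam \<epsilon>)))"

definition spectral_shift ::
    "'h::complex_hilbert set \<Rightarrow> ('h \<Rightarrow> 'h) \<Rightarrow> ('h \<Rightarrow> 'h) \<Rightarrow> real \<Rightarrow> real"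
  where "spectral_shift D H H0 lam = 1 / pi * boundary_arg (perturbation_det D H H0) lam"


section \<open>The A-integral\<close>

definition L1_w0 :: "'a measure \<Rightarrow> ('a \<Rightarrow> complex) \<Rightarrow> bool"
  where "L1_w0 M f \<longleftrightarrow> f \<in> borel_measurable M \<and>
    ((\<lambda>t. ennreal t * emeasure M {x\<in>space M. norm (f x) > t}) \<longlongrightarrow> 0) at_top \<and>
    ((\<lambda>t. ennreal t * emeasure M {x\<in>space M. norm (f x) > t}) \<longlongrightarrow> 0) (at_right 0)"

definition has_A_integral :: "'a measure \<Rightarrow> ('a \<Rightarrow> complex) \<Rightarrow> complex \<Rightarrow> bool"
  where "has_A_integral M f I \<longleftrightarrow> L1_w0 M f \<and>
    ((\<lambda>(b, B). LINT x:{x\<in>space M. b \<le> norm (f x) \<and> norm (f x) \<le> B}|M. f x)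
      \<longlongrightarrow> I) (at_right 0 \<times>\<^sub>F at_top)"

definition A_integrable :: "'a measure \<Rightarrow> ('a \<Rightarrow> complex) \<Rightarrow> bool"
  where "A_integrable M f \<longleftrightarrow> (\<exists>I. has_A_integral M f I)"

definition A_integral :: "'a measure \<Rightarrow> ('a \<Rightarrow> complex) \<Rightarrow> complex"
  where "A_integral M f = (THE I. has_A_integral M f I)"

text \<open>The measure \<open>d\<lambda> / (1 + \<lambda>\<^sup>2)\<close> on the real line.\<close>

definition cauchy_measure :: "real measure"
  where "cauchy_measure = density lborel (\<lambda>x. ennreal (1 / (1 + x\<^sup>2)))"

end

theory Submission
  imports Defs "HOL-Complex_Analysis.Complex_Analysis" "HOL-Probability.Sinc_Integral"
begin

text \<open>The perturbation determinant is an infinite product of factors with real part at least one, and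
  the \<open>A\<close>-integral representation holds for every such product.

  On the side of operators, elimination along an orthonormal basis writes \<open>V = \<Sum> u\<^sub>n \<otimes> u\<^sub>n\<close> with
  \<open>\<Sum> (norm u\<^sub>n)\<^sup>2 < \<infinity>\<close> (\<open>rank_one_decomposition\<close>).  Let \<open>R\<^sub>k\<close> be the resolvent of
  \<open>H\<^sub>0 - \<i> (u\<^sub>0 \<otimes> u\<^sub>0 + \<dots> + u\<^sub>k\<^sub>-\<^sub>1 \<otimes> u\<^sub>k\<^sub>-\<^sub>1)\<close>.  Gaussian elimination in the matrix \<open>1 - \<i> (\<langle>R\<^sub>0 u\<^sub>m, u\<^sub>n\<rangle>)\<close> shows that
  \<open>det (1 - \<i> V R\<^sub>0) = \<Prod> p\<^sub>k\<close> with \<open>p\<^sub>k = 1 - \<i> \<langle>R\<^sub>k u\<^sub>k, u\<^sub>k\<rangle>\<close> (\<open>fredholm_det_product\<close>).  For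
  a maximal accumulative operator \<open>R\<^sub>0\<close> is everywhere defined and dissipative, each \<open>R\<^sub>k\<close> inherits
  this, and therefore \<open>Re p\<^sub>k \<ge> 1\<close> and \<open>cmod (p\<^sub>k - 1) \<le> (norm u\<^sub>k)\<^sup>2 / Im z\<close> (\<open>pivot_properties\<close>).

  Consequently \<open>L = \<Sum> Ln p\<^sub>k\<close> is the normalised logarithm of the determinant, and it has nonnegative
  real part.  Such a function has finite boundary values almost everywhere
  (\<open>positive_real_part_boundary\<close>, by Fatou's theorem), and \<open>\<xi>\<close> is \<open>Im L / pi\<close> on the real line.
  For bounded holomorphic functions \<open>w\<close> the Schwarz formula recovers \<open>w\<close> from \<open>Im w\<close> on the real line
  and \<open>Re w (\<i>)\<close>; but \<open>\<xi>\<close> need not be integrable, so it does not apply to \<open>L\<close> directly.  It does apply to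
  the bounded functions \<open>B L / (B + L)\<close>, which tend to \<open>L\<close> as \<open>B \<rightarrow> \<infinity>\<close>.  The difference between
  this damping and a truncation of the integrand at height \<open>B\<close> is controlled pointwise by the
  defect \<open>B (cmod L)\<^sup>2 / (cmod (B + L))\<^sup>2\<close>, and so is the distribution function of the integrand.
  Both properties that define the \<open>A\<close>-integral hence follow once the integral of the defect tends
  to zero (\<open>A_integral_boundary_Im\<close>).

  The defect is the part of \<open>Re (B L / (B + L))\<close> that is not accounted for by \<open>Re L\<close>.  Its integral
  tends to zero if the boundary measure of the positive harmonic function \<open>Re L\<close> has no singular
  part, that is, if \<open>Re L\<close> has integral \<open>pi Re L(\<i>)\<close> with respect to \<open>d\<lambda> / (1 + \<lambda>\<^sup>2)\<close>
  (\<open>defect_integral_tendsto_0\<close>).  This holds for each \<open>Ln p\<^sub>k\<close>, because \<open>Re p\<^sub>k \<ge> 1\<close> allows one to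
  approximate it from below by bounded functions (\<open>log_full_mean_value\<close>), and it is inherited by sums with
  nonnegative real parts (\<open>log_product\<close>).\<close>

section \<open>Determinants indexed by finite sets\<close>

text \<open>The index set is arbitrary because principal minors of one matrix over many finite subsets
  of an orthonormal basis have to be compared, and because one determinant below lives on a
  sum type.\<close>

definition set_det :: "'a set \<Rightarrow> ('a \<Rightarrow> 'a \<Rightarrow> complex) \<Rightarrow> complex"
  where "set_det F A = (\<Sum>p | p permutes F. of_int (sign p) * (\<Prod>e\<in>F. A e (p e)))"

lemma minor_eq_set_det: "minor T F = set_det F (\<lambda>e f. cinner (T e) f)"
  by (simp add: minor_def set_det_def)

lemma set_det_cong:
  assumes "\<And>e f. e \<in> F \<Longrightarrow> f \<in> F \<Longrightarrow> A e f = B e f"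
  shows "set_det F A = set_det F B"
  unfolding set_det_def
proof (rule sum.cong)
  fix p assume "p \<in> {p. p permutes F}"
  then show "of_int (sign p) * (\<Prod>e\<in>F. A e (p e)) = of_int (sign p) * (\<Prod>e\<in>F. B e (p e))"
    using assms by (auto intro!: prod.cong simp: permutes_in_image)
qed simp

lemma set_det_empty [simp]: "set_det {} A = 1"
  by (simp add: set_det_def)

lemma set_det_tendsto:
  assumes "\<And>e f. e \<in> F \<Longrightarrow> f \<in> F \<Longrightarrow> ((\<lambda>n. A n e f) \<longlongrightarrow> B e f) G"
  shows "((\<lambda>n. set_det F (A n)) \<longlongrightarrow> set_det F B) G"
  unfolding set_det_def
  by (intro tendsto_sum tendsto_mult tendsto_const tendsto_prod)
     (auto simp: permutes_in_image intro: assms)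

lemma set_det_permute_rows:
  assumes "finite F" "q permutes F"
  shows "set_det F (\<lambda>e f. A (q e) f) = of_int (sign q) * set_det F A"
proof -
  have "set_det F (\<lambda>e f. A (q e) f)
      = (\<Sum>p | p permutes F. of_int (sign (p \<circ> q)) * (\<Prod>e\<in>F. A (q e) ((p \<circ> q) e)))"
    unfolding set_det_def
    by (rule sum_permutations_compose_right [OF assms(2)])
  also have "\<dots> = (\<Sum>p | p permutes F. of_int (sign q) * (of_int (sign p) * (\<Prod>e\<in>F. A e (p e))))"
  proof (rule sum.cong)
    fix p assume "p \<in> {p. p permutes F}"
    then have p: "p permutes F" by simp
    have "sign (p \<circ> q) = sign p * sign q"
      using p assms by (intro sign_compose) (auto simp: permutation_permutes)
    moreover have "(\<Prod>e\<in>F. A (q e) ((p \<circ> q) e)) = (\<Prod>e\<in>F. A e (p e))"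
      using prod.permute [OF assms(2), of "\<lambda>e. A e (p e)"] by (simp add: o_def)
    ultimately show "of_int (sign (p \<circ> q)) * (\<Prod>e\<in>F. A (q e) ((p \<circ> q) e))
        = of_int (sign q) * (of_int (sign p) * (\<Prod>e\<in>F. A e (p e)))"
      by simp
  qed simp
  finally show ?thesis
    by (simp add: set_det_def sum_distrib_left)
qed

text \<open>Composing with the transposition of \<open>s\<close> and \<open>t\<close> changes the sign and leaves the matrix
  unchanged.\<close>

lemma set_det_equal_rows:
  assumes "finite F" "s \<in> F" "t \<in> F" "s \<noteq> t" "\<And>f. f \<in> F \<Longrightarrow> A s f = A t f"
  shows "set_det F A = 0"
proof -
  have "set_det F (\<lambda>e f. A (Transposition.transpose s t e) f) = set_det F A"
    by (rule set_det_cong) (auto simp: Transposition.transpose_def assms)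
  moreover have "set_det F (\<lambda>e f. A (Transposition.transpose s t e) f) = - set_det F A"
    using set_det_permute_rows [OF assms(1) permutes_swap_id [OF assms(2,3)], of A] assms(4)
    by (simp add: sign_swap_id)
  ultimately show ?thesis by simp
qed

lemma set_det_row_add:
  assumes "finite F" "s \<in> F"
  shows "set_det F (\<lambda>e f. if e = s then x f + c * y f else A e f)
    = set_det F (\<lambda>e f. if e = s then x f else A e f) + c * set_det F (\<lambda>e f. if e = s then y f else A e f)"
proof -
  have *: "(\<Prod>e\<in>F. if e = s then g e else A e (p e)) = g s * (\<Prod>e\<in>F - {s}. A e (p e))" for g p
    using assms by (subst prod.remove [of F s]) (auto intro!: prod.cong)
  show ?thesis
    unfolding set_det_def * by (simp add: algebra_simps sum.distrib sum_distrib_left)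
qed

lemma set_det_add_row_multiple:
  assumes "finite F" "s \<in> F" "t \<in> F" "s \<noteq> t"
  shows "set_det F (\<lambda>e f. if e = t then A t f + c * A s f else A e f) = set_det F A"
proof -
  have "set_det F (\<lambda>e f. if e = t then A s f else A e f) = 0"
    by (rule set_det_equal_rows [OF assms]) (use assms in auto)
  moreover have "set_det F (\<lambda>e f. if e = t then A t f else A e f) = set_det F A"
    by (rule set_det_cong) auto
  ultimately show ?thesis
    by (subst set_det_row_add) (use assms in auto)
qed

text \<open>The row \<open>s\<close> itself stays fixed, so its multiples can be added to the other rows one row at a
  time.\<close>

lemma set_det_eliminate_rows:
  assumes "finite S" "s \<notin> S" "T \<subseteq> S"
  shows "set_det (insert s S) (\<lambda>e f. if e \<in> T then A e f + c e * A s f else A e f)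
    = set_det (insert s S) A"
proof -
  have "finite T" using assms finite_subset by blast
  then show ?thesis using assms(3)
  proof (induction T rule: finite_induct)
    case (insert t T)
    let ?B = "\<lambda>e f. if e \<in> T then A e f + c e * A s f else A e f"
    have st: "s \<noteq> t" "s \<notin> T" "t \<in> S" using insert assms by auto
    have "set_det (insert s S) (\<lambda>e f. if e \<in> insert t T then A e f + c e * A s f else A e f)
        = set_det (insert s S) (\<lambda>e f. if e = t then ?B t f + c t * ?B s f else ?B e f)"
      by (rule set_det_cong) (use insert st in auto)
    also have "\<dots> = set_det (insert s S) ?B"
      by (rule set_det_add_row_multiple) (use st assms in auto)
    also have "\<dots> = set_det (insert s S) A" using insert by simp
    finally show ?case .
  qed simp
qed

text \<open>A permutation that does not fix \<open>s\<close> sends some other element to \<open>s\<close> and thus picks up a zero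
  of that column; the remaining permutations are those of \<open>S\<close>.\<close>

lemma set_det_column_zero:
  assumes "finite S" "s \<notin> S" "\<And>e. e \<in> S \<Longrightarrow> A e s = 0"
  shows "set_det (insert s S) A = A s s * set_det S A"
proof -
  have "set_det (insert s S) A
      = (\<Sum>p | p permutes S. of_int (sign p) * (\<Prod>e\<in>insert s S. A e (p e)))"
    unfolding set_det_def
  proof (rule sum.mono_neutral_right)
    show "finite {p. p permutes insert s S}" using assms by (intro finite_permutations) auto
    show "{p. p permutes S} \<subseteq> {p. p permutes insert s S}"
      using permutes_subset by blast
    show "\<forall>p\<in>{p. p permutes insert s S} - {p. p permutes S}.
        of_int (sign p) * (\<Prod>e\<in>insert s S. A e (p e)) = 0"
    proof
      fix p assume p: "p \<in> {p. p permutes insert s S} - {p. p permutes S}"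
      have "p s \<noteq> s"
      proof
        assume "p s = s"
        then have "p permutes S" using p permutes_superset [of p "insert s S" S] by auto
        then show False using p by simp
      qed
      obtain e where e: "p e = s" using p by (metis DiffD1 mem_Collect_eq permutes_def)
      have "e \<in> S" using p e \<open>p s \<noteq> s\<close> by (metis DiffD1 insertE insertI1 mem_Collect_eq permutes_in_image)
      then have "(\<Prod>e\<in>insert s S. A e (p e)) = 0"
        using assms e by (intro prod_zero) auto
      then show "of_int (sign p) * (\<Prod>e\<in>insert s S. A e (p e)) = 0" by simp
    qed
  qed
  also have "\<dots> = A s s * set_det S A"
    unfolding set_det_def sum_distrib_left
  proof (rule sum.cong)
    fix p assume "p \<in> {p. p permutes S}"
    then have "p s = s" using assms permutes_not_in by auto
    then show "of_int (sign p) * (\<Prod>e\<in>insert s S. A e (p e)) = A s s * (of_int (sign p) * (\<Prod>e\<in>S. A e (p e)))"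
      using assms by simp
  qed simp
  finally show ?thesis .
qed

text \<open>One step of Gaussian elimination. It is the common source of the Sylvester identity, of the
  Hadamard inequality and of the product formula for the perturbation determinant.\<close>

lemma set_det_Schur:
  assumes "finite S" "s \<notin> S" "A s s \<noteq> 0"
  shows "set_det (insert s S) A = A s s * set_det S (\<lambda>e f. A e f - A e s * A s f / A s s)"
proof -
  let ?B = "\<lambda>e f. if e \<in> S then A e f + (- A e s / A s s) * A s f else A e f"
  have "set_det (insert s S) A = set_det (insert s S) ?B"
    by (rule set_det_eliminate_rows [symmetric]) (use assms in auto)
  also have "\<dots> = ?B s s * set_det S ?B"
    by (rule set_det_column_zero) (use assms in auto)
  also have "set_det S ?B = set_det S (\<lambda>e f. A e f - A e s * A s f / A s s)"
    by (rule set_det_cong) auto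
  finally show ?thesis using assms by simp
qed

text \<open>The Leibniz product over \<open>F\<close> is expanded by choosing for each row either the entry of \<open>A\<close> or
  that of the identity; the rows of the second kind must be fixed by the permutation.\<close>

lemma set_det_one_plus:
  assumes "finite F"
  shows "set_det F (\<lambda>e f. (if e = f then 1 else 0) + A e f) = (\<Sum>S\<in>Pow F. set_det S A)"
proof -
  have "set_det F (\<lambda>e f. (if e = f then 1 else 0) + A e f)
      = (\<Sum>p | p permutes F. \<Sum>S\<in>Pow F. of_int (sign p) *
          ((\<Prod>e\<in>S. A e (p e)) * (\<Prod>e\<in>F - S. if e = p e then 1 else 0)))"
    unfolding set_det_def
    by (rule sum.cong) (auto simp: add.commute [of "if _ then _ else _"] prod_add [OF assms] sum_distrib_left)
  also have "\<dots> = (\<Sum>S\<in>Pow F. \<Sum>p | p permutes F. of_int (sign p) *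
          ((\<Prod>e\<in>S. A e (p e)) * (\<Prod>e\<in>F - S. if e = p e then 1 else 0)))"
    by (rule sum.swap)
  also have "\<dots> = (\<Sum>S\<in>Pow F. set_det S A)"
  proof (rule sum.cong)
    fix S assume S: "S \<in> Pow F"
    have "(\<Sum>p | p permutes F. of_int (sign p) *
          ((\<Prod>e\<in>S. A e (p e)) * (\<Prod>e\<in>F - S. if e = p e then 1 else 0)))
        = (\<Sum>p | p permutes S. of_int (sign p) *
          ((\<Prod>e\<in>S. A e (p e)) * (\<Prod>e\<in>F - S. if e = p e then 1 else 0)))"
    proof (rule sum.mono_neutral_right)
      show "finite {p. p permutes F}" using assms by (intro finite_permutations) auto
      show "{p. p permutes S} \<subseteq> {p. p permutes F}" using S permutes_subset by blast
      show "\<forall>p\<in>{p. p permutes F} - {p. p permutes S}. of_int (sign p) *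
          ((\<Prod>e\<in>S. A e (p e)) * (\<Prod>e\<in>F - S. if e = p e then 1 else 0)) = (0::complex)"
      proof
        fix p assume p: "p \<in> {p. p permutes F} - {p. p permutes S}"
        then obtain e where "e \<in> F - S" "p e \<noteq> e"
          using permutes_superset [of p F S] by auto
        then have "(\<Prod>e\<in>F - S. if e = p e then 1 else 0) = (0::complex)"
          using assms by (intro prod_zero bexI [of _ e]) auto
        then show "of_int (sign p) * ((\<Prod>e\<in>S. A e (p e)) * (\<Prod>e\<in>F - S. if e = p e then 1 else 0)) = (0::complex)"
          by simp
      qed
    qed
    also have "\<dots> = set_det S A"
      unfolding set_det_def
    proof (rule sum.cong)
      fix p assume "p \<in> {p. p permutes S}"
      then have "(\<Prod>e\<in>F - S. if e = p e then 1 else 0) = (1::complex)"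
        by (intro prod.neutral) (auto simp: permutes_not_in)
      then show "of_int (sign p) * ((\<Prod>e\<in>S. A e (p e)) * (\<Prod>e\<in>F - S. if e = p e then 1 else 0))
          = of_int (sign p) * (\<Prod>e\<in>S. A e (p e))" by simp
    qed simp
    finally show "(\<Sum>p | p permutes F. of_int (sign p) *
          ((\<Prod>e\<in>S. A e (p e)) * (\<Prod>e\<in>F - S. if e = p e then 1 else 0))) = set_det S A" .
  qed simp
  finally show ?thesis .
qed

lemma set_det_reindex:
  assumes "finite F" "inj_on g F"
  shows "set_det (g ` F) A = set_det F (\<lambda>e f. A (g e) (g f))"
proof -
  have bij: "bij_betw g F (g ` F)" using assms by (simp add: inj_on_imp_bij_betw)
  have eq: "map_permutation F g = (\<lambda>p x. if x \<in> g ` F then g (p (inv_into F g x)) else x)"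
    by (auto simp: fun_eq_iff map_permutation_def restrict_id_def)
  have "bij_betw (map_permutation F g) {p. p permutes F} {p. p permutes g ` F}"
    unfolding eq by (rule bij_betw_permutations [OF bij])
  then have "set_det (g ` F) A
      = (\<Sum>p | p permutes F. of_int (sign (map_permutation F g p)) * (\<Prod>e\<in>g ` F. A e (map_permutation F g p e)))"
    unfolding set_det_def by (rule sum.reindex_bij_betw [symmetric])
  also have "\<dots> = set_det F (\<lambda>e f. A (g e) (g f))"
    unfolding set_det_def
  proof (rule sum.cong)
    fix p assume "p \<in> {p. p permutes F}"
    then have p: "p permutes F" by simp
    have "(\<Prod>e\<in>g ` F. A e (map_permutation F g p e)) = (\<Prod>e\<in>F. A (g e) (map_permutation F g p (g e)))"
      using assms by (simp add: prod.reindex)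
    also have "\<dots> = (\<Prod>e\<in>F. A (g e) (g (p e)))"
      using assms by (intro prod.cong) (auto simp: eq)
    finally show "of_int (sign (map_permutation F g p)) * (\<Prod>e\<in>g ` F. A e (map_permutation F g p e))
        = of_int (sign p) * (\<Prod>e\<in>F. A (g e) (g (p e)))"
      using sign_map_permutation [OF assms(2) p assms(1)] by simp
  qed simp
  finally show ?thesis .
qed

text \<open>Summing over all functions \<open>\<phi>\<close> instead of the subsets of \<open>K\<close> avoids choosing an enumeration:
  functions that are not injective contribute zero, and each subset is counted once for
  every one of its enumerations, whence the factorial.\<close>

lemma set_det_Cauchy_Binet:
  assumes F: "finite F" and K: "finite K"
  shows "fact (card F) * set_det F (\<lambda>e f. \<Sum>n\<in>K. a n e * b n f)
    = (\<Sum>\<phi>\<in>F \<rightarrow>\<^sub>E K. set_det F (\<lambda>e f. a (\<phi> e) f) * set_det F (\<lambda>e f. b (\<phi> e) f))"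
proof -
  let ?Db = "\<lambda>\<phi>. set_det F (\<lambda>e f. b (\<phi> e) f)"
  let ?w = "\<Sum>\<phi>\<in>F \<rightarrow>\<^sub>E K. (\<Prod>e\<in>F. a (\<phi> e) e) * ?Db \<phi>"
  have fin: "finite (F \<rightarrow>\<^sub>E K)" using assms by (intro finite_PiE) auto
  have "set_det F (\<lambda>e f. \<Sum>n\<in>K. a n e * b n f)
      = (\<Sum>p | p permutes F. of_int (sign p) * (\<Sum>\<phi>\<in>F \<rightarrow>\<^sub>E K. (\<Prod>e\<in>F. a (\<phi> e) e * b (\<phi> e) (p e))))"
    unfolding set_det_def using assms
    by (subst prod_sum_PiE) auto
  also have "\<dots> = (\<Sum>p | p permutes F. \<Sum>\<phi>\<in>F \<rightarrow>\<^sub>E K. (\<Prod>e\<in>F. a (\<phi> e) e) * (of_int (sign p) * (\<Prod>e\<in>F. b (\<phi> e) (p e))))"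
    by (simp add: sum_distrib_left prod.distrib mult_ac)
  also have "\<dots> = ?w"
    by (subst sum.swap) (simp add: set_det_def sum_distrib_left)
  finally have w: "set_det F (\<lambda>e f. \<Sum>n\<in>K. a n e * b n f) = ?w" .
  have "(\<Sum>\<phi>\<in>F \<rightarrow>\<^sub>E K. set_det F (\<lambda>e f. a (\<phi> e) f) * ?Db \<phi>)
      = (\<Sum>q | q permutes F. \<Sum>\<phi>\<in>F \<rightarrow>\<^sub>E K. of_int (sign q) * (\<Prod>e\<in>F. a (\<phi> e) (q e)) * ?Db \<phi>)"
    unfolding set_det_def [of F "\<lambda>e f. a (_ e) f"] sum_distrib_right by (rule sum.swap)
  \<comment> \<open>Substituting \<open>\<phi> \<circ> q\<close> for \<open>\<phi>\<close> permutes the rows of the second determinant and absorbs the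
    sign of \<open>q\<close>, so every permutation of the first determinant contributes the same amount.\<close>
  also have "\<dots> = (\<Sum>q | q permutes F. ?w)"
  proof (rule sum.cong)
    fix q assume "q \<in> {q. q permutes F}"
    then have q: "q permutes F" by simp
    have qi: "inv q permutes F" using q by (rule permutes_inv)
    show "(\<Sum>\<phi>\<in>F \<rightarrow>\<^sub>E K. of_int (sign q) * (\<Prod>e\<in>F. a (\<phi> e) (q e)) * ?Db \<phi>) = ?w"
    proof (rule sum.reindex_bij_witness [where i = "\<lambda>\<psi>. \<psi> \<circ> q" and j = "\<lambda>\<phi>. \<phi> \<circ> inv q"])
      fix \<phi> assume phi: "\<phi> \<in> F \<rightarrow>\<^sub>E K"
      show "(\<phi> \<circ> inv q) \<circ> q = \<phi>" using q by (simp add: o_assoc [symmetric] permutes_inv_o)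
      show "\<phi> \<circ> inv q \<in> F \<rightarrow>\<^sub>E K"
        using phi qi by (auto simp: PiE_iff extensional_def permutes_in_image permutes_not_in)
      show "(\<phi> \<circ> q) \<circ> inv q = \<phi>" using q by (simp add: o_assoc [symmetric] permutes_inv_o)
      show "\<phi> \<circ> q \<in> F \<rightarrow>\<^sub>E K"
        using phi q by (auto simp: PiE_iff extensional_def permutes_in_image permutes_not_in)
      define \<psi> where "\<psi> = \<phi> \<circ> inv q"
      have phi_eq: "\<phi> = \<psi> \<circ> q" unfolding \<psi>_def using q by (simp add: o_assoc [symmetric] permutes_inv_o)
      have "?Db \<phi> = of_int (sign q) * ?Db \<psi>"
        using set_det_permute_rows [OF F q, of "\<lambda>e f. b (\<psi> e) f"] by (simp add: phi_eq)
      moreover have "(\<Prod>e\<in>F. a (\<phi> e) (q e)) = (\<Prod>e\<in>F. a (\<psi> e) e)"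
        using prod.permute [OF q, of "\<lambda>e. a (\<psi> e) e"] by (simp add: phi_eq o_def)
      moreover have "of_int (sign q) * of_int (sign q) = (1::complex)"
        by (metis of_int_1 of_int_mult sign_idempotent)
      ultimately show "(\<Prod>e\<in>F. a ((\<phi> \<circ> inv q) e) e) * ?Db (\<phi> \<circ> inv q)
          = of_int (sign q) * (\<Prod>e\<in>F. a (\<phi> e) (q e)) * ?Db \<phi>"
        unfolding \<psi>_def [symmetric]
        by (metis (no_types, lifting) mult.assoc mult.commute mult.left_neutral)
    qed
  qed simp
  also have "\<dots> = fact (card F) * ?w" by (simp add: card_permutations [OF refl F])
  finally show ?thesis using w by simp
qed

text \<open>Both sides are the determinant of the block matrix with rows \<open>(1, -a)\<close> and \<open>(b, 1)\<close>, whose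
  two diagonal blocks can be eliminated in either order.\<close>

lemma set_det_Sylvester:
  assumes F: "finite F" and K: "finite K"
  shows "set_det F (\<lambda>e f. (if e = f then 1 else 0) + (\<Sum>n\<in>K. a n e * b n f))
    = set_det K (\<lambda>m n. (if m = n then 1 else 0) + (\<Sum>e\<in>F. b m e * a n e))"
proof -
  \<comment> \<open>The block matrix after the indices in \<open>J\<close> of the second block or those in \<open>G\<close> of the first
    block have been eliminated.\<close>
  define M :: "'b set \<Rightarrow> 'a set \<Rightarrow> 'a + 'b \<Rightarrow> 'a + 'b \<Rightarrow> complex" where
    "M J G x y = (case x of
        Inl e \<Rightarrow> (case y of Inl f \<Rightarrow> (if e = f then 1 else 0) + (\<Sum>n\<in>J. a n e * b n f) | Inr n \<Rightarrow> - a n e)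
      | Inr m \<Rightarrow> (case y of Inl f \<Rightarrow> b m f | Inr n \<Rightarrow> (if m = n then 1 else 0) + (\<Sum>e\<in>G. b m e * a n e)))"
    for J G x y
  have 1: "set_det (Inl ` F \<union> Inr ` K') (M J {}) = set_det (Inl ` F) (M (J \<union> K') {})"
    if "finite K'" "finite J" "J \<inter> K' = {}" for K' J
    using that
  proof (induction K' arbitrary: J rule: finite_induct)
    case (insert n K')
    have "set_det (Inl ` F \<union> Inr ` insert n K') (M J {})
       = set_det (insert (Inr n) (Inl ` F \<union> Inr ` K')) (M J {})" by simp
    also have "\<dots> = set_det (Inl ` F \<union> Inr ` K') (M (insert n J) {})"
    proof -
      have "set_det (insert (Inr n) (Inl ` F \<union> Inr ` K')) (M J {})
          = M J {} (Inr n) (Inr n) * set_det (Inl ` F \<union> Inr ` K')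
              (\<lambda>x y. M J {} x y - M J {} x (Inr n) * M J {} (Inr n) y / M J {} (Inr n) (Inr n))"
        by (rule set_det_Schur) (use insert F in \<open>auto simp: M_def\<close>)
      also have "\<dots> = set_det (Inl ` F \<union> Inr ` K')
              (\<lambda>x y. M J {} x y - M J {} x (Inr n) * M J {} (Inr n) y / M J {} (Inr n) (Inr n))"
        by (simp add: M_def)
      also have "\<dots> = set_det (Inl ` F \<union> Inr ` K') (M (insert n J) {})"
      proof (rule set_det_cong)
        fix x y assume "x \<in> Inl ` F \<union> Inr ` K'" "y \<in> Inl ` F \<union> Inr ` K'"
        moreover have "n \<notin> K'" "n \<notin> J" "finite J" using insert by auto
        ultimately show "M J {} x y - M J {} x (Inr n) * M J {} (Inr n) y / M J {} (Inr n) (Inr n)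
            = M (insert n J) {} x y"
          by (cases x; cases y) (auto simp: M_def)
      qed
      finally show ?thesis .
    qed
    also have "\<dots> = set_det (Inl ` F) (M (insert n J \<union> K') {})"
      using insert by (intro insert.IH) auto
    finally show ?case by simp
  qed simp
  have 2: "set_det (Inl ` F' \<union> Inr ` K) (M {} G) = set_det (Inr ` K) (M {} (G \<union> F'))"
    if "finite F'" "finite G" "G \<inter> F' = {}" for F' G
    using that
  proof (induction F' arbitrary: G rule: finite_induct)
    case (insert n K')
    have "set_det (Inl ` insert n K' \<union> Inr ` K) (M {} G)
       = set_det (insert (Inl n) (Inl ` K' \<union> Inr ` K)) (M {} G)" by simp
    also have "\<dots> = set_det (Inl ` K' \<union> Inr ` K) (M {} (insert n G))"
    proof -
      have "set_det (insert (Inl n) (Inl ` K' \<union> Inr ` K)) (M {} G)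
          = M {} G (Inl n) (Inl n) * set_det (Inl ` K' \<union> Inr ` K)
              (\<lambda>x y. M {} G x y - M {} G x (Inl n) * M {} G (Inl n) y / M {} G (Inl n) (Inl n))"
        by (rule set_det_Schur) (use insert K in \<open>auto simp: M_def\<close>)
      also have "\<dots> = set_det (Inl ` K' \<union> Inr ` K)
              (\<lambda>x y. M {} G x y - M {} G x (Inl n) * M {} G (Inl n) y / M {} G (Inl n) (Inl n))"
        by (simp add: M_def)
      also have "\<dots> = set_det (Inl ` K' \<union> Inr ` K) (M {} (insert n G))"
      proof (rule set_det_cong)
        fix x y assume "x \<in> Inl ` K' \<union> Inr ` K" "y \<in> Inl ` K' \<union> Inr ` K"
        moreover have "n \<notin> K'" "n \<notin> G" "finite G" using insert by auto
        ultimately show "M {} G x y - M {} G x (Inl n) * M {} G (Inl n) y / M {} G (Inl n) (Inl n)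
            = M {} (insert n G) x y"
          by (cases x; cases y) (auto simp: M_def)
      qed
      finally show ?thesis .
    qed
    also have "\<dots> = set_det (Inr ` K) (M {} (insert n G \<union> K'))"
      using insert by (intro insert.IH) auto
    finally show ?case by simp
  qed simp
  have "set_det (Inl ` F) (M K {}) = set_det (Inr ` K) (M {} F)"
    using 1 [OF K, of "{}"] 2 [OF F, of "{}"] by simp
  then show ?thesis
    by (simp add: set_det_reindex F K M_def)
qed

text \<open>The hypothesis says that the Hermitian matrix \<open>M\<close> is bounded below by the identity. The
  Schur complement inherits this, since its quadratic form is the one of \<open>M\<close> at a vector
  whose entry \<open>s\<close> has been chosen optimally, and its diagonal entries are smaller.\<close>

lemma set_det_Hadamard:
  assumes "finite F"
    and "\<And>e f. e \<in> F \<Longrightarrow> f \<in> F \<Longrightarrow> M f e = cnj (M e f)"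
    and "\<And>x. (\<Sum>e\<in>F. (cmod (x e))\<^sup>2) \<le> Re (\<Sum>e\<in>F. \<Sum>f\<in>F. x e * cnj (x f) * M e f)"
  shows "cmod (set_det F M) \<le> (\<Prod>e\<in>F. Re (M e e))"
  using assms
proof (induction F arbitrary: M rule: finite_induct)
  case (insert s S)
  have herm: "M f e = cnj (M e f)" if "e \<in> insert s S" "f \<in> insert s S" for e f
    using insert.prems(1) that by blast
  have diag: "M e e = of_real (Re (M e e))" if "e \<in> insert s S" for e
    using herm [OF that that] by (simp add: complex_eq_iff)
  have ms: "1 \<le> Re (M s s)"
  proof -
    have "(\<Sum>e\<in>insert s S. (cmod (if e = s then 1 else 0))\<^sup>2) = 1"
      using insert.hyps by (simp add: if_distrib [of cmod] if_distrib [of "\<lambda>x. x\<^sup>2"] cong: if_cong)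
    moreover have "(\<Sum>e\<in>insert s S. \<Sum>f\<in>insert s S. (if e = s then 1 else 0) * cnj (if f = s then 1 else 0) * M e f) = M s s"
      using insert.hyps by (auto simp: if_distrib [of cnj] if_distrib [of "\<lambda>x. x * _"] cong: if_cong intro!: sum.neutral)
    ultimately show ?thesis using insert.prems(2) [of "\<lambda>e. if e = s then 1 else 0"] by simp
  qed
  define N where "N e f = M e f - M e s * M s f / M s s" for e f
  have nz: "M s s \<noteq> 0" using ms by auto
  have "cmod (set_det S N) \<le> (\<Prod>e\<in>S. Re (N e e))"
  proof (rule insert.IH)
    show "N f e = cnj (N e f)" if "e \<in> S" "f \<in> S" for e f
    proof -
      have "cnj (M e f) = M f e" "cnj (M e s) = M s e" "cnj (M s f) = M f s" "cnj (M s s) = M s s"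
        using herm [of e f] herm [of e s] herm [of s f] herm [of s s] that by auto
      then show ?thesis by (simp add: N_def)
    qed
    fix x :: "'a \<Rightarrow> complex"
    \<comment> \<open>This entry makes the product with column \<open>s\<close> of \<open>M\<close> vanish.\<close>
    define c where "c = - (\<Sum>e\<in>S. x e * M e s) / M s s"
    define y where "y e = (if e = s then c else x e)" for e
    have y: "y s = c" "\<And>e. e \<in> S \<Longrightarrow> y e = x e" using insert.hyps by (auto simp: y_def)
    have col: "c * M s s + (\<Sum>e\<in>S. x e * M e s) = 0" using nz by (simp add: c_def)
    have rowsum: "(\<Sum>e\<in>insert s S. y e * M e f) = (\<Sum>e\<in>S. x e * N e f)" if "f \<in> S" for f
    proof -
      have "(\<Sum>e\<in>S. x e * N e f) = (\<Sum>e\<in>S. x e * M e f) - (\<Sum>e\<in>S. x e * M e s) * M s f / M s s"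
        by (simp add: N_def algebra_simps sum_subtractf sum_distrib_left sum_divide_distrib)
      then show ?thesis using insert.hyps y by (simp add: c_def)
    qed
    have "(\<Sum>e\<in>insert s S. \<Sum>f\<in>insert s S. y e * cnj (y f) * M e f)
        = (\<Sum>f\<in>insert s S. cnj (y f) * (\<Sum>e\<in>insert s S. y e * M e f))"
      by (subst sum.swap) (simp add: sum_distrib_left mult_ac)
    also have "\<dots> = (\<Sum>f\<in>S. cnj (x f) * (\<Sum>e\<in>S. x e * N e f))"
    proof -
      have z: "(\<Sum>e\<in>insert s S. y e * M e s) = 0"
        using insert.hyps col y by simp
      have "(\<Sum>f\<in>insert s S. cnj (y f) * (\<Sum>e\<in>insert s S. y e * M e f))
        = (\<Sum>f\<in>S. cnj (y f) * (\<Sum>e\<in>insert s S. y e * M e f))"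
        using insert.hyps z by (subst sum.insert) auto
      also have "\<dots> = (\<Sum>f\<in>S. cnj (x f) * (\<Sum>e\<in>S. x e * N e f))"
        by (rule sum.cong) (simp_all only: rowsum y)
      finally show ?thesis .
    qed
    also have "\<dots> = (\<Sum>e\<in>S. \<Sum>f\<in>S. x e * cnj (x f) * N e f)"
      by (subst sum.swap) (simp add: sum_distrib_left mult_ac)
    finally have "Re (\<Sum>e\<in>S. \<Sum>f\<in>S. x e * cnj (x f) * N e f) \<ge> (\<Sum>e\<in>insert s S. (cmod (y e))\<^sup>2)"
      using insert.prems(2) [of y] by simp
    moreover have "(\<Sum>e\<in>insert s S. (cmod (y e))\<^sup>2) = (cmod c)\<^sup>2 + (\<Sum>e\<in>S. (cmod (x e))\<^sup>2)"
      using insert.hyps y by simp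
    ultimately show "(\<Sum>e\<in>S. (cmod (x e))\<^sup>2) \<le> Re (\<Sum>e\<in>S. \<Sum>f\<in>S. x e * cnj (x f) * N e f)"
      by (smt (verit) zero_le_power2)
  qed
  also have "\<dots> \<le> (\<Prod>e\<in>S. Re (M e e))"
  proof (rule prod_mono, intro conjI)
    fix e assume e: "e \<in> S"
    have eq: "Re (N e e) = Re (M e e) - (cmod (M e s))\<^sup>2 / Re (M s s)"
    proof -
      have "M e s * M s e = of_real ((cmod (M e s))\<^sup>2)"
        using herm [of e s] e complex_norm_square [of "M e s"] by auto
      then have "N e e = of_real (Re (M e e)) - of_real ((cmod (M e s))\<^sup>2) / of_real (Re (M s s))"
        unfolding N_def using diag [of e] diag [of s] e by simp
      then show ?thesis by (metis Re_complex_of_real of_real_diff of_real_divide)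
    qed
    show "Re (N e e) \<le> Re (M e e)" unfolding eq using ms by simp
    show "0 \<le> Re (N e e)"
    proof -
      define y where "y g = (if g = e then 1 else if g = s then - M e s / M s s else 0)" for g
      have es: "e \<noteq> s" using e insert.hyps by auto
      have ye: "y e = 1" "y s = - M e s / M s s" using es by (auto simp: y_def)
      have two: "(\<Sum>g\<in>insert s S. h g) = h s + h e" if "\<And>g. g \<noteq> e \<Longrightarrow> g \<noteq> s \<Longrightarrow> h g = 0" for h :: "'a \<Rightarrow> complex"
      proof -
        have "(\<Sum>g\<in>S. h g) = (\<Sum>g\<in>{e}. h g)"
          using insert.hyps e that by (intro sum.mono_neutral_right) auto
        then show ?thesis using insert.hyps by simp
      qed
      have "(\<Sum>g\<in>insert s S. \<Sum>f\<in>insert s S. y g * cnj (y f) * M g f)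
         = y s * cnj (y s) * M s s + y s * cnj (y e) * M s e + (y e * cnj (y s) * M e s + y e * cnj (y e) * M e e)"
        by (subst two; (subst two)?) (auto simp: y_def two)
      also have "\<dots> = N e e"
      proof -
        have "cnj (M e s) = M s e" "cnj (M s s) = M s s"
          using herm [of e s] herm [of s s] e by auto
        then show ?thesis using nz by (simp add: ye N_def field_simps)
      qed
      finally have "0 \<le> Re (N e e)" using insert.prems(2) [of y]
        by (smt (verit) sum_nonneg zero_le_power2)
      then show ?thesis .
    qed
  qed
  finally have "cmod (set_det S N) \<le> (\<Prod>e\<in>S. Re (M e e))" .
  moreover have "set_det (insert s S) M = M s s * set_det S N"
    unfolding N_def using insert.hyps nz by (intro set_det_Schur) auto
  moreover have "cmod (M s s) = Re (M s s)" using diag [of s] ms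
    by (metis insertI1 linorder_not_le norm_of_real abs_of_nonneg order_trans zero_le_one)
  ultimately show ?case using insert.hyps ms by (simp add: norm_mult mult_left_mono)
qed simp

section \<open>Complex inner products\<close>

lemma cinner_add_right: "cinner x (y + z) = cinner x y + cinner (x::'h::complex_inner) z"
  by (metis cinner_add_left cinner_commute complex_cnj_add)

lemma cinner_scaleC_right: "cinner x (a *\<^sub>C y) = cnj a * cinner (x::'h::complex_inner) y"
  by (metis cinner_scaleC_left cinner_commute complex_cnj_mult)

lemma cinner_zero_left [simp]: "cinner 0 (y::'h::complex_inner) = 0"
  using cinner_add_left [of 0 0 y] by simp

lemma cinner_zero_right [simp]: "cinner (y::'h::complex_inner) 0 = 0"
  using cinner_add_right [of y 0 0] by simp

lemma cinner_minus_left: "cinner (- x) (y::'h::complex_inner) = - cinner x y"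
  using cinner_add_left [of x "- x" y] by (simp add: eq_neg_iff_add_eq_0 add.commute)

lemma cinner_minus_right: "cinner x (- (y::'h::complex_inner)) = - cinner x y"
  using cinner_add_right [of x y "- y"] by (simp add: eq_neg_iff_add_eq_0 add.commute)

lemma cinner_diff_left: "cinner (x - y) (z::'h::complex_inner) = cinner x z - cinner y z"
  using cinner_add_left [of x "- y" z] by (simp add: cinner_minus_left)

lemma cinner_diff_right: "cinner x (y - (z::'h::complex_inner)) = cinner x y - cinner x z"
  using cinner_add_right [of x y "- z"] by (simp add: cinner_minus_right)

lemma cinner_sum_left: "cinner (\<Sum>i\<in>I. f i) (y::'h::complex_inner) = (\<Sum>i\<in>I. cinner (f i) y)"
  by (induction I rule: infinite_finite_induct) (auto simp: cinner_add_left)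

lemma cinner_sum_right: "cinner y (\<Sum>i\<in>I. f i) = (\<Sum>i\<in>I. cinner (y::'h::complex_inner) (f i))"
  by (induction I rule: infinite_finite_induct) (auto simp: cinner_add_right)

lemmas cinner_simps = cinner_add_left cinner_add_right cinner_diff_left cinner_diff_right
  cinner_scaleC_left cinner_scaleC_right

lemma Re_cinner_self: "Re (cinner x (x::'h::complex_inner)) = (norm x)\<^sup>2"
  by (simp add: cinner_self)

lemma scaleC_zero_left [simp]: "0 *\<^sub>C (x::'h::complex_inner) = 0"
  using scaleR_scaleC [of 0 x] by simp

lemma scaleC_one [simp]: "1 *\<^sub>C (x::'h::complex_inner) = x"
  using scaleR_scaleC [of 1 x] by simp

lemma scaleC_zero_right [simp]: "a *\<^sub>C (0::'h::complex_inner) = 0"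
  using scaleC_add_right [of a 0 0] by simp

lemma scaleC_minus_left: "(- a) *\<^sub>C (x::'h::complex_inner) = - (a *\<^sub>C x)"
  using scaleC_add_left [of a "- a" x] by (simp add: eq_neg_iff_add_eq_0 add.commute)

lemma scaleC_minus_right: "a *\<^sub>C (- (x::'h::complex_inner)) = - (a *\<^sub>C x)"
  using scaleC_add_right [of a x "- x"] by (simp add: eq_neg_iff_add_eq_0 add.commute)

lemma scaleC_diff_left: "(a - b) *\<^sub>C (x::'h::complex_inner) = a *\<^sub>C x - b *\<^sub>C x"
  using scaleC_add_left [of a "- b" x] by (simp add: scaleC_minus_left)

lemma scaleC_diff_right: "a *\<^sub>C (x - (y::'h::complex_inner)) = a *\<^sub>C x - a *\<^sub>C y"
  using scaleC_add_right [of a x "- y"] by (simp add: scaleC_minus_right)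

lemma norm_scaleC: "norm (a *\<^sub>C (x::'h::complex_inner)) = cmod a * norm x"
proof -
  have "complex_of_real ((norm (a *\<^sub>C x))\<^sup>2) = complex_of_real ((cmod a * norm x)\<^sup>2)"
    unfolding cinner_self [symmetric] cinner_scaleC_left cinner_scaleC_right
    by (simp only: cinner_self power_mult_distrib of_real_mult complex_norm_square mult_ac)
  then have "(norm (a *\<^sub>C x))\<^sup>2 = (cmod a * norm x)\<^sup>2" by (simp only: of_real_eq_iff)
  then show ?thesis by (rule power2_eq_imp_eq) auto
qed

text \<open>For semidefinite forms, so that it applies to \<open>\<langle>W x, y\<rangle>\<close> with a positive operator \<open>W\<close>.\<close>

lemma semi_inner_Cauchy_Schwarz:
  fixes \<beta> :: "'h::complex_inner \<Rightarrow> 'h \<Rightarrow> complex"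
  assumes add: "\<And>x y z. \<beta> (x + y) z = \<beta> x z + \<beta> y z" and scale: "\<And>a x y. \<beta> (a *\<^sub>C x) y = a * \<beta> x y"
    and herm: "\<And>x y. \<beta> y x = cnj (\<beta> x y)" and pos: "\<And>x. 0 \<le> Re (\<beta> x x)"
  shows "(cmod (\<beta> x y))\<^sup>2 \<le> Re (\<beta> x x) * Re (\<beta> y y)"
proof -
  have add': "\<beta> x (y + z) = \<beta> x y + \<beta> x z" for x y z
    by (metis add herm complex_cnj_add complex_cnj_cnj)
  have scale': "\<beta> x (a *\<^sub>C y) = cnj a * \<beta> x y" for a x y
    by (metis scale herm complex_cnj_mult complex_cnj_cnj)
  \<comment> \<open>The form is evaluated at \<open>x - s \<beta>(x, y) y\<close>; the resulting quadratic polynomial in \<open>s\<close> is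
    minimised below, or \<open>s\<close> is taken large if it is linear.\<close>
  have expand: "0 \<le> Re (\<beta> x x) - 2 * s * (cmod (\<beta> x y))\<^sup>2 + s\<^sup>2 * (cmod (\<beta> x y))\<^sup>2 * Re (\<beta> y y)" for s :: real
  proof -
    define t where "t = - of_real s * \<beta> x y"
    have "\<beta> (x + t *\<^sub>C y) (x + t *\<^sub>C y)
        = \<beta> x x + (cnj t * \<beta> x y + t * \<beta> y x) + (t * cnj t) * \<beta> y y"
      by (simp add: add add' scale scale' algebra_simps)
    also have "cnj t * \<beta> x y + t * \<beta> y x = - of_real (2 * s * (cmod (\<beta> x y))\<^sup>2)"
      unfolding herm [of y x] t_def of_real_mult complex_norm_square by (simp add: algebra_simps)
    also have "t * cnj t = of_real (s\<^sup>2 * (cmod (\<beta> x y))\<^sup>2)"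
      unfolding t_def of_real_mult complex_norm_square by (simp add: power2_eq_square)
    finally show ?thesis using pos [of "x + t *\<^sub>C y"] by simp
  qed
  show ?thesis
  proof (cases "Re (\<beta> y y) = 0")
    case True
    have "(cmod (\<beta> x y))\<^sup>2 = 0"
    proof (rule ccontr)
      assume "(cmod (\<beta> x y))\<^sup>2 \<noteq> 0"
      then have c: "0 < (cmod (\<beta> x y))\<^sup>2" by simp
      have "0 \<le> Re (\<beta> x x) - 2 * (Re (\<beta> x x) + 1) / (cmod (\<beta> x y))\<^sup>2 * (cmod (\<beta> x y))\<^sup>2"
        using expand [of "(Re (\<beta> x x) + 1) / (cmod (\<beta> x y))\<^sup>2"] True by simp
      then show False using c pos [of x] by simp
    qed
    then show ?thesis using True by simp
  next
    case False
    then have a: "0 < Re (\<beta> y y)" using pos [of y] by simp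
    have "0 \<le> Re (\<beta> x x) - (cmod (\<beta> x y))\<^sup>2 / Re (\<beta> y y)"
      using expand [of "1 / Re (\<beta> y y)"] a by (simp add: field_simps power2_eq_square)
    then show ?thesis using a by (simp add: field_simps)
  qed
qed

lemma cinner_Cauchy_Schwarz: "cmod (cinner x (y::'h::complex_inner)) \<le> norm x * norm y"
proof -
  have "(cmod (cinner x y))\<^sup>2 \<le> Re (cinner x x) * Re (cinner y y)"
    by (rule semi_inner_Cauchy_Schwarz)
       (auto simp: cinner_add_left cinner_scaleC_left cinner_self intro: cinner_commute)
  then have "(cmod (cinner x y))\<^sup>2 \<le> (norm x * norm y)\<^sup>2"
    by (simp add: Re_cinner_self power_mult_distrib)
  then show ?thesis by (rule power2_le_imp_le) simp
qed

lemma tendsto_cinner_left: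
  fixes y :: "'h::complex_inner"
  assumes "(f \<longlongrightarrow> l) F"
  shows "((\<lambda>n. cinner (f n) y) \<longlongrightarrow> cinner l y) F"
proof -
  have "((\<lambda>n. cinner (f n) y - cinner l y) \<longlongrightarrow> 0) F"
  proof (rule Lim_null_comparison)
    show "\<forall>\<^sub>F n in F. norm (cinner (f n) y - cinner l y) \<le> norm (f n - l) * norm y"
      unfolding cinner_diff_left [symmetric] by (simp add: cinner_Cauchy_Schwarz)
    have "((\<lambda>n. norm (f n - l) * norm y) \<longlongrightarrow> norm (l - l) * norm y) F"
      by (intro tendsto_intros assms)
    then show "((\<lambda>n. norm (f n - l) * norm y) \<longlongrightarrow> 0) F" by simp
  qed
  then show ?thesis by (simp add: LIM_zero_iff)
qed

lemma norm_diff_square: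
  fixes x y :: "'h::complex_inner"
  shows "(norm (x - y))\<^sup>2 = (norm x)\<^sup>2 - 2 * Re (cinner x y) + (norm y)\<^sup>2"
proof -
  have "Re (cinner y x) = Re (cinner x y)" by (subst cinner_commute) simp
  then show ?thesis
    unfolding Re_cinner_self [symmetric] by (simp add: cinner_diff_left cinner_diff_right)
qed

lemma parallelogram:
  fixes x y :: "'h::complex_inner"
  shows "(norm (x + y))\<^sup>2 + (norm (x - y))\<^sup>2 = 2 * (norm x)\<^sup>2 + 2 * (norm y)\<^sup>2"
  using norm_diff_square [of x y] norm_diff_square [of x "- y"] by (simp add: cinner_minus_right)

section \<open>Orthogonal complements\<close>

definition complex_subspace :: "'h::complex_inner set \<Rightarrow> bool"
  where "complex_subspace K \<longleftrightarrow> 0 \<in> K \<and> (\<forall>x\<in>K. \<forall>y\<in>K. x + y \<in> K) \<and> (\<forall>a. \<forall>x\<in>K. a *\<^sub>C x \<in> K)"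

text \<open>The projection theorem: a minimising sequence for the distance from \<open>x\<close> to \<open>K\<close> is Cauchy by
  the parallelogram law, and the difference of \<open>x\<close> and the nearest point is orthogonal to
  \<open>K\<close>.\<close>

lemma exists_orthogonal_vector:
  fixes K :: "'h::complex_hilbert set"
  assumes K: "complex_subspace K" "closed K" "K \<noteq> UNIV"
  obtains g where "g \<noteq> 0" "\<And>k. k \<in> K \<Longrightarrow> cinner k g = 0"
proof -
  obtain x where x: "x \<notin> K" using K(3) by blast
  have K0: "0 \<in> K" using K(1) by (simp add: complex_subspace_def)
  define d where "d = infdist x K"
  have d: "d \<le> norm (x - k)" if "k \<in> K" for k
    unfolding d_def dist_norm [symmetric] by (rule infdist_le [OF that])
  have d0: "0 \<le> d" unfolding d_def by (rule infdist_nonneg)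
  have "\<exists>k. \<forall>n. k n \<in> K \<and> norm (x - k n) < d + inverse (real (Suc n))"
  proof (intro choice allI)
    fix n
    have "Inf (dist x ` K) < d + inverse (real (Suc n))"
    proof -
      have "K \<noteq> {}" using K0 by blast
      from infdist_notempty [OF this, of x] have "Inf (dist x ` K) = d" by (simp add: d_def)
      then show ?thesis by simp
    qed
    then show "\<exists>k. k \<in> K \<and> norm (x - k) < d + inverse (real (Suc n))"
      using cInf_lessD [of "dist x ` K"] K0 by (auto simp: dist_norm)
  qed
  then obtain k where k: "\<And>n. k n \<in> K" "\<And>n. norm (x - k n) < d + inverse (real (Suc n))" by blast
  have key: "(norm (k m - k n))\<^sup>2 \<le> 2 * ((norm (x - k m))\<^sup>2 - d\<^sup>2) + 2 * ((norm (x - k n))\<^sup>2 - d\<^sup>2)" for m n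
  proof -
    have "(1/2) *\<^sub>C (k m + k n) \<in> K" using K(1) k(1) by (simp add: complex_subspace_def)
    then have "d \<le> norm (x - (1/2) *\<^sub>C (k m + k n))" by (rule d)
    moreover have "(x - k m) + (x - k n) = 2 *\<^sub>C (x - (1/2) *\<^sub>C (k m + k n))"
    proof -
      have "2 *\<^sub>C x = x + x" using scaleC_add_left [of 1 1 x] by simp
      then show ?thesis by (simp add: scaleC_diff_right scaleC_scaleC)
    qed
    then have "norm ((x - k m) + (x - k n)) = 2 * norm (x - (1/2) *\<^sub>C (k m + k n))"
      by (simp add: norm_scaleC)
    ultimately have "(2 * d)\<^sup>2 \<le> (norm ((x - k m) + (x - k n)))\<^sup>2" using d0 by (intro power_mono) auto
    moreover have "(x - k m) - (x - k n) = k n - k m" by simp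
    ultimately show ?thesis using parallelogram [of "x - k m" "x - k n"]
      by (simp add: norm_minus_commute power_mult_distrib)
  qed
  have lim: "(\<lambda>n. norm (x - k n)) \<longlonglongrightarrow> d"
  proof (rule tendsto_sandwich [OF _ _ tendsto_const])
    show "\<forall>\<^sub>F n in sequentially. d \<le> norm (x - k n)" using d k(1) by simp
    show "\<forall>\<^sub>F n in sequentially. norm (x - k n) \<le> d + inverse (real (Suc n))" using k(2) by (simp add: less_imp_le)
    show "(\<lambda>n. d + inverse (real (Suc n))) \<longlonglongrightarrow> d"
      using tendsto_add [OF tendsto_const LIMSEQ_inverse_real_of_nat] by simp
  qed
  have "Cauchy k"
  proof (rule CauchyI)
    fix e :: real assume e: "e > 0"
    have "(\<lambda>n. (norm (x - k n))\<^sup>2 - d\<^sup>2) \<longlonglongrightarrow> d\<^sup>2 - d\<^sup>2" by (intro tendsto_intros lim)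
    then have "\<forall>\<^sub>F n in sequentially. (norm (x - k n))\<^sup>2 - d\<^sup>2 < e\<^sup>2 / 4"
      by (rule order_tendstoD(2)) (use e in simp)
    then obtain N where N: "\<And>n. n \<ge> N \<Longrightarrow> (norm (x - k n))\<^sup>2 - d\<^sup>2 < e\<^sup>2 / 4"
      by (auto simp: eventually_sequentially)
    show "\<exists>M. \<forall>m\<ge>M. \<forall>n\<ge>M. norm (k m - k n) < e"
    proof (intro exI allI impI)
      fix m n assume mn: "m \<ge> N" "n \<ge> N"
      have "(norm (k m - k n))\<^sup>2 < 2 * (e\<^sup>2 / 4) + 2 * (e\<^sup>2 / 4)"
        by (rule le_less_trans [OF key add_strict_mono])
          (rule mult_strict_left_mono [OF N [OF mn(1)]] mult_strict_left_mono [OF N [OF mn(2)]], simp)+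
      then have "(norm (k m - k n))\<^sup>2 < e\<^sup>2" by simp
      then show "norm (k m - k n) < e" using e by (simp add: power2_less_imp_less)
    qed
  qed
  then obtain l where l: "k \<longlonglongrightarrow> l" using Cauchy_convergent_iff convergent_def by blast
  have lK: "l \<in> K" using K(2) k(1) l closed_sequentially by blast
  have "(\<lambda>n. norm (x - k n)) \<longlonglongrightarrow> norm (x - l)" by (intro tendsto_intros l)
  then have nd: "norm (x - l) = d" using lim LIMSEQ_unique by blast
  show thesis
  proof
    show "x - l \<noteq> 0" using x lK by auto
    fix u assume u: "u \<in> K"
    define c where "c = cinner (x - l) u"
    \<comment> \<open>Moving the nearest point by \<open>s c u\<close> with a small \<open>s\<close> would bring it closer to \<open>x\<close> unless
      \<open>c\<close> vanishes.\<close>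
    define s where "s = 1 / ((norm u)\<^sup>2 + 1)"
    have s: "s > 0" "s * (norm u)\<^sup>2 \<le> 1" by (simp_all add: s_def add_nonneg_pos divide_le_eq)
    have "l + (of_real s * c) *\<^sub>C u \<in> K" using K(1) lK u by (simp add: complex_subspace_def)
    then have "d \<le> norm (x - (l + (of_real s * c) *\<^sub>C u))" by (rule d)
    then have "d\<^sup>2 \<le> (norm ((x - l) - (of_real s * c) *\<^sub>C u))\<^sup>2"
      using d0 by (intro power_mono) (auto simp: diff_diff_eq)
    also have "\<dots> = d\<^sup>2 - 2 * Re (cnj (of_real s * c) * c) + (s * cmod c * norm u)\<^sup>2"
      unfolding norm_diff_square cinner_scaleC_right norm_scaleC nd c_def using s
      by (simp add: norm_mult)
    also have "Re (cnj (of_real s * c) * c) = s * (cmod c)\<^sup>2"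
      unfolding cmod_power2 by (simp add: power2_eq_square algebra_simps)
    finally have "2 * (s * (cmod c)\<^sup>2) \<le> (s * (cmod c)\<^sup>2) * (s * (norm u)\<^sup>2)"
      by (simp add: power2_eq_square mult_ac)
    also have "\<dots> \<le> (s * (cmod c)\<^sup>2) * 1" using s by (intro mult_left_mono) auto
    finally have "s * (cmod c)\<^sup>2 \<le> 0" by simp
    then have "c = 0" using s by (simp add: mult_le_0_iff)
    then show "cinner u (x - l) = 0" unfolding c_def by (subst cinner_commute) simp
  qed
qed

section \<open>Orthogonal expansions\<close>

definition fourier_sum :: "'h::complex_inner set \<Rightarrow> 'h \<Rightarrow> 'h"
  where "fourier_sum F u = (\<Sum>e\<in>F. cinner u e *\<^sub>C e)"

lemma cinner_sum_orthonormal: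
  assumes "orthonormal B" "F \<subseteq> B" "finite F" "e \<in> F"
  shows "cinner (\<Sum>f\<in>F. c f *\<^sub>C f) e = c e"
proof -
  have "cinner (\<Sum>f\<in>F. c f *\<^sub>C f) e = (\<Sum>f\<in>F. if f = e then c e else 0)"
    unfolding cinner_sum_left cinner_scaleC_left
    by (rule sum.cong) (use assms in \<open>auto simp: orthonormal_def subset_iff\<close>)
  then show ?thesis using assms by simp
qed

lemma norm_fourier_sum:
  assumes "orthonormal B" "F \<subseteq> B" "finite F"
  shows "(norm (fourier_sum F u))\<^sup>2 = (\<Sum>e\<in>F. (cmod (cinner u e))\<^sup>2)"
proof -
  have "cinner (fourier_sum F u) (fourier_sum F u) = (\<Sum>e\<in>F. cnj (cinner u e) * cinner (fourier_sum F u) e)"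
    by (subst (2) fourier_sum_def) (simp add: cinner_sum_right cinner_scaleC_right)
  also have "\<dots> = (\<Sum>e\<in>F. cnj (cinner u e) * cinner u e)"
    unfolding fourier_sum_def by (intro sum.cong refl) (simp add: cinner_sum_orthonormal [OF assms])
  also have "\<dots> = of_real (\<Sum>e\<in>F. (cmod (cinner u e))\<^sup>2)"
    unfolding of_real_sum complex_norm_square by (simp add: mult.commute)
  finally show ?thesis unfolding cinner_self of_real_eq_iff .
qed

lemma fourier_sum_best_approximation:
  assumes B: "orthonormal B" "F' \<subseteq> B" "finite F'" and F: "F \<subseteq> F'"
  shows "norm (u - fourier_sum F' u) \<le> norm (u - (\<Sum>e\<in>F. c e *\<^sub>C e))"
proof -
  let ?s = "\<Sum>e\<in>F. c e *\<^sub>C e" and ?P = "fourier_sum F' u"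
  have orth: "cinner (u - ?P) e = 0" if "e \<in> F'" for e
    using cinner_sum_orthonormal [OF B that, of "cinner u"] by (simp add: cinner_diff_left fourier_sum_def)
  have "cinner (u - ?P) (?s - ?P) = 0"
    unfolding cinner_diff_right using F
    by (subst (2) fourier_sum_def) (auto simp: cinner_sum_right cinner_scaleC_right orth subset_iff intro!: sum.neutral)
  then have "(norm ((u - ?P) - (?s - ?P)))\<^sup>2 = (norm (u - ?P))\<^sup>2 + (norm (?s - ?P))\<^sup>2"
    unfolding norm_diff_square [of "u - ?P"] by simp
  then have "(norm (u - ?P))\<^sup>2 \<le> (norm (u - ?s))\<^sup>2" by simp
  then show ?thesis by (rule power2_le_imp_le) simp
qed

text \<open>The finite linear combinations of basis vectors are dense, for otherwise a vector orthogonal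
  to their closure would contradict completeness of the basis; the Fourier sums are the best
  approximations.\<close>

lemma fourier_sum_tendsto:
  fixes u :: "'h::complex_hilbert"
  assumes B: "orthonormal_basis B"
  shows "((\<lambda>F. fourier_sum F u) \<longlongrightarrow> u) (finite_subsets_at_top B)"
proof -
  have on: "orthonormal B" and complete: "\<And>x. (\<And>e. e \<in> B \<Longrightarrow> cinner x e = 0) \<Longrightarrow> x = 0"
    using B by (auto simp: orthonormal_basis_def)
  define S where "S = {(\<Sum>e\<in>F. c e *\<^sub>C e) | F c. finite F \<and> F \<subseteq> B}"
  have SI: "(\<Sum>e\<in>F. c e *\<^sub>C e) \<in> S" if "finite F" "F \<subseteq> B" for F c using that by (auto simp: S_def)
  have Sadd: "x + y \<in> S" if xy: "x \<in> S" "y \<in> S" for x y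
  proof -
    obtain F c G d where x: "x = (\<Sum>e\<in>F. c e *\<^sub>C e)" "finite F" "F \<subseteq> B"
      and y: "y = (\<Sum>e\<in>G. d e *\<^sub>C e)" "finite G" "G \<subseteq> B" using xy by (auto simp: S_def)
    have "x = (\<Sum>e\<in>F \<union> G. (if e \<in> F then c e else 0) *\<^sub>C e)"
      unfolding x(1) by (rule sum.mono_neutral_cong_left) (use x y in auto)
    moreover have "y = (\<Sum>e\<in>F \<union> G. (if e \<in> G then d e else 0) *\<^sub>C e)"
      unfolding y(1) by (rule sum.mono_neutral_cong_left) (use x y in auto)
    ultimately have "x + y = (\<Sum>e\<in>F \<union> G. ((if e \<in> F then c e else 0) + (if e \<in> G then d e else 0)) *\<^sub>C e)"
      by (simp add: sum.distrib scaleC_add_left)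
    then show ?thesis using SI [of "F \<union> G"] x y by simp
  qed
  have Sscale: "a *\<^sub>C x \<in> S" if xS: "x \<in> S" for a x
  proof -
    obtain F c where x: "x = (\<Sum>e\<in>F. c e *\<^sub>C e)" "finite F" "F \<subseteq> B" using xS by (auto simp: S_def)
    have "a *\<^sub>C (\<Sum>e\<in>F. c e *\<^sub>C e) = (\<Sum>e\<in>F. (a * c e) *\<^sub>C e)"
      using x(2) by (induction F rule: finite_induct) (auto simp: scaleC_add_right scaleC_scaleC)
    then show ?thesis using SI [of F] x by simp
  qed
  have cont_scale: "continuous_on A (\<lambda>x::'h. a *\<^sub>C x)" for a A
  proof (rule continuous_on_sequentiallyI)
    fix v and l :: 'h assume v: "v \<longlonglongrightarrow> l"
    have "(\<lambda>n. a *\<^sub>C v n - a *\<^sub>C l) \<longlonglongrightarrow> 0"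
    proof (rule Lim_null_comparison)
      show "\<forall>\<^sub>F n in sequentially. norm (a *\<^sub>C v n - a *\<^sub>C l) \<le> cmod a * norm (v n - l)"
        by (simp add: scaleC_diff_right [symmetric] norm_scaleC)
      have "(\<lambda>n. cmod a * norm (v n - l)) \<longlonglongrightarrow> cmod a * norm (l - l)" by (intro tendsto_intros v)
      then show "(\<lambda>n. cmod a * norm (v n - l)) \<longlonglongrightarrow> 0" by simp
    qed
    then show "(\<lambda>n. a *\<^sub>C v n) \<longlonglongrightarrow> a *\<^sub>C l" by (simp add: LIM_zero_iff)
  qed
  have "complex_subspace (closure S)"
    unfolding complex_subspace_def
  proof (intro conjI ballI allI)
    show "0 \<in> closure S" using SI [of "{}"] closure_subset by auto
    fix x y assume "x \<in> closure S" "y \<in> closure S"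
    then obtain a b where a: "\<And>n. a n \<in> S" "a \<longlonglongrightarrow> x" and b: "\<And>n. b n \<in> S" "b \<longlonglongrightarrow> y"
      unfolding closure_sequential by blast
    have "(\<lambda>n. a n + b n) \<longlonglongrightarrow> x + y" by (intro tendsto_add a b)
    then show "x + y \<in> closure S"
      unfolding closure_sequential by (intro exI [of _ "\<lambda>n. a n + b n"]) (simp add: Sadd a(1) b(1))
  next
    fix c :: complex and x assume "x \<in> closure S"
    then have "c *\<^sub>C x \<in> (\<lambda>x. c *\<^sub>C x) ` closure S" by blast
    also have "\<dots> \<subseteq> closure S"
      by (rule image_closure_subset [OF cont_scale closed_closure]) (use Sscale closure_subset in blast)
    finally show "c *\<^sub>C x \<in> closure S" .
  qed
  have "closure S = UNIV"
  proof (rule ccontr)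
    assume "closure S \<noteq> UNIV"
    then obtain g where g: "g \<noteq> 0" "\<And>k. k \<in> closure S \<Longrightarrow> cinner k g = 0"
      using exists_orthogonal_vector [OF \<open>complex_subspace (closure S)\<close> closed_closure] by blast
    have "cinner g e = 0" if "e \<in> B" for e
    proof -
      have "e \<in> S" using SI [of "{e}" "\<lambda>_. 1"] that by simp
      then have "cinner e g = 0" using g(2) closure_subset by blast
      then show ?thesis by (subst cinner_commute) simp
    qed
    then show False using complete g(1) by blast
  qed
  show ?thesis
  proof (rule tendstoI)
    fix \<epsilon> :: real assume "\<epsilon> > 0"
    then obtain s where "s \<in> S" "dist s u < \<epsilon>"
      using \<open>closure S = UNIV\<close> by (metis UNIV_I closure_approachable)
    then obtain F c where F: "finite F" "F \<subseteq> B" "norm (u - (\<Sum>e\<in>F. c e *\<^sub>C e)) < \<epsilon>"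
      by (auto simp: S_def dist_norm norm_minus_commute)
    have "dist (fourier_sum F' u) u < \<epsilon>" if "finite F'" "F \<subseteq> F'" "F' \<subseteq> B" for F'
      using fourier_sum_best_approximation [OF on that(3,1,2), of u c] F(3)
      by (simp add: dist_norm norm_minus_commute)
    then show "\<forall>\<^sub>F F in finite_subsets_at_top B. dist (fourier_sum F u) u < \<epsilon>"
      unfolding eventually_finite_subsets_at_top using F(1,2) by blast
  qed
qed

section \<open>The resolvent of a maximal accumulative operator\<close>

text \<open>Subtracting \<open>z\<close> makes the form of \<open>A\<close> strictly dissipative; the norm bound follows by
  Cauchy-Schwarz.\<close>

lemma accumulative_bounded_below:
  assumes A: "accumulative D A" and z: "Im z > 0" and h: "h \<in> D"
  shows "Im (cinner (A h - z *\<^sub>C h) h) \<le> - Im z * (norm h)\<^sup>2"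
    "Im z * norm h \<le> norm (A h - z *\<^sub>C h)"
proof -
  have "Im (cinner (A h) h) \<le> 0" using A h by (simp add: accumulative_def)
  then show 1: "Im (cinner (A h - z *\<^sub>C h) h) \<le> - Im z * (norm h)\<^sup>2"
    by (simp add: cinner_diff_left cinner_scaleC_left cinner_self)
  have "Im z * (norm h)\<^sup>2 \<le> cmod (cinner (A h - z *\<^sub>C h) h)"
    using 1 abs_Im_le_cmod [of "cinner (A h - z *\<^sub>C h) h"] by linarith
  also have "\<dots> \<le> norm (A h - z *\<^sub>C h) * norm h" by (rule cinner_Cauchy_Schwarz)
  finally have "(Im z * norm h) * norm h \<le> norm (A h - z *\<^sub>C h) * norm h"
    by (simp add: power2_eq_square mult_ac)
  then show "Im z * norm h \<le> norm (A h - z *\<^sub>C h)"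
    by (cases "norm h = 0") (auto simp: mult_le_cancel_right)
qed

lemma linear_op_onD:
  assumes "linear_op_on D A"
  shows "0 \<in> D" "\<And>x y. x \<in> D \<Longrightarrow> y \<in> D \<Longrightarrow> x + y \<in> D" "\<And>x y. x \<in> D \<Longrightarrow> y \<in> D \<Longrightarrow> A (x + y) = A x + A y"
    "\<And>a x. x \<in> D \<Longrightarrow> a *\<^sub>C x \<in> D" "\<And>a x. x \<in> D \<Longrightarrow> A (a *\<^sub>C x) = a *\<^sub>C A x"
    "\<And>x y. x \<in> D \<Longrightarrow> y \<in> D \<Longrightarrow> x - y \<in> D" "\<And>x y. x \<in> D \<Longrightarrow> y \<in> D \<Longrightarrow> A (x - y) = A x - A y"
proof -
  show 1: "0 \<in> D" "\<And>x y. x \<in> D \<Longrightarrow> y \<in> D \<Longrightarrow> x + y \<in> D" "\<And>x y. x \<in> D \<Longrightarrow> y \<in> D \<Longrightarrow> A (x + y) = A x + A y"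
    "\<And>a x. x \<in> D \<Longrightarrow> a *\<^sub>C x \<in> D" "\<And>a x. x \<in> D \<Longrightarrow> A (a *\<^sub>C x) = a *\<^sub>C A x"
    using assms by (simp_all add: linear_op_on_def)
  have m: "x - y = x + (- 1) *\<^sub>C y" for x y :: 'a by (simp add: scaleC_minus_left)
  show "x - y \<in> D" if "x \<in> D" "y \<in> D" for x y unfolding m by (intro 1 that)
  show "A (x - y) = A x - A y" if "x \<in> D" "y \<in> D" for x y
    unfolding m by (simp add: 1 that)
qed

lemma tendsto_scaleC:
  fixes x :: "'h::complex_inner"
  assumes "(f \<longlongrightarrow> a) F" "(g \<longlongrightarrow> x) F"
  shows "((\<lambda>n. f n *\<^sub>C g n) \<longlongrightarrow> a *\<^sub>C x) F"
proof -
  have "((\<lambda>n. f n *\<^sub>C g n - a *\<^sub>C x) \<longlongrightarrow> 0) F"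
  proof (rule Lim_null_comparison)
    show "\<forall>\<^sub>F n in F. norm (f n *\<^sub>C g n - a *\<^sub>C x) \<le> cmod (f n) * norm (g n - x) + cmod (f n - a) * norm x"
    proof (rule always_eventually, rule allI)
      fix n
      have "f n *\<^sub>C g n - a *\<^sub>C x = f n *\<^sub>C (g n - x) + (f n - a) *\<^sub>C x"
        by (simp add: scaleC_diff_left scaleC_diff_right)
      then show "norm (f n *\<^sub>C g n - a *\<^sub>C x) \<le> cmod (f n) * norm (g n - x) + cmod (f n - a) * norm x"
        by (metis norm_scaleC norm_triangle_ineq)
    qed
    have "((\<lambda>n. cmod (f n) * norm (g n - x) + cmod (f n - a) * norm x) \<longlongrightarrow> cmod a * norm (x - x) + cmod (a - a) * norm x) F"
      by (intro tendsto_intros assms)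
    then show "((\<lambda>n. cmod (f n) * norm (g n - x) + cmod (f n - a) * norm x) \<longlongrightarrow> 0) F" by simp
  qed
  then show ?thesis by (simp add: LIM_zero_iff)
qed

lemma closed_graphD:
  assumes "closed ((\<lambda>h. (h, A h)) ` D)" "\<And>n. f n \<in> D" "f \<longlonglongrightarrow> x" "(\<lambda>n. A (f n)) \<longlonglongrightarrow> y"
  shows "x \<in> D" "y = A x"
proof -
  have lim: "(\<lambda>n. (f n, A (f n))) \<longlonglongrightarrow> (x, y)" by (intro tendsto_Pair assms)
  have mem: "(f n, A (f n)) \<in> (\<lambda>h. (h, A h)) ` D" for n by (rule imageI [OF assms(2)])
  have "(x, y) \<in> (\<lambda>h. (h, A h)) ` D"
    by (rule closed_sequentially [OF assms(1) mem lim])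
  then show "x \<in> D" "y = A x" by auto
qed

text \<open>The lower bound turns convergence of the values into convergence of the arguments, and the
  graph of \<open>A\<close> is closed.\<close>

lemma closed_range_shift:
  fixes D :: "'h::complex_hilbert set"
  assumes A: "accumulative D A" and z: "Im z > 0"
  shows "closed ((\<lambda>h. A h - z *\<^sub>C h) ` D)"
proof (rule closed_sequential_limits [THEN iffD2], intro allI impI, elim conjE)
  fix y l assume "\<forall>n. y n \<in> (\<lambda>h. A h - z *\<^sub>C h) ` D" and l: "y \<longlonglongrightarrow> l"
  then have "\<forall>n. \<exists>h. h \<in> D \<and> y n = A h - z *\<^sub>C h" by auto
  then obtain h where h: "\<And>n. h n \<in> D" "\<And>n. y n = A (h n) - z *\<^sub>C h n" by metis
  have lin: "linear_op_on D A" and cl: "closed ((\<lambda>h. (h, A h)) ` D)" using A by (auto simp: accumulative_def)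
  have diff: "Im z * norm (h m - h n) \<le> norm (y m - y n)" for m n
  proof -
    have "y m - y n = A (h m - h n) - z *\<^sub>C (h m - h n)"
      using h by (simp add: linear_op_onD(7) [OF lin] scaleC_diff_right)
    then show ?thesis
      using accumulative_bounded_below(2) [OF A z linear_op_onD(6) [OF lin h(1) h(1)]] by simp
  qed
  have "Cauchy h"
  proof (rule CauchyI)
    fix e :: real assume e: "e > 0"
    have "Cauchy y" using l by (rule LIMSEQ_imp_Cauchy)
    then obtain N where N: "\<And>m n. m \<ge> N \<Longrightarrow> n \<ge> N \<Longrightarrow> norm (y m - y n) < e * Im z"
      using CauchyD [of y "e * Im z"] e z by auto
    show "\<exists>M. \<forall>m\<ge>M. \<forall>n\<ge>M. norm (h m - h n) < e"
    proof (intro exI allI impI)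
      fix m n assume mn: "m \<ge> N" "n \<ge> N"
      have "norm (h m - h n) * Im z < e * Im z" using diff [of m n] N [OF mn] by (simp add: mult.commute)
      then show "norm (h m - h n) < e" using z by simp
    qed
  qed
  then obtain x where x: "h \<longlonglongrightarrow> x" using Cauchy_convergent_iff convergent_def by blast
  have "(\<lambda>n. y n + z *\<^sub>C h n) \<longlonglongrightarrow> l + z *\<^sub>C x" by (intro tendsto_add l tendsto_scaleC tendsto_const x)
  then have "(\<lambda>n. A (h n)) \<longlonglongrightarrow> l + z *\<^sub>C x" by (simp add: h(2))
  from closed_graphD [OF cl h(1) x this] have "x \<in> D" "l = A x - z *\<^sub>C x"
    by (auto simp: eq_diff_eq)
  then show "l \<in> (\<lambda>h. A h - z *\<^sub>C h) ` D" by blast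
qed

text \<open>This is where maximality enters. If the range of \<open>A - z\<close> were not everything, there would be
  a vector \<open>g \<noteq> 0\<close> orthogonal to it. On \<open>D\<close> one then has \<open>\<langle>A h, g\<rangle> = z \<langle>h, g\<rangle>\<close>, as if \<open>g\<close>
  were an eigenvector of the adjoint with eigenvalue \<open>cnj z\<close>. Extending \<open>A\<close> by
  \<open>A g = cnj z g\<close> makes the mixed terms of the quadratic form real, and \<open>Im (cnj z) < 0\<close>, so
  the extension is again accumulative.\<close>

lemma maximal_accumulative_range:
  fixes D :: "'h::complex_hilbert set"
  assumes max: "maximal_accumulative D A" and z: "Im z > 0"
  shows "(\<lambda>h. A h - z *\<^sub>C h) ` D = UNIV"
proof (rule ccontr)
  let ?K = "(\<lambda>h. A h - z *\<^sub>C h) ` D"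
  assume ne: "?K \<noteq> UNIV"
  have A: "accumulative D A" using max by (simp add: maximal_accumulative_def)
  have lin: "linear_op_on D A" and dense: "closure D = UNIV" and cl: "closed ((\<lambda>h. (h, A h)) ` D)"
    and acc: "\<And>h. h \<in> D \<Longrightarrow> Im (cinner (A h) h) \<le> 0" using A by (auto simp: accumulative_def)
  note L = linear_op_onD [OF lin]
  have "complex_subspace ?K"
    unfolding complex_subspace_def
  proof (intro conjI ballI allI)
    have "A 0 = 0" using L(7) [OF L(1) L(1)] by simp
    then show "0 \<in> ?K" using L(1) by force
  next
    fix x y assume "x \<in> ?K" "y \<in> ?K"
    then obtain g h where "g \<in> D" "h \<in> D" "x = A g - z *\<^sub>C g" "y = A h - z *\<^sub>C h" by blast
    then have "x + y = A (g + h) - z *\<^sub>C (g + h)" "g + h \<in> D" by (simp_all add: L scaleC_add_right)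
    then show "x + y \<in> ?K" by blast
  next
    fix a x assume "x \<in> ?K"
    then obtain g where "g \<in> D" "x = A g - z *\<^sub>C g" by blast
    then have "a *\<^sub>C x = A (a *\<^sub>C g) - z *\<^sub>C (a *\<^sub>C g)" "a *\<^sub>C g \<in> D"
      by (simp_all add: L scaleC_diff_right scaleC_scaleC mult.commute)
    then show "a *\<^sub>C x \<in> ?K" by blast
  qed
  then obtain g where g: "g \<noteq> 0" "\<And>k. k \<in> ?K \<Longrightarrow> cinner k g = 0"
    using exists_orthogonal_vector [OF _ closed_range_shift [OF A z] ne] by metis
  have orth: "cinner (A h) g = z * cinner h g" if "h \<in> D" for h
    using g(2) [of "A h - z *\<^sub>C h"] that by (simp add: cinner_diff_left cinner_scaleC_left)
  have ng: "0 < (norm g)\<^sup>2" using g(1) by simp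
  have gD: "g \<notin> D"
  proof
    assume gD: "g \<in> D"
    have "cinner (A g - z *\<^sub>C g) g = 0" by (rule g(2)) (rule imageI [OF gD])
    then have "0 \<le> - Im z * (norm g)\<^sup>2" using accumulative_bounded_below(1) [OF A z gD] by simp
    moreover have "0 < Im z * (norm g)\<^sup>2" using z ng by (rule mult_pos_pos)
    ultimately show False by simp
  qed
  have uniq: "h = h' \<and> c = c'" if "h \<in> D" "h' \<in> D" "h + c *\<^sub>C g = h' + c' *\<^sub>C g" for h h' c c'
  proof -
    have e: "(c' - c) *\<^sub>C g = h - h'" using that(3) by (simp add: scaleC_diff_left algebra_simps)
    have "c = c'"
    proof (rule ccontr)
      assume "c \<noteq> c'"
      then have "g = (1 / (c' - c)) *\<^sub>C ((c' - c) *\<^sub>C g)" by (simp add: scaleC_scaleC)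
      then have "g = (1 / (c' - c)) *\<^sub>C (h - h')" unfolding e .
      then show False using gD L(4) [OF L(6) [OF that(1,2)]] by metis
    qed
    then show ?thesis using that(3) by simp
  qed
  define D' where "D' = {h + c *\<^sub>C g | h c. h \<in> D}"
  define A' where "A' x = (THE y. \<exists>h c. h \<in> D \<and> x = h + c *\<^sub>C g \<and> y = A h + (c * cnj z) *\<^sub>C g)" for x
  have A': "A' (h + c *\<^sub>C g) = A h + (c * cnj z) *\<^sub>C g" if "h \<in> D" for h c
    unfolding A'_def
  proof (rule the_equality)
    show "\<exists>h' c'. h' \<in> D \<and> h + c *\<^sub>C g = h' + c' *\<^sub>C g \<and> A h + (c * cnj z) *\<^sub>C g = A h' + (c' * cnj z) *\<^sub>C g"
      using that by blast
    fix y assume "\<exists>h' c'. h' \<in> D \<and> h + c *\<^sub>C g = h' + c' *\<^sub>C g \<and> y = A h' + (c' * cnj z) *\<^sub>C g"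
    then show "y = A h + (c * cnj z) *\<^sub>C g" using uniq [OF that] by blast
  qed
  have D'I: "h + c *\<^sub>C g \<in> D'" if "h \<in> D" for h c using that by (auto simp: D'_def)
  have D'E: "\<exists>h c. h \<in> D \<and> x = h + c *\<^sub>C g" if "x \<in> D'" for x using that by (auto simp: D'_def)
  have sub: "D \<subseteq> D'"
  proof
    fix h assume "h \<in> D"
    then show "h \<in> D'" using D'I [of h 0] by simp
  qed
  have ext: "A' h = A h" if "h \<in> D" for h using A' [OF that, of 0] by simp
  have "accumulative D' A'"
    unfolding accumulative_def
  proof (intro conjI ballI)
    show "linear_op_on D' A'"
      unfolding linear_op_on_def
    proof (intro conjI ballI allI)
      show "0 \<in> D'" using sub L(1) by blast
      fix x y assume "x \<in> D'" "y \<in> D'"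
      then obtain h c k b where hk: "h \<in> D" "x = h + c *\<^sub>C g" "k \<in> D" "y = k + b *\<^sub>C g" using D'E by meson
      then have s: "x + y = (h + k) + (c + b) *\<^sub>C g" by (simp add: scaleC_add_left)
      show "x + y \<in> D'" unfolding s by (intro D'I L hk)
      show "A' (x + y) = A' x + A' y"
        unfolding s A' [OF L(2) [OF hk(1,3)]] unfolding hk(2,4) A' [OF hk(1)] A' [OF hk(3)]
        by (simp add: L hk scaleC_add_left distrib_right)
    next
      fix a x assume "x \<in> D'"
      then obtain h c where h: "h \<in> D" "x = h + c *\<^sub>C g" using D'E by meson
      then have s: "a *\<^sub>C x = a *\<^sub>C h + (a * c) *\<^sub>C g" by (simp add: scaleC_add_right scaleC_scaleC)
      show "a *\<^sub>C x \<in> D'" unfolding s by (intro D'I L h)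
      show "A' (a *\<^sub>C x) = a *\<^sub>C A' x"
        unfolding s A' [OF L(4) [OF h(1)]] unfolding h(2) A' [OF h(1)]
        by (simp add: L h scaleC_add_right scaleC_scaleC mult.assoc)
    qed
    show "closure D' = UNIV" using closure_mono [OF sub] dense by blast
    show "closed ((\<lambda>h. (h, A' h)) ` D')"
    proof (rule closed_sequential_limits [THEN iffD2], intro allI impI, elim conjE)
      fix p l assume "\<forall>n. p n \<in> (\<lambda>h. (h, A' h)) ` D'" and pl: "p \<longlonglongrightarrow> l"
      then have "\<forall>n. \<exists>h c. h \<in> D \<and> p n = (h + c *\<^sub>C g, A' (h + c *\<^sub>C g))" using D'E by fastforce
      then obtain h c where hc: "\<And>n. h n \<in> D" "\<And>n. p n = (h n + c n *\<^sub>C g, A' (h n + c n *\<^sub>C g))" by metis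
      define x y where "x = fst l" and "y = snd l"
      have lx: "(\<lambda>n. h n + c n *\<^sub>C g) \<longlonglongrightarrow> x" using tendsto_fst [OF pl] by (simp add: hc(2) x_def)
      have ly: "(\<lambda>n. A (h n) + (c n * cnj z) *\<^sub>C g) \<longlonglongrightarrow> y" using tendsto_snd [OF pl] by (simp add: hc A' y_def)
      \<comment> \<open>Pairing \<open>(A' - z) (h + c g)\<close> with \<open>g\<close> isolates \<open>c\<close>, so convergence in the graph of
        \<open>A'\<close> forces convergence of the coefficients and of the components in \<open>D\<close>.\<close>
      have k0: "(cnj z - z) * of_real ((norm g)\<^sup>2) \<noteq> 0" using z ng by (auto simp: complex_eq_iff)
      have "(\<lambda>n. cinner ((A (h n) + (c n * cnj z) *\<^sub>C g) - z *\<^sub>C (h n + c n *\<^sub>C g)) g) \<longlonglongrightarrow> cinner (y - z *\<^sub>C x) g"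
        by (intro tendsto_cinner_left tendsto_diff ly tendsto_scaleC tendsto_const lx)
      moreover have "cinner ((A (h n) + (c n * cnj z) *\<^sub>C g) - z *\<^sub>C (h n + c n *\<^sub>C g)) g
          = c n * ((cnj z - z) * of_real ((norm g)\<^sup>2))" for n
        using orth [OF hc(1) [of n]] by (simp add: cinner_simps cinner_self algebra_simps)
      ultimately have "(\<lambda>n. c n * ((cnj z - z) * of_real ((norm g)\<^sup>2))) \<longlonglongrightarrow> cinner (y - z *\<^sub>C x) g" by simp
      then have "(\<lambda>n. c n * ((cnj z - z) * of_real ((norm g)\<^sup>2)) / ((cnj z - z) * of_real ((norm g)\<^sup>2)))
          \<longlonglongrightarrow> cinner (y - z *\<^sub>C x) g / ((cnj z - z) * of_real ((norm g)\<^sup>2))"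
        by (rule tendsto_divide [OF _ tendsto_const k0])
      then obtain b where b: "c \<longlonglongrightarrow> b" using k0 by auto
      have "(\<lambda>n. (h n + c n *\<^sub>C g) - c n *\<^sub>C g) \<longlonglongrightarrow> x - b *\<^sub>C g"
        by (intro tendsto_diff lx tendsto_scaleC b tendsto_const)
      then have h1: "h \<longlonglongrightarrow> x - b *\<^sub>C g" by simp
      have "(\<lambda>n. (A (h n) + (c n * cnj z) *\<^sub>C g) - (c n * cnj z) *\<^sub>C g) \<longlonglongrightarrow> y - (b * cnj z) *\<^sub>C g"
        by (intro tendsto_diff ly tendsto_scaleC tendsto_mult b tendsto_const)
      then have h2: "(\<lambda>n. A (h n)) \<longlonglongrightarrow> y - (b * cnj z) *\<^sub>C g" by simp
      from closed_graphD [OF cl hc(1) h1 h2] have xD: "x - b *\<^sub>C g \<in> D" and yA: "y = A (x - b *\<^sub>C g) + (b * cnj z) *\<^sub>C g"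
        by (auto simp: diff_eq_eq)
      have "x = (x - b *\<^sub>C g) + b *\<^sub>C g" by simp
      then have "x \<in> D'" "A' x = y" using D'I [OF xD, of b] A' [OF xD, of b] yA by auto
      then show "l \<in> (\<lambda>h. (h, A' h)) ` D'" by (simp add: x_def y_def image_iff prod_eq_iff)
    qed
    fix x assume "x \<in> D'"
    then obtain h c where h: "h \<in> D" "x = h + c *\<^sub>C g" using D'E by meson
    define u where "u = cnj c * (z * cinner h g)"
    have gh: "cinner g h = cnj (cinner h g)" by (rule cinner_commute)
    have "cinner (A' x) x = cinner (A h) h + (u + cnj u) + of_real ((cmod c)\<^sup>2 * (norm g)\<^sup>2) * cnj z"
      using orth [OF h(1)] h unfolding of_real_mult complex_norm_square [of c]
      by (simp add: A' cinner_simps cinner_self gh u_def algebra_simps)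
    then have "Im (cinner (A' x) x) = Im (cinner (A h) h) - (cmod c)\<^sup>2 * (norm g)\<^sup>2 * Im z" by simp
    also have "\<dots> \<le> 0" using acc [OF h(1)] z by (smt (verit) mult_nonneg_nonneg zero_le_power2)
    finally show "Im (cinner (A' x) x) \<le> 0" .
  qed
  then have "D' = D" using max sub ext unfolding maximal_accumulative_def by blast
  moreover have "g \<in> D'" using D'I [OF L(1), of 1] by simp
  ultimately show False using gD by simp
qed

text \<open>The properties of \<open>(A - z)\<^sup>-\<^sup>1\<close> that survive a perturbation of \<open>A\<close> by \<open>- \<i>\<close> times a positive
  operator of rank one. The inequality is dissipativity of \<open>A\<close> expressed at \<open>h = R x\<close>; it
  also bounds \<open>R\<close> by \<open>1 / Im z\<close>.\<close>

definition dissipative_resolvent :: "complex \<Rightarrow> ('h::complex_inner \<Rightarrow> 'h) \<Rightarrow> bool"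
  where "dissipative_resolvent z R \<longleftrightarrow>
    (\<forall>x y. R (x + y) = R x + R y) \<and> (\<forall>a x. R (a *\<^sub>C x) = a *\<^sub>C R x) \<and>
    (\<forall>x. Im z * (norm (R x))\<^sup>2 \<le> Im (cinner (R x) x))"

lemma resolvent_properties:
  fixes D :: "'h::complex_hilbert set"
  assumes max: "maximal_accumulative D A" and z: "Im z > 0"
  shows "resolvent_op D A z x \<in> D" "A (resolvent_op D A z x) - z *\<^sub>C resolvent_op D A z x = x"
    "h \<in> D \<Longrightarrow> resolvent_op D A z (A h - z *\<^sub>C h) = h"
    "dissipative_resolvent z (resolvent_op D A z)"
proof -
  have A: "accumulative D A" using max by (simp add: maximal_accumulative_def)
  have lin: "linear_op_on D A" using A by (simp add: accumulative_def)
  note L = linear_op_onD [OF lin]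
  note ran = maximal_accumulative_range [OF max z]
  let ?R = "resolvent_op D A z"
  show RD: "?R x \<in> D" for x
    unfolding resolvent_op_def by (rule inv_into_into) (simp add: ran)
  show Req: "A (?R x) - z *\<^sub>C ?R x = x" for x
    unfolding resolvent_op_def by (rule f_inv_into_f) (simp add: ran)
  have inj: "h = k" if "h \<in> D" "k \<in> D" "A h - z *\<^sub>C h = A k - z *\<^sub>C k" for h k
  proof -
    have "A (h - k) - z *\<^sub>C (h - k) = (A h - z *\<^sub>C h) - (A k - z *\<^sub>C k)"
      using that(1,2) by (simp add: L scaleC_diff_right)
    then have "A (h - k) - z *\<^sub>C (h - k) = 0" using that(3) by simp
    then have "Im z * norm (h - k) \<le> 0" using accumulative_bounded_below(2) [OF A z L(6) [OF that(1,2)]] by simp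
    then show ?thesis using z by (simp add: mult_le_0_iff)
  qed
  show Rinv: "?R (A h - z *\<^sub>C h) = h" if "h \<in> D" for h
    by (rule inj [OF RD that Req])
  show "dissipative_resolvent z ?R"
    unfolding dissipative_resolvent_def
  proof (intro conjI allI)
    show "?R (x + y) = ?R x + ?R y" for x y
      by (rule inj [OF RD L(2) [OF RD RD]]) (simp add: Req L RD scaleC_add_right add_diff_add)
    show "?R (a *\<^sub>C x) = a *\<^sub>C ?R x" for a x
    proof (rule inj [OF RD L(4) [OF RD]])
      have "A (a *\<^sub>C ?R x) - z *\<^sub>C a *\<^sub>C ?R x = a *\<^sub>C (A (?R x) - z *\<^sub>C ?R x)"
        by (simp add: L RD scaleC_diff_right scaleC_scaleC mult.commute)
      then show "A (?R (a *\<^sub>C x)) - z *\<^sub>C ?R (a *\<^sub>C x) = A (a *\<^sub>C ?R x) - z *\<^sub>C a *\<^sub>C ?R x"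
        by (simp add: Req)
    qed
    show "Im z * (norm (?R x))\<^sup>2 \<le> Im (cinner (?R x) x)" for x
    proof -
      have "Im (cinner x (?R x)) \<le> - Im z * (norm (?R x))\<^sup>2"
        using accumulative_bounded_below(1) [OF A z RD, of x] by (simp add: Req)
      moreover have "Im (cinner (?R x) x) = - Im (cinner x (?R x))"
        by (subst cinner_commute) simp
      ultimately show ?thesis by simp
    qed
  qed
qed

lemma dissipative_resolventD:
  assumes "dissipative_resolvent z R"
  shows "R (x + y) = R x + R y" "R (a *\<^sub>C x) = a *\<^sub>C R x" "R 0 = 0" "R (x - y) = R x - R y"
    "Im z * (norm (R x))\<^sup>2 \<le> Im (cinner (R x) x)" "R (\<Sum>i\<in>I. f i) = (\<Sum>i\<in>I. R (f i))"
proof -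
  show 1: "R (x + y) = R x + R y" "R (a *\<^sub>C x) = a *\<^sub>C R x" "Im z * (norm (R x))\<^sup>2 \<le> Im (cinner (R x) x)" for x y a
    using assms by (auto simp: dissipative_resolvent_def)
  show 0: "R 0 = 0" using 1(2) [of 0 0] by simp
  show "R (x - y) = R x - R y"
    using 1(1) [of x "(- 1) *\<^sub>C y"] 1(2) [of "- 1" y] by (simp add: scaleC_minus_left)
  show "R (\<Sum>i\<in>I. f i) = (\<Sum>i\<in>I. R (f i))"
    by (induction I rule: infinite_finite_induct) (auto simp: 0 1)
qed

lemma dissipative_resolvent_bound:
  assumes R: "dissipative_resolvent z R" and z: "Im z > 0"
  shows "norm (R x) \<le> norm x / Im z"
proof -
  have "Im z * (norm (R x))\<^sup>2 \<le> cmod (cinner (R x) x)"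
    using dissipative_resolventD(5) [OF R, of x] abs_Im_le_cmod [of "cinner (R x) x"] by linarith
  also have "\<dots> \<le> norm (R x) * norm x" by (rule cinner_Cauchy_Schwarz)
  finally have "(Im z * norm (R x)) * norm (R x) \<le> norm x * norm (R x)"
    by (simp add: power2_eq_square mult_ac)
  then have "Im z * norm (R x) \<le> norm x"
    by (cases "norm (R x) = 0") (auto simp: mult_le_cancel_right)
  then show ?thesis using z by (simp add: pos_le_divide_eq mult.commute)
qed

lemma resolvent_identity:
  fixes D :: "'h::complex_hilbert set"
  assumes max: "maximal_accumulative D A" and z: "Im z > 0" and w: "Im w > 0"
  shows "resolvent_op D A z x - resolvent_op D A w x = (z - w) *\<^sub>C resolvent_op D A z (resolvent_op D A w x)"
proof -
  note Rz = resolvent_properties [OF max z] and Rw = resolvent_properties [OF max w]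
  let ?h = "resolvent_op D A w x"
  have "A ?h - z *\<^sub>C ?h = x - (z - w) *\<^sub>C ?h"
    using Rw(2) [of x] by (simp add: scaleC_diff_left) (metis add_diff_cancel_left' diff_add_cancel)
  then have "resolvent_op D A z (x - (z - w) *\<^sub>C ?h) = ?h" using Rz(3) [OF Rw(1), of x] by simp
  then have "resolvent_op D A z x - (z - w) *\<^sub>C resolvent_op D A z ?h = ?h"
    by (simp add: dissipative_resolventD [OF Rz(4)])
  then show ?thesis by (simp add: algebra_simps)
qed

text \<open>By the resolvent identity the difference quotient at \<open>w\<close> is \<open>\<langle>R z (R w x), y\<rangle>\<close>, which is
  continuous in \<open>z\<close>.\<close>

lemma resolvent_weakly_holomorphic:
  fixes D :: "'h::complex_hilbert set"
  assumes max: "maximal_accumulative D A"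
  shows "(\<lambda>z. cinner (resolvent_op D A z x) y) holomorphic_on upper_half_plane"
proof -
  let ?R = "resolvent_op D A"
  have op: "open upper_half_plane" unfolding upper_half_plane_def by (rule open_halfspace_Im_gt)
  have "((\<lambda>z. cinner (?R z x) y) has_field_derivative cinner (?R w (?R w x)) y) (at w)" if wU: "w \<in> upper_half_plane" for w
  proof -
    have w: "Im w > 0" using wU by (simp add: upper_half_plane_def)
    let ?v = "?R w x"
    note Rw = resolvent_properties(4) [OF max w]
    have ev: "\<forall>\<^sub>F z in at w. Im w / 2 < Im z"
    proof -
      have "open {z. Im w / 2 < Im z}" by (rule open_halfspace_Im_gt)
      then have "\<forall>\<^sub>F z in nhds w. z \<in> {z. Im w / 2 < Im z}" using w by (intro eventually_nhds_in_open) auto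
      then show ?thesis unfolding at_within_def by (auto intro: eventually_inf_principal [THEN iffD2] eventually_mono)
    qed
    have lim: "((\<lambda>z. cinner (?R z ?v) y) \<longlongrightarrow> cinner (?R w ?v) y) (at w)"
    proof (rule tendsto_cinner_left)
      have "((\<lambda>z. ?R z ?v - ?R w ?v) \<longlongrightarrow> 0) (at w)"
      proof (rule Lim_null_comparison)
        show "\<forall>\<^sub>F z in at w. norm (?R z ?v - ?R w ?v) \<le> cmod (z - w) * (norm (?R w ?v) / (Im w / 2))"
        proof (rule eventually_mono [OF ev])
          fix z assume z: "Im w / 2 < Im z"
          then have z0: "Im z > 0" using w by simp
          have "norm (?R z ?v - ?R w ?v) = cmod (z - w) * norm (?R z (?R w ?v))"
            unfolding resolvent_identity [OF max z0 w] norm_scaleC ..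
          also have "norm (?R z (?R w ?v)) \<le> norm (?R w ?v) / Im z"
            by (rule dissipative_resolvent_bound [OF resolvent_properties(4) [OF max z0] z0])
          also have "\<dots> \<le> norm (?R w ?v) / (Im w / 2)" using z w z0 by (intro divide_left_mono) auto
          finally show "norm (?R z ?v - ?R w ?v) \<le> cmod (z - w) * (norm (?R w ?v) / (Im w / 2))"
            by (simp add: mult_left_mono)
        qed
        have "((\<lambda>z. cmod (z - w) * (norm (?R w ?v) / (Im w / 2))) \<longlongrightarrow> cmod (w - w) * (norm (?R w ?v) / (Im w / 2))) (at w)"
          by (intro tendsto_mult tendsto_const tendsto_norm tendsto_diff tendsto_ident_at)
        then show "((\<lambda>z. cmod (z - w) * (norm (?R w ?v) / (Im w / 2))) \<longlongrightarrow> 0) (at w)" by simp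
      qed
      then show "((\<lambda>z. ?R z ?v) \<longlongrightarrow> ?R w ?v) (at w)" by (simp add: LIM_zero_iff)
    qed
    show ?thesis
      unfolding has_field_derivative_iff
    proof (rule Lim_transform_eventually [OF lim])
      show "\<forall>\<^sub>F z in at w. cinner (?R z ?v) y = (cinner (?R z x) y - cinner (?R w x) y) / (z - w)"
        using eventually_conj [OF ev eventually_neq_at_within [of w w UNIV]]
      proof (rule eventually_mono)
        fix z assume z: "Im w / 2 < Im z \<and> z \<noteq> w"
        then have z0: "Im z > 0" using w by simp
        show "cinner (?R z ?v) y = (cinner (?R z x) y - cinner (?R w x) y) / (z - w)"
          unfolding cinner_diff_left [symmetric] resolvent_identity [OF max z0 w] cinner_scaleC_left
          using z by simp
      qed
    qed
  qed
  then show ?thesis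
    using holomorphic_onI field_differentiable_def field_differentiable_at_within by metis
qed

section \<open>Positive operators of trace class\<close>

lemma positive_opD:
  fixes W :: "'h::complex_inner \<Rightarrow> 'h"
  assumes "positive_op W"
  shows "bounded_linear W" "W (x + y) = W x + W y" "W (x - y) = W x - W y" "W (a *\<^sub>C x) = a *\<^sub>C W x"
    "cinner (W x) y = cinner x (W y)" "0 \<le> Re (cinner (W x) x)" "W 0 = 0"
proof -
  show b: "bounded_linear W" using assms by (simp add: positive_op_def selfadjoint_op_def bounded_op_def)
  interpret bounded_linear W by (rule b)
  show "W (x + y) = W x + W y" "W (x - y) = W x - W y" "W 0 = 0" by (rule add diff zero)+
  show "W (a *\<^sub>C x) = a *\<^sub>C W x" "cinner (W x) y = cinner x (W y)" "0 \<le> Re (cinner (W x) x)"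
    using assms by (auto simp: positive_op_def selfadjoint_op_def bounded_op_def)
qed

lemma positive_op_hermitian:
  assumes "positive_op W"
  shows "cinner (W y) x = cnj (cinner (W x) y)"
  by (subst positive_opD(5) [OF assms]) (rule cinner_commute)

lemma positive_op_Cauchy_Schwarz:
  assumes W: "positive_op W"
  shows "(cmod (cinner (W x) y))\<^sup>2 \<le> Re (cinner (W x) x) * Re (cinner (W y) y)"
proof (rule semi_inner_Cauchy_Schwarz [of "\<lambda>x y. cinner (W x) y"])
  show "cinner (W (x + y)) z = cinner (W x) z + cinner (W y) z" for x y z
    by (simp add: positive_opD [OF W] cinner_add_left)
  show "cinner (W (a *\<^sub>C x)) y = a * cinner (W x) y" for a x y
    by (simp add: positive_opD [OF W] cinner_scaleC_left)
  show "cinner (W y) x = cnj (cinner (W x) y)" for x y by (rule positive_op_hermitian [OF W])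
  show "0 \<le> Re (cinner (W x) x)" for x by (rule positive_opD(6) [OF W])
qed

lemma positive_op_eq_0:
  assumes W: "positive_op W" and 0: "Re (cinner (W a) a) = 0"
  shows "W a = 0"
proof -
  have "(cmod (cinner (W a) (W a)))\<^sup>2 \<le> 0"
    using positive_op_Cauchy_Schwarz [OF W, of a "W a"] 0 by simp
  then show ?thesis by (simp add: cinner_self)
qed

text \<open>If \<open>V\<close> and \<open>P\<close> are positive with \<open>V\<^sup>2 = P\<^sup>2\<close>, then \<open>V \<le> P\<close>. They are in fact equal, but the
  inequality suffices to compare traces.

  Put \<open>Q = V - P\<close> and suppose that \<open>s = sup {\<langle>Q y, y\<rangle> | norm y = 1}\<close> is positive. A unit
  vector \<open>y\<close> that nearly attains the supremum is an approximate eigenvector: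
  \<open>A y = s y - Q y\<close> is small, because \<open>A\<close> is positive and \<open>\<langle>A y, y\<rangle>\<close> is small. From
  \<open>norm (V y) = norm (P y)\<close> one gets \<open>\<langle>Q y, P y\<rangle> + \<langle>V y, Q y\<rangle> = 0\<close>, hence
  \<open>s (\<langle>P y, y\<rangle> + \<langle>V y, y\<rangle>) = \<langle>A y, P y\<rangle> + \<langle>V y, A y\<rangle>\<close>. The right-hand side is small, but the
  left-hand side is at least \<open>s \<langle>Q y, y\<rangle>\<close>, which is close to \<open>s\<^sup>2\<close>.\<close>

lemma quadratic_form_le_abs:
  fixes V P :: "'h::complex_inner \<Rightarrow> 'h"
  assumes V: "positive_op V" and P: "positive_op P" and sq: "\<And>x. norm (V x) = norm (P x)"
  shows "Re (cinner (V x) x) \<le> Re (cinner (P x) x)"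
proof (rule ccontr)
  define Q where "Q x = V x - P x" for x
  define q where "q x = Re (cinner (Q x) x)" for x
  assume "\<not> ?thesis"
  then have qx: "0 < q x" by (simp add: q_def Q_def cinner_diff_left)
  obtain K1 where K1: "0 < K1" "\<And>x. norm (V x) \<le> norm x * K1"
    using bounded_linear.pos_bounded [OF positive_opD(1) [OF V]] by blast
  obtain K2 where K2: "0 < K2" "\<And>x. norm (P x) \<le> norm x * K2"
    using bounded_linear.pos_bounded [OF positive_opD(1) [OF P]] by blast
  define C where "C = K1 + K2"
  have C: "0 < C" using K1 K2 by (simp add: C_def)
  have Qlin: "Q (x + y) = Q x + Q y" "Q (a *\<^sub>C x) = a *\<^sub>C Q x" for x y a
    by (simp_all add: Q_def positive_opD [OF V] positive_opD [OF P] scaleC_diff_right)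
  have Qb: "norm (Q x) \<le> C * norm x" for x
    using norm_triangle_ineq4 [of "V x" "P x"] K1(2) [of x] K2(2) [of x] by (simp add: Q_def C_def algebra_simps)
  have qb: "q x \<le> C * (norm x)\<^sup>2" for x
  proof -
    have "q x \<le> cmod (cinner (Q x) x)" unfolding q_def by (rule complex_Re_le_cmod)
    also have "\<dots> \<le> norm (Q x) * norm x" by (rule cinner_Cauchy_Schwarz)
    also have "\<dots> \<le> C * norm x * norm x" by (intro mult_right_mono Qb) simp
    finally show ?thesis by (simp add: power2_eq_square mult.assoc)
  qed
  have qscale: "q (of_real t *\<^sub>C y) = t\<^sup>2 * q y" for t y
    by (simp add: q_def Qlin cinner_scaleC_left cinner_scaleC_right power2_eq_square mult.assoc)
  define S where "S = q ` {x. norm x = 1}"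
  have bdd: "bdd_above S" unfolding S_def using qb by (intro bdd_aboveI2 [of _ _ C]) (metis mem_Collect_eq mult.right_neutral one_power2)
  define s where "s = Sup S"
  have unit: "norm (of_real (1 / norm y) *\<^sub>C y) = 1" if "y \<noteq> 0" for y :: 'h
    using that by (simp add: norm_scaleC norm_divide)
  have qs: "q y \<le> s * (norm y)\<^sup>2" for y
  proof (cases "y = 0")
    case True then show ?thesis by (simp add: q_def)
  next
    case False
    have "q (of_real (1 / norm y) *\<^sub>C y) \<le> s"
      unfolding s_def by (rule cSup_upper [OF _ bdd]) (use unit [OF False] in \<open>auto simp: S_def\<close>)
    then have "(1 / norm y)\<^sup>2 * q y \<le> s" unfolding qscale .
    then show ?thesis using False by (simp add: power_one_over field_simps)
  qed
  have x0: "x \<noteq> 0" using qx by (auto simp: q_def)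
  have s: "0 < s"
  proof (rule ccontr)
    assume "\<not> 0 < s"
    then have "s * (norm x)\<^sup>2 \<le> 0" by (intro mult_nonpos_nonneg) auto
    then show False using qx qs [of x] by linarith
  qed
  define A where "A x = of_real s *\<^sub>C x - Q x" for x
  have Ab: "norm (A y) \<le> (s + C) * norm y" for y
    using norm_triangle_ineq4 [of "of_real s *\<^sub>C y" "Q y"] Qb [of y] s
    by (simp add: A_def norm_scaleC algebra_simps)
  have Aq: "Re (cinner (A y) y) = s * (norm y)\<^sup>2 - q y" for y
    by (simp add: A_def q_def cinner_diff_left cinner_scaleC_left cinner_self)
  have ACS: "(cmod (cinner (A x) y))\<^sup>2 \<le> Re (cinner (A x) x) * Re (cinner (A y) y)" for x y
  proof (rule semi_inner_Cauchy_Schwarz [of "\<lambda>x y. cinner (A x) y"])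
    show "cinner (A (x + y)) z = cinner (A x) z + cinner (A y) z" for x y z
      by (simp add: A_def Qlin cinner_simps scaleC_add_right)
    show "cinner (A (a *\<^sub>C x)) y = a * cinner (A x) y" for a x y
      by (simp add: A_def Qlin cinner_simps algebra_simps)
    show "cinner (A y) x = cnj (cinner (A x) y)" for x y
      using positive_op_hermitian [OF V, of y x] positive_op_hermitian [OF P, of y x] cinner_commute [of y x]
      by (simp add: A_def Q_def cinner_simps)
    show "0 \<le> Re (cinner (A x) x)" for x using qs [of x] by (simp add: Aq)
  qed
  define M where "M = s + C"
  have M: "0 < M" using s C by (simp add: M_def)
  have Asq: "(norm (A y))\<^sup>2 \<le> M * (s * (norm y)\<^sup>2 - q y)" for y
  proof (cases "A y = 0")
    case True then show ?thesis using qs [of y] M by simp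
  next
    case False
    have "((norm (A y))\<^sup>2)\<^sup>2 = (cmod (cinner (A y) (A y)))\<^sup>2" by (simp add: cinner_self norm_power)
    also have "\<dots> \<le> Re (cinner (A y) y) * Re (cinner (A (A y)) (A y))" by (rule ACS)
    also have "\<dots> \<le> Re (cinner (A y) y) * (M * (norm (A y))\<^sup>2)"
    proof (rule mult_left_mono)
      have "Re (cinner (A (A y)) (A y)) \<le> norm (A (A y)) * norm (A y)"
        using complex_Re_le_cmod cinner_Cauchy_Schwarz by (rule order_trans)
      also have "\<dots> \<le> (M * norm (A y)) * norm (A y)" unfolding M_def by (intro mult_right_mono Ab) simp
      finally show "Re (cinner (A (A y)) (A y)) \<le> M * (norm (A y))\<^sup>2" by (simp add: power2_eq_square mult.assoc)
      show "0 \<le> Re (cinner (A y) y)" using qs [of y] by (simp add: Aq)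
    qed
    finally have "(norm (A y))\<^sup>2 * (norm (A y))\<^sup>2 \<le> (M * Re (cinner (A y) y)) * (norm (A y))\<^sup>2"
      by (simp add: power2_eq_square mult_ac)
    then have "(norm (A y))\<^sup>2 \<le> M * Re (cinner (A y) y)"
      by (rule mult_right_le_imp_le) (use False in simp)
    then show ?thesis unfolding Aq .
  qed
  have approx: "s * q y \<le> C * norm (A y)" if y: "norm y = 1" for y
  proof -
    have "cinner (Q y) (P y) + cinner (V y) (Q y) = 0"
      using sq [of y] by (simp add: Q_def cinner_diff_left cinner_diff_right cinner_self)
    moreover have Qy: "Q y = of_real s *\<^sub>C y - A y" by (simp add: A_def)
    ultimately have "of_real s * (cinner y (P y) + cinner (V y) y) = cinner (A y) (P y) + cinner (V y) (A y)"
      by (simp add: cinner_simps algebra_simps)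
    then have "Re (of_real s * (cinner y (P y) + cinner (V y) y)) = Re (cinner (A y) (P y) + cinner (V y) (A y))"
      by (rule arg_cong)
    then have e: "s * (Re (cinner (P y) y) + Re (cinner (V y) y)) = Re (cinner (A y) (P y)) + Re (cinner (V y) (A y))"
      by (simp add: positive_opD(5) [OF P])
    have "norm (A y) * norm (P y) \<le> norm (A y) * K2"
      using K2(2) [of y] y by (intro mult_left_mono) auto
    then have "Re (cinner (A y) (P y)) \<le> norm (A y) * K2"
      using order_trans [OF complex_Re_le_cmod cinner_Cauchy_Schwarz, of "A y" "P y"] by linarith
    moreover have "norm (V y) * norm (A y) \<le> K1 * norm (A y)"
      using K1(2) [of y] y by (intro mult_right_mono) auto
    then have "Re (cinner (V y) (A y)) \<le> K1 * norm (A y)"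
      using order_trans [OF complex_Re_le_cmod cinner_Cauchy_Schwarz, of "V y" "A y"] by linarith
    moreover have "s * q y \<le> s * (Re (cinner (P y) y) + Re (cinner (V y) y))"
      using s positive_opD(6) [OF P, of y] by (intro mult_left_mono) (auto simp: q_def Q_def cinner_diff_left)
    ultimately show ?thesis unfolding e C_def by (simp add: algebra_simps)
  qed
  define k where "k = C\<^sup>2 * M + 1"
  have k: "0 < k" using M by (simp add: k_def add_nonneg_pos)
  \<comment> \<open>With \<open>\<langle>Q y, y\<rangle> > s - d\<close> the estimates give \<open>(s\<^sup>2 / 2)\<^sup>2 \<le> k d\<close>; this choice of \<open>d\<close> makes
    that impossible.\<close>
  define d where "d = min (s / 2) (s ^ 4 / (8 * k))"
  have d: "0 < d" "d \<le> s / 2" "d \<le> s ^ 4 / (8 * k)" using s k by (auto simp: d_def)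
  have "S \<noteq> {}" using unit [OF x0] by (auto simp: S_def)
  moreover have "s - d < Sup S" using d by (simp add: s_def)
  ultimately obtain y where y: "norm y = 1" "s - d < q y"
    using less_cSup_iff [OF _ bdd] by (auto simp: S_def)
  have "s / 2 \<le> q y" using y d by simp
  then have "s * (s / 2) \<le> C * norm (A y)" using approx [OF y(1)] s mult_left_mono [of "s / 2" "q y" s] by linarith
  then have "(s * (s / 2))\<^sup>2 \<le> (C * norm (A y))\<^sup>2" using s by (intro power_mono) auto
  also have "\<dots> \<le> C\<^sup>2 * (M * (s - q y))"
    using Asq [of y] y(1) unfolding power_mult_distrib by (intro mult_left_mono) auto
  also have "\<dots> \<le> C\<^sup>2 * (M * d)" using y M by (intro mult_left_mono) auto
  also have "\<dots> \<le> k * d" using d by (simp add: k_def algebra_simps)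
  also have "\<dots> \<le> s ^ 4 / 8" using d(3) k by (simp add: field_simps)
  finally have "s ^ 4 / 4 \<le> s ^ 4 / 8" by (simp add: power2_eq_square power4_eq_xxxx)
  then show False using s by simp
qed

lemma trace_class_diagonal_summable:
  fixes V :: "'h::complex_hilbert \<Rightarrow> 'h"
  assumes V: "positive_op V" "trace_class V"
  shows "(\<lambda>e. Re (cinner (V e) e)) summable_on some_basis"
proof -
  obtain P where P: "positive_op P" "\<And>x y. cinner (P (P x)) y = cinner (V x) (V y)"
    and s: "(\<lambda>e. Re (cinner (P e) e)) summable_on some_basis"
    using V(2) by (auto simp: trace_class_def is_abs_op_def)
  have "norm (V x) = norm (P x)" for x
  proof -
    have "cinner (V x) (V x) = cinner (P x) (P x)"
      using P(2) [of x x] positive_opD(5) [OF P(1), of "P x" x] by simp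
    then have "(norm (V x))\<^sup>2 = (norm (P x))\<^sup>2" unfolding cinner_self of_real_eq_iff .
    then show ?thesis by (rule power2_eq_imp_eq) auto
  qed
  then show ?thesis
    by (intro summable_on_comparison_test [OF s] quadratic_form_le_abs [OF V(1) P(1)] positive_opD(6) [OF V(1)])
qed

section \<open>Cholesky elimination for positive operators\<close>

text \<open>If \<open>\<langle>W a, a\<rangle> = 0\<close> this is the zero vector, by \<open>x / 0 = 0\<close>; then also \<open>W a = 0\<close>, and nothing
  needs to be subtracted.\<close>

definition pivot_vector :: "('h::complex_inner \<Rightarrow> 'h) \<Rightarrow> 'h \<Rightarrow> 'h"
  where "pivot_vector W a = of_real (1 / sqrt (Re (cinner (W a) a))) *\<^sub>C W a"

text \<open>The operator \<open>W - u \<otimes> u\<close> with the pivot vector \<open>u\<close>, which is the Schur complement of \<open>W\<close>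
  with respect to the line spanned by \<open>a\<close>.\<close>

definition deflate :: "('h::complex_inner \<Rightarrow> 'h) \<Rightarrow> 'h \<Rightarrow> 'h \<Rightarrow> 'h"
  where "deflate W a x = W x - cinner x (pivot_vector W a) *\<^sub>C pivot_vector W a"

lemma deflate_form:
  "cinner (deflate W a x) y = cinner (W x) y - cinner x (pivot_vector W a) * cinner (pivot_vector W a) y"
  by (simp add: deflate_def cinner_simps)

text \<open>Positivity is the inequality of Cauchy and Schwarz for the form of \<open>W\<close>.\<close>

lemma positive_op_deflate:
  assumes W: "positive_op W"
  shows "positive_op (deflate W a)" "deflate W a a = 0" "W b = 0 \<Longrightarrow> deflate W a b = 0"
proof -
  let ?u = "pivot_vector W a"
  define r where "r = Re (cinner (W a) a)"
  have r0: "0 \<le> r" unfolding r_def by (rule positive_opD(6) [OF W])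
  have xu: "cinner x ?u = of_real (1 / sqrt r) * cinner (W x) a" for x
    by (simp add: pivot_vector_def cinner_scaleC_right r_def positive_opD(5) [OF W, of x a])
  have diag: "cinner (W a) a = of_real r"
    using positive_op_hermitian [OF W, of a a] by (simp add: r_def complex_eq_iff)
  have bl: "bounded_linear (deflate W a)"
  proof -
    have "bounded_linear (\<lambda>x. cinner x ?u *\<^sub>C ?u)"
    proof (rule bounded_linear_intro)
      show "cinner (x + y) ?u *\<^sub>C ?u = cinner x ?u *\<^sub>C ?u + cinner y ?u *\<^sub>C ?u" for x y
        by (simp add: cinner_add_left scaleC_add_left)
      show "cinner (t *\<^sub>R x) ?u *\<^sub>C ?u = t *\<^sub>R (cinner x ?u *\<^sub>C ?u)" for t x
        by (simp add: scaleR_scaleC cinner_scaleC_left scaleC_scaleC)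
      show "norm (cinner x ?u *\<^sub>C ?u) \<le> norm x * (norm ?u * norm ?u)" for x
        using mult_right_mono [OF cinner_Cauchy_Schwarz [of x ?u], of "norm ?u"] by (simp add: norm_scaleC mult.assoc)
    qed
    then show ?thesis unfolding deflate_def by (rule bounded_linear_sub [OF positive_opD(1) [OF W]])
  qed
  show "positive_op (deflate W a)"
    unfolding positive_op_def selfadjoint_op_def bounded_op_def
  proof (intro conjI allI)
    show "bounded_linear (deflate W a)" by (rule bl)
    show "deflate W a (c *\<^sub>C x) = c *\<^sub>C deflate W a x" for c x
      by (simp add: deflate_def positive_opD [OF W] cinner_scaleC_left scaleC_diff_right scaleC_scaleC)
    show "cinner (deflate W a x) y = cinner x (deflate W a y)" for x y
    proof -
      have "cinner x (deflate W a y) = cinner x (W y) - cnj (cinner y ?u) * cinner x ?u"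
        by (simp add: deflate_def cinner_simps)
      also have "cnj (cinner y ?u) = cinner ?u y" by (rule cinner_commute [symmetric])
      finally show ?thesis by (simp add: deflate_form positive_opD(5) [OF W] mult.commute)
    qed
    show "0 \<le> Re (cinner (deflate W a x) x)" for x
    proof -
      have "cinner ?u x = cnj (cinner x ?u)" by (rule cinner_commute)
      then have e: "Re (cinner (deflate W a x) x) = Re (cinner (W x) x) - (cmod (cinner x ?u))\<^sup>2"
        by (simp add: deflate_form complex_mult_cnj cmod_power2)
      have "(cmod (cinner x ?u))\<^sup>2 \<le> Re (cinner (W x) x)"
      proof (cases "r = 0")
        case True
        then show ?thesis using positive_opD(6) [OF W, of x] by (simp add: xu)
      next
        case False
        then have r: "0 < r" using r0 by simp
        have "(cmod (cinner (W x) a))\<^sup>2 \<le> Re (cinner (W x) x) * r"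
          unfolding r_def by (rule positive_op_Cauchy_Schwarz [OF W])
        then show ?thesis using r
          by (simp add: xu norm_mult norm_divide power_divide power_mult_distrib pos_divide_le_eq)
      qed
      then show ?thesis unfolding e by simp
    qed
  qed
  show "deflate W a a = 0"
  proof (cases "r = 0")
    case True
    then have "W a = 0" unfolding r_def by (rule positive_op_eq_0 [OF W])
    then show ?thesis by (simp add: deflate_def pivot_vector_def)
  next
    case False
    then have r: "0 < r" using r0 by simp
    have "cinner a ?u * of_real (1 / sqrt r) = 1"
      unfolding xu diag using r by (simp add: of_real_mult [symmetric] del: of_real_mult)
    then have "cinner a ?u *\<^sub>C ?u = W a"
      unfolding pivot_vector_def [of W a, folded r_def] scaleC_scaleC
      by (metis pivot_vector_def r_def scaleC_one)
    then show ?thesis by (simp add: deflate_def)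
  qed
  show "deflate W a b = 0" if "W b = 0" using that by (simp add: deflate_def xu)
qed

primrec cholesky_remainder :: "('h::complex_inner \<Rightarrow> 'h) \<Rightarrow> (nat \<Rightarrow> 'h) \<Rightarrow> nat \<Rightarrow> 'h \<Rightarrow> 'h"
  where "cholesky_remainder V e 0 = V"
  | "cholesky_remainder V e (Suc k) = deflate (cholesky_remainder V e k) (e k)"

text \<open>Deflation along the basis vectors one after the other writes \<open>V\<close> as a sum of operators of
  rank one. Every basis vector lies in the kernel of all sufficiently late remainders, so
  each column of \<open>V\<close> is a finite sum; no convergence question arises for single matrix
  entries. The remainders being positive, the squared norms of the vectors add up to at most
  the trace.\<close>

lemma rank_one_decomposition:
  fixes V :: "'h::complex_hilbert \<Rightarrow> 'h"
  assumes V: "positive_op V" "trace_class V"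
  obtains u :: "nat \<Rightarrow> 'h" where "summable (\<lambda>n. (norm (u n))\<^sup>2)"
    "\<And>f. f \<in> some_basis \<Longrightarrow> \<exists>N0. \<forall>N\<ge>N0. \<forall>x. cinner (V x) f = (\<Sum>n<N. cinner x (u n) * cinner (u n) f)"
proof -
  let ?B = "some_basis :: 'h set"
  have ob: "orthonormal_basis ?B" by (rule orthonormal_basis_some_basis)
  then have on: "orthonormal ?B" by (simp add: orthonormal_basis_def)
  have tr: "(\<lambda>e. Re (cinner (V e) e)) summable_on ?B" by (rule trace_class_diagonal_summable [OF V])
  define B' where "B' = {e \<in> ?B. Re (cinner (V e) e) \<noteq> 0}"
  have cB: "countable B'"
    unfolding B'_def by (rule summable_countable_real [OF tr])
  \<comment> \<open>An enumeration, with repetitions, of the basis vectors with nonzero diagonal entry; the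
    others are in the kernel of \<open>V\<close> already.\<close>
  define e where "e n = (if B' = {} then 0 else from_nat_into B' n)" for n
  define W where "W = cholesky_remainder V e"
  define u where "u n = pivot_vector (W n) (e n)" for n
  have Wpos: "positive_op (W n)" for n
    unfolding W_def by (induction n) (simp_all add: V positive_op_deflate(1))
  have W0: "W 0 = V" by (simp add: W_def)
  have WSuc: "W (Suc n) = deflate (W n) (e n)" for n by (simp add: W_def)
  have keep: "W N b = 0" if "W n b = 0" "n \<le> N" for n N b
    using that(2,1)
  proof (induction N rule: dec_induct)
    case (step m)
    then show ?case unfolding WSuc by (intro positive_op_deflate(3) Wpos) simp
  qed
  have form: "cinner (W N x) y = cinner (V x) y - (\<Sum>n<N. cinner x (u n) * cinner (u n) y)" for N x y
    by (induction N) (simp_all add: W0 WSuc deflate_form u_def)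
  have part2: "\<exists>N0. \<forall>N\<ge>N0. \<forall>x. cinner (V x) f = (\<Sum>n<N. cinner x (u n) * cinner (u n) f)" if f: "f \<in> ?B" for f
  proof -
    have "\<exists>N0. W N0 f = 0"
    proof (cases "f \<in> B'")
      case True
      obtain k where "from_nat_into B' k = f" using from_nat_into_surj [OF cB True] by blast
      then have "f = e k" using True by (auto simp: e_def)
      then have "W (Suc k) f = 0" unfolding WSuc by (simp add: positive_op_deflate(2) [OF Wpos])
      then show ?thesis by blast
    next
      case False
      then have "Re (cinner (V f) f) = 0" using f by (simp add: B'_def)
      then have "W 0 f = 0" unfolding W0 by (rule positive_op_eq_0 [OF V(1)])
      then show ?thesis by blast
    qed
    then obtain N0 where N0: "W N0 f = 0" by blast
    have "cinner (V x) f = (\<Sum>n<N. cinner x (u n) * cinner (u n) f)" if "N \<ge> N0" for N x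
    proof -
      have "cinner (W N x) f = cinner x (W N f)" by (rule positive_opD(5) [OF Wpos])
      also have "\<dots> = 0" by (simp add: keep [OF N0 that])
      finally show ?thesis unfolding form by simp
    qed
    then show ?thesis by blast
  qed
  define t where "t = infsum (\<lambda>e. Re (cinner (V e) e)) ?B"
  \<comment> \<open>On a finite part of the basis the two sums may be interchanged; the bound then passes to
    the limit.\<close>
  have fin: "(\<Sum>n<N. (norm (fourier_sum F (u n)))\<^sup>2) \<le> t" if F: "finite F" "F \<subseteq> ?B" for F N
  proof -
    have "(\<Sum>n<N. (norm (fourier_sum F (u n)))\<^sup>2) = (\<Sum>f\<in>F. \<Sum>n<N. (cmod (cinner (u n) f))\<^sup>2)"
      unfolding norm_fourier_sum [OF on F(2,1)] by (rule sum.swap)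
    also have "\<dots> \<le> (\<Sum>f\<in>F. Re (cinner (V f) f))"
    proof (rule sum_mono)
      fix f
      have "0 \<le> Re (cinner (W N f) f)" by (rule positive_opD(6) [OF Wpos])
      also have "\<dots> = Re (cinner (V f) f) - (\<Sum>n<N. Re (cinner f (u n) * cinner (u n) f))" by (simp add: form)
      also have "(\<Sum>n<N. Re (cinner f (u n) * cinner (u n) f)) = (\<Sum>n<N. (cmod (cinner (u n) f))\<^sup>2)"
      proof (rule sum.cong [OF refl])
        fix n
        have "cinner f (u n) = cnj (cinner (u n) f)" by (rule cinner_commute)
        then show "Re (cinner f (u n) * cinner (u n) f) = (cmod (cinner (u n) f))\<^sup>2"
          unfolding cmod_power2 by (simp add: power2_eq_square)
      qed
      finally show "(\<Sum>n<N. (cmod (cinner (u n) f))\<^sup>2) \<le> Re (cinner (V f) f)" by simp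
    qed
    also have "\<dots> \<le> t"
      unfolding t_def using F by (intro finite_sum_le_infsum tr positive_opD(6) [OF V(1)])
    finally show ?thesis .
  qed
  have le: "(\<Sum>n<N. (norm (u n))\<^sup>2) \<le> t" for N
  proof (rule tendsto_upperbound)
    show "((\<lambda>F. \<Sum>n<N. (norm (fourier_sum F (u n)))\<^sup>2) \<longlongrightarrow> (\<Sum>n<N. (norm (u n))\<^sup>2)) (finite_subsets_at_top ?B)"
      by (intro tendsto_sum tendsto_power tendsto_norm fourier_sum_tendsto ob)
    show "\<forall>\<^sub>F F in finite_subsets_at_top ?B. (\<Sum>n<N. (norm (fourier_sum F (u n)))\<^sup>2) \<le> t"
      by (rule eventually_finite_subsets_at_top_weakI) (rule fin)
  qed simp
  have "summable (\<lambda>n. (norm (u n))\<^sup>2)"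
    by (rule summableI_nonneg_bounded [OF _ le]) simp
  then show thesis using that part2 by blast
qed

section \<open>Minors of factorised matrices\<close>

text \<open>By the formula of Cauchy and Binet this is the principal minor over \<open>F\<close> of the Gram matrix
  \<open>c\<^sup>* c\<close>, where \<open>c\<close> has \<open>N\<close> rows. In this form it is visibly nonnegative and increasing in
  \<open>N\<close>.\<close>

definition gram_minor :: "(nat \<Rightarrow> 'a \<Rightarrow> complex) \<Rightarrow> nat \<Rightarrow> 'a set \<Rightarrow> real"
  where "gram_minor c N F =
    (\<Sum>\<phi>\<in>F \<rightarrow>\<^sub>E {..<N}. (cmod (set_det F (\<lambda>e f. c (\<phi> e) f)))\<^sup>2) / fact (card F)"

lemma set_det_cnj: "cnj (set_det F A) = set_det F (\<lambda>e f. cnj (A e f))"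
  by (simp add: set_det_def)

lemma set_det_gram:
  assumes "finite F"
  shows "set_det F (\<lambda>e f. \<Sum>n<N. cnj (c n e) * c n f) = of_real (gram_minor c N F)"
proof -
  have "fact (card F) * set_det F (\<lambda>e f. \<Sum>n<N. cnj (c n e) * c n f)
      = (\<Sum>\<phi>\<in>F \<rightarrow>\<^sub>E {..<N}. cnj (set_det F (\<lambda>e f. c (\<phi> e) f)) * set_det F (\<lambda>e f. c (\<phi> e) f))"
    unfolding set_det_cnj by (rule set_det_Cauchy_Binet [OF assms]) simp
  also have "\<dots> = of_real (\<Sum>\<phi>\<in>F \<rightarrow>\<^sub>E {..<N}. (cmod (set_det F (\<lambda>e f. c (\<phi> e) f)))\<^sup>2)"
    unfolding of_real_sum complex_norm_square by (simp add: mult.commute)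
  also have "\<dots> = fact (card F) * of_real (gram_minor c N F)"
    by (simp add: gram_minor_def)
  finally show ?thesis by simp
qed

lemma gram_minor_nonneg: "0 \<le> gram_minor c N F"
  unfolding gram_minor_def by (intro divide_nonneg_nonneg sum_nonneg) auto

lemma gram_minor_mono:
  assumes "finite F" "N \<le> M"
  shows "gram_minor c N F \<le> gram_minor c M F"
  unfolding gram_minor_def
proof (rule divide_right_mono, rule sum_mono2)
  show "finite (F \<rightarrow>\<^sub>E {..<M})" using assms by (intro finite_PiE) auto
  show "F \<rightarrow>\<^sub>E {..<N} \<subseteq> F \<rightarrow>\<^sub>E {..<M}" using assms(2) by (intro PiE_mono) auto
qed auto

text \<open>The minors of a product of two matrices are bounded by those of two Gram matrices: in the
  formula of Cauchy and Binet each product is at most the mean of the squares.\<close>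

lemma set_det_product_bound:
  assumes F: "finite F"
  shows "cmod (set_det F (\<lambda>e f. \<Sum>n<N. a n e * b n f)) \<le> (gram_minor (\<lambda>n e. cnj (a n e)) N F + gram_minor b N F) / 2"
proof -
  let ?D = "\<lambda>c \<phi>. set_det F (\<lambda>e f. c (\<phi> e) f) :: complex"
  have a: "cmod (?D (\<lambda>n e. cnj (a n e)) \<phi>) = cmod (?D a \<phi>)" for \<phi>
    using arg_cong [OF set_det_cnj [of F "\<lambda>e f. a (\<phi> e) f"], of cmod] by simp
  have CB: "fact (card F) * set_det F (\<lambda>e f. \<Sum>n<N. a n e * b n f) = (\<Sum>\<phi>\<in>F \<rightarrow>\<^sub>E {..<N}. ?D a \<phi> * ?D b \<phi>)"
    by (rule set_det_Cauchy_Binet [OF F]) simp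
  have "fact (card F) * cmod (set_det F (\<lambda>e f. \<Sum>n<N. a n e * b n f)) = cmod (\<Sum>\<phi>\<in>F \<rightarrow>\<^sub>E {..<N}. ?D a \<phi> * ?D b \<phi>)"
    unfolding CB [symmetric] norm_mult norm_fact ..
  also have "\<dots> \<le> (\<Sum>\<phi>\<in>F \<rightarrow>\<^sub>E {..<N}. ((cmod (?D a \<phi>))\<^sup>2 + (cmod (?D b \<phi>))\<^sup>2) / 2)"
  proof (rule sum_norm_le)
    fix \<phi>
    have "x * y \<le> (x\<^sup>2 + y\<^sup>2) / 2" for x y :: real
      using zero_le_power2 [of "x - y"] unfolding power2_diff by simp
    then show "cmod (?D a \<phi> * ?D b \<phi>) \<le> ((cmod (?D a \<phi>))\<^sup>2 + (cmod (?D b \<phi>))\<^sup>2) / 2"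
      unfolding norm_mult .
  qed
  also have "\<dots> = fact (card F) * ((gram_minor (\<lambda>n e. cnj (a n e)) N F + gram_minor b N F) / 2)"
    unfolding gram_minor_def a by (simp add: sum.distrib sum_divide_distrib [symmetric] field_simps)
  finally show ?thesis by (simp add: mult_le_cancel_left_pos)
qed

text \<open>The sum of all principal minors is \<open>det (1 + c\<^sup>* c)\<close>, which is at most the product of its
  diagonal entries. The bound depends only on the Hilbert-Schmidt norm of \<open>c\<close>, not on \<open>F\<close>
  and \<open>N\<close>.\<close>

lemma sum_gram_minor_le:
  fixes c :: "nat \<Rightarrow> 'a \<Rightarrow> complex"
  assumes F: "finite F" and K: "(\<Sum>e\<in>F. \<Sum>n<N. (cmod (c n e))\<^sup>2) \<le> K"
  shows "(\<Sum>S\<in>Pow F. gram_minor c N S) \<le> exp K"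
proof -
  let ?A = "\<lambda>e f. \<Sum>n<N. cnj (c n e) * c n f"
  let ?M = "\<lambda>e f. (if e = f then 1 else 0) + ?A e f"
  have "complex_of_real (\<Sum>S\<in>Pow F. gram_minor c N S) = (\<Sum>S\<in>Pow F. set_det S ?A)"
    unfolding of_real_sum using F by (intro sum.cong refl set_det_gram [symmetric]) (auto intro: finite_subset)
  also have "\<dots> = set_det F ?M" by (rule set_det_one_plus [OF F, symmetric])
  finally have "(\<Sum>S\<in>Pow F. gram_minor c N S) \<le> cmod (set_det F ?M)"
    by (metis abs_ge_self norm_of_real)
  also have "\<dots> \<le> (\<Prod>e\<in>F. Re (?M e e))"
  proof (rule set_det_Hadamard [OF F])
    show "?M f e = cnj (?M e f)" for e f by (simp add: mult.commute)
    fix x :: "'a \<Rightarrow> complex"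
    have "(\<Sum>e\<in>F. \<Sum>f\<in>F. x e * cnj (x f) * ?M e f)
        = (\<Sum>e\<in>F. \<Sum>f\<in>F. x e * cnj (x f) * (if e = f then 1 else 0)) + (\<Sum>e\<in>F. \<Sum>f\<in>F. x e * cnj (x f) * ?A e f)"
      by (simp add: distrib_left sum.distrib)
    also have "(\<Sum>e\<in>F. \<Sum>f\<in>F. x e * cnj (x f) * (if e = f then 1 else 0)) = of_real (\<Sum>e\<in>F. (cmod (x e))\<^sup>2)"
      unfolding of_real_sum complex_norm_square
      by (rule sum.cong [OF refl]) (simp add: F if_distrib [of "\<lambda>y. _ * y"] cong: if_cong)
    also have "(\<Sum>e\<in>F. \<Sum>f\<in>F. x e * cnj (x f) * ?A e f)
        = (\<Sum>n<N. (\<Sum>e\<in>F. x e * cnj (c n e)) * (\<Sum>f\<in>F. cnj (x f) * c n f))"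
    proof -
      have "(\<Sum>e\<in>F. \<Sum>f\<in>F. x e * cnj (x f) * ?A e f)
          = (\<Sum>e\<in>F. \<Sum>f\<in>F. \<Sum>n<N. (x e * cnj (c n e)) * (cnj (x f) * c n f))"
        by (simp add: sum_distrib_left mult_ac)
      also have "\<dots> = (\<Sum>e\<in>F. \<Sum>n<N. \<Sum>f\<in>F. (x e * cnj (c n e)) * (cnj (x f) * c n f))"
        by (rule sum.cong [OF refl]) (rule sum.swap)
      also have "\<dots> = (\<Sum>n<N. \<Sum>e\<in>F. \<Sum>f\<in>F. (x e * cnj (c n e)) * (cnj (x f) * c n f))"
        by (rule sum.swap)
      finally show ?thesis by (simp add: sum_product)
    qed
    also have "\<dots> = of_real (\<Sum>n<N. (cmod (\<Sum>e\<in>F. x e * cnj (c n e)))\<^sup>2)"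
      unfolding of_real_sum complex_norm_square by simp
    finally have "Re (\<Sum>e\<in>F. \<Sum>f\<in>F. x e * cnj (x f) * ?M e f)
        = (\<Sum>e\<in>F. (cmod (x e))\<^sup>2) + (\<Sum>n<N. (cmod (\<Sum>e\<in>F. x e * cnj (c n e)))\<^sup>2)"
      by (simp only: plus_complex.sel Re_complex_of_real)
    then show "(\<Sum>e\<in>F. (cmod (x e))\<^sup>2) \<le> Re (\<Sum>e\<in>F. \<Sum>f\<in>F. x e * cnj (x f) * ?M e f)"
      by (simp add: sum_nonneg)
  qed
  also have "\<dots> = (\<Prod>e\<in>F. 1 + (\<Sum>n<N. (cmod (c n e))\<^sup>2))"
  proof (rule prod.cong [OF refl])
    fix e
    have "?M e e = of_real (1 + (\<Sum>n<N. (cmod (c n e))\<^sup>2))"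
      unfolding of_real_add of_real_sum complex_norm_square by (simp add: mult.commute)
    then show "Re (?M e e) = 1 + (\<Sum>n<N. (cmod (c n e))\<^sup>2)" by (simp only: Re_complex_of_real)
  qed
  also have "\<dots> \<le> (\<Prod>e\<in>F. exp (\<Sum>n<N. (cmod (c n e))\<^sup>2))"
    by (intro prod_mono conjI exp_ge_add_one_self add_nonneg_nonneg sum_nonneg) auto
  also have "\<dots> = exp (\<Sum>e\<in>F. \<Sum>n<N. (cmod (c n e))\<^sup>2)" by (rule exp_sum [OF F, symmetric])
  also have "\<dots> \<le> exp K" using K by simp
  finally show ?thesis .
qed

section \<open>Dominated convergence for sums over finite subsets\<close>

lemma filterlim_Pow_finite_subsets:
  "filterlim Pow (finite_subsets_at_top {F. F \<subseteq> B \<and> finite F}) (finite_subsets_at_top B)"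
  unfolding filterlim_finite_subsets_at_top
proof (intro allI impI)
  fix X assume X: "finite X \<and> X \<subseteq> {F. F \<subseteq> B \<and> finite F}"
  then have "finite (\<Union>X)" "\<Union>X \<subseteq> B" by auto
  then show "\<forall>\<^sub>F F in finite_subsets_at_top B. finite (Pow F) \<and> X \<subseteq> Pow F \<and> Pow F \<subseteq> {F. F \<subseteq> B \<and> finite F}"
    unfolding eventually_finite_subsets_at_top by (intro exI [of _ "\<Union>X"]) (auto intro: finite_subset)
qed

text \<open>Outside a large finite set both sums are dominated by a small tail of \<open>\<Gamma>\<close>, and on the finite
  set the terms eventually coincide.\<close>

lemma infsum_tendsto_eventually_eq:
  fixes t :: "nat \<Rightarrow> 'a \<Rightarrow> complex" and \<Gamma> :: "'a \<Rightarrow> real"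
  assumes \<Gamma>: "\<Gamma> summable_on X" and dom: "\<And>N F. F \<in> X \<Longrightarrow> cmod (t N F) \<le> \<Gamma> F"
    and eq: "\<And>F. F \<in> X \<Longrightarrow> \<exists>N0. \<forall>N\<ge>N0. t N F = s F"
  shows "s summable_on X" "t N summable_on X" "(\<lambda>N. infsum (t N) X) \<longlonglongrightarrow> infsum s X"
proof -
  have doms: "cmod (s F) \<le> \<Gamma> F" if "F \<in> X" for F
    using eq [OF that] dom [OF that] by (metis order_refl)
  have G0: "0 \<le> \<Gamma> F" if "F \<in> X" for F using order_trans [OF norm_ge_zero dom [OF that]] .
  have as: "(\<lambda>F. norm (s F)) summable_on X"
    by (rule summable_on_comparison_test [OF \<Gamma> doms]) auto
  then show ss: "s summable_on X" by (rule Infinite_Sum.abs_summable_summable)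
  have at: "(\<lambda>F. norm (t N F)) summable_on X" for N
    by (rule summable_on_comparison_test [OF \<Gamma> dom]) auto
  then show ts: "t N summable_on X" for N by (rule Infinite_Sum.abs_summable_summable)
  show "(\<lambda>N. infsum (t N) X) \<longlonglongrightarrow> infsum s X"
  proof (rule LIMSEQ_I)
    fix r :: real assume r: "r > 0"
    have "(sum \<Gamma> \<longlongrightarrow> infsum \<Gamma> X) (finite_subsets_at_top X)"
      using infsum_tendsto [OF \<Gamma>] .
    then have "\<forall>\<^sub>F Y in finite_subsets_at_top X. dist (sum \<Gamma> Y) (infsum \<Gamma> X) < r / 3"
      by (rule tendstoD) (use r in simp)
    then obtain Y where Y: "finite Y" "Y \<subseteq> X" "dist (sum \<Gamma> Y) (infsum \<Gamma> X) < r / 3"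
      unfolding eventually_finite_subsets_at_top by blast
    have "\<exists>N0. \<forall>F\<in>Y. \<forall>N\<ge>N0. t N F = s F"
      using Y(1,2)
    proof (induction Y rule: finite_induct)
      case (insert F Y)
      then obtain N0 N1 where "\<forall>F\<in>Y. \<forall>N\<ge>N0. t N F = s F" "\<forall>N\<ge>N1. t N F = s F"
        using eq [of F] by auto
      then show ?case by (intro exI [of _ "max N0 N1"]) auto
    qed simp
    then obtain N0 where N0: "\<And>F N. F \<in> Y \<Longrightarrow> N \<ge> N0 \<Longrightarrow> t N F = s F" by blast
    show "\<exists>N0. \<forall>N\<ge>N0. norm (infsum (t N) X - infsum s X) < r"
    proof (intro exI allI impI)
      fix N assume N: "N \<ge> N0"
      have \<Gamma>Y: "\<Gamma> summable_on (X - Y)" using \<Gamma> by (rule summable_on_subset_banach) auto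
      have XY: "Y \<union> (X - Y) = X" using Y by auto
      have tail: "infsum \<Gamma> (X - Y) < r / 3"
      proof -
        have "infsum \<Gamma> (Y \<union> (X - Y)) = infsum \<Gamma> Y + infsum \<Gamma> (X - Y)"
          by (rule infsum_Un_disjoint [OF summable_on_finite [OF Y(1)] \<Gamma>Y]) auto
        then show ?thesis using Y(3) unfolding XY infsum_finite [OF Y(1)] dist_real_def by linarith
      qed
      have split: "infsum f X = sum f Y + infsum f (X - Y)" if "f summable_on X" for f :: "'a \<Rightarrow> complex"
      proof -
        have fY: "f summable_on (X - Y)" using that by (rule summable_on_subset_banach) auto
        have "infsum f (Y \<union> (X - Y)) = infsum f Y + infsum f (X - Y)"
          by (rule infsum_Un_disjoint [OF summable_on_finite [OF Y(1)] fY]) auto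
        then show ?thesis unfolding XY infsum_finite [OF Y(1)] .
      qed
      have b: "cmod (infsum f (X - Y)) \<le> infsum \<Gamma> (X - Y)" if "\<And>F. F \<in> X \<Longrightarrow> cmod (f F) \<le> \<Gamma> F" for f :: "'a \<Rightarrow> complex"
      proof -
        have "(\<lambda>F. norm (f F)) summable_on (X - Y)"
          by (rule summable_on_comparison_test [OF \<Gamma>Y]) (use that in auto)
        then have "f summable_on (X - Y)" by (rule Infinite_Sum.abs_summable_summable)
        then show ?thesis
          by (rule norm_infsum_le [OF has_sum_infsum has_sum_infsum [OF \<Gamma>Y]]) (use that in auto)
      qed
      have "sum (t N) Y = sum s Y" by (rule sum.cong) (simp_all add: N0 N)
      then have "infsum (t N) X - infsum s X = infsum (t N) (X - Y) - infsum s (X - Y)"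
        using split [OF ts [of N]] split [OF ss] by simp
      moreover have "cmod (infsum (t N) (X - Y)) \<le> infsum \<Gamma> (X - Y)" by (rule b) (rule dom)
      moreover have "cmod (infsum s (X - Y)) \<le> infsum \<Gamma> (X - Y)" by (rule b) (rule doms)
      ultimately have "norm (infsum (t N) X - infsum s X) \<le> infsum \<Gamma> (X - Y) + infsum \<Gamma> (X - Y)"
        using norm_triangle_ineq4 [of "infsum (t N) (X - Y)" "infsum s (X - Y)"] by simp
      then show "norm (infsum (t N) X - infsum s X) < r" using tail r by simp
    qed
  qed
qed

section \<open>Rank one updates of the resolvent\<close>

text \<open>The formula of Sherman and Morrison: if \<open>R = (A - z)\<^sup>-\<^sup>1\<close>, then this is the resolvent of
  \<open>A - \<i> (u\<^sub>0 \<otimes> u\<^sub>0 + \<dots> + u\<^sub>k\<^sub>-\<^sub>1 \<otimes> u\<^sub>k\<^sub>-\<^sub>1)\<close> at \<open>z\<close>, one summand being added in each step.\<close>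

primrec rank_one_resolvent :: "('h::complex_inner \<Rightarrow> 'h) \<Rightarrow> (nat \<Rightarrow> 'h) \<Rightarrow> nat \<Rightarrow> 'h \<Rightarrow> 'h"
  where "rank_one_resolvent R u 0 = R"
  | "rank_one_resolvent R u (Suc k) = (\<lambda>x. rank_one_resolvent R u k x +
      (\<i> * cinner (rank_one_resolvent R u k x) (u k) / (1 - \<i> * cinner (rank_one_resolvent R u k (u k)) (u k)))
        *\<^sub>C rank_one_resolvent R u k (u k))"

text \<open>The perturbation determinant of the \<open>k\<close>-th step, and at the same time the \<open>k\<close>-th pivot of
  Gaussian elimination in \<open>1 - \<i> (\<langle>R u\<^sub>m, u\<^sub>n\<rangle>)\<close>.\<close>

definition pivot :: "('h::complex_inner \<Rightarrow> 'h) \<Rightarrow> (nat \<Rightarrow> 'h) \<Rightarrow> nat \<Rightarrow> complex"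
  where "pivot R u k = 1 - \<i> * cinner (rank_one_resolvent R u k (u k)) (u k)"

lemma dissipative_pivot:
  assumes R: "dissipative_resolvent z R" and z: "Im z > 0"
  shows "1 \<le> Re (1 - \<i> * cinner (R v) v)"
proof -
  have "0 \<le> Im z * (norm (R v))\<^sup>2" using z by simp
  then show ?thesis using dissipative_resolventD(5) [OF R, of v] by simp
qed

text \<open>Adding \<open>- \<i> v \<otimes> v\<close> to the operator can only decrease the imaginary part of its form.\<close>

lemma dissipative_resolvent_update:
  fixes R :: "'h::complex_inner \<Rightarrow> 'h"
  assumes R: "dissipative_resolvent z R" and z: "Im z > 0"
  shows "dissipative_resolvent z (\<lambda>x. R x + (\<i> * cinner (R x) v / (1 - \<i> * cinner (R v) v)) *\<^sub>C R v)"
proof -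
  note D = dissipative_resolventD [OF R]
  define p where "p = 1 - \<i> * cinner (R v) v"
  have "1 \<le> Re p" unfolding p_def by (rule dissipative_pivot [OF R z])
  then have p: "p \<noteq> 0" by auto
  define c where "c x = \<i> * cinner (R x) v / p" for x
  define h where "h x = R x + c x *\<^sub>C R v" for x
  have "Im z * (norm (h x))\<^sup>2 \<le> Im (cinner (h x) x)" for x
  proof -
    \<comment> \<open>The value of the old operator at \<open>h x\<close>; it differs from \<open>x\<close> by the perturbation
      \<open>- \<i> \<langle>h x, v\<rangle> v\<close>.\<close>
    define y where "y = x + c x *\<^sub>C v"
    have hy: "h x = R y" by (simp add: h_def y_def D)
    have cy: "c x = \<i> * cinner (h x) v"
    proof -
      have "\<i> * cinner (h x) v = \<i> * cinner (R x) v + c x * (\<i> * cinner (R v) v)"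
        by (simp add: h_def cinner_simps algebra_simps)
      also have "\<i> * cinner (R x) v = c x * p" using p by (simp add: c_def)
      finally show ?thesis by (simp add: p_def algebra_simps)
    qed
    have "x = y - c x *\<^sub>C v" by (simp add: y_def)
    then have "cinner (h x) x = cinner (h x) y - cnj (c x) * cinner (h x) v"
      by (metis cinner_diff_right cinner_scaleC_right)
    also have "cnj (c x) * cinner (h x) v = - \<i> * of_real ((cmod (cinner (h x) v))\<^sup>2)"
      unfolding complex_norm_square cy by simp
    finally have "Im (cinner (h x) x) = Im (cinner (h x) y) + (cmod (cinner (h x) v))\<^sup>2" by simp
    moreover have "Im z * (norm (h x))\<^sup>2 \<le> Im (cinner (h x) y)" unfolding hy by (rule D(5))
    ultimately show ?thesis by (smt (verit) zero_le_power2)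
  qed
  moreover have "c (x + y) = c x + c y" "c (a *\<^sub>C x) = a * c x" for x y a
    by (simp_all add: c_def D cinner_simps distrib_left add_divide_distrib)
  then have "h (x + y) = h x + h y" "h (a *\<^sub>C x) = a *\<^sub>C h x" for x y a
    by (simp_all add: h_def D scaleC_add_left scaleC_add_right scaleC_scaleC)
  ultimately have "dissipative_resolvent z h" unfolding dissipative_resolvent_def by blast
  then show ?thesis unfolding h_def c_def p_def .
qed

lemma rank_one_resolvent_dissipative:
  assumes "dissipative_resolvent z R" "Im z > 0"
  shows "dissipative_resolvent z (rank_one_resolvent R u k)"
  by (induction k) (simp_all add: assms dissipative_resolvent_update)

lemma pivot_properties:
  assumes R: "dissipative_resolvent z R" and z: "Im z > 0"
  shows "1 \<le> Re (pivot R u k)" "cmod (pivot R u k - 1) \<le> (norm (u k))\<^sup>2 / Im z"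
proof -
  let ?R = "rank_one_resolvent R u k"
  have Rk: "dissipative_resolvent z ?R" by (rule rank_one_resolvent_dissipative [OF R z])
  show "1 \<le> Re (pivot R u k)" unfolding pivot_def by (rule dissipative_pivot [OF Rk z])
  have "cmod (pivot R u k - 1) = cmod (cinner (?R (u k)) (u k))" by (simp add: pivot_def norm_mult)
  also have "\<dots> \<le> norm (?R (u k)) * norm (u k)" by (rule cinner_Cauchy_Schwarz)
  also have "\<dots> \<le> (norm (u k) / Im z) * norm (u k)"
    by (intro mult_right_mono dissipative_resolvent_bound [OF Rk z]) simp
  finally show "cmod (pivot R u k - 1) \<le> (norm (u k))\<^sup>2 / Im z" by (simp add: power2_eq_square)
qed

text \<open>The Schur complement of the first entry is the same matrix built from the updated resolvent.\<close>

lemma set_det_resolvent_pivots: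
  assumes R: "dissipative_resolvent z R" and z: "Im z > 0"
  shows "set_det {k..<N} (\<lambda>m n. (if m = n then 1 else 0) - \<i> * cinner (rank_one_resolvent R u k (u m)) (u n))
    = (\<Prod>j=k..<N. pivot R u j)"
proof (induction "N - k" arbitrary: k)
  case 0
  then show ?case by simp
next
  case (Suc d)
  let ?R = "rank_one_resolvent R u"
  let ?M = "\<lambda>k m n. (if m = n then 1 else 0) - \<i> * cinner (?R k (u m)) (u n)"
  have kN: "k < N" and d: "d = N - Suc k" using Suc(2) by auto
  have p: "pivot R u k \<noteq> 0" using pivot_properties(1) [OF R z, of u k] by auto
  have ins: "{k..<N} = insert k {Suc k..<N}" using kN by auto
  have piv: "?M k k k = pivot R u k" by (simp add: pivot_def)
  have "set_det {k..<N} (?M k) = pivot R u k * set_det {Suc k..<N} (\<lambda>m n. ?M k m n - ?M k m k * ?M k k n / pivot R u k)"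
    unfolding ins using set_det_Schur [of "{Suc k..<N}" k "?M k"] p unfolding piv by simp
  also have "set_det {Suc k..<N} (\<lambda>m n. ?M k m n - ?M k m k * ?M k k n / pivot R u k) = set_det {Suc k..<N} (?M (Suc k))"
  proof (rule set_det_cong)
    fix m n assume "m \<in> {Suc k..<N}" "n \<in> {Suc k..<N}"
    then have ne: "m \<noteq> k" "k \<noteq> n" by auto
    show "?M k m n - ?M k m k * ?M k k n / pivot R u k = ?M (Suc k) m n"
      using ne p by (simp add: pivot_def [symmetric] cinner_simps) (simp add: field_simps)
  qed
  also have "\<dots> = (\<Prod>j=Suc k..<N. pivot R u j)" by (rule Suc(1) [OF d])
  also have "pivot R u k * (\<Prod>j=Suc k..<N. pivot R u j) = (\<Prod>j=k..<N. pivot R u j)"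
    unfolding ins by simp
  finally show ?case .
qed

lemma pivot_holomorphic:
  assumes hol: "\<And>x y. (\<lambda>z. cinner (R z x) y) holomorphic_on upper_half_plane"
    and R: "\<And>z. Im z > 0 \<Longrightarrow> dissipative_resolvent z (R z)"
  shows "(\<lambda>z. pivot (R z) u k) holomorphic_on upper_half_plane"
proof -
  have p: "1 - \<i> * cinner (rank_one_resolvent (R z) u k (u k)) (u k) \<noteq> 0" if "z \<in> upper_half_plane" for z k
  proof -
    have z: "Im z > 0" using that by (simp add: upper_half_plane_def)
    show ?thesis using pivot_properties(1) [OF R [OF z] z, of u k] unfolding pivot_def [symmetric] by auto
  qed
  have "(\<lambda>z. cinner (rank_one_resolvent (R z) u k x) y) holomorphic_on upper_half_plane" for x y
  proof (induction k arbitrary: x y)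
    case 0
    then show ?case by (simp add: hol)
  next
    case (Suc k)
    show ?case
      unfolding rank_one_resolvent.simps cinner_add_left cinner_scaleC_left
      by (intro holomorphic_on_add holomorphic_on_mult holomorphic_on_divide holomorphic_on_diff holomorphic_on_const Suc p)
  qed
  then show ?thesis
    unfolding pivot_def by (intro holomorphic_on_mult holomorphic_on_diff holomorphic_on_const)
qed

section \<open>The perturbation determinant as an infinite product\<close>

text \<open>Grouping the finite sets by their cardinality recovers the series of traces of exterior
  powers.\<close>

lemma fredholm_det_eq_infsum:
  fixes S :: "'h::complex_hilbert \<Rightarrow> 'h"
  assumes "minor (\<lambda>x. S x - x) summable_on {F. F \<subseteq> some_basis \<and> finite F}"
  shows "fredholm_det S = infsum (minor (\<lambda>x. S x - x)) {F. F \<subseteq> some_basis \<and> finite F}"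
proof -
  let ?t = "minor (\<lambda>x. S x - x)"
  let ?X = "{F :: 'h set. F \<subseteq> some_basis \<and> finite F}"
  define A where "A k = {F :: 'h set. F \<subseteq> some_basis \<and> finite F \<and> card F = k}" for k
  have bij: "bij_betw snd (Sigma UNIV A) ?X"
    by (rule bij_betw_byWitness [where f' = "\<lambda>F. (card F, F)"]) (auto simp: A_def)
  have "(\<lambda>p. ?t (snd p)) summable_on Sigma UNIV A"
    using summable_on_reindex_bij_betw [OF bij, of ?t] assms by simp
  then have s: "(\<lambda>(k, F). ?t F) summable_on Sigma UNIV A" by (simp add: case_prod_unfold)
  have "infsum (\<lambda>k. infsum ?t (A k)) UNIV = infsum (\<lambda>(k, F). ?t F) (Sigma UNIV A)"
    by (rule infsum_Sigma'_banach [OF s])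
  also have "\<dots> = infsum ?t ?X"
    using infsum_reindex_bij_betw [OF bij, of ?t] by (simp add: case_prod_unfold)
  finally have e: "infsum (\<lambda>k. infsum ?t (A k)) UNIV = infsum ?t ?X" .
  have "(\<lambda>k. infsum ?t (A k)) summable_on UNIV"
    by (rule summable_on_Sigma_banach [OF s])
  then have "(\<lambda>k. infsum ?t (A k)) sums infsum ?t ?X"
    unfolding e [symmetric] by (intro has_sum_imp_sums has_sum_infsum)
  then show ?thesis
    unfolding fredholm_det_def trace_exterior_power_def A_def by (rule sums_unique [symmetric])
qed

text \<open>With \<open>V = \<Sum> u\<^sub>n \<otimes> u\<^sub>n\<close> the matrix of \<open>- \<i> V R\<close> is a product of the matrices
  \<open>a = (- \<i> \<langle>R e, u\<^sub>n\<rangle>)\<close> and \<open>b = (\<langle>u\<^sub>n, f\<rangle>)\<close>. If \<open>n\<close> is restricted to \<open>n < N\<close>, the sum of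
  the minors over all finite sets of basis vectors is, by the Sylvester identity, the limit
  of \<open>N \<times> N\<close> determinants, and that limit is the product of the first \<open>N\<close> pivots.

  As \<open>N\<close> grows, each minor eventually equals that of \<open>- \<i> V R\<close>, since each column of \<open>V\<close> is a
  finite sum. The Gram minors of \<open>a\<close> and \<open>b\<close>, which are Hilbert-Schmidt matrices by the
  Bessel inequality, dominate uniformly in \<open>N\<close>.\<close>

lemma fredholm_det_product:
  fixes R V :: "'h::complex_hilbert \<Rightarrow> 'h" and u :: "nat \<Rightarrow> 'h"
  assumes R: "dissipative_resolvent z R" and z: "Im z > 0"
    and su: "summable (\<lambda>n. (norm (u n))\<^sup>2)"
    and V: "\<And>f. f \<in> some_basis \<Longrightarrow> \<exists>N0. \<forall>N\<ge>N0. \<forall>x. cinner (V x) f = (\<Sum>n<N. cinner x (u n) * cinner (u n) f)"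
    and S: "\<And>x. S x - x = (- \<i>) *\<^sub>C V (R x)"
  shows "(\<lambda>N. \<Prod>k<N. pivot R u k) \<longlonglongrightarrow> fredholm_det S"
proof -
  let ?B = "some_basis :: 'h set"
  let ?X = "{F. F \<subseteq> ?B \<and> finite F}"
  note D = dissipative_resolventD [OF R]
  have ob: "orthonormal_basis ?B" by (rule orthonormal_basis_some_basis)
  then have on: "orthonormal ?B" by (simp add: orthonormal_basis_def)
  define T where "T x = S x - x" for x
  define a where "a n e = - \<i> * cinner (R e) (u n)" for n e
  define b where "b n f = cinner (u n) f" for n f
  define t where "t N F = set_det F (\<lambda>e f. \<Sum>n<N. a n e * b n f)" for N F
  have Tmat: "\<exists>N0. \<forall>N\<ge>N0. \<forall>e. cinner (T e) f = (\<Sum>n<N. a n e * b n f)" if f: "f \<in> ?B" for f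
  proof -
    obtain N0 where N0: "\<And>N x. N \<ge> N0 \<Longrightarrow> cinner (V x) f = (\<Sum>n<N. cinner x (u n) * cinner (u n) f)"
      using V [OF f] by blast
    have "cinner (T e) f = (\<Sum>n<N. a n e * b n f)" if "N \<ge> N0" for N e
      unfolding T_def S cinner_scaleC_left N0 [OF that] by (simp add: a_def b_def sum_distrib_left mult.assoc)
    then show ?thesis by blast
  qed
  have ev: "\<exists>N0. \<forall>N\<ge>N0. t N F = minor T F" if F: "F \<in> ?X" for F
  proof -
    have "\<exists>N0. \<forall>f\<in>F. \<forall>N\<ge>N0. \<forall>e. cinner (T e) f = (\<Sum>n<N. a n e * b n f)"
    proof -
      have "finite F" "F \<subseteq> ?B" using F by auto
      then show ?thesis
      proof (induction F rule: finite_induct)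
        case (insert g G)
        then obtain N0 N1 where "\<forall>f\<in>G. \<forall>N\<ge>N0. \<forall>e. cinner (T e) f = (\<Sum>n<N. a n e * b n f)"
          "\<forall>N\<ge>N1. \<forall>e. cinner (T e) g = (\<Sum>n<N. a n e * b n g)" using Tmat [of g] by auto
        then show ?case by (intro exI [of _ "max N0 N1"]) auto
      qed simp
    qed
    then obtain N0 where N0: "\<And>f N e. f \<in> F \<Longrightarrow> N \<ge> N0 \<Longrightarrow> cinner (T e) f = (\<Sum>n<N. a n e * b n f)" by blast
    have "t N F = minor T F" if "N \<ge> N0" for N
      unfolding t_def minor_eq_set_det by (rule set_det_cong) (rule N0 [OF _ that, symmetric])
    then show ?thesis by blast
  qed
  have bessel: "(\<Sum>e\<in>F. (cmod (cinner v e))\<^sup>2) \<le> (norm v)\<^sup>2" if "F \<in> ?X" for F and v :: 'h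
  proof -
    have F: "F \<subseteq> ?B" "finite F" using that by auto
    have orth: "cinner (v - fourier_sum F v) e = 0" if "e \<in> F" for e
      using cinner_sum_orthonormal [OF on F that, of "cinner v"] by (simp add: cinner_diff_left fourier_sum_def)
    have "cinner (v - fourier_sum F v) (fourier_sum F v) = 0"
      by (subst (2) fourier_sum_def) (simp add: cinner_sum_right cinner_scaleC_right orth)
    then have "cinner v (fourier_sum F v) = of_real ((norm (fourier_sum F v))\<^sup>2)"
      by (simp add: cinner_diff_left cinner_self)
    then have "(norm (v - fourier_sum F v))\<^sup>2 = (norm v)\<^sup>2 - (norm (fourier_sum F v))\<^sup>2"
      unfolding norm_diff_square by simp
    then have "(norm (fourier_sum F v))\<^sup>2 \<le> (norm v)\<^sup>2" by (smt (verit) zero_le_power2)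
    then show ?thesis unfolding norm_fourier_sum [OF on F] .
  qed
  \<comment> \<open>The Bessel inequality for the adjoint of \<open>R\<close>, phrased without the adjoint: \<open>R\<close> is applied
    to the combination \<open>y\<close> of basis vectors for which \<open>\<langle>R y, v\<rangle>\<close> is the sum in question.\<close>
  have besselR: "(\<Sum>e\<in>F. (cmod (cinner (R e) v))\<^sup>2) \<le> (norm v)\<^sup>2 / (Im z)\<^sup>2" if "F \<in> ?X" for F and v :: 'h
  proof -
    have F: "F \<subseteq> ?B" "finite F" using that by auto
    define s where "s = (\<Sum>e\<in>F. (cmod (cinner (R e) v))\<^sup>2)"
    define y where "y = (\<Sum>e\<in>F. cnj (cinner (R e) v) *\<^sub>C e)"
    have "cinner (R y) v = (\<Sum>e\<in>F. cnj (cinner (R e) v) * cinner (R e) v)"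
      by (simp add: y_def D cinner_sum_left cinner_scaleC_left)
    also have "\<dots> = of_real s"
      unfolding s_def of_real_sum complex_norm_square by (simp add: mult.commute)
    finally have ys: "cinner (R y) v = of_real s" .
    have "cinner y e = cnj (cinner (R e) v)" if "e \<in> F" for e
      unfolding y_def by (rule cinner_sum_orthonormal [OF on F that])
    then have "y = fourier_sum F y"
      unfolding fourier_sum_def y_def [symmetric] by (subst y_def) (simp cong: sum.cong)
    then have "(norm y)\<^sup>2 = (\<Sum>e\<in>F. (cmod (cinner y e))\<^sup>2)" using norm_fourier_sum [OF on F, of y] by simp
    also have "\<dots> = s"
      unfolding s_def by (rule sum.cong) (simp_all add: \<open>\<And>e. e \<in> F \<Longrightarrow> cinner y e = cnj (cinner (R e) v)\<close>)
    finally have ny: "(norm y)\<^sup>2 = s" .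
    have s0: "0 \<le> s" unfolding s_def by (rule sum_nonneg) simp
    have "s = cmod (cinner (R y) v)" unfolding ys using s0 by simp
    also have "\<dots> \<le> norm (R y) * norm v" by (rule cinner_Cauchy_Schwarz)
    also have "\<dots> \<le> (norm y / Im z) * norm v" by (intro mult_right_mono dissipative_resolvent_bound [OF R z]) simp
    finally have "(norm y)\<^sup>2 \<le> norm y * (norm v / Im z)" unfolding ny by simp
    then have yy: "norm y * norm y \<le> norm y * (norm v / Im z)" by (simp only: power2_eq_square)
    have "norm y \<le> norm v / Im z"
    proof (cases "y = 0")
      case True then show ?thesis using z by simp
    next
      case False
      then show ?thesis using mult_left_le_imp_le [OF yy] by simp
    qed
    then have "(norm y)\<^sup>2 \<le> (norm v / Im z)\<^sup>2" by (intro power_mono) auto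
    then show ?thesis unfolding ny s_def power_divide .
  qed
  define U where "U = (\<Sum>n. (norm (u n))\<^sup>2)"
  have U: "(\<Sum>n<N. (norm (u n))\<^sup>2) \<le> U" for N
    unfolding U_def by (rule sum_le_suminf [OF su]) auto
  \<comment> \<open>The Gram matrix of the first factor is \<open>a a\<^sup>*\<close>, with entries \<open>\<Sum> a n e cnj (a n f)\<close>.\<close>
  define a' where "a' n e = cnj (a n e)" for n e
  have ba: "(\<Sum>e\<in>F. \<Sum>n<N. (cmod (a' n e))\<^sup>2) \<le> U / (Im z)\<^sup>2" if "F \<in> ?X" for F N
  proof -
    have "(\<Sum>e\<in>F. \<Sum>n<N. (cmod (a' n e))\<^sup>2) = (\<Sum>n<N. \<Sum>e\<in>F. (cmod (cinner (R e) (u n)))\<^sup>2)"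
      by (subst sum.swap) (simp add: a'_def a_def norm_mult)
    also have "\<dots> \<le> (\<Sum>n<N. (norm (u n))\<^sup>2 / (Im z)\<^sup>2)" by (intro sum_mono besselR that)
    also have "\<dots> \<le> U / (Im z)\<^sup>2"
      unfolding sum_divide_distrib [symmetric] by (intro divide_right_mono U) simp
    finally show ?thesis .
  qed
  have bb: "(\<Sum>e\<in>F. \<Sum>n<N. (cmod (b n e))\<^sup>2) \<le> U" if "F \<in> ?X" for F N
  proof -
    have "(\<Sum>e\<in>F. \<Sum>n<N. (cmod (b n e))\<^sup>2) = (\<Sum>n<N. \<Sum>e\<in>F. (cmod (cinner (u n) e))\<^sup>2)"
      by (subst sum.swap) (simp add: b_def)
    also have "\<dots> \<le> (\<Sum>n<N. (norm (u n))\<^sup>2)" by (intro sum_mono bessel that)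
    also have "\<dots> \<le> U" by (rule U)
    finally show ?thesis .
  qed
  define K where "K = (exp (U / (Im z)\<^sup>2) + exp U) / 2"
  define \<gamma> where "\<gamma> N F = (gram_minor a' N F + gram_minor b N F) / 2" for N F
  have \<gamma>0: "0 \<le> \<gamma> N F" for N F by (simp add: \<gamma>_def gram_minor_nonneg)
  have \<gamma>sum: "(\<Sum>F\<in>Y. \<gamma> N F) \<le> K" if Y: "finite Y" "Y \<subseteq> ?X" for Y N
  proof -
    have UY: "finite (\<Union>Y)" "\<Union>Y \<in> ?X" using Y by auto
    have "(\<Sum>F\<in>Y. \<gamma> N F) \<le> (\<Sum>F\<in>Pow (\<Union>Y). \<gamma> N F)"
      using UY(1) \<gamma>0 by (intro sum_mono2) auto
    also have "\<dots> = ((\<Sum>F\<in>Pow (\<Union>Y). gram_minor a' N F) + (\<Sum>F\<in>Pow (\<Union>Y). gram_minor b N F)) / 2"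
      by (simp add: \<gamma>_def sum.distrib sum_divide_distrib [symmetric])
    also have "\<dots> \<le> K"
      unfolding K_def by (intro divide_right_mono add_mono sum_gram_minor_le UY ba bb) simp
    finally show ?thesis .
  qed
  define \<Gamma> where "\<Gamma> F = (SUP N. \<gamma> N F)" for F
  have \<gamma>K: "\<gamma> N F \<le> K" if "F \<in> ?X" for N F using \<gamma>sum [of "{F}" N] that by simp
  have \<gamma>bdd: "bdd_above (range (\<lambda>N. \<gamma> N F))" if "F \<in> ?X" for F
    by (rule bdd_aboveI2 [where M = K]) (rule \<gamma>K [OF that])
  have \<gamma>le: "\<gamma> N F \<le> \<Gamma> F" if "F \<in> ?X" for N F
    unfolding \<Gamma>_def by (rule cSUP_upper [OF UNIV_I \<gamma>bdd [OF that]])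
  have \<gamma>lim: "(\<lambda>N. \<gamma> N F) \<longlonglongrightarrow> \<Gamma> F" if "F \<in> ?X" for F
    unfolding \<Gamma>_def
  proof (rule LIMSEQ_incseq_SUP)
    show "bdd_above (range (\<lambda>N. \<gamma> N F))" by (rule \<gamma>bdd [OF that])
    have "finite F" using that by simp
    then show "incseq (\<lambda>N. \<gamma> N F)"
      unfolding incseq_def \<gamma>_def by (intro allI impI divide_right_mono add_mono gram_minor_mono) auto
  qed
  have \<Gamma>s: "\<Gamma> summable_on ?X"
  proof (rule nonneg_bdd_above_summable_on)
    show "0 \<le> \<Gamma> F" if "F \<in> ?X" for F using order_trans [OF \<gamma>0 \<gamma>le [OF that, of 0]] .
    show "bdd_above (sum \<Gamma> ` {F. F \<subseteq> ?X \<and> finite F})"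
    proof (rule bdd_aboveI2)
      fix Y assume "Y \<in> {F. F \<subseteq> ?X \<and> finite F}"
      then have Y: "finite Y" "Y \<subseteq> ?X" by auto
      have "(\<lambda>N. \<Sum>F\<in>Y. \<gamma> N F) \<longlonglongrightarrow> (\<Sum>F\<in>Y. \<Gamma> F)" using Y by (intro tendsto_sum \<gamma>lim) auto
      then show "sum \<Gamma> Y \<le> K" by (rule LIMSEQ_le_const2) (use \<gamma>sum [OF Y] in blast)
    qed
  qed
  have t\<Gamma>: "cmod (t N F) \<le> \<Gamma> F" if "F \<in> ?X" for N F
  proof -
    have "finite F" using that by simp
    then have "cmod (t N F) \<le> \<gamma> N F" unfolding t_def \<gamma>_def a'_def by (rule set_det_product_bound)
    also have "\<dots> \<le> \<Gamma> F" by (rule \<gamma>le [OF that])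
    finally show ?thesis .
  qed
  have dom: "minor T summable_on ?X" "t N summable_on ?X"
      "(\<lambda>N. infsum (t N) ?X) \<longlonglongrightarrow> infsum (minor T) ?X" for N
    by (rule infsum_tendsto_eventually_eq [OF \<Gamma>s, of t "minor T"]; (rule t\<Gamma> ev; assumption))+
  have prod: "infsum (t N) ?X = (\<Prod>k<N. pivot R u k)" for N
  proof -
    have "((\<lambda>F. \<Sum>S\<in>Pow F. t N S) \<longlongrightarrow> infsum (t N) ?X) (finite_subsets_at_top ?B)"
      by (rule filterlim_compose [OF infsum_tendsto [OF dom(2)] filterlim_Pow_finite_subsets])
    moreover have "\<forall>\<^sub>F F in finite_subsets_at_top ?B. (\<Sum>S\<in>Pow F. t N S)
        = set_det {..<N} (\<lambda>m n. (if m = n then 1 else 0) - \<i> * cinner (R (fourier_sum F (u m))) (u n))"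
    proof (rule eventually_finite_subsets_at_top_weakI)
      fix F assume F: "finite F" "F \<subseteq> ?B"
      have "(\<Sum>S\<in>Pow F. t N S) = set_det F (\<lambda>e f. (if e = f then 1 else 0) + (\<Sum>n<N. a n e * b n f))"
        unfolding t_def by (rule set_det_one_plus [OF F(1), symmetric])
      also have "\<dots> = set_det {..<N} (\<lambda>m n. (if m = n then 1 else 0) + (\<Sum>e\<in>F. b m e * a n e))"
        by (rule set_det_Sylvester [OF F(1)]) simp
      also have "\<dots> = set_det {..<N} (\<lambda>m n. (if m = n then 1 else 0) - \<i> * cinner (R (fourier_sum F (u m))) (u n))"
      proof (rule set_det_cong)
        fix m n
        have "(\<Sum>e\<in>F. b m e * a n e) = - \<i> * cinner (R (fourier_sum F (u m))) (u n)"
          by (simp add: fourier_sum_def D cinner_sum_left cinner_scaleC_left a_def b_def sum_distrib_left sum_negf mult_ac)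
        then show "(if m = n then 1 else 0) + (\<Sum>e\<in>F. b m e * a n e)
            = (if m = n then 1 else 0) - \<i> * cinner (R (fourier_sum F (u m))) (u n)" by simp
      qed
      finally show "(\<Sum>S\<in>Pow F. t N S)
        = set_det {..<N} (\<lambda>m n. (if m = n then 1 else 0) - \<i> * cinner (R (fourier_sum F (u m))) (u n))" .
    qed
    ultimately have "((\<lambda>F. set_det {..<N} (\<lambda>m n. (if m = n then 1 else 0) - \<i> * cinner (R (fourier_sum F (u m))) (u n)))
        \<longlongrightarrow> infsum (t N) ?X) (finite_subsets_at_top ?B)"
      by (rule Lim_transform_eventually)
    moreover have "((\<lambda>F. set_det {..<N} (\<lambda>m n. (if m = n then 1 else 0) - \<i> * cinner (R (fourier_sum F (u m))) (u n)))
        \<longlongrightarrow> set_det {..<N} (\<lambda>m n. (if m = n then 1 else 0) - \<i> * cinner (R (u m)) (u n))) (finite_subsets_at_top ?B)"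
    proof (intro set_det_tendsto tendsto_diff tendsto_const tendsto_mult tendsto_cinner_left)
      fix m
      have "((\<lambda>F. R (fourier_sum F (u m)) - R (u m)) \<longlongrightarrow> 0) (finite_subsets_at_top ?B)"
      proof (rule Lim_null_comparison)
        show "\<forall>\<^sub>F F in finite_subsets_at_top ?B. norm (R (fourier_sum F (u m)) - R (u m)) \<le> norm (fourier_sum F (u m) - u m) / Im z"
          unfolding D(4) [symmetric] by (intro always_eventually allI dissipative_resolvent_bound [OF R z])
        have "((\<lambda>F. norm (fourier_sum F (u m) - u m) / Im z) \<longlongrightarrow> norm (u m - u m) / Im z) (finite_subsets_at_top ?B)"
          by (intro tendsto_divide tendsto_norm tendsto_diff tendsto_const fourier_sum_tendsto ob) (use z in simp)
        then show "((\<lambda>F. norm (fourier_sum F (u m) - u m) / Im z) \<longlongrightarrow> 0) (finite_subsets_at_top ?B)" by simp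
      qed
      then show "((\<lambda>F. R (fourier_sum F (u m))) \<longlongrightarrow> R (u m)) (finite_subsets_at_top ?B)" by (simp add: LIM_zero_iff)
    qed
    ultimately have "infsum (t N) ?X = set_det {..<N} (\<lambda>m n. (if m = n then 1 else 0) - \<i> * cinner (R (u m)) (u n))"
      by (rule tendsto_unique [OF finite_subsets_at_top_neq_bot])
    also have "\<dots> = (\<Prod>k<N. pivot R u k)"
      using set_det_resolvent_pivots [OF R z, of 0 N u] by (simp add: lessThan_atLeast0)
    finally show ?thesis .
  qed
  have "fredholm_det S = infsum (minor T) ?X"
    unfolding T_def by (rule fredholm_det_eq_infsum) (use dom(1) in \<open>simp add: T_def [abs_def]\<close>)
  then show ?thesis using dom(3) unfolding prod by simp
qed

section \<open>Integrals over horizontal lines\<close>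

lemma cauchy_density_integral:
  shows integrable_cauchy_density: "integrable lborel (\<lambda>x::real. 1 / (1 + x\<^sup>2))"
    and LINT_cauchy_density: "(LINT x|lborel. 1 / (1 + x\<^sup>2)) = pi"
proof -
  show "integrable lborel (\<lambda>x::real. 1 / (1 + x\<^sup>2))"
     "(LINT x|lborel. 1 / (1 + x\<^sup>2)) = pi"
    using integrable_inverse_1_plus_square LBINT_inverse_1_plus_square
    by (auto simp: set_integrable_def interval_lebesgue_integral_def set_lebesgue_integral_def
          einterval_def inverse_eq_divide)
qed

lemma integrable_cauchy_bound:
  fixes f :: "real \<Rightarrow> 'b::{banach, second_countable_topology}"
  assumes "f \<in> borel_measurable borel" "\<And>x. norm (f x) \<le> c / (1 + x\<^sup>2)"
  shows "integrable lborel f"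
proof (rule Bochner_Integration.integrable_bound)
  show "integrable lborel (\<lambda>x::real. c * (1 / (1 + x\<^sup>2)))"
    by (intro integrable_mult_right integrable_cauchy_density)
  show "AE x in lborel. norm (f x) \<le> norm (c * (1 / (1 + x\<^sup>2)))"
    using assms(2) by (intro AE_I2) (metis mult.right_neutral norm_ge_zero order_trans abs_ge_self real_norm_def times_divide_eq_right)
qed (use assms in auto)

lemma continuous_on_Complex: "continuous_on A (\<lambda>x. Complex x c)"
  unfolding Complex_eq by (intro continuous_intros)

lemma holomorphic_line_measurable:
  assumes "q holomorphic_on S" "\<And>x. Complex x c \<in> S"
  shows "(\<lambda>x. q (Complex x c)) \<in> borel_measurable borel"
proof (rule borel_measurable_continuous_onI)
  show "continuous_on UNIV (\<lambda>x. q (Complex x c))"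
    by (rule continuous_on_compose2 [OF holomorphic_on_imp_continuous_on [OF assms(1)] continuous_on_Complex])
      (use assms(2) in blast)
qed

lemma LINT_indicator_exhaust:
  fixes f :: "real \<Rightarrow> complex"
  assumes "integrable lborel f"
  shows "(\<lambda>n. LINT x|lborel. indicator {- real n..real n} x *\<^sub>R f x) \<longlonglongrightarrow> (LINT x|lborel. f x)"
proof (rule integral_dominated_convergence [where w = "\<lambda>x. norm (f x)"])
  show "AE x in lborel. (\<lambda>n. indicator {- real n..real n} x *\<^sub>R f x) \<longlonglongrightarrow> f x"
  proof (rule AE_I2, rule tendsto_eventually)
    fix x :: real
    obtain m where "\<bar>x\<bar> \<le> real m" using real_arch_simple by blast
    then show "\<forall>\<^sub>F n in sequentially. indicator {- real n..real n} x *\<^sub>R f x = f x"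
      by (intro eventually_sequentiallyI [of m]) (auto simp: indicator_def)
  qed
qed (use assms in \<open>auto simp: indicator_def\<close>)

text \<open>Integrating \<open>q\<close> along long horizontal segments by means of a primitive \<open>Q\<close> leaves the
  variation of \<open>Q\<close> along the two vertical sides, which tends to zero.\<close>

lemma LINT_line_shift:
  assumes hol: "q holomorphic_on S" and S: "open S" "convex S"
    and sub: "\<And>z. a \<le> Im z \<Longrightarrow> Im z \<le> b \<Longrightarrow> z \<in> S"
    and bound: "\<And>z. a \<le> Im z \<Longrightarrow> Im z \<le> b \<Longrightarrow> cmod (q z) \<le> c / (1 + (Re z)\<^sup>2)"
    and ab: "a \<le> b"
  shows "(LINT x|lborel. q (Complex x a)) = (LINT x|lborel. q (Complex x b))"
proof -
  obtain Q where Q: "\<And>z. z \<in> S \<Longrightarrow> (Q has_field_derivative q z) (at z)"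
    using holomorphic_convex_primitive' [OF S(2,1) hol] S(1) by (metis at_within_open)
  have int: "integrable lborel (\<lambda>x. q (Complex x y))" if "a \<le> y" "y \<le> b" for y
    using that bound [of "Complex _ y"]
    by (intro integrable_cauchy_bound [where c = c] holomorphic_line_measurable [OF hol] sub) auto
  have FTC: "(LINT x|lborel. indicator {- real n..real n} x *\<^sub>R q (Complex x y))
      = Q (Complex n y) - Q (Complex (- n) y)" if "a \<le> y" "y \<le> b" for y n
  proof -
    have "((\<lambda>x. Q (Complex x y)) has_vector_derivative q (Complex x y)) (at x within {- real n..real n})" for x
    proof -
      have "(Q has_field_derivative q (Complex x y)) (at (Complex x y))"
        using that by (intro Q sub) auto
      moreover have "((\<lambda>x. Complex x y) has_vector_derivative 1) (at x within {- real n..real n})"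
        unfolding Complex_eq by (auto intro!: derivative_eq_intros)
      ultimately show ?thesis
        using field_vector_diff_chain_within [of "\<lambda>x. Complex x y" 1 x "{- real n..real n}" Q "q (Complex x y)"]
        by (simp add: o_def has_field_derivative_at_within)
    qed
    moreover have "continuous_on {- real n..real n} (\<lambda>x. q (Complex x y))"
      by (rule continuous_on_compose2 [OF holomorphic_on_imp_continuous_on [OF hol] continuous_on_Complex])
         (use that in \<open>auto intro!: sub\<close>)
    ultimately show ?thesis
      by (intro integral_FTC_Icc) auto
  qed
  have vert: "cmod (Q (Complex x b) - Q (Complex x a)) \<le> c / (1 + x\<^sup>2) * (b - a)" for x
  proof -
    have "cmod (Q (Complex x b) - Q (Complex x a)) \<le> c / (1 + x\<^sup>2) * cmod (Complex x b - Complex x a)"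
    proof (rule field_differentiable_bound [where S = "{z. Re z = x \<and> a \<le> Im z \<and> Im z \<le> b}" and f' = q])
      show "convex {z. Re z = x \<and> a \<le> Im z \<and> Im z \<le> b}"
      proof -
        have "{z. Re z = x \<and> a \<le> Im z \<and> Im z \<le> b}
            = ({z. Re z \<le> x} \<inter> {z. Re z \<ge> x}) \<inter> ({z. Im z \<ge> a} \<inter> {z. Im z \<le> b})" by auto
        then show ?thesis
          by (simp only: convex_Int convex_halfspace_Re_le convex_halfspace_Re_ge
              convex_halfspace_Im_le convex_halfspace_Im_ge)
      qed
      show "(Q has_field_derivative q z) (at z within {z. Re z = x \<and> a \<le> Im z \<and> Im z \<le> b})"
        if "z \<in> {z. Re z = x \<and> a \<le> Im z \<and> Im z \<le> b}" for z
      proof -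
        have "z \<in> S" using that by (intro sub) simp_all
        then show ?thesis by (rule has_field_derivative_at_within [OF Q])
      qed
      show "cmod (q z) \<le> c / (1 + x\<^sup>2)" if "z \<in> {z. Re z = x \<and> a \<le> Im z \<and> Im z \<le> b}" for z
        using bound [of z] that by simp
      show "Complex x b \<in> {z. Re z = x \<and> a \<le> Im z \<and> Im z \<le> b}"
        "Complex x a \<in> {z. Re z = x \<and> a \<le> Im z \<and> Im z \<le> b}" using ab by simp_all
    qed
    moreover have "cmod (Complex x b - Complex x a) = b - a"
      using ab by (simp add: complex_diff cmod_def)
    ultimately show ?thesis by simp
  qed
  have decay: "(\<lambda>n. c / (1 + (real n)\<^sup>2) * (b - a)) \<longlonglongrightarrow> 0"
    by real_asymp
  have v0: "(\<lambda>n. Q (Complex (real n) b) - Q (Complex (real n) a)) \<longlonglongrightarrow> 0"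
    "(\<lambda>n. Q (Complex (- real n) b) - Q (Complex (- real n) a)) \<longlonglongrightarrow> 0"
    using vert [of "real _"] vert [of "- real _"] by (auto intro!: Lim_null_comparison [OF _ decay])
  have "(\<lambda>n. (LINT x|lborel. indicator {- real n..real n} x *\<^sub>R q (Complex x b))
      - (LINT x|lborel. indicator {- real n..real n} x *\<^sub>R q (Complex x a))) \<longlonglongrightarrow> 0"
    using tendsto_diff [OF v0] ab by (simp add: FTC algebra_simps)
  moreover have "(\<lambda>n. (LINT x|lborel. indicator {- real n..real n} x *\<^sub>R q (Complex x b))
      - (LINT x|lborel. indicator {- real n..real n} x *\<^sub>R q (Complex x a))) \<longlonglongrightarrow>
      (LINT x|lborel. q (Complex x b)) - (LINT x|lborel. q (Complex x a))"
    using ab by (intro tendsto_diff LINT_indicator_exhaust int) auto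
  ultimately show ?thesis
    using LIMSEQ_unique by fastforce
qed

text \<open>The line is moved upwards to infinity. The decay is needed only far out, since on a compact
  half-disc a continuous function is bounded.\<close>

lemma LINT_line_eq_0:
  assumes hol: "q holomorphic_on {z. Im z > - d}" and d: "d > 0"
    and bound: "\<And>z. 0 \<le> Im z \<Longrightarrow> R \<le> cmod z \<Longrightarrow> cmod (q z) \<le> c / (1 + (cmod z)\<^sup>2)"
  shows "integrable lborel (\<lambda>x. q (of_real x))" "(LINT x|lborel. q (of_real x)) = 0"
proof -
  have S: "open {z. Im z > - d}" "convex {z. Im z > - d}"
    using open_halfspace_Im_gt convex_halfspace_Im_gt by auto
  have comp: "compact {z. 0 \<le> Im z \<and> cmod z \<le> R}"
  proof -
    have "{z. 0 \<le> Im z \<and> cmod z \<le> R} = {z. 0 \<le> Im z} \<inter> cball 0 R" by auto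
    then show ?thesis by (simp add: closed_halfspace_Im_ge closed_Int_compact)
  qed
  moreover have "continuous_on {z. 0 \<le> Im z \<and> cmod z \<le> R} (\<lambda>z. (1 + (cmod z)\<^sup>2) * cmod (q z))"
    by (intro continuous_intros continuous_on_subset [OF holomorphic_on_imp_continuous_on [OF hol]])
       (use d in auto)
  ultimately have "bounded ((\<lambda>z. (1 + (cmod z)\<^sup>2) * cmod (q z)) ` {z. 0 \<le> Im z \<and> cmod z \<le> R})"
    by (intro compact_imp_bounded compact_continuous_image)
  then obtain c' where c': "\<And>z. 0 \<le> Im z \<Longrightarrow> cmod z \<le> R \<Longrightarrow> (1 + (cmod z)\<^sup>2) * cmod (q z) \<le> c'"
    unfolding bounded_iff by fastforce
  define k where "k = max c c'"
  have pos: "0 < 1 + (cmod z)\<^sup>2" for z by (simp add: add_pos_nonneg)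
  have b: "cmod (q z) \<le> k / (1 + (cmod z)\<^sup>2)" if "0 \<le> Im z" for z
  proof (cases "R \<le> cmod z")
    case True
    then have "cmod (q z) \<le> c / (1 + (cmod z)\<^sup>2)" using bound that by simp
    also have "\<dots> \<le> k / (1 + (cmod z)\<^sup>2)" by (intro divide_right_mono) (auto simp: k_def)
    finally show ?thesis .
  next
    case False
    then have "(1 + (cmod z)\<^sup>2) * cmod (q z) \<le> k" using c' [of z] that by (simp add: k_def)
    then show ?thesis using pos [of z] by (simp add: pos_le_divide_eq mult.commute)
  qed
  have k0: "0 \<le> k" using b [of 0] by (smt (verit) div_by_1 norm_ge_zero norm_zero power_zero_numeral zero_complex.simps(2))
  have b2: "cmod (q z) \<le> k / (1 + (Re z)\<^sup>2)" if "0 \<le> Im z" for z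
  proof -
    have "k / (1 + (cmod z)\<^sup>2) \<le> k / (1 + (Re z)\<^sup>2)"
      using k0 by (intro divide_left_mono mult_pos_pos) (auto simp: cmod_power2 add_pos_nonneg)
    then show ?thesis using b [OF that] by simp
  qed
  have eq: "(LINT x|lborel. q (Complex x 0)) = (LINT x|lborel. q (Complex x (real n)))" for n
    by (rule LINT_line_shift [OF hol S, of _ _ k]) (use d b2 in auto)
  have meas: "(\<lambda>x. q (Complex x (real n))) \<in> borel_measurable borel" for n
    using d by (intro holomorphic_line_measurable [OF hol]) (auto intro: order.strict_trans2 [of _ 0])
  have "(\<lambda>n. LINT x|lborel. q (Complex x (real n))) \<longlonglongrightarrow> (LINT x::real|lborel. 0 :: complex)"
  proof (rule integral_dominated_convergence [where w = "\<lambda>x. k * (1 / (1 + x\<^sup>2))"])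
    show "AE x in lborel. (\<lambda>n. q (Complex x (real n))) \<longlonglongrightarrow> 0"
    proof (rule AE_I2)
      fix x :: real
      have bnd: "cmod (q (Complex x (real n))) \<le> k / (1 + (x\<^sup>2 + (real n)\<^sup>2))" for n
        using b [of "Complex x (real n)"] by (simp add: cmod_power2)
      have lim: "(\<lambda>n. k / (1 + (x\<^sup>2 + (real n)\<^sup>2))) \<longlonglongrightarrow> 0" by real_asymp
      show "(\<lambda>n. q (Complex x (real n))) \<longlonglongrightarrow> 0"
        by (rule Lim_null_comparison [OF _ lim]) (simp add: bnd)
    qed
    show "AE x in lborel. cmod (q (Complex x (real n))) \<le> k * (1 / (1 + x\<^sup>2))" for n
    proof (rule AE_I2)
      show "cmod (q (Complex x (real n))) \<le> k * (1 / (1 + x\<^sup>2))" for x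
        using b2 [of "Complex x (real n)"] by simp
    qed
    show "integrable lborel (\<lambda>x::real. k * (1 / (1 + x\<^sup>2)))"
      by (intro Bochner_Integration.integrable_mult_right integrable_cauchy_density)
  qed (use meas in simp_all)
  then have "(\<lambda>n::nat. LINT x|lborel. q (Complex x 0)) \<longlonglongrightarrow> 0"
    by (simp only: eq [symmetric] Bochner_Integration.integral_zero)
  then have "(LINT x|lborel. q (Complex x 0)) = 0"
    by (simp only: LIMSEQ_const_iff)
  then show "(LINT x|lborel. q (of_real x)) = 0"
    by (simp only: complex_of_real_def)
  show "integrable lborel (\<lambda>x. q (of_real x))"
  proof (rule integrable_cauchy_bound)
    show "(\<lambda>x. q (of_real x)) \<in> borel_measurable borel"
      using meas [of 0] by (simp add: complex_of_real_def)
    show "cmod (q (of_real x)) \<le> k / (1 + x\<^sup>2)" for x :: real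
      using b2 [of "of_real x"] by simp
  qed
qed

section \<open>Cauchy and Poisson kernels\<close>

lemma one_plus_norm_le:
  fixes a z :: complex
  assumes "1 \<le> cmod (z - a)"
  shows "1 + (cmod z)\<^sup>2 \<le> (3 + 2 * (cmod a)\<^sup>2) * (cmod (z - a))\<^sup>2"
proof -
  have "(cmod z)\<^sup>2 \<le> (cmod (z - a) + cmod a)\<^sup>2"
    by (intro power_mono) (metis diff_add_cancel norm_triangle_ineq, simp)
  also have "\<dots> \<le> 2 * (cmod (z - a))\<^sup>2 + 2 * (cmod a)\<^sup>2"
    using sum_squares_ge_zero zero_le_power2 [of "cmod (z - a) - cmod a"] by (simp add: power2_eq_square algebra_simps)
  finally have "(cmod z)\<^sup>2 \<le> 2 * (cmod (z - a))\<^sup>2 + 2 * (cmod a)\<^sup>2" .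
  moreover have "1 + 2 * (cmod a)\<^sup>2 \<le> (1 + 2 * (cmod a)\<^sup>2) * (cmod (z - a))\<^sup>2"
    using mult_left_mono [of 1 "(cmod (z - a))\<^sup>2" "1 + 2 * (cmod a)\<^sup>2"] assms by (simp add: one_le_power)
  ultimately show ?thesis by (simp add: algebra_simps)
qed

text \<open>The difference of two Cauchy kernels decays quadratically, so it can be integrated against
  every bounded function.\<close>

lemma kernel_decay:
  fixes a b :: complex
  obtains c where "0 \<le> c"
    "\<And>z. cmod a + cmod b + 1 \<le> cmod z \<Longrightarrow> cmod (1 / (z - a) - 1 / (z - b)) \<le> c / (1 + (cmod z)\<^sup>2)"
proof
  define k where "k = sqrt (3 + 2 * (cmod a)\<^sup>2) * sqrt (3 + 2 * (cmod b)\<^sup>2)"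
  show "0 \<le> cmod (a - b) * k" by (simp add: k_def)
  fix z assume z: "cmod a + cmod b + 1 \<le> cmod z"
  have "cmod z \<le> cmod (z - a) + cmod a" "cmod z \<le> cmod (z - b) + cmod b"
    by (metis diff_add_cancel norm_triangle_ineq)+
  then have 1: "1 \<le> cmod (z - a)" "1 \<le> cmod (z - b)" using z norm_ge_zero [of a] norm_ge_zero [of b] by linarith+
  then have nz: "z \<noteq> a" "z \<noteq> b" by auto
  have "(1 + (cmod z)\<^sup>2)\<^sup>2 \<le> ((3 + 2 * (cmod a)\<^sup>2) * (cmod (z - a))\<^sup>2) * ((3 + 2 * (cmod b)\<^sup>2) * (cmod (z - b))\<^sup>2)"
    unfolding power2_eq_square [of "1 + _"]
    using one_plus_norm_le [OF 1(1)] one_plus_norm_le [OF 1(2)]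
    by (intro mult_mono) (auto simp: add_nonneg_nonneg)
  also have "\<dots> = (k * (cmod (z - a) * cmod (z - b)))\<^sup>2"
    by (simp add: k_def power_mult_distrib add_nonneg_nonneg)
  finally have "1 + (cmod z)\<^sup>2 \<le> k * (cmod (z - a) * cmod (z - b))"
    by (rule power2_le_imp_le) (simp add: k_def)
  moreover have "1 / (z - a) - 1 / (z - b) = (a - b) / ((z - a) * (z - b))"
    using nz by (simp add: field_simps)
  ultimately show "cmod (1 / (z - a) - 1 / (z - b)) \<le> cmod (a - b) * k / (1 + (cmod z)\<^sup>2)"
    using nz by (simp add: norm_divide norm_mult divide_simps add_pos_nonneg mult_left_mono mult.assoc add_nonneg_eq_0_iff)

qed

lemma LINT_cauchy_kernel_lower:
  assumes hol: "w holomorphic_on {z. Im z > - d}" and d: "d > 0"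
    and M: "\<And>z. 0 \<le> Im z \<Longrightarrow> cmod (w z) \<le> M" and ab: "Im a < 0" "Im b < 0"
  shows "integrable lborel (\<lambda>x. w (of_real x) * (1 / (of_real x - a) - 1 / (of_real x - b)))"
    "(LINT x|lborel. w (of_real x) * (1 / (of_real x - a) - 1 / (of_real x - b))) = 0"
proof -
  obtain c where c: "0 \<le> c"
    "\<And>z. cmod a + cmod b + 1 \<le> cmod z \<Longrightarrow> cmod (1 / (z - a) - 1 / (z - b)) \<le> c / (1 + (cmod z)\<^sup>2)"
    using kernel_decay by blast
  define e where "e = min d (min (- Im a) (- Im b))"
  have e: "0 < e" using d ab by (simp add: e_def)
  have ne: "z \<noteq> a" "z \<noteq> b" "Im z > - d" if "Im z > - e" for z using that by (auto simp: e_def)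
  have "(\<lambda>z. w z * (1 / (z - a) - 1 / (z - b))) holomorphic_on {z. Im z > - e}"
    using ne by (intro holomorphic_intros holomorphic_on_subset [OF hol]) auto
  moreover have "cmod (w z * (1 / (z - a) - 1 / (z - b))) \<le> (M * c) / (1 + (cmod z)\<^sup>2)"
    if "0 \<le> Im z" "cmod a + cmod b + 1 \<le> cmod z" for z
  proof -
    have "cmod (w z * (1 / (z - a) - 1 / (z - b))) \<le> M * (c / (1 + (cmod z)\<^sup>2))"
      unfolding norm_mult using M [OF that(1)] c(2) [OF that(2)]
      by (intro mult_mono) (auto intro: order_trans [OF norm_ge_zero])
    then show ?thesis by simp
  qed
  ultimately show "integrable lborel (\<lambda>x. w (of_real x) * (1 / (of_real x - a) - 1 / (of_real x - b)))"
    "(LINT x|lborel. w (of_real x) * (1 / (of_real x - a) - 1 / (of_real x - b))) = 0"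
    using LINT_line_eq_0 [of "\<lambda>z. w z * (1 / (z - a) - 1 / (z - b))" e "cmod a + cmod b + 1" "M * c"] e by blast+
qed

lemma poisson_kernel_integral:
  assumes y: "y > 0"
  shows integrable_poisson_kernel: "integrable lborel (\<lambda>t. y / ((t - x)\<^sup>2 + y\<^sup>2))"
    and LINT_poisson_kernel: "(LINT t|lborel. y / ((t - x)\<^sup>2 + y\<^sup>2)) = pi"
proof -
  have eq: "y / ((x + y * t - x)\<^sup>2 + y\<^sup>2) = (1 / y) * (1 / (1 + t\<^sup>2))" for t
  proof -
    have "(x + y * t - x)\<^sup>2 + y\<^sup>2 = y * (y * (1 + t\<^sup>2))" by (simp add: power2_eq_square algebra_simps)
    then show ?thesis using y by simp
  qed
  have "integrable lborel (\<lambda>t. y / ((x + y * t - x)\<^sup>2 + y\<^sup>2))"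
    unfolding eq by (intro Bochner_Integration.integrable_mult_right integrable_cauchy_density)
  then show "integrable lborel (\<lambda>t. y / ((t - x)\<^sup>2 + y\<^sup>2))"
    using lborel_integrable_real_affine_iff [of y "\<lambda>t. y / ((t - x)\<^sup>2 + y\<^sup>2)" x] y by simp
  have "(LINT t|lborel. y / ((t - x)\<^sup>2 + y\<^sup>2)) = \<bar>y\<bar> *\<^sub>R (LINT t|lborel. y / ((x + y * t - x)\<^sup>2 + y\<^sup>2))"
    using y by (intro lborel_integral_real_affine) auto
  also have "\<dots> = pi" unfolding eq integral_mult_right_zero LINT_cauchy_density using y by simp
  finally show "(LINT t|lborel. y / ((t - x)\<^sup>2 + y\<^sup>2)) = pi" .
qed

lemma kernel_conj:
  assumes "Im a > 0"
  shows "1 / (of_real t - a) - 1 / (of_real t - cnj a) = 2 * \<i> * of_real (Im a / ((t - Re a)\<^sup>2 + (Im a)\<^sup>2))"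
proof -
  have "of_real t - a \<noteq> 0" "of_real t - cnj a \<noteq> 0" using assms by (auto simp: complex_eq_iff)
  then have "1 / (of_real t - a) - 1 / (of_real t - cnj a) = (a - cnj a) / ((of_real t - a) * cnj (of_real t - a))"
    by (simp add: field_simps)
  also have "(of_real t - a) * cnj (of_real t - a) = of_real ((t - Re a)\<^sup>2 + (Im a)\<^sup>2)"
    using complex_norm_square [of "of_real t - a"] by (simp add: cmod_power2)
  also have "a - cnj a = 2 * \<i> * of_real (Im a)" by (simp add: complex_diff_cnj)
  finally show ?thesis by simp
qed

text \<open>The constant function \<open>w a\<close> is integrated explicitly, through the Poisson kernel; the
  remaining function \<open>w - w a\<close> cancels the pole at \<open>a\<close>, so the integral over the line
  vanishes.\<close>

lemma LINT_cauchy_kernel_upper: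
  assumes hol: "w holomorphic_on {z. Im z > - d}" and d: "d > 0"
    and M: "\<And>z. 0 \<le> Im z \<Longrightarrow> cmod (w z) \<le> M" and ab: "Im a > 0" "Im b < 0"
  shows "integrable lborel (\<lambda>x. w (of_real x) * (1 / (of_real x - a) - 1 / (of_real x - b)))"
    "(LINT x|lborel. w (of_real x) * (1 / (of_real x - a) - 1 / (of_real x - b))) = 2 * pi * \<i> * w a"
proof -
  let ?K = "\<lambda>x::real. 1 / (of_real x - a) - 1 / (of_real x - b)"
  have one: "integrable lborel ?K" "(LINT x|lborel. ?K x) = 2 * pi * \<i>"
  proof -
    have 1: "integrable lborel (\<lambda>x::real. 1 * (1 / (of_real x - cnj a) - 1 / (of_real x - b)))"
      "(LINT x|lborel. 1 * (1 / (of_real x - cnj a) - 1 / (of_real x - b))) = 0"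
      using LINT_cauchy_kernel_lower [of "\<lambda>_. 1" 1 1 "cnj a" b] ab by auto
    have 2: "integrable lborel (\<lambda>x::real. 1 / (of_real x - a) - 1 / (of_real x - cnj a))"
      unfolding kernel_conj [OF ab(1)]
      by (intro Bochner_Integration.integrable_mult_right integrable_of_real integrable_poisson_kernel [OF ab(1)])
    have 3: "(LINT x|lborel. 1 / (of_real x - a) - 1 / (of_real x - cnj a)) = 2 * pi * \<i>"
      unfolding kernel_conj [OF ab(1)] integral_mult_right_zero integral_complex_of_real LINT_poisson_kernel [OF ab(1)]
      by simp
    have K: "?K = (\<lambda>x. (1 / (of_real x - a) - 1 / (of_real x - cnj a)) + 1 * (1 / (of_real x - cnj a) - 1 / (of_real x - b)))"
      by auto
    show "integrable lborel ?K"
      unfolding K by (rule Bochner_Integration.integrable_add [OF 2 1(1)])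
    show "(LINT x|lborel. ?K x) = 2 * pi * \<i>"
      unfolding K Bochner_Integration.integral_add [OF 2 1(1)] 1(2) 3 by simp
  qed
  obtain c where c: "0 \<le> c"
    "\<And>z. cmod a + cmod b + 1 \<le> cmod z \<Longrightarrow> cmod (1 / (z - a) - 1 / (z - b)) \<le> c / (1 + (cmod z)\<^sup>2)"
    using kernel_decay by blast
  define e where "e = min d (- Im b)"
  have e: "0 < e" using d ab by (simp add: e_def)
  have ne: "z \<noteq> b" "Im z > - d" if "Im z > - e" for z using that by (auto simp: e_def)
  have M0: "0 \<le> M" using order_trans [OF norm_ge_zero M [of 0]] by simp
  define g where "g z = (if z = a then deriv w a else (w z - w a) / (z - a))" for z
  define q where "q z = g z * ((a - b) / (z - b))" for z
  have "open {z. Im z > - d}" by (rule open_halfspace_Im_gt)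
  then have "g holomorphic_on {z. Im z > - d}"
    unfolding g_def using hol by (intro pole_lemma_open)
  then have "q holomorphic_on {z. Im z > - e}"
    unfolding q_def using ne by (intro holomorphic_on_mult holomorphic_on_divide holomorphic_on_diff
        holomorphic_on_const holomorphic_on_ident) (auto elim!: holomorphic_on_subset)
  moreover have qeq: "q z = (w z - w a) * (1 / (z - a) - 1 / (z - b))" if "z \<noteq> a" "z \<noteq> b" for z
  proof -
    have "1 / (z - a) - 1 / (z - b) = (a - b) / ((z - a) * (z - b))"
      using that by (simp add: field_simps)
    then show ?thesis using that by (simp add: q_def g_def)
  qed
  moreover have "cmod (q z) \<le> (2 * M * c) / (1 + (cmod z)\<^sup>2)"
    if z: "0 \<le> Im z" "cmod a + cmod b + 1 \<le> cmod z" for z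
  proof -
    have "z \<noteq> a" "z \<noteq> b" using z(2) norm_ge_zero [of a] norm_ge_zero [of b] by (auto simp del: norm_ge_zero)
    moreover have "cmod (w z - w a) \<le> 2 * M"
      using M [OF z(1)] M [of a] ab norm_triangle_ineq4 [of "w z" "w a"] by auto
    ultimately have "cmod (q z) \<le> (2 * M) * (c / (1 + (cmod z)\<^sup>2))"
      using c(2) [OF z(2)] unfolding qeq [OF \<open>z \<noteq> a\<close> \<open>z \<noteq> b\<close>] norm_mult
      using M0 by (intro mult_mono) auto
    then show ?thesis by simp
  qed
  ultimately have q: "integrable lborel (\<lambda>x. q (of_real x))" "(LINT x|lborel. q (of_real x)) = 0"
    using LINT_line_eq_0 [of q e "cmod a + cmod b + 1" "2 * M * c"] e by blast+
  have qx: "q (of_real x) = (w (of_real x) - w a) * ?K x" for x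
    using ab by (intro qeq) auto
  have eq: "w (of_real x) * ?K x = q (of_real x) + w a * ?K x" for x
    unfolding qx distrib_right [symmetric] by simp
  show "integrable lborel (\<lambda>x. w (of_real x) * ?K x)" "(LINT x|lborel. w (of_real x) * ?K x) = 2 * pi * \<i> * w a"
    unfolding eq using q one by auto
qed

section \<open>The Poisson maximal function\<close>

text \<open>At \<open>t\<close> a single summand suffices: the one for the smallest dyadic ball around \<open>x\<close> that
  contains \<open>t\<close>.\<close>

lemma poisson_kernel_le_dyadic:
  fixes x t y :: real
  assumes y: "y > 0"
  shows "ennreal (y / ((t - x)\<^sup>2 + y\<^sup>2)) \<le> (\<Sum>k. ennreal (4 / (4 ^ k * y)) * indicator (cball x (2 ^ k * y)) t)"
proof -
  define k where "k = (LEAST k. \<bar>t - x\<bar> \<le> 2 ^ k * y)"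
  obtain n where "\<bar>t - x\<bar> / y < 2 ^ n" using real_arch_pow [of 2 "\<bar>t - x\<bar> / y"] by auto
  then have "\<bar>t - x\<bar> \<le> 2 ^ n * y" using y by (simp add: divide_less_eq)
  then have k: "\<bar>t - x\<bar> \<le> 2 ^ k * y" unfolding k_def by (rule LeastI)
  have "y / ((t - x)\<^sup>2 + y\<^sup>2) \<le> 4 / (4 ^ k * y)"
  proof (cases k)
    case 0
    have "y / ((t - x)\<^sup>2 + y\<^sup>2) \<le> y / y\<^sup>2"
      using y by (intro divide_left_mono) (auto simp: add_nonneg_pos)
    also have "\<dots> \<le> 4 / y" using y by (simp add: power2_eq_square divide_right_mono)
    finally show ?thesis using 0 by simp
  next
    case (Suc j)
    then have "\<not> \<bar>t - x\<bar> \<le> 2 ^ j * y" unfolding k_def by (metis lessI not_less_Least)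
    then have "(2 ^ j * y)\<^sup>2 \<le> \<bar>t - x\<bar>\<^sup>2" using y by (intro power_mono) auto
    then have "4 ^ j * y\<^sup>2 \<le> (t - x)\<^sup>2"
      by (simp add: power_mult_distrib power_mult [symmetric] mult.commute [of _ 2]) (simp add: power_mult)
    then have "y / ((t - x)\<^sup>2 + y\<^sup>2) \<le> y / (4 ^ j * y\<^sup>2)"
      using y by (intro divide_left_mono mult_pos_pos add_nonneg_pos) (auto intro: order_trans)
    also have "\<dots> = 4 / (4 ^ k * y)" using y Suc by (simp add: power2_eq_square)
    finally show ?thesis .
  qed
  then have "ennreal (y / ((t - x)\<^sup>2 + y\<^sup>2)) \<le> ennreal (4 / (4 ^ k * y)) * indicator (cball x (2 ^ k * y)) t"
    using k by (simp add: dist_real_def abs_minus_commute ennreal_leI)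
  also have "\<dots> = (\<Sum>k\<in>{k}. ennreal (4 / (4 ^ k * y)) * indicator (cball x (2 ^ k * y)) t)"
    by (simp only: sum.insert finite.emptyI empty_iff not_False_eq_True sum.empty add_0_right)
  also have "\<dots> \<le> (\<Sum>k. ennreal (4 / (4 ^ k * y)) * indicator (cball x (2 ^ k * y)) t)"
    by (rule sum_le_suminf) auto
  finally show ?thesis .
qed

lemma emeasure_UN_le_count_space:
  assumes "countable I" "\<And>i. i \<in> I \<Longrightarrow> X i \<in> sets M"
  shows "emeasure M (\<Union>i\<in>I. X i) \<le> (\<integral>\<^sup>+i. emeasure M (X i) \<partial>count_space I)"
proof -
  have sets: "(\<Union>i\<in>I. X i) \<in> sets M" using assms by (intro sets.countable_UN') auto
  have "emeasure M (\<Union>i\<in>I. X i) = (\<integral>\<^sup>+x. indicator (\<Union>i\<in>I. X i) x \<partial>M)"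
    using sets by simp
  also have "\<dots> \<le> (\<integral>\<^sup>+x. (\<integral>\<^sup>+i. indicator (X i) x \<partial>count_space I) \<partial>M)"
  proof (rule nn_integral_mono)
    fix x
    show "indicator (\<Union>i\<in>I. X i) x \<le> (\<integral>\<^sup>+i. indicator (X i) x \<partial>count_space I :: ennreal)"
    proof (cases "x \<in> (\<Union>i\<in>I. X i)")
      case True
      then obtain j where j: "j \<in> I" "x \<in> X j" by blast
      then have "1 \<le> (\<integral>\<^sup>+i. indicator (X i) x \<partial>count_space I :: ennreal)"
        using nn_integral_ge_point [of j I "\<lambda>i. indicator (X i) x"] by simp
      then show ?thesis using True by simp
    qed simp
  qed
  also have "\<dots> = (\<integral>\<^sup>+i. (\<integral>\<^sup>+x. indicator (X i) x \<partial>M) \<partial>count_space I)"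
    using assms by (intro nn_integral_count_space_nn_integral) auto
  also have "\<dots> = (\<integral>\<^sup>+i. emeasure M (X i) \<partial>count_space I)"
    using assms by (intro nn_integral_cong) simp
  finally show ?thesis .
qed

text \<open>The weak type estimate for the Poisson maximal function. The exceptional set \<open>U\<close> is the
  union of the fivefold enlargements, from the Vitali covering lemma, of disjoint balls on
  which the mean of \<open>\<phi>\<close> is large; outside \<open>U\<close> all means are small, and the Poisson kernel is
  dominated by a geometric series of normalised balls.\<close>

lemma poisson_maximal_inequality:
  fixes \<phi> :: "real \<Rightarrow> ennreal"
  assumes \<phi> [measurable]: "\<phi> \<in> borel_measurable borel" and s: "s > 0"
    and fin: "(\<integral>\<^sup>+t. \<phi> t \<partial>lborel) < \<infinity>"
  obtains U where "U \<in> sets lborel" "emeasure lborel U \<le> ennreal (80 / s) * (\<integral>\<^sup>+t. \<phi> t \<partial>lborel)"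
    "\<And>x y. x \<notin> U \<Longrightarrow> y > 0 \<Longrightarrow> (\<integral>\<^sup>+t. ennreal (y / ((t - x)\<^sup>2 + y\<^sup>2)) * \<phi> t \<partial>lborel) \<le> ennreal s"
proof -
  \<comment> \<open>The dyadic series contributes a factor \<open>4 + 2 + 1 + \<dots> = 8\<close>.\<close>
  define a where "a = s / 8"
  have a: "a > 0" using s by (simp add: a_def)
  obtain I where I: "(\<integral>\<^sup>+t. \<phi> t \<partial>lborel) = ennreal I" "I \<ge> 0"
    using fin by (metis ennreal_cases infinity_ennreal_def less_irrefl)
  define J where "J x r = (\<integral>\<^sup>+t. \<phi> t * indicator (cball x r) t \<partial>lborel)" for x r
  have ind [measurable]: "(\<lambda>t. indicator (cball x r) t :: ennreal) \<in> borel_measurable borel" for x r :: real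
    by (intro borel_measurable_indicator) auto
  define K where "K = {(x, r). r > 0 \<and> J x r > ennreal (a * r)}"
  have JI: "J x r \<le> ennreal I" for x r
    unfolding J_def I(1) [symmetric] by (intro nn_integral_mono) (auto simp: indicator_def)
  have bd: "0 < snd i \<and> snd i \<le> I / a" if "i \<in> K" for i
  proof -
    have "ennreal (a * snd i) \<le> ennreal I" "snd i > 0"
      using that JI [of "fst i" "snd i"] by (auto simp: K_def intro: order.trans less_imp_le)
    then have "a * snd i \<le> I" using a I(2) by (simp add: ennreal_le_iff)
    then show ?thesis using a \<open>snd i > 0\<close> by (simp add: pos_le_divide_eq mult.commute)
  qed
  obtain C where C: "countable C" "C \<subseteq> K"
     "pairwise (\<lambda>i j. disjnt (cball (fst i) (snd i)) (cball (fst j) (snd j))) C"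
     "(\<Union>i\<in>K. cball (fst i) (snd i)) \<subseteq> (\<Union>i\<in>C. cball (fst i) (5 * snd i))"
    by (rule Vitali_covering_lemma_cballs [OF order_refl bd]) blast
  define U where "U = (\<Union>i\<in>C. cball (fst i) (5 * snd i))"
  show thesis
  proof
    show "U \<in> sets lborel" unfolding U_def using C(1) by (intro sets.countable_UN') auto
    have "emeasure lborel U \<le> (\<integral>\<^sup>+i. emeasure lborel (cball (fst i) (5 * snd i)) \<partial>count_space C)"
      unfolding U_def by (rule emeasure_UN_le_count_space [OF C(1)]) auto
    also have "\<dots> \<le> (\<integral>\<^sup>+i. ennreal (10 / a) * emeasure (density lborel \<phi>) (cball (fst i) (snd i)) \<partial>count_space C)"
    proof (rule nn_integral_mono)
      fix i assume "i \<in> space (count_space C)"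
      then have i: "i \<in> K" using C(2) by auto
      have pos: "snd i > 0" using bd [OF i] by simp
      have "cball (fst i) (5 * snd i) = {fst i - 5 * snd i .. fst i + 5 * snd i}"
        by (rule cball_eq_atLeastAtMost)
      then have "emeasure lborel (cball (fst i) (5 * snd i)) = ennreal (10 * snd i)"
        using pos by (simp add: emeasure_lborel_Icc_eq)
      also have "\<dots> = ennreal (10 / a) * ennreal (a * snd i)"
        using a pos by (simp add: ennreal_mult [symmetric])
      also have "\<dots> \<le> ennreal (10 / a) * J (fst i) (snd i)"
        using i by (intro mult_left_mono) (auto simp: K_def less_imp_le)
      also have "J (fst i) (snd i) = emeasure (density lborel \<phi>) (cball (fst i) (snd i))"
        unfolding J_def by (subst emeasure_density) auto
      finally show "emeasure lborel (cball (fst i) (5 * snd i))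
          \<le> ennreal (10 / a) * emeasure (density lborel \<phi>) (cball (fst i) (snd i))" .
    qed
    also have "\<dots> = ennreal (10 / a) * (\<integral>\<^sup>+i. emeasure (density lborel \<phi>) (cball (fst i) (snd i)) \<partial>count_space C)"
      by (rule nn_integral_cmult) auto
    also have "(\<integral>\<^sup>+i. emeasure (density lborel \<phi>) (cball (fst i) (snd i)) \<partial>count_space C)
        = emeasure (density lborel \<phi>) (\<Union>i\<in>C. cball (fst i) (snd i))"
      using C(1,3) by (intro emeasure_UN_countable [symmetric])
         (auto simp: disjoint_family_on_def pairwise_def disjnt_def)
    also have "\<dots> \<le> emeasure (density lborel \<phi>) (space (density lborel \<phi>))"
      by (rule emeasure_space)
    also have "\<dots> = (\<integral>\<^sup>+t. \<phi> t \<partial>lborel)"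
      by (simp add: emeasure_density)
    finally show "emeasure lborel U \<le> ennreal (80 / s) * (\<integral>\<^sup>+t. \<phi> t \<partial>lborel)"
      by (simp add: a_def mult_left_mono)
    fix x y :: real assume x: "x \<notin> U" and y: "y > 0"
    have J: "J x r \<le> ennreal (a * r)" if "r > 0" for r
    proof (rule ccontr)
      assume "\<not> J x r \<le> ennreal (a * r)"
      then have "(x, r) \<in> K" using that by (simp add: K_def)
      then have "x \<in> (\<Union>i\<in>K. cball (fst i) (snd i))" using that by force
      then show False using subsetD [OF C(4)] x unfolding U_def by blast
    qed
    have "(\<integral>\<^sup>+t. ennreal (y / ((t - x)\<^sup>2 + y\<^sup>2)) * \<phi> t \<partial>lborel)
        \<le> (\<integral>\<^sup>+t. (\<Sum>k. ennreal (4 / (4 ^ k * y)) * (\<phi> t * indicator (cball x (2 ^ k * y)) t)) \<partial>lborel)"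
    proof (rule nn_integral_mono)
      fix t
      have "ennreal (y / ((t - x)\<^sup>2 + y\<^sup>2)) * \<phi> t
          \<le> (\<Sum>k. ennreal (4 / (4 ^ k * y)) * indicator (cball x (2 ^ k * y)) t) * \<phi> t"
        by (intro mult_right_mono poisson_kernel_le_dyadic y) simp
      also have "\<dots> = (\<Sum>k. ennreal (4 / (4 ^ k * y)) * (\<phi> t * indicator (cball x (2 ^ k * y)) t))"
        by (subst ennreal_suminf_multc [symmetric]) (simp add: mult_ac)
      finally show "ennreal (y / ((t - x)\<^sup>2 + y\<^sup>2)) * \<phi> t
        \<le> (\<Sum>k. ennreal (4 / (4 ^ k * y)) * (\<phi> t * indicator (cball x (2 ^ k * y)) t))" .
    qed
    also have "\<dots> = (\<Sum>k. \<integral>\<^sup>+t. ennreal (4 / (4 ^ k * y)) * (\<phi> t * indicator (cball x (2 ^ k * y)) t) \<partial>lborel)"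
      by (rule nn_integral_suminf) simp
    also have "\<dots> = (\<Sum>k. ennreal (4 / (4 ^ k * y)) * J x (2 ^ k * y))"
      unfolding J_def by (subst nn_integral_cmult) auto
    also have "\<dots> \<le> (\<Sum>k. ennreal (4 * a * (1/2) ^ k))"
    proof (rule suminf_le)
      fix k
      have "ennreal (4 / (4 ^ k * y)) * J x (2 ^ k * y) \<le> ennreal (4 / (4 ^ k * y)) * ennreal (a * (2 ^ k * y))"
        using y by (intro mult_left_mono J) auto
      also have "\<dots> = ennreal (4 * a * (1/2) ^ k)"
      proof -
        have "(4::real) ^ k = 2 ^ k * 2 ^ k" by (simp add: power_mult_distrib [symmetric])
        then have "4 / (4 ^ k * y) * (a * (2 ^ k * y)) = 4 * a * (1/2) ^ k"
          using y by (simp add: power_one_over field_simps)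
        then show ?thesis using y a by (simp add: ennreal_mult [symmetric])
      qed
      finally show "ennreal (4 / (4 ^ k * y)) * J x (2 ^ k * y) \<le> ennreal (4 * a * (1/2) ^ k)" .
    qed auto
    also have "\<dots> = ennreal (4 * a * 2)"
      using a geometric_sums [of "1/2::real"]
      by (intro sums_unique [symmetric] sums_ennreal [THEN iffD2] sums_mult) auto
    finally show "(\<integral>\<^sup>+t. ennreal (y / ((t - x)\<^sup>2 + y\<^sup>2)) * \<phi> t \<partial>lborel) \<le> ennreal s"
      by (simp add: a_def)
  qed
qed

text \<open>Subharmonicity of \<open>cmod g\<^sup>2\<close>, obtained from the Poisson representation of \<open>g\<close> and from
  nonnegativity of the variance of \<open>cmod g\<close> with respect to the Poisson kernel.\<close>

lemma poisson_Jensen: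
  assumes hol: "g holomorphic_on {z. Im z > - d}" and d: "d > 0"
    and M: "\<And>z. 0 \<le> Im z \<Longrightarrow> cmod (g z) \<le> M" and y: "y > 0"
  shows "ennreal (pi * (cmod (g (Complex x y)))\<^sup>2)
    \<le> (\<integral>\<^sup>+t. ennreal (y / ((t - x)\<^sup>2 + y\<^sup>2)) * ennreal ((cmod (g (of_real t)))\<^sup>2) \<partial>lborel)"
proof -
  let ?k = "\<lambda>t. y / ((t - x)\<^sup>2 + y\<^sup>2)"
  let ?u = "\<lambda>t. cmod (g (of_real t))"
  have M0: "0 \<le> M" using order_trans [OF norm_ge_zero M [of 0]] by simp
  have k0: "0 \<le> ?k t" for t using y by simp
  have k: "integrable lborel ?k" "(LINT t|lborel. ?k t) = pi"
    using integrable_poisson_kernel [OF y] LINT_poisson_kernel [OF y] by auto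
  have meas [measurable]: "(\<lambda>t. g (of_real t)) \<in> borel_measurable borel"
    using holomorphic_line_measurable [OF hol, of 0] d by (simp add: complex_of_real_def)
  have uM: "?u t \<le> M" for t using M by simp
  have i1: "integrable lborel (\<lambda>t. ?k t * ?u t)"
    by (rule Bochner_Integration.integrable_bound [OF integrable_mult_left [OF k(1), of M]])
       (use k0 uM M0 in \<open>auto simp: abs_mult intro!: AE_I2 divide_right_mono mult_left_mono\<close>)
  have i2: "integrable lborel (\<lambda>t. ?k t * (?u t)\<^sup>2)"
    by (rule Bochner_Integration.integrable_bound [OF integrable_mult_left [OF k(1), of "M\<^sup>2"]])
       (use k0 uM M0 in \<open>auto simp: abs_mult intro!: AE_I2 divide_right_mono mult_left_mono power_mono\<close>)
  define A where "A = (LINT t|lborel. ?k t * ?u t) / pi"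
  have rep: "2 * pi * \<i> * g (Complex x y)
      = (LINT t|lborel. g (of_real t) * (2 * \<i> * of_real (?k t)))"
    using LINT_cauchy_kernel_upper(2) [OF hol d M, of "Complex x y" "cnj (Complex x y)"] y
      kernel_conj [of "Complex x y"] by simp
  have "cmod (2 * pi * \<i> * g (Complex x y)) \<le> (LINT t|lborel. cmod (g (of_real t) * (2 * \<i> * of_real (?k t))))"
    unfolding rep by (rule integral_norm_bound)
  also have "\<dots> = (LINT t|lborel. 2 * (?k t * ?u t))"
  proof (intro Bochner_Integration.integral_cong refl)
    have "cmod (c * (2 * \<i> * of_real r)) = 2 * (r * cmod c)" if "0 \<le> r" for r c
      using that by (simp add: norm_mult)
    then show "cmod (g (of_real t) * (2 * \<i> * of_real (?k t))) = 2 * (?k t * ?u t)" for t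
      using k0 [of t] by blast
  qed
  also have "\<dots> = 2 * (LINT t|lborel. ?k t * ?u t)"
    by (rule integral_mult_right_zero)
  finally have gA: "cmod (g (Complex x y)) \<le> A"
    by (simp add: norm_mult A_def pos_le_divide_eq mult.commute)
  have "0 \<le> (LINT t|lborel. ?k t * (?u t - A)\<^sup>2)"
    using k0 by (intro integral_nonneg_AE AE_I2 mult_nonneg_nonneg) auto
  also have "\<dots> = (LINT t|lborel. ?k t * (?u t)\<^sup>2 - (2 * A) * (?k t * ?u t) + A\<^sup>2 * ?k t)"
    by (intro Bochner_Integration.integral_cong) (auto simp: power2_eq_square algebra_simps add_divide_distrib diff_divide_distrib)
  also have "\<dots> = (LINT t|lborel. ?k t * (?u t)\<^sup>2) - (2 * A) * (LINT t|lborel. ?k t * ?u t) + A\<^sup>2 * (LINT t|lborel. ?k t)"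
    using i1 i2 k(1)
    by (simp only: Bochner_Integration.integral_add Bochner_Integration.integral_diff integral_mult_right_zero
        Bochner_Integration.integrable_diff Bochner_Integration.integrable_mult_right)
  also have "\<dots> = (LINT t|lborel. ?k t * (?u t)\<^sup>2) - pi * A\<^sup>2"
    unfolding k(2) by (simp add: A_def power2_eq_square)
  finally have "pi * A\<^sup>2 \<le> (LINT t|lborel. ?k t * (?u t)\<^sup>2)" by simp
  moreover have "pi * (cmod (g (Complex x y)))\<^sup>2 \<le> pi * A\<^sup>2"
    using gA by (intro mult_left_mono power_mono) auto
  ultimately have "ennreal (pi * (cmod (g (Complex x y)))\<^sup>2) \<le> ennreal (LINT t|lborel. ?k t * (?u t)\<^sup>2)"
    by (intro ennreal_leI) (rule order_trans)
  also have "\<dots> = (\<integral>\<^sup>+t. ennreal (?k t * (?u t)\<^sup>2) \<partial>lborel)"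
    using i2 k0 by (intro nn_integral_eq_integral [symmetric] AE_I2 mult_nonneg_nonneg) auto
  also have "\<dots> = (\<integral>\<^sup>+t. ennreal (?k t) * ennreal ((?u t)\<^sup>2) \<partial>lborel)"
    by (intro nn_integral_cong) (rule ennreal_mult [OF k0 zero_le_power2])
  finally show ?thesis .
qed

text \<open>Boundedness makes a midpoint convex function on the half-line decreasing: an increase over
  one step would be repeated over every later step. A decreasing bounded function varies by
  less than \<open>\<eta> / 2\<close> near zero.\<close>

lemma midpoint_convex_second_difference:
  fixes B :: "real \<Rightarrow> real"
  assumes conv: "\<And>e d. e > 0 \<Longrightarrow> d > 0 \<Longrightarrow> 2 * B (e + d / 2) \<le> B e + B (e + d)"
    and bd: "\<And>e. e > 0 \<Longrightarrow> B e \<le> K" and \<eta>: "\<eta> > 0"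
  obtains e0 where "e0 > 0" "\<And>e d. e > 0 \<Longrightarrow> d > 0 \<Longrightarrow> e + d \<le> e0 \<Longrightarrow> B e + B (e + d) - 2 * B (e + d / 2) \<le> \<eta>"
proof -
  have anti: "B b \<le> B a" if ab: "0 < a" "a < b" for a b
  proof (rule ccontr)
    assume "\<not> B b \<le> B a"
    define d where "d = b - a"
    define D where "D = B b - B a"
    have D: "D > 0" "d > 0" using \<open>\<not> B b \<le> B a\<close> ab by (auto simp: D_def d_def)
    have step: "D \<le> B (a + real (Suc n) * d) - B (a + real n * d)" for n
    proof (induction n)
      case 0 then show ?case by (simp add: D_def d_def)
    next
      case (Suc n)
      have "2 * B ((a + real n * d) + (2 * d) / 2) \<le> B (a + real n * d) + B ((a + real n * d) + 2 * d)"
        using ab D by (intro conv) (auto simp: add_pos_nonneg)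
      moreover have "(a + real n * d) + (2 * d) / 2 = a + real (Suc n) * d"
        "(a + real n * d) + 2 * d = a + real (Suc (Suc n)) * d" by (auto simp: algebra_simps)
      ultimately show ?case using Suc.IH by (smt (verit))
    qed
    have lin: "B a + real n * D \<le> B (a + real n * d)" for n
    proof (induction n)
      case (Suc n)
      then show ?case using step [of n] by (simp add: algebra_simps)
    qed simp
    obtain n where "real n * D > K - B a" using reals_Archimedean3 [OF D(1)] by blast
    then have "K < B (a + real n * d)" using lin [of n] by linarith
    moreover have "B (a + real n * d) \<le> K" using ab D by (intro bd) (auto simp: add_pos_nonneg)
    ultimately show False by simp
  qed
  have bdd: "bdd_above (B ` {0<..})" using bd by (intro bdd_aboveI2 [of _ _ K]) simp
  define S where "S = (SUP e\<in>{0<..}. B e)"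
  have le: "B e \<le> S" if "e > 0" for e unfolding S_def using that bdd by (intro cSUP_upper) auto
  have "S - \<eta> / 2 < S" using \<eta> by simp
  then obtain e0 where e0: "e0 > 0" "S - \<eta> / 2 < B e0"
    unfolding S_def using less_cSUP_iff [OF _ bdd] by (auto simp: S_def)
  show thesis
  proof
    show "e0 > 0" by fact
    fix e d :: real assume ed: "e > 0" "d > 0" "e + d \<le> e0"
    have "B e0 \<le> B (e + d / 2)" using ed by (intro anti) auto
    then show "B e + B (e + d) - 2 * B (e + d / 2) \<le> \<eta>" using e0 le [of e] le [of "e + d"] ed by simp
  qed
qed

section \<open>The theorem of Fatou\<close>

lemma Complex_add_ii: "Complex x a + \<i> * of_real b = Complex x (a + b)"
  by (simp add: complex_eq_iff)

text \<open>In \<open>cmod (h (x + \<i> e) - h (x + \<i> (e + d)))\<^sup>2\<close> the mixed term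
  \<open>h (x + \<i> e) cnj (h (x + \<i> (e + d)))\<close> is the restriction to a horizontal line of the
  holomorphic function \<open>h (z + \<i> c) cnj (h (cnj z + \<i> c))\<close> with \<open>c = e + d / 2\<close>. Shifting
  the line to the real axis turns the mixed term into the energy at height \<open>c\<close>.\<close>

lemma energy_identity:
  assumes hol: "h holomorphic_on upper_half_plane"
    and bd: "\<And>z. Im z > 0 \<Longrightarrow> (cmod (h z))\<^sup>2 \<le> k / (1 + (Re z)\<^sup>2)" and ed: "e > 0" "d > 0"
  shows "(LINT x|lborel. (cmod (h (Complex x e) - h (Complex x (e + d))))\<^sup>2)
    = (LINT x|lborel. (cmod (h (Complex x e)))\<^sup>2) + (LINT x|lborel. (cmod (h (Complex x (e + d))))\<^sup>2)
      - 2 * (LINT x|lborel. (cmod (h (Complex x (e + d / 2))))\<^sup>2)"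
proof -
  define c where "c = e + d / 2"
  define q where "q z = h (z + \<i> * of_real c) * cnj (h (cnj z + \<i> * of_real c))" for z
  define S where "S = {z. - c < Im z} \<inter> {z. Im z < c}"
  have c: "c > 0" using ed by (simp add: c_def)
  have S: "open S" "convex S"
    unfolding S_def by (simp_all add: open_halfspace_Im_gt open_halfspace_Im_lt open_Int convex_Int
        convex_halfspace_Im_gt convex_halfspace_Im_lt)
  have h1: "(\<lambda>z. h (z + \<i> * of_real c)) holomorphic_on S"
    by (rule holomorphic_on_compose_gen [OF _ hol, unfolded o_def])
       (auto intro!: holomorphic_intros simp: upper_half_plane_def S_def)
  have "cnj ` S \<subseteq> S" by (auto simp: S_def)
  then have "(cnj \<circ> (\<lambda>z. h (z + \<i> * of_real c)) \<circ> cnj) holomorphic_on S"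
    using S(1) h1 by (intro holomorphic_on_compose_cnj_cnj holomorphic_on_subset [OF h1])
  then have "(\<lambda>z. cnj (h (cnj z + \<i> * of_real c))) holomorphic_on S" by (simp add: o_def)
  with h1 have q: "q holomorphic_on S" unfolding q_def by (rule holomorphic_on_mult)
  have k: "cmod (h z) \<le> sqrt (k / (1 + (Re z)\<^sup>2))" if "Im z > 0" for z
    using bd [OF that] by (simp add: real_le_rsqrt)
  have "(LINT x|lborel. q (Complex x (- d / 2))) = (LINT x|lborel. q (Complex x 0))"
  proof (rule LINT_line_shift [OF q S])
    fix z assume z: "- d / 2 \<le> Im z" "Im z \<le> 0"
    show "z \<in> S" using z ed by (simp add: S_def c_def)
    have i: "Im (z + \<i> * of_real c) > 0" "Im (cnj z + \<i> * of_real c) > 0" using z ed by (auto simp: c_def)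
    have k0: "0 \<le> k / (1 + (Re z)\<^sup>2)" using order_trans [OF zero_le_power2 bd [OF i(1)]] by simp
    have "cmod (q z) \<le> sqrt (k / (1 + (Re z)\<^sup>2)) * sqrt (k / (1 + (Re z)\<^sup>2))"
      unfolding q_def norm_mult complex_mod_cnj
      using k [OF i(1)] k [OF i(2)] k0 by (intro mult_mono) auto
    also have "\<dots> = k / (1 + (Re z)\<^sup>2)"
      by (rule real_sqrt_mult_self [THEN trans, OF abs_of_nonneg [OF k0]])
    finally show "cmod (q z) \<le> k / (1 + (Re z)\<^sup>2)" .
  qed (use ed in simp)
  moreover have "q (Complex x (- d / 2)) = h (Complex x e) * cnj (h (Complex x (e + d)))" for x
  proof -
    have "Complex x (- d / 2) + \<i> * of_real c = Complex x e"
      "cnj (Complex x (- d / 2)) + \<i> * of_real c = Complex x (e + d)"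
      by (simp_all add: complex_eq_iff c_def)
    then show ?thesis by (simp add: q_def)
  qed
  moreover have "q (Complex x 0) = of_real ((cmod (h (Complex x (e + d / 2))))\<^sup>2)" for x
  proof -
    have "Complex x 0 + \<i> * of_real c = Complex x (e + d / 2)"
      "cnj (Complex x 0) + \<i> * of_real c = Complex x (e + d / 2)"
      by (simp_all add: complex_eq_iff c_def)
    then show ?thesis by (simp only: q_def complex_norm_square)
  qed
  ultimately have "(LINT x|lborel. h (Complex x e) * cnj (h (Complex x (e + d))))
      = (LINT x|lborel. of_real ((cmod (h (Complex x (e + d / 2))))\<^sup>2))" by simp
  then have mix: "(LINT x|lborel. h (Complex x e) * cnj (h (Complex x (e + d))))
      = of_real (LINT x|lborel. (cmod (h (Complex x (e + d / 2))))\<^sup>2)"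
    by (simp only: integral_complex_of_real)
  have meas: "(\<lambda>x. h (Complex x s)) \<in> borel_measurable borel" if "s > 0" for s
    using that by (intro holomorphic_line_measurable [OF hol]) (simp add: upper_half_plane_def)
  have i1: "integrable lborel (\<lambda>x. (cmod (h (Complex x s)))\<^sup>2)" if "s > 0" for s
    using meas [OF that] bd [of "Complex _ s"] that
    by (intro integrable_cauchy_bound [where c = k]) (auto intro!: borel_measurable_power borel_measurable_norm)
  have i2: "integrable lborel (\<lambda>x. h (Complex x e) * cnj (h (Complex x (e + d))))"
  proof (rule Bochner_Integration.integrable_bound)
    show "integrable lborel (\<lambda>x. (cmod (h (Complex x e)))\<^sup>2 + (cmod (h (Complex x (e + d))))\<^sup>2)"
      using ed by (intro Bochner_Integration.integrable_add i1) auto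
    have [measurable]: "(\<lambda>x. h (Complex x e)) \<in> borel_measurable borel"
      "(\<lambda>x. h (Complex x (e + d))) \<in> borel_measurable borel"
      using ed by (auto intro: meas)
    show "(\<lambda>x. h (Complex x e) * cnj (h (Complex x (e + d)))) \<in> borel_measurable lborel"
    proof -
      have [measurable]: "cnj \<in> borel_measurable borel"
        by (intro borel_measurable_continuous_onI continuous_intros)
      show ?thesis by measurable
    qed
    show "AE x in lborel. cmod (h (Complex x e) * cnj (h (Complex x (e + d))))
        \<le> norm ((cmod (h (Complex x e)))\<^sup>2 + (cmod (h (Complex x (e + d))))\<^sup>2)"
    proof (rule AE_I2)
      fix x
      have "a * b \<le> a\<^sup>2 + b\<^sup>2" for a b :: real
        using zero_le_power2 [of "a - b"] zero_le_power2 [of a] zero_le_power2 [of b]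
        unfolding power2_diff by linarith
      then show "cmod (h (Complex x e) * cnj (h (Complex x (e + d))))
        \<le> norm ((cmod (h (Complex x e)))\<^sup>2 + (cmod (h (Complex x (e + d))))\<^sup>2)"
        by (simp add: norm_mult)
    qed
  qed
  have pt: "(cmod (a - b))\<^sup>2 = (cmod a)\<^sup>2 + (cmod b)\<^sup>2 - 2 * Re (a * cnj b)" for a b
    unfolding cmod_power2 by (simp add: power2_eq_square algebra_simps)
  have "(LINT x|lborel. Re (h (Complex x e) * cnj (h (Complex x (e + d)))))
      = (LINT x|lborel. (cmod (h (Complex x (e + d / 2))))\<^sup>2)"
    unfolding integral_Re [OF i2] mix by simp
  moreover have "integrable lborel (\<lambda>x. Re (h (Complex x e) * cnj (h (Complex x (e + d)))))"
    by (rule integrable_Re [OF i2])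
  moreover have "e + d > 0" using ed by simp
  ultimately show ?thesis
    unfolding pt using i1 [OF ed(1)] i1 [of "e + d"]
    by (simp only: Bochner_Integration.integral_add Bochner_Integration.integral_diff
        Bochner_Integration.integrable_add integral_mult_right_zero Bochner_Integration.integrable_mult_right)
qed

lemma Cauchy_at_right_limit:
  fixes f :: "real \<Rightarrow> 'a::banach"
  assumes "\<And>s. s > 0 \<Longrightarrow> \<exists>d>0. \<forall>y y'. 0 < y \<longrightarrow> y < d \<longrightarrow> 0 < y' \<longrightarrow> y' < d \<longrightarrow> norm (f y - f y') \<le> s"
  shows "\<exists>l. (f \<longlongrightarrow> l) (at_right 0)"
proof -
  define X where "X n = f (inverse (real (Suc n)))" for n
  have small: "\<exists>N. \<forall>n\<ge>N. inverse (real (Suc n)) < d" if "d > 0" for d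
    using reals_Archimedean [OF that] by (meson inverse_le_iff_le le_less_trans of_nat_0_less_iff of_nat_le_iff Suc_le_mono zero_less_Suc)
  have "Cauchy X"
  proof (rule CauchyI)
    fix s :: real assume "s > 0"
    then obtain d where d: "d > 0" "\<And>y y'. 0 < y \<Longrightarrow> y < d \<Longrightarrow> 0 < y' \<Longrightarrow> y' < d \<Longrightarrow> norm (f y - f y') \<le> s / 2"
      using assms [of "s / 2"] by auto
    obtain N where N: "\<And>n. n \<ge> N \<Longrightarrow> inverse (real (Suc n)) < d" using small [OF d(1)] by blast
    show "\<exists>M. \<forall>m\<ge>M. \<forall>n\<ge>M. norm (X m - X n) < s"
    proof (intro exI allI impI)
      fix m n assume "m \<ge> N" "n \<ge> N"
      then have "norm (X m - X n) \<le> s / 2" unfolding X_def using N by (intro d(2)) auto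
      then show "norm (X m - X n) < s" using \<open>s > 0\<close> by simp
    qed
  qed
  then obtain l where l: "X \<longlonglongrightarrow> l" using Cauchy_convergent_iff convergent_def by blast
  have "(f \<longlongrightarrow> l) (at_right 0)"
  proof (rule tendstoI)
    fix s :: real assume s: "s > 0"
    then obtain d where d: "d > 0" "\<And>y y'. 0 < y \<Longrightarrow> y < d \<Longrightarrow> 0 < y' \<Longrightarrow> y' < d \<Longrightarrow> norm (f y - f y') \<le> s / 2"
      using assms [of "s / 2"] by auto
    obtain N where N: "\<And>n. n \<ge> N \<Longrightarrow> inverse (real (Suc n)) < d" using small [OF d(1)] by blast
    have "dist (f y) l < s" if "0 < y" "y < d" for y
    proof -
      have "(\<lambda>n. norm (f y - X n)) \<longlonglongrightarrow> norm (f y - l)" by (intro tendsto_intros l)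
      moreover have "\<forall>\<^sub>F n in sequentially. norm (f y - X n) \<le> s / 2"
        unfolding X_def using N that d(2) by (intro eventually_sequentiallyI [of N]) auto
      ultimately have "norm (f y - l) \<le> s / 2"
        by (intro tendsto_upperbound) auto
      then show ?thesis using s by (simp add: dist_norm)
    qed
    then show "\<forall>\<^sub>F y in at_right 0. dist (f y) l < s"
      using d(1) by (auto simp: eventually_at_right_field)
  qed
  then show ?thesis by blast
qed

lemma holomorphic_vertical_shift:
  assumes "w holomorphic_on upper_half_plane" "d > 0"
  shows "(\<lambda>z. w (z + \<i> * of_real d)) holomorphic_on {z. Im z > - d}"
  by (rule holomorphic_on_compose_gen [OF _ assms(1), unfolded o_def])
     (auto intro!: holomorphic_intros simp: upper_half_plane_def)

text \<open>By the energy identity the energies at the heights \<open>e\<close> form a bounded midpoint convex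
  function, so the differences \<open>h (x + \<i> y) - h (x + \<i> (y + e))\<close> have arbitrarily small mean
  square, uniformly for all small \<open>y\<close>, once \<open>e\<close> is small. The maximal inequality turns this
  into smallness for all \<open>y > 0\<close> at once outside a set of small measure. Since
  \<open>h (x + \<i> (y + e))\<close> is continuous up to \<open>y = 0\<close>, \<open>h (x + \<i> y)\<close> satisfies the Cauchy
  criterion for almost every \<open>x\<close>.\<close>

lemma Fatou_upper_half_plane_L2:
  assumes hol: "h holomorphic_on upper_half_plane"
    and bd: "\<And>z. Im z > 0 \<Longrightarrow> (cmod (h z))\<^sup>2 \<le> k / (1 + (Re z)\<^sup>2)"
  shows "AE x in lborel. \<exists>l. ((\<lambda>e. h (Complex x e)) \<longlongrightarrow> l) (at_right 0)"
proof -
  define B where "B e = (LINT x|lborel. (cmod (h (Complex x e)))\<^sup>2)" for e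
  define \<Delta> where "\<Delta> e x y = cmod (h (Complex x y) - h (Complex x (y + e)))" for e x y :: real
  have cont: "continuous_on UNIV (\<lambda>x. h (Complex x y))" if "y > 0" for y
    by (rule continuous_on_compose2 [OF holomorphic_on_imp_continuous_on [OF hol] continuous_on_Complex])
       (use that in \<open>auto simp: upper_half_plane_def\<close>)
  have k0: "0 \<le> k" using order_trans [OF zero_le_power2 bd [of \<i>]] by simp
  have hb: "cmod (h z) \<le> sqrt k" if "Im z > 0" for z
  proof -
    have "k / (1 + (Re z)\<^sup>2) \<le> k / 1" using k0 by (intro divide_left_mono) (auto simp: add_pos_nonneg)
    then have "(cmod (h z))\<^sup>2 \<le> k" using bd [OF that] by simp
    then show ?thesis by (simp add: real_le_rsqrt)
  qed
  have B_bd: "B e \<le> k * pi" if "e > 0" for e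
  proof -
    have "(LINT x|lborel. (cmod (h (Complex x e)))\<^sup>2) \<le> (LINT x|lborel. k * (1 / (1 + x\<^sup>2)))"
    proof (rule integral_mono')
      show "integrable lborel (\<lambda>x::real. k * (1 / (1 + x\<^sup>2)))"
        by (intro Bochner_Integration.integrable_mult_right integrable_cauchy_density)
      show "(cmod (h (Complex x e)))\<^sup>2 \<le> k * (1 / (1 + x\<^sup>2))" for x
        using bd [of "Complex x e"] that by simp
      show "0 \<le> k * (1 / (1 + x\<^sup>2))" for x
        using k0 by (intro mult_nonneg_nonneg divide_nonneg_nonneg add_nonneg_nonneg) auto
    qed
    then show ?thesis unfolding B_def integral_mult_right_zero LINT_cauchy_density .
  qed
  have conv: "2 * B (e + d / 2) \<le> B e + B (e + d)" if "e > 0" "d > 0" for e d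
  proof -
    have "0 \<le> (LINT x|lborel. (cmod (h (Complex x e) - h (Complex x (e + d))))\<^sup>2)" by simp
    then show ?thesis using energy_identity [OF hol bd that] by (simp add: B_def)
  qed
  define E where "E s e = {x. \<exists>y>0. s < (\<Delta> e x y)\<^sup>2}" for s e
  have E_sets: "E s e \<in> sets lborel" if "e > 0" for s e
  proof -
    have "open {x. s < (\<Delta> e x y)\<^sup>2}" if "y > 0" for y
      unfolding \<Delta>_def using that \<open>e > 0\<close> by (intro open_Collect_less continuous_intros cont) auto
    then have "open (\<Union>y\<in>{0<..}. {x. s < (\<Delta> e x y)\<^sup>2})" by blast
    moreover have "E s e = (\<Union>y\<in>{0<..}. {x. s < (\<Delta> e x y)\<^sup>2})" by (auto simp: E_def)
    ultimately show ?thesis by simp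
  qed
  have E_small: "\<exists>e>0. emeasure lborel (E s e) \<le> ennreal \<theta>" if s: "s > 0" and \<theta>: "\<theta> > 0" for s \<theta>
  proof -
    define \<eta> where "\<eta> = \<theta> * s / 80"
    have \<eta>: "\<eta> > 0" using s \<theta> by (simp add: \<eta>_def)
    obtain e0 where e0: "e0 > 0"
      "\<And>e d. e > 0 \<Longrightarrow> d > 0 \<Longrightarrow> e + d \<le> e0 \<Longrightarrow> B e + B (e + d) - 2 * B (e + d / 2) \<le> \<eta>"
      using midpoint_convex_second_difference [of B, OF conv B_bd \<eta>] by blast
    define e where "e = e0 / 2"
    have e: "e > 0" using e0 by (simp add: e_def)
    \<comment> \<open>The maximal inequality needs a function that is holomorphic across the line, so it is
      applied on the line of height \<open>y0\<close> and \<open>y0\<close> is sent to zero afterwards.\<close>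
    define F where "F y0 = {x. \<exists>y>y0. s < (\<Delta> e x y)\<^sup>2}" for y0
    have F_sets: "F y0 \<in> sets lborel" if "y0 > 0" for y0
    proof -
      have "open {x. s < (\<Delta> e x y)\<^sup>2}" if "y > y0" for y
        unfolding \<Delta>_def using that \<open>e > 0\<close> \<open>y0 > 0\<close> by (intro open_Collect_less continuous_intros cont) auto
      then have "open (\<Union>y\<in>{y0<..}. {x. s < (\<Delta> e x y)\<^sup>2})" by blast
      moreover have "F y0 = (\<Union>y\<in>{y0<..}. {x. s < (\<Delta> e x y)\<^sup>2})" by (auto simp: F_def)
      ultimately show ?thesis by simp
    qed
    have F_small: "emeasure lborel (F y0) \<le> ennreal \<theta>" if y0: "0 < y0" "y0 \<le> e" for y0
    proof -
      define g where "g z = h (z + \<i> * of_real y0) - h (z + \<i> * of_real (y0 + e))" for z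
      have ghol: "g holomorphic_on {z. Im z > - y0}"
        unfolding g_def using y0 e
        by (intro holomorphic_on_diff holomorphic_vertical_shift [OF hol]
            holomorphic_on_subset [OF holomorphic_vertical_shift [OF hol, of "y0 + e"]]) auto
      have gM: "cmod (g z) \<le> sqrt k + sqrt k" if "0 \<le> Im z" for z
        unfolding g_def using that y0 e
        by (intro order_trans [OF norm_triangle_ineq4] add_mono hb) auto
      have greal: "g (of_real t) = h (Complex t y0) - h (Complex t (y0 + e))" for t
      proof -
        have "of_real t + \<i> * of_real a = Complex t a" for a by (simp add: complex_eq_iff)
        then show ?thesis by (simp only: g_def)
      qed
      have gC: "g (Complex x y) = h (Complex x (y + y0)) - h (Complex x (y + y0 + e))" for x y
        unfolding g_def Complex_add_ii by (simp add: add.assoc)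
      have ye: "y0 + e > 0" using y0 e by simp
      define \<phi> where "\<phi> t = (cmod (g (of_real t)))\<^sup>2" for t
      have gcont: "continuous_on UNIV (\<lambda>t. g (of_real t))"
        unfolding greal using cont [OF y0(1)] cont [OF ye] by (rule continuous_on_diff)
      then have "continuous_on UNIV \<phi>"
        unfolding \<phi>_def by (intro continuous_on_power continuous_on_norm)
      then have meas: "\<phi> \<in> borel_measurable borel"
        by (rule borel_measurable_continuous_onI)
      have \<phi>b: "\<phi> t \<le> 4 * k / (1 + t\<^sup>2)" for t
      proof -
        have "(a + b)\<^sup>2 \<le> 2 * a\<^sup>2 + 2 * b\<^sup>2" for a b :: real
          using zero_le_power2 [of "a - b"] unfolding power2_diff power2_sum by linarith
        moreover have "\<phi> t \<le> (cmod (h (Complex t y0)) + cmod (h (Complex t (y0 + e))))\<^sup>2"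
          unfolding \<phi>_def greal by (intro power_mono norm_triangle_ineq4) simp
        ultimately have "\<phi> t \<le> 2 * (cmod (h (Complex t y0)))\<^sup>2 + 2 * (cmod (h (Complex t (y0 + e))))\<^sup>2"
          by (rule order_trans [rotated])
        also have "\<dots> \<le> 2 * (k / (1 + t\<^sup>2)) + 2 * (k / (1 + t\<^sup>2))"
          using bd [of "Complex t y0"] bd [of "Complex t (y0 + e)"] y0 ye by simp
        finally show ?thesis by simp
      qed
      have int: "integrable lborel \<phi>"
        by (rule integrable_cauchy_bound [OF meas, of "4 * k"]) (use \<phi>b in \<open>simp add: \<phi>_def\<close>)
      have nn: "(\<integral>\<^sup>+t. ennreal (\<phi> t) \<partial>lborel) = ennreal (LINT t|lborel. \<phi> t)"
        by (rule nn_integral_eq_integral [OF int]) (simp add: \<phi>_def)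
      have "(LINT t|lborel. \<phi> t) = B y0 + B (y0 + e) - 2 * B (y0 + e / 2)"
        unfolding \<phi>_def greal B_def by (rule energy_identity [OF hol bd y0(1) e])
      also have "\<dots> \<le> \<eta>" using y0 e by (intro e0) (auto simp: e_def)
      finally have I: "(\<integral>\<^sup>+t. ennreal (\<phi> t) \<partial>lborel) \<le> ennreal \<eta>" unfolding nn by (rule ennreal_leI)
      obtain U where U: "U \<in> sets lborel" "emeasure lborel U \<le> ennreal (80 / s) * (\<integral>\<^sup>+t. ennreal (\<phi> t) \<partial>lborel)"
        "\<And>x y. x \<notin> U \<Longrightarrow> y > 0 \<Longrightarrow> (\<integral>\<^sup>+t. ennreal (y / ((t - x)\<^sup>2 + y\<^sup>2)) * ennreal (\<phi> t) \<partial>lborel) \<le> ennreal s"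
        using poisson_maximal_inequality [of "\<lambda>t. ennreal (\<phi> t)" s] meas s nn by (auto simp: less_top [symmetric])
      have "F y0 \<subseteq> U"
      proof
        fix x assume "x \<in> F y0"
        then obtain y where y: "y > y0" "s < (\<Delta> e x y)\<^sup>2" by (auto simp: F_def)
        show "x \<in> U"
        proof (rule ccontr)
          assume "x \<notin> U"
          have "ennreal (pi * (cmod (g (Complex x (y - y0))))\<^sup>2) \<le> ennreal s"
            using poisson_Jensen [OF ghol y0(1) gM, of "y - y0" x] U(3) [OF \<open>x \<notin> U\<close>, of "y - y0"] y
            unfolding \<phi>_def by (auto intro: order_trans)
          then have "pi * (cmod (g (Complex x (y - y0))))\<^sup>2 \<le> s" using s by (simp add: ennreal_le_iff)
          moreover have "cmod (g (Complex x (y - y0))) = \<Delta> e x y" unfolding gC \<Delta>_def by simp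
          moreover have "1 * (\<Delta> e x y)\<^sup>2 \<le> pi * (\<Delta> e x y)\<^sup>2" using pi_gt3 by (intro mult_right_mono) auto
          ultimately show False using y by simp
        qed
      qed
      then have "emeasure lborel (F y0) \<le> emeasure lborel U" using U(1) by (rule emeasure_mono)
      also have "\<dots> \<le> ennreal (80 / s) * ennreal \<eta>"
        by (rule order_trans [OF U(2)]) (intro mult_left_mono I, simp)
      also have "\<dots> = ennreal \<theta>" using s \<theta> by (simp add: ennreal_mult [symmetric] \<eta>_def)
      finally show ?thesis .
    qed
    have "E s e = (\<Union>n. F (e / real (Suc n)))"
    proof
      show "E s e \<subseteq> (\<Union>n. F (e / real (Suc n)))"
      proof
        fix x assume "x \<in> E s e"
        then obtain y where y: "y > 0" "s < (\<Delta> e x y)\<^sup>2" by (auto simp: E_def)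
        obtain n where "inverse (real (Suc n)) < y / e"
          using reals_Archimedean [of "y / e"] y e by auto
        then have "e / real (Suc n) < y" using e by (simp add: field_simps)
        then show "x \<in> (\<Union>n. F (e / real (Suc n)))" using y by (auto simp: F_def)
      qed
      show "(\<Union>n. F (e / real (Suc n))) \<subseteq> E s e"
      proof
        fix x assume "x \<in> (\<Union>n. F (e / real (Suc n)))"
        then obtain n y where "y > e / real (Suc n)" "s < (\<Delta> e x y)\<^sup>2" by (auto simp: F_def)
        moreover have "e / real (Suc n) > 0" using e by simp
        ultimately show "x \<in> E s e" unfolding E_def by (blast intro: less_trans)
      qed
    qed
    moreover have "emeasure lborel (\<Union>n. F (e / real (Suc n))) = (SUP n. emeasure lborel (F (e / real (Suc n))))"
    proof (rule SUP_emeasure_incseq [symmetric])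
      show "range (\<lambda>n. F (e / real (Suc n))) \<subseteq> sets lborel"
        using F_sets e by (auto simp del: of_nat_Suc)
      show "incseq (\<lambda>n. F (e / real (Suc n)))"
      proof (rule incseq_SucI)
        fix n
        have "e / real (Suc (Suc n)) \<le> e / real (Suc n)" using e by (intro divide_left_mono) auto
        then show "F (e / real (Suc n)) \<subseteq> F (e / real (Suc (Suc n)))"
          unfolding F_def by (intro Collect_mono impI) (meson le_less_trans)
      qed
    qed
    moreover have "(SUP n. emeasure lborel (F (e / real (Suc n)))) \<le> ennreal \<theta>"
    proof (rule SUP_least)
      fix n
      have "e / real (Suc n) \<le> e / 1" using e by (intro divide_left_mono) auto
      then show "emeasure lborel (F (e / real (Suc n))) \<le> ennreal \<theta>" using e by (intro F_small) auto
    qed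
    ultimately show ?thesis using e by metis
  qed
  have null: "\<exists>N\<in>null_sets lborel. \<forall>x. x \<notin> N \<longrightarrow> (\<exists>e>0. \<forall>y>0. (\<Delta> e x y)\<^sup>2 \<le> s)" if s: "s > 0" for s
  proof -
    have "\<exists>e. \<forall>m. e m > 0 \<and> emeasure lborel (E s (e m)) \<le> ennreal (inverse (real (Suc m)))"
      using E_small [OF s] by (intro choice allI) (metis inverse_positive_iff_positive of_nat_0_less_iff zero_less_Suc)
    then obtain e where e: "\<And>m. e m > 0" "\<And>m. emeasure lborel (E s (e m)) \<le> ennreal (inverse (real (Suc m)))"
      by blast
    define N where "N = (\<Inter>m. E s (e m))"
    have N: "N \<in> sets lborel" unfolding N_def using E_sets e(1) by (intro sets.countable_INT) auto
    have "emeasure lborel N \<le> ennreal (inverse (real (Suc m)))" for m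
      using E_sets [OF e(1)] by (intro order_trans [OF emeasure_mono e(2)]) (auto simp: N_def)
    moreover have "(\<lambda>m. ennreal (inverse (real (Suc m)))) \<longlonglongrightarrow> ennreal 0"
      by (intro tendsto_ennrealI LIMSEQ_inverse_real_of_nat)
    ultimately have "emeasure lborel N \<le> ennreal 0"
      by (intro LIMSEQ_le_const) auto
    then have nul: "N \<in> null_sets lborel" using N by auto
    have ex: "\<exists>e>0. \<forall>y>0. (\<Delta> e x y)\<^sup>2 \<le> s" if "x \<notin> N" for x
    proof -
      from that obtain m where m: "x \<notin> E s (e m)" by (auto simp: N_def)
      show ?thesis
      proof (intro exI [of _ "e m"] conjI allI impI)
        show "(\<Delta> (e m) x y)\<^sup>2 \<le> s" if "0 < y" for y
        proof (rule ccontr)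
          assume "\<not> (\<Delta> (e m) x y)\<^sup>2 \<le> s"
          then have "0 < y \<and> s < (\<Delta> (e m) x y)\<^sup>2" using that by simp
          then have "x \<in> E s (e m)" unfolding E_def by (intro CollectI exI)
          then show False using m by contradiction
        qed
      qed (rule e(1))
    qed
    show ?thesis by (intro bexI [of _ N] allI impI ex nul)
  qed
  have "\<exists>N. \<forall>j. N j \<in> null_sets lborel \<and> (\<forall>x. x \<notin> N j \<longrightarrow> (\<exists>e>0. \<forall>y>0. (\<Delta> e x y)\<^sup>2 \<le> (inverse (real (Suc j)))\<^sup>2))"
    using null by (intro choice allI) (metis inverse_positive_iff_positive of_nat_0_less_iff zero_less_Suc zero_less_power)
  then obtain N where N: "\<And>j. N j \<in> null_sets lborel"
    "\<And>j x. x \<notin> N j \<Longrightarrow> \<exists>e>0. \<forall>y>0. (\<Delta> e x y)\<^sup>2 \<le> (inverse (real (Suc j)))\<^sup>2" by blast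
  show ?thesis
  proof (rule AE_I')
    show "(\<Union>j. N j) \<in> null_sets lborel" using N(1) by blast
    have "\<exists>l. ((\<lambda>e. h (Complex x e)) \<longlongrightarrow> l) (at_right 0)" if x: "x \<notin> (\<Union>j. N j)" for x
    proof (rule Cauchy_at_right_limit)
      fix s :: real assume s: "s > 0"
      obtain j where j: "inverse (real (Suc j)) < s / 3" using reals_Archimedean [of "s / 3"] s by auto
      obtain e where e: "e > 0" "\<And>y. y > 0 \<Longrightarrow> (\<Delta> e x y)\<^sup>2 \<le> (inverse (real (Suc j)))\<^sup>2"
        using N(2) [of x j] x by auto
      have e': "\<Delta> e x y \<le> s / 3" if "y > 0" for y
      proof -
        have "\<Delta> e x y \<le> inverse (real (Suc j))" by (rule power2_le_imp_le [OF e(2) [OF that]]) simp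
        then show ?thesis using j by simp
      qed
      have "continuous_on {-e<..} (\<lambda>y. h (Complex x (y + e)))"
      proof -
        have "continuous_on {-e<..} (\<lambda>y. Complex x (y + e))"
          unfolding Complex_eq by (intro continuous_intros)
        then show ?thesis
          by (rule continuous_on_compose2 [OF holomorphic_on_imp_continuous_on [OF hol]])
             (auto simp: upper_half_plane_def)
      qed
      then have ct: "isCont (\<lambda>y. h (Complex x (y + e))) 0"
        using e(1) by (intro continuous_on_interior [of "{-e<..}"]) (auto simp: interior_open)
      obtain d where d: "d > 0" "\<And>y. \<bar>y\<bar> < d \<Longrightarrow> cmod (h (Complex x (y + e)) - h (Complex x (0 + e))) < s / 6"
        using ct [unfolded continuous_at_eps_delta dist_norm, rule_format, of "s / 6"] s by auto
      show "\<exists>d>0. \<forall>y y'. 0 < y \<longrightarrow> y < d \<longrightarrow> 0 < y' \<longrightarrow> y' < d \<longrightarrow> cmod (h (Complex x y) - h (Complex x y')) \<le> s"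
      proof (intro exI conjI allI impI)
        fix y y' assume y: "0 < y" "y < d" "0 < y'" "y' < d"
        let ?a = "h (Complex x y)" and ?b = "h (Complex x y')" and ?a' = "h (Complex x (y + e))"
          and ?b' = "h (Complex x (y' + e))" and ?m = "h (Complex x (0 + e))"
        have 1: "cmod (?a - ?a') \<le> s / 3" "cmod (?b - ?b') \<le> s / 3"
          using e' [of y] e' [of y'] y by (auto simp: \<Delta>_def)
        have 2: "cmod (?a' - ?m) < s / 6" "cmod (?b' - ?m) < s / 6"
          using d(2) [of y] d(2) [of y'] y by auto
        have "?a - ?b = (?a - ?a') + (?a' - ?m) - (?b' - ?m) - (?b - ?b')" by simp
        then have "cmod (?a - ?b) \<le> cmod (?a - ?a') + cmod (?a' - ?m) + cmod (?b' - ?m) + cmod (?b - ?b')"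
          by (smt (verit) norm_triangle_ineq norm_triangle_ineq4)
        then show "cmod (?a - ?b) \<le> s" using 1 2 by linarith
      qed (fact d(1))
    qed
    then show "{x \<in> space lborel. \<not> (\<exists>l. ((\<lambda>e. h (Complex x e)) \<longlongrightarrow> l) (at_right 0))} \<subseteq> (\<Union>j. N j)"
      by blast
  qed
qed

text \<open>Division by \<open>z + \<i>\<close> makes \<open>w\<close> square integrable on horizontal lines without affecting
  existence of limits.\<close>

lemma Fatou_upper_half_plane:
  assumes hol: "w holomorphic_on upper_half_plane"
    and bd: "\<And>z. Im z > 0 \<Longrightarrow> cmod (w z) \<le> M"
  shows "AE x in lborel. \<exists>l. ((\<lambda>e. w (Complex x e)) \<longlongrightarrow> l) (at_right 0)"
proof -
  define h where "h z = w z / (z + \<i>)" for z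
  have nz: "z + \<i> \<noteq> 0" if "Im z > 0" for z
  proof
    assume "z + \<i> = 0" then have "Im (z + \<i>) = 0" by simp
    then show False using that by simp
  qed
  have "h holomorphic_on upper_half_plane"
    unfolding h_def using nz by (intro holomorphic_on_divide hol holomorphic_intros) (auto simp: upper_half_plane_def)
  moreover have "(cmod (h z))\<^sup>2 \<le> M\<^sup>2 / (1 + (Re z)\<^sup>2)" if "Im z > 0" for z
  proof -
    have "1 \<le> (Im z + 1)\<^sup>2" using that by (simp add: one_le_power)
    then have "1 + (Re z)\<^sup>2 \<le> (cmod (z + \<i>))\<^sup>2" by (simp add: cmod_power2)
    moreover have "(cmod (w z))\<^sup>2 \<le> M\<^sup>2" using bd [OF that] by (intro power_mono) auto
    ultimately show ?thesis unfolding h_def norm_divide power_divide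
      by (intro frac_le) (auto simp: add_pos_nonneg)
  qed
  ultimately have "AE x in lborel. \<exists>l. ((\<lambda>e. h (Complex x e)) \<longlongrightarrow> l) (at_right 0)"
    by (rule Fatou_upper_half_plane_L2)
  then show ?thesis
  proof (rule AE_mp, intro AE_I2 impI)
    fix x assume "\<exists>l. ((\<lambda>e. h (Complex x e)) \<longlongrightarrow> l) (at_right 0)"
    then obtain l where l: "((\<lambda>e. h (Complex x e)) \<longlongrightarrow> l) (at_right 0)" by blast
    have "((\<lambda>e. h (Complex x e) * (Complex x e + \<i>)) \<longlongrightarrow> l * (Complex x 0 + \<i>)) (at_right 0)"
      unfolding Complex_eq by (intro tendsto_intros l [unfolded Complex_eq])
    moreover have "h (Complex x e) * (Complex x e + \<i>) = w (Complex x e)" if "0 < e" for e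
      using nz [of "Complex x e"] that by (simp add: h_def)
    then have "\<forall>\<^sub>F e in at_right 0. h (Complex x e) * (Complex x e + \<i>) = w (Complex x e)"
      by (rule eventually_mono [OF eventually_at_right_less])
    ultimately show "\<exists>l. ((\<lambda>e. w (Complex x e)) \<longlongrightarrow> l) (at_right 0)"
      by (blast intro: Lim_transform_eventually)
  qed
qed

section \<open>Vertical boundary values\<close>

lemma Complex_in_uhp [simp]: "Complex x y \<in> upper_half_plane \<longleftrightarrow> 0 < y"
  by (simp add: upper_half_plane_def)

lemma isCont_real_eps_delta:
  fixes f :: "real \<Rightarrow> 'b::real_normed_vector"
  assumes "isCont f x" "s > 0"
  obtains d where "d > 0" "\<And>y. \<bar>y - x\<bar> < d \<Longrightarrow> norm (f y - f x) < s"
  using assms unfolding continuous_at_eps_delta dist_norm real_norm_def by blast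

text \<open>By continuity, existence of the limit can be tested by the Cauchy criterion on rational
  heights, so it fails or holds on a Borel set; there the limit is that of a sequence.
  Elsewhere the value of \<open>Lim\<close> is unspecified, but the same at all such points, because its
  defining predicate is empty.\<close>

lemma borel_measurable_vertical_Lim:
  fixes u :: "real \<Rightarrow> real \<Rightarrow> 'b::{banach, second_countable_topology}"
  assumes meas: "\<And>e. e > 0 \<Longrightarrow> (\<lambda>x. u x e) \<in> borel_measurable borel"
    and cont: "\<And>x. continuous_on {0<..} (u x)"
  shows "(\<lambda>x. Lim (at_right 0) (u x)) \<in> borel_measurable borel"
proof -
  define E where "E = {x. \<exists>l. (u x \<longlongrightarrow> l) (at_right 0)}"
  define R where "R m = \<rat> \<inter> {0<..<inverse (real (Suc m))}" for m
  define E' where "E' = (\<Inter>j. \<Union>m. \<Inter>r\<in>R m. \<Inter>r'\<in>R m. {x. norm (u x r - u x r') \<le> inverse (real (Suc j))})"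
  have R_ne: "R m \<noteq> {}" for m
    using Rats_dense_in_real [of 0 "inverse (real (Suc m))"] by (auto simp: R_def)
  have R_pos: "r > 0" if "r \<in> R m" for r m using that by (auto simp: R_def)
  have cR: "countable (R m)" for m unfolding R_def by (intro countable_Int1 countable_rat)
  have S0: "{x. norm (u x r - u x r') \<le> inverse (real (Suc j))} \<in> sets borel" if "r > 0" "r' > 0" for r r' j
  proof -
    have [measurable]: "(\<lambda>x. u x r) \<in> borel_measurable borel" "(\<lambda>x. u x r') \<in> borel_measurable borel"
      using that meas by auto
    show ?thesis by measurable
  qed
  have S: "(\<Inter>r\<in>R m. \<Inter>r'\<in>R m. {x. norm (u x r - u x r') \<le> inverse (real (Suc j))}) \<in> sets borel" for m j
    by (intro sets.countable_INT'' cR S0 R_pos) simp_all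
  have E'_sets: "E' \<in> sets borel"
    unfolding E'_def by (intro sets.countable_INT sets.countable_UN image_subsetI S) simp
  have "E = E'"
  proof (intro set_eqI iffI)
    fix x assume "x \<in> E"
    then obtain l where l: "(u x \<longlongrightarrow> l) (at_right 0)" by (auto simp: E_def)
    have "\<exists>m. \<forall>r\<in>R m. \<forall>r'\<in>R m. norm (u x r - u x r') \<le> inverse (real (Suc j))" for j
    proof -
      have "\<forall>\<^sub>F e in at_right 0. dist (u x e) l < inverse (real (Suc j)) / 2"
        by (rule tendstoD [OF l]) simp
      then obtain d where d: "d > 0" "\<And>e. 0 < e \<Longrightarrow> e < d \<Longrightarrow> dist (u x e) l < inverse (real (Suc j)) / 2"
        by (auto simp: eventually_at_right_field)
      obtain m where m: "inverse (real (Suc m)) < d" using reals_Archimedean [OF d(1)] by auto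
      have "norm (u x r - u x r') \<le> inverse (real (Suc j))" if r: "r \<in> R m" "r' \<in> R m" for r r'
      proof -
        have "0 < r" "r < d" "0 < r'" "r' < d" using r m by (auto simp: R_def)
        then have "dist (u x r) l < inverse (real (Suc j)) / 2" "dist (u x r') l < inverse (real (Suc j)) / 2"
          by (simp_all only: d(2))
        then have "dist (u x r) (u x r') < inverse (real (Suc j))"
          using dist_triangle2 [of "u x r" "u x r'" l] by linarith
        then show ?thesis by (simp add: dist_norm)
      qed
      then show ?thesis by blast
    qed
    then show "x \<in> E'" by (auto simp: E'_def)
  next
    fix x assume x: "x \<in> E'"
    have "\<exists>l. (u x \<longlongrightarrow> l) (at_right 0)"
    proof (rule Cauchy_at_right_limit)
      fix s :: real assume s: "s > 0"
      obtain j where j: "inverse (real (Suc j)) < s / 3" using reals_Archimedean [of "s / 3"] s by auto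
      have "\<exists>m. \<forall>r\<in>R m. \<forall>r'\<in>R m. norm (u x r - u x r') \<le> inverse (real (Suc j))"
        using x unfolding E'_def INT_iff UN_iff mem_Collect_eq by simp
      then obtain m where m: "\<And>r r'. r \<in> R m \<Longrightarrow> r' \<in> R m \<Longrightarrow> norm (u x r - u x r') \<le> inverse (real (Suc j))"
        by metis
      define d where "d = inverse (real (Suc m))"
      have d: "d > 0" by (simp add: d_def)
      have near: "\<exists>r\<in>R m. norm (u x y - u x r) < s / 3" if y: "0 < y" "y < d" for y
      proof -
        have ct: "isCont (u x) y"
          using cont [of x] y by (intro continuous_on_interior [of "{0<..}"]) (auto simp: interior_open)
        obtain t where t: "t > 0" "\<And>y'. \<bar>y' - y\<bar> < t \<Longrightarrow> norm (u x y' - u x y) < s / 3"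
          using isCont_real_eps_delta [OF ct, of "s / 3"] s by (metis zero_less_divide_iff zero_less_numeral)
        obtain r where r: "r \<in> \<rat>" "y < r" "r < min d (y + t)"
          using Rats_dense_in_real [of y "min d (y + t)"] y t by auto
        then have "r \<in> R m" using y by (auto simp: R_def d_def)
        moreover have "norm (u x r - u x y) < s / 3" using r by (intro t(2)) auto
        ultimately show ?thesis by (metis norm_minus_commute)
      qed
      show "\<exists>d>0. \<forall>y y'. 0 < y \<longrightarrow> y < d \<longrightarrow> 0 < y' \<longrightarrow> y' < d \<longrightarrow> norm (u x y - u x y') \<le> s"
      proof (intro exI conjI allI impI)
        fix y y' assume "0 < y" "y < d" "0 < y'" "y' < d"
        then obtain r r' where r: "r \<in> R m" "norm (u x y - u x r) < s / 3"
          "r' \<in> R m" "norm (u x y' - u x r') < s / 3" using near by meson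
        have "u x y - u x y' = (u x y - u x r) + (u x r - u x r') - (u x y' - u x r')" by simp
        then have "norm (u x y - u x y') \<le> norm (u x y - u x r) + norm (u x r - u x r') + norm (u x y' - u x r')"
          by (smt (verit) norm_triangle_ineq norm_triangle_ineq4)
        then show "norm (u x y - u x y') \<le> s" using r m [OF r(1,3)] j by linarith
      qed (fact d)
    qed
    then show "x \<in> E" by (simp add: E_def)
  qed
  then have E: "E \<in> sets borel" using E'_sets by simp
  define c :: 'b where "c = (THE l. False)"
  have eq: "Lim (at_right 0) (u x) = (if x \<in> E then lim (\<lambda>n. u x (inverse (real (Suc n)))) else c)" for x
  proof (cases "x \<in> E")
    case True
    then obtain l where l: "(u x \<longlongrightarrow> l) (at_right 0)" by (auto simp: E_def)
    have "filterlim (\<lambda>n. inverse (real (Suc n))) (at_right 0) sequentially"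
      unfolding at_within_def using LIMSEQ_inverse_real_of_nat
      by (auto simp: filterlim_inf filterlim_principal)
    then have "(\<lambda>n. u x (inverse (real (Suc n)))) \<longlonglongrightarrow> l"
      by (rule filterlim_compose [OF l])
    then show ?thesis using True l by (simp add: limI tendsto_Lim)
  next
    case False
    then have "(\<lambda>l. (u x \<longlongrightarrow> l) (at_right 0)) = (\<lambda>l. False)" by (auto simp: E_def)
    then show ?thesis using False by (simp add: Lim_def t2_space_class.Lim_def c_def)
  qed
  have "(\<lambda>x. lim (\<lambda>n. u x (inverse (real (Suc n))))) \<in> borel_measurable borel"
    by (intro borel_measurable_lim_metric meas) simp
  then show ?thesis unfolding eq using E by (intro measurable_If_set) auto
qed

definition boundary_value :: "(complex \<Rightarrow> complex) \<Rightarrow> real \<Rightarrow> complex"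
  where "boundary_value w x = Lim (at_right 0) (\<lambda>e. w (Complex x e))"

lemma continuous_on_vertical:
  assumes "w holomorphic_on upper_half_plane"
  shows "continuous_on {0<..} (\<lambda>e. w (Complex x e))"
proof -
  have "continuous_on {0<..} (\<lambda>e. Complex x e)"
    unfolding Complex_eq by (intro continuous_intros)
  then show ?thesis
    by (rule continuous_on_compose2 [OF holomorphic_on_imp_continuous_on [OF assms]]) auto
qed

lemma boundary_value_measurable [measurable]:
  assumes "w holomorphic_on upper_half_plane"
  shows "boundary_value w \<in> borel_measurable borel"
  unfolding boundary_value_def
  by (rule borel_measurable_vertical_Lim)
     (auto intro!: holomorphic_line_measurable [OF assms] continuous_on_vertical [OF assms])

lemma boundary_value_eq: "((\<lambda>e. w (Complex x e)) \<longlongrightarrow> l) (at_right 0) \<Longrightarrow> boundary_value w x = l"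
  unfolding boundary_value_def by (rule tendsto_Lim) simp

lemma boundary_value_bounded_AE:
  assumes "w holomorphic_on upper_half_plane" "\<And>z. Im z > 0 \<Longrightarrow> cmod (w z) \<le> M"
  shows "AE x in lborel. ((\<lambda>e. w (Complex x e)) \<longlongrightarrow> boundary_value w x) (at_right 0)"
  using Fatou_upper_half_plane [OF assms]
  by (rule AE_mp) (auto intro!: AE_I2 simp: boundary_value_eq)

section \<open>The Cauchy distribution\<close>

lemma sets_cauchy_measure [measurable_cong, simp]: "sets cauchy_measure = sets borel"
  by (simp add: cauchy_measure_def)

lemma space_cauchy_measure [simp]: "space cauchy_measure = UNIV"
  by (simp add: cauchy_measure_def)

lemma one_plus_square_pos [simp]: "0 < 1 + (x::real)\<^sup>2"
  by (simp add: add_pos_nonneg)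

lemma AE_cauchy_measure: "(AE x in lborel. P x) \<Longrightarrow> (AE x in cauchy_measure. P x)"
  unfolding cauchy_measure_def by (subst AE_density) auto

lemma AE_cauchy_measureD:
  assumes "AE x in cauchy_measure. P x"
  shows "AE x in lborel. P x"
proof -
  have "AE x in lborel. 0 < ennreal (1 / (1 + x\<^sup>2)) \<longrightarrow> P x"
    using assms unfolding cauchy_measure_def by (subst (asm) AE_density) auto
  then show ?thesis by simp
qed

lemma emeasure_cauchy_measure: "emeasure cauchy_measure UNIV = ennreal pi"
proof -
  have "emeasure cauchy_measure UNIV = (\<integral>\<^sup>+x. ennreal (1 / (1 + x\<^sup>2)) \<partial>lborel)"
    unfolding cauchy_measure_def by (subst emeasure_density) auto
  also have "\<dots> = ennreal (LINT x|lborel. 1 / (1 + x\<^sup>2))"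
    by (rule nn_integral_eq_integral [OF integrable_cauchy_density]) (simp add: less_imp_le)
  finally show ?thesis by (simp only: LINT_cauchy_density)
qed

interpretation cauchy: finite_measure cauchy_measure
  by standard (simp add: emeasure_cauchy_measure)

lemma LINT_const_cauchy_measure: "(LINT x|cauchy_measure. c) = pi * c" for c :: real
  by (simp add: measure_def emeasure_cauchy_measure)

lemma cauchy_bounded_integrable:
  fixes f :: "real \<Rightarrow> 'b::{banach, second_countable_topology}"
  assumes "f \<in> borel_measurable borel" "AE x in cauchy_measure. norm (f x) \<le> c"
  shows "integrable cauchy_measure f"
  using assms by (intro cauchy.integrable_const_bound) auto

lemma LINT_cauchy_measure:
  fixes f :: "real \<Rightarrow> complex"
  assumes "f \<in> borel_measurable borel"
  shows "(LINT x|cauchy_measure. f x) = (LINT x|lborel. f x / (1 + (of_real x)\<^sup>2))"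
proof -
  have "(LINT x|cauchy_measure. f x) = (LINT x|lborel. (1 / (1 + x\<^sup>2)) *\<^sub>R f x)"
    unfolding cauchy_measure_def using assms by (intro integral_density) (auto intro!: AE_I2 simp: less_imp_le)
  also have "\<dots> = (LINT x|lborel. f x / (1 + (of_real x)\<^sup>2))"
    by (intro Bochner_Integration.integral_cong) (auto simp: scaleR_conv_of_real)
  finally show ?thesis .
qed

section \<open>The Schwarz formula\<close>

text \<open>The kernel by which a holomorphic function is recovered from the imaginary part of its
  boundary values; the normalisation with respect to \<open>d\<lambda> / (1 + \<lambda>\<^sup>2)\<close> makes it constant at
  \<open>z = \<i>\<close>.\<close>

definition schwarz_kernel :: "complex \<Rightarrow> real \<Rightarrow> complex"
  where "schwarz_kernel z t = (1 + z * of_real t) / (of_real t - z)"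

lemma schwarz_kernel_measurable [measurable]: "schwarz_kernel z \<in> borel_measurable borel"
  unfolding schwarz_kernel_def by measurable

lemma schwarz_kernel_bound:
  assumes "Im z > 0"
  shows "cmod (schwarz_kernel z t) \<le> cmod z + (1 + (cmod z)\<^sup>2) / Im z"
proof -
  have nz: "of_real t - z \<noteq> 0" using assms by (auto simp: complex_eq_iff)
  have "schwarz_kernel z t = z + (1 + z\<^sup>2) / (of_real t - z)"
    using nz by (simp add: schwarz_kernel_def field_simps power2_eq_square)
  then have "cmod (schwarz_kernel z t) \<le> cmod z + cmod (1 + z\<^sup>2) / cmod (of_real t - z)"
    by (metis norm_divide norm_triangle_ineq)
  also have "\<dots> \<le> cmod z + (1 + (cmod z)\<^sup>2) / Im z"
  proof -
    have "cmod (1 + z\<^sup>2) \<le> 1 + (cmod z)\<^sup>2"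
      by (metis norm_one norm_power norm_triangle_ineq)
    moreover have "Im z \<le> cmod (of_real t - z)"
      using abs_Im_le_cmod [of "of_real t - z"] assms by simp
    ultimately show ?thesis using assms by (intro add_left_mono frac_le) (auto intro: add_nonneg_nonneg)
  qed
  finally show ?thesis .
qed

lemma schwarz_kernel_ii: "schwarz_kernel \<i> t = \<i>"
proof -
  have "of_real t - \<i> \<noteq> 0" by (auto simp: complex_eq_iff)
  then show ?thesis by (simp add: schwarz_kernel_def field_simps)
qed

text \<open>In terms of Cauchy kernels relative to the pole \<open>- \<i>\<close>, the integral over \<open>w\<close> gives the value
  at \<open>z\<close>, and the integral over \<open>cnj w\<close> is the conjugate of one with \<open>cnj z\<close> in place of
  \<open>z\<close>, in which the pole lies outside the half-plane.\<close>

lemma schwarz_formula_line: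
  fixes w :: "complex \<Rightarrow> complex"
  assumes hol: "w holomorphic_on {z. Im z > - d}" and d: "d > 0"
    and M: "\<And>z. 0 \<le> Im z \<Longrightarrow> cmod (w z) \<le> M" and z: "Im z > 0"
  shows "(LINT t|cauchy_measure. schwarz_kernel z t * of_real (Im (w (of_real t)))) = pi * (w z - of_real (Re (w \<i>)))"
proof -
  define K where "K a t = 1 / (of_real t - a) - 1 / (of_real t - (- \<i>))" for a :: complex and t :: real
  have meas [measurable]: "(\<lambda>t. w (of_real t)) \<in> borel_measurable borel"
    using holomorphic_line_measurable [OF hol, of 0] d by (simp add: complex_of_real_def)
  have nz: "of_real t - \<i> \<noteq> 0" "of_real t + \<i> \<noteq> 0" for t by (auto simp: complex_eq_iff)
  have sq: "1 + (of_real t)\<^sup>2 = (of_real t - \<i>) * (of_real t + \<i>)" for t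
    by (simp add: algebra_simps power2_eq_square)
  have ker: "schwarz_kernel a t / (1 + (of_real t)\<^sup>2) = K a t - K \<i> t / 2" if "Im a \<noteq> 0" for a t
  proof -
    have na: "of_real t - a \<noteq> 0" using that by (auto simp: complex_eq_iff)
    show ?thesis
      unfolding schwarz_kernel_def K_def sq using na nz [of t]
      by (simp add: divide_simps) (simp add: algebra_simps)
  qed
  have cnj_ker: "schwarz_kernel z t = cnj (schwarz_kernel (cnj z) t)" for t
    by (simp add: schwarz_kernel_def)
  have i1: "integrable lborel (\<lambda>t. w (of_real t) * K z t)" "(LINT t|lborel. w (of_real t) * K z t) = 2 * pi * \<i> * w z"
    unfolding K_def using LINT_cauchy_kernel_upper [OF hol d M z, of "- \<i>"] by simp_all
  have i2: "integrable lborel (\<lambda>t. w (of_real t) * K \<i> t)" "(LINT t|lborel. w (of_real t) * K \<i> t) = 2 * pi * \<i> * w \<i>"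
    unfolding K_def using LINT_cauchy_kernel_upper [OF hol d M, of \<i> "- \<i>"] by simp_all
  have i3: "integrable lborel (\<lambda>t. w (of_real t) * K (cnj z) t)" "(LINT t|lborel. w (of_real t) * K (cnj z) t) = 0"
    unfolding K_def using LINT_cauchy_kernel_lower [OF hol d M, of "cnj z" "- \<i>"] z by simp_all
  define P where "P t = w (of_real t) * K z t - w (of_real t) * K \<i> t / 2" for t
  define Q where "Q t = w (of_real t) * K (cnj z) t - w (of_real t) * K \<i> t / 2" for t
  have P: "integrable lborel P" "(LINT t|lborel. P t) = 2 * pi * \<i> * w z - pi * \<i> * w \<i>"
    unfolding P_def using i1 i2 by simp_all
  have Q: "integrable lborel Q" "(LINT t|lborel. Q t) = - pi * \<i> * w \<i>"
    unfolding Q_def using i3 i2 by simp_all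
  have pt: "schwarz_kernel z t * of_real (Im (w (of_real t))) / (1 + (of_real t)\<^sup>2) = (P t - cnj (Q t)) / (2 * \<i>)" for t
  proof -
    have "P t = w (of_real t) * (schwarz_kernel z t / (1 + (of_real t)\<^sup>2))"
      using ker [of z t] z by (simp add: P_def right_diff_distrib)
    moreover have "Q t = w (of_real t) * (schwarz_kernel (cnj z) t / (1 + (of_real t)\<^sup>2))"
      using ker [of "cnj z" t] z by (simp add: Q_def right_diff_distrib)
    then have "cnj (Q t) = cnj (w (of_real t)) * (schwarz_kernel z t / (1 + (of_real t)\<^sup>2))"
      by (simp add: cnj_ker)
    moreover have "of_real (Im (w (of_real t))) = (w (of_real t) - cnj (w (of_real t))) / (2 * \<i>)"
      by (simp add: complex_eq_iff)
    moreover have "a * ((x - y) / c) / s = (x * (a / s) - y * (a / s)) / c" for a x y c s :: complex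
      by (simp add: algebra_simps diff_divide_distrib)
    ultimately show ?thesis by (simp only:)
  qed
  have "(LINT t|cauchy_measure. schwarz_kernel z t * of_real (Im (w (of_real t))))
      = (LINT t|lborel. (P t - cnj (Q t)) / (2 * \<i>))"
    by (subst LINT_cauchy_measure) (measurable, simp add: pt)
  also have "\<dots> = ((LINT t|lborel. P t) - cnj (LINT t|lborel. Q t)) / (2 * \<i>)"
    using P(1) Q(1) by (simp add: integrable_cnj)
  also have "\<dots> = pi * (w z - (w \<i> + cnj (w \<i>)) / 2)"
    unfolding P(2) Q(2) by (simp add: field_simps)
  also have "(w \<i> + cnj (w \<i>)) / 2 = of_real (Re (w \<i>))" by (simp add: complex_add_cnj)
  finally show ?thesis .
qed

lemma filterlim_inverse_Suc: "filterlim (\<lambda>n. inverse (real (Suc n))) (at_right 0) sequentially"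
  unfolding at_within_def using LIMSEQ_inverse_real_of_nat
  by (auto simp: filterlim_inf filterlim_principal)

text \<open>The functions \<open>w (z + \<i> e)\<close> are holomorphic across the real line; dominated convergence
  applies as \<open>e\<close> tends to zero.\<close>

lemma schwarz_formula:
  fixes w :: "complex \<Rightarrow> complex"
  assumes hol: "w holomorphic_on upper_half_plane"
    and M: "\<And>z. Im z > 0 \<Longrightarrow> cmod (w z) \<le> M" and z: "Im z > 0"
  shows "(LINT t|cauchy_measure. schwarz_kernel z t * of_real (Im (boundary_value w t))) = pi * (w z - of_real (Re (w \<i>)))"
proof -
  have bv: "AE x in lborel. ((\<lambda>e. w (Complex x e)) \<longlongrightarrow> boundary_value w x) (at_right 0)"
    by (rule boundary_value_bounded_AE [OF hol M])
  define e where "e n = inverse (real (Suc n))" for n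
  have e: "e n > 0" for n by (simp add: e_def)
  define c where "c = cmod z + (1 + (cmod z)\<^sup>2) / Im z"
  have e0: "e \<longlonglongrightarrow> 0" unfolding e_def by (rule LIMSEQ_inverse_real_of_nat)
  have opn: "open upper_half_plane" unfolding upper_half_plane_def by (rule open_halfspace_Im_gt)
  have shift: "(\<lambda>n. w (a + \<i> * of_real (e n))) \<longlonglongrightarrow> w a" if "Im a > 0" for a
  proof -
    have "isCont w a"
      using holomorphic_on_imp_continuous_on [OF hol] that opn
      by (auto simp: continuous_on_eq_continuous_at upper_half_plane_def)
    moreover have "(\<lambda>n. a + \<i> * of_real (e n)) \<longlonglongrightarrow> a + \<i> * of_real 0"
      by (intro tendsto_intros e0)
    ultimately show ?thesis by (auto intro: isCont_tendsto_compose)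
  qed
  have line: "(LINT t|cauchy_measure. schwarz_kernel z t * of_real (Im (w (Complex t (e n)))))
      = pi * (w (z + \<i> * of_real (e n)) - of_real (Re (w (\<i> + \<i> * of_real (e n)))))" for n
  proof -
    have "(LINT t|cauchy_measure. schwarz_kernel z t * of_real (Im (w (of_real t + \<i> * of_real (e n)))))
      = pi * (w (z + \<i> * of_real (e n)) - of_real (Re (w (\<i> + \<i> * of_real (e n)))))"
    proof (rule schwarz_formula_line [OF holomorphic_vertical_shift [OF hol e [of n]] e [of n] _ z])
      show "cmod (w (\<zeta> + \<i> * of_real (e n))) \<le> M" if "0 \<le> Im \<zeta>" for \<zeta>
        using that e [of n] by (intro M) simp
    qed
    then show ?thesis by (simp only: Complex_eq)
  qed
  have meas: "(\<lambda>t. w (Complex t (e n))) \<in> borel_measurable borel" for n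
    using e by (intro holomorphic_line_measurable [OF hol]) auto
  have "(\<lambda>n. LINT t|cauchy_measure. schwarz_kernel z t * of_real (Im (w (Complex t (e n)))))
      \<longlonglongrightarrow> (LINT t|cauchy_measure. schwarz_kernel z t * of_real (Im (boundary_value w t)))"
  proof (rule integral_dominated_convergence [where w = "\<lambda>_. c * M"])
    show "(\<lambda>t. schwarz_kernel z t * of_real (Im (boundary_value w t))) \<in> borel_measurable cauchy_measure"
      using boundary_value_measurable [OF hol] by measurable
    show "(\<lambda>t. schwarz_kernel z t * of_real (Im (w (Complex t (e n))))) \<in> borel_measurable cauchy_measure" for n
      using meas [of n] by measurable
    show "integrable cauchy_measure (\<lambda>_. c * M)" by simp
    show "AE x in cauchy_measure. (\<lambda>n. schwarz_kernel z x * of_real (Im (w (Complex x (e n)))))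
        \<longlonglongrightarrow> schwarz_kernel z x * of_real (Im (boundary_value w x))"
      using AE_cauchy_measure [OF bv]
    proof (rule AE_mp, intro AE_I2 impI)
      fix x assume "((\<lambda>e. w (Complex x e)) \<longlongrightarrow> boundary_value w x) (at_right 0)"
      then have "(\<lambda>n. w (Complex x (e n))) \<longlonglongrightarrow> boundary_value w x"
        unfolding e_def by (rule filterlim_compose [OF _ filterlim_inverse_Suc])
      then show "(\<lambda>n. schwarz_kernel z x * of_real (Im (w (Complex x (e n)))))
        \<longlonglongrightarrow> schwarz_kernel z x * of_real (Im (boundary_value w x))"
        by (intro tendsto_intros)
    qed
    show "AE x in cauchy_measure. norm (schwarz_kernel z x * of_real (Im (w (Complex x (e n))))) \<le> c * M" for n
    proof (rule AE_I2)
      fix x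
      have c0: "0 \<le> c" using order_trans [OF norm_ge_zero schwarz_kernel_bound [OF z, of 0]] by (simp add: c_def)
      have "\<bar>Im (w (Complex x (e n)))\<bar> \<le> M"
        using abs_Im_le_cmod M [of "Complex x (e n)"] e [of n] by (auto intro: order_trans)
      then show "norm (schwarz_kernel z x * of_real (Im (w (Complex x (e n))))) \<le> c * M"
        unfolding norm_mult norm_of_real using c0 schwarz_kernel_bound [OF z, of x]
        by (intro mult_mono) (auto simp: c_def)
    qed
  qed
  moreover have "(\<lambda>n. pi * (w (z + \<i> * of_real (e n)) - of_real (Re (w (\<i> + \<i> * of_real (e n))))))
      \<longlonglongrightarrow> pi * (w z - of_real (Re (w \<i>)))"
    by (intro tendsto_intros shift z) simp
  ultimately show ?thesis unfolding line by (rule LIMSEQ_unique)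
qed

lemma mean_value_formula:
  fixes w :: "complex \<Rightarrow> complex"
  assumes hol: "w holomorphic_on upper_half_plane"
    and M: "\<And>z. Im z > 0 \<Longrightarrow> cmod (w z) \<le> M"
  shows "(LINT t|cauchy_measure. Re (boundary_value w t)) = pi * Re (w \<i>)"
proof -
  have bv: "AE x in lborel. ((\<lambda>e. w (Complex x e)) \<longlongrightarrow> boundary_value w x) (at_right 0)"
    by (rule boundary_value_bounded_AE [OF hol M])
  have "AE t in cauchy_measure. Im (boundary_value (\<lambda>z. \<i> * w z) t) = Re (boundary_value w t)"
    using AE_cauchy_measure [OF bv]
  proof (rule AE_mp, intro AE_I2 impI)
    fix x assume "((\<lambda>e. w (Complex x e)) \<longlongrightarrow> boundary_value w x) (at_right 0)"
    then have "boundary_value (\<lambda>z. \<i> * w z) x = \<i> * boundary_value w x"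
      by (intro boundary_value_eq tendsto_intros)
    then show "Im (boundary_value (\<lambda>z. \<i> * w z) x) = Re (boundary_value w x)" by simp
  qed
  moreover have hol': "(\<lambda>z. \<i> * w z) holomorphic_on upper_half_plane"
    by (intro holomorphic_intros hol)
  ultimately have eq: "(LINT t|cauchy_measure. \<i> * of_real (Im (boundary_value (\<lambda>z. \<i> * w z) t)))
      = (LINT t|cauchy_measure. \<i> * of_real (Re (boundary_value w t)))"
    using boundary_value_measurable [OF hol] boundary_value_measurable [OF hol']
    by (intro integral_cong_AE) auto
  have "(LINT t|cauchy_measure. \<i> * of_real (Im (boundary_value (\<lambda>z. \<i> * w z) t)))
      = pi * (\<i> * w \<i> - of_real (Re (\<i> * w \<i>)))"
    using schwarz_formula [OF hol', of M \<i>] M by (simp add: schwarz_kernel_ii norm_mult)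
  then have "\<i> * of_real (LINT t|cauchy_measure. Re (boundary_value w t)) = pi * (\<i> * w \<i> - of_real (Re (\<i> * w \<i>)))"
    unfolding eq by simp
  then show ?thesis by (simp add: complex_eq_iff)
qed

section \<open>Functions with nonnegative real part\<close>

text \<open>A conformal substitute for truncation at level \<open>B\<close>: it maps the right half-plane into itself
  and into the disc of radius \<open>B\<close>, it is close to the identity for \<open>cmod w\<close> small against
  \<open>B\<close>, and it preserves holomorphy.\<close>

definition damp :: "real \<Rightarrow> complex \<Rightarrow> complex"
  where "damp B w = of_real B * w / (of_real B + w)"

text \<open>The part of \<open>Re (damp B w)\<close> that does not come from \<open>Re w\<close>. It is comparable to
  \<open>min ((cmod w)\<^sup>2 / B) B\<close>, so it controls both the error \<open>w - damp B w\<close> for \<open>cmod w \<le> B\<close>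
  and the measure of the set \<open>cmod w > B\<close>.\<close>

definition defect :: "real \<Rightarrow> complex \<Rightarrow> real"
  where "defect B w = B * (cmod w)\<^sup>2 / (cmod (of_real B + w))\<^sup>2"

lemma damp_denominator:
  assumes "B > 0" "Re w \<ge> 0"
  shows "B \<le> cmod (of_real B + w)" "cmod w \<le> cmod (of_real B + w)" "of_real B + w \<noteq> 0"
proof -
  show 1: "B \<le> cmod (of_real B + w)"
    using abs_Re_le_cmod [of "of_real B + w"] assms by simp
  show "of_real B + w \<noteq> 0" using 1 assms by auto
  show "cmod w \<le> cmod (of_real B + w)"
    unfolding cmod_def using assms by (intro real_sqrt_le_mono add_right_mono power_mono) auto
qed

lemma damp_bounds:
  assumes "B > 0" "Re w \<ge> 0"
  shows "cmod (damp B w) \<le> B" "cmod (damp B w) \<le> cmod w"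
    "cmod (w - damp B w) \<le> (cmod w)\<^sup>2 / B" "Re (damp B w) = defect B w + B\<^sup>2 * Re w / (cmod (of_real B + w))\<^sup>2"
    "0 \<le> defect B w" "defect B w \<le> B" "Re (damp B w) \<ge> 0"
proof -
  note d = damp_denominator [OF assms]
  have p: "0 < cmod (of_real B + w)" using d(3) by simp
  show "cmod (damp B w) \<le> B"
  proof -
    have "cmod (damp B w) = B * (cmod w / cmod (of_real B + w))" using assms by (simp add: damp_def norm_mult norm_divide)
    also have "\<dots> \<le> B * 1" using assms d p by (intro mult_left_mono) (auto simp: divide_le_eq)
    finally show ?thesis by simp
  qed
  show "cmod (damp B w) \<le> cmod w"
  proof -
    have "cmod (damp B w) = cmod w * (B / cmod (of_real B + w))" using assms by (simp add: damp_def norm_mult norm_divide)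
    also have "\<dots> \<le> cmod w * 1" using assms d p by (intro mult_left_mono) (auto simp: divide_le_eq)
    finally show ?thesis by simp
  qed
  show "cmod (w - damp B w) \<le> (cmod w)\<^sup>2 / B"
  proof -
    have "w - damp B w = w\<^sup>2 / (of_real B + w)"
      using d(3) by (simp add: damp_def field_simps power2_eq_square)
    then have "cmod (w - damp B w) = (cmod w)\<^sup>2 / cmod (of_real B + w)" by (simp add: norm_divide norm_power)
    also have "\<dots> \<le> (cmod w)\<^sup>2 / B" using assms d p by (intro divide_left_mono) auto
    finally show ?thesis .
  qed
  show eq: "Re (damp B w) = defect B w + B\<^sup>2 * Re w / (cmod (of_real B + w))\<^sup>2"
    unfolding damp_def defect_def Re_divide cmod_power2
    by (simp add: add_divide_distrib [symmetric]) (simp add: algebra_simps power2_eq_square)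
  show nn: "0 \<le> defect B w" using assms by (simp add: defect_def)
  then show "Re (damp B w) \<ge> 0" unfolding eq using assms by simp
  have "(cmod w)\<^sup>2 / (cmod (of_real B + w))\<^sup>2 \<le> 1"
    using d p by (simp add: divide_le_eq power_mono)
  then have "B * ((cmod w)\<^sup>2 / (cmod (of_real B + w))\<^sup>2) \<le> B * 1" using assms by (intro mult_left_mono) auto
  then show "defect B w \<le> B" by (simp add: defect_def)
qed

lemma defect_lower_bounds:
  assumes "B > 0" "Re w \<ge> 0"
  shows "B < cmod w \<Longrightarrow> B \<le> 4 * defect B w" "cmod w \<le> B \<Longrightarrow> (cmod w)\<^sup>2 / B \<le> 4 * defect B w"
proof -
  have p: "0 < cmod (of_real B + w)" using damp_denominator(3) [OF assms] by simp
  have tri: "cmod (of_real B + w) \<le> B + cmod w"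
    using norm_triangle_ineq [of "of_real B" w] assms by simp
  show "B \<le> 4 * defect B w" if "B < cmod w"
  proof -
    have "(cmod (of_real B + w))\<^sup>2 \<le> (2 * cmod w)\<^sup>2" using tri that by (intro power_mono) auto
    then have "B * (cmod (of_real B + w))\<^sup>2 \<le> B * (4 * (cmod w)\<^sup>2)"
      using assms by (intro mult_left_mono) (auto simp: power_mult_distrib)
    then show ?thesis using p by (simp add: defect_def pos_le_divide_eq mult_ac)
  qed
  show "(cmod w)\<^sup>2 / B \<le> 4 * defect B w" if "cmod w \<le> B"
  proof -
    have "(cmod (of_real B + w))\<^sup>2 \<le> (2 * B)\<^sup>2" using tri that by (intro power_mono) auto
    then have "(cmod w)\<^sup>2 * (cmod (of_real B + w))\<^sup>2 \<le> (cmod w)\<^sup>2 * (4 * (B * B))"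
      by (intro mult_left_mono) (auto simp: power_mult_distrib power2_eq_square)
    then show ?thesis using p assms by (simp add: defect_def divide_simps mult_ac)
  qed
qed

lemma damp_holomorphic:
  assumes "g holomorphic_on upper_half_plane" "\<And>z. Im z > 0 \<Longrightarrow> Re (g z) \<ge> 0" "B > 0"
  shows "(\<lambda>z. damp B (g z)) holomorphic_on upper_half_plane"
  unfolding damp_def using damp_denominator(3) [OF assms(3) assms(2)]
  by (intro holomorphic_intros assms(1)) (auto simp: upper_half_plane_def)

lemma damp_tendsto:
  assumes "(f \<longlongrightarrow> l) F" "B > 0" "Re l \<ge> 0"
  shows "((\<lambda>x. damp B (f x)) \<longlongrightarrow> damp B l) F"
  unfolding damp_def using damp_denominator(3) [OF assms(2,3)] by (intro tendsto_intros assms(1))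

lemma boundary_Re_nonneg:
  assumes "((\<lambda>e. g (Complex x e)) \<longlongrightarrow> l) (at_right 0)" "\<And>z. Im z > 0 \<Longrightarrow> Re (g z) \<ge> 0"
  shows "Re l \<ge> 0"
proof (rule tendsto_lowerbound [OF tendsto_Re [OF assms(1)]])
  show "\<forall>\<^sub>F e in at_right 0. 0 \<le> Re (g (Complex x e))"
    by (rule eventually_mono [OF eventually_at_right_less]) (simp add: assms(2))
qed simp

text \<open>The function \<open>g / (1 + g)\<close> is bounded and has boundary values almost everywhere, hence so
  has \<open>g\<close>, except that the value may be infinite. At such a point all the functions
  \<open>g / (n + g)\<close> have boundary value \<open>1\<close>, whereas their mean value, that of
  \<open>Re (g \<i> / (n + g \<i>))\<close>, tends to zero; so these points form a null set.\<close>

lemma positive_real_part_boundary: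
  assumes hol: "g holomorphic_on upper_half_plane" and pos: "\<And>z. Im z > 0 \<Longrightarrow> Re (g z) \<ge> 0"
  shows "AE x in lborel. ((\<lambda>e. g (Complex x e)) \<longlongrightarrow> boundary_value g x) (at_right 0)"
proof -
  define w where "w n z = damp (real (Suc n)) (g z) / of_real (real (Suc n))" for n z
  have whol: "w n holomorphic_on upper_half_plane" for n
    unfolding w_def using damp_holomorphic [OF hol pos, of "real (Suc n)"]
    by (intro holomorphic_on_divide holomorphic_on_const) (auto simp del: of_nat_Suc)
  have wb: "cmod (w n z) \<le> 1" if "Im z > 0" for n z
    using damp_bounds(1) [of "real (Suc n)" "g z"] pos [OF that]
    by (simp add: w_def norm_divide del: of_nat_Suc)
  have wpos: "Re (w n z) \<ge> 0" if "Im z > 0" for n z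
    using damp_bounds(7) [of "real (Suc n)" "g z"] pos [OF that] unfolding w_def Re_divide_of_real by simp
  have wg: "w n z = g z / (of_nat (Suc n) + g z)" for n z
    by (simp add: w_def damp_def del: of_nat_Suc)
  have nz: "of_nat (Suc n) + g z \<noteq> 0" if "Im z > 0" for n z
    using damp_denominator(3) [of "real (Suc n)" "g z"] pos [OF that] by (simp del: of_nat_Suc)
  have conv: "AE x in lborel. \<forall>n. ((\<lambda>e. w n (Complex x e)) \<longlongrightarrow> boundary_value (w n) x) (at_right 0)"
    unfolding AE_all_countable using boundary_value_bounded_AE [OF whol wb] by blast
  define A where "A = {x. boundary_value (w 0) x = 1}"
  have meas [measurable]: "boundary_value (w n) \<in> borel_measurable borel" for n
    by (rule boundary_value_measurable [OF whol])
  have A [measurable]: "A \<in> sets borel" unfolding A_def by measurable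
  have pt: "indicator A x \<le> Re (boundary_value (w n) x)"
    if "\<forall>n. ((\<lambda>e. w n (Complex x e)) \<longlongrightarrow> boundary_value (w n) x) (at_right 0)" for x n
  proof (cases "x \<in> A")
    case True
    let ?N = "of_nat (Suc n) :: complex"
    have c0: "((\<lambda>e. w 0 (Complex x e)) \<longlongrightarrow> 1) (at_right 0)"
      using that True unfolding A_def mem_Collect_eq by metis
    have "((\<lambda>e. w 0 (Complex x e) / (?N * (1 - w 0 (Complex x e)) + w 0 (Complex x e))) \<longlongrightarrow> 1 / (?N * (1 - 1) + 1)) (at_right 0)"
      by (intro tendsto_intros c0) simp
    moreover have "w 0 z / (?N * (1 - w 0 z) + w 0 z) = w n z" if "Im z > 0" for z
    proof -
      have "1 - w 0 z = 1 / (1 + g z)" using nz [of z 0] that by (simp add: wg field_simps)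
      then have "?N * (1 - w 0 z) + w 0 z = (?N + g z) / (1 + g z)"
        by (simp add: wg add_divide_distrib)
      then show ?thesis using nz [of z 0] that by (simp add: wg)
    qed
    then have "\<forall>\<^sub>F e in at_right 0. w 0 (Complex x e) / (?N * (1 - w 0 (Complex x e)) + w 0 (Complex x e)) = w n (Complex x e)"
      by (intro eventually_mono [OF eventually_at_right_less]) simp
    ultimately have "((\<lambda>e. w n (Complex x e)) \<longlongrightarrow> 1 / (?N * (1 - 1) + 1)) (at_right 0)"
      by (rule Lim_transform_eventually)
    then have "boundary_value (w n) x = 1" by (intro boundary_value_eq) simp
    then show ?thesis by simp
  next
    case False
    then show ?thesis using boundary_Re_nonneg [of "w n"] that wpos by auto
  qed
  have le: "measure cauchy_measure A \<le> pi * cmod (g \<i>) / real (Suc n)" for n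
  proof -
    have "measure cauchy_measure A = (LINT x|cauchy_measure. indicator A x)"
      by simp
    also have "\<dots> \<le> (LINT x|cauchy_measure. Re (boundary_value (w n) x))"
    proof (rule integral_mono_AE)
      show "integrable cauchy_measure (\<lambda>x. indicator A x :: real)"
        by (rule cauchy_bounded_integrable [where c = 1]) (auto simp: indicator_def)
      have "AE x in cauchy_measure. cmod (boundary_value (w n) x) \<le> 1"
        using AE_cauchy_measure [OF conv]
      proof (rule AE_mp, intro AE_I2 impI)
        fix x assume "\<forall>n. ((\<lambda>e. w n (Complex x e)) \<longlongrightarrow> boundary_value (w n) x) (at_right 0)"
        then have "((\<lambda>e. cmod (w n (Complex x e))) \<longlongrightarrow> cmod (boundary_value (w n) x)) (at_right 0)"
          by (intro tendsto_norm) blast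
        then show "cmod (boundary_value (w n) x) \<le> 1"
          by (rule tendsto_upperbound [OF _ eventually_mono [OF eventually_at_right_less]]) (simp_all add: wb)
      qed
      then have "AE x in cauchy_measure. norm (Re (boundary_value (w n) x)) \<le> 1"
        by (rule AE_mp) (auto intro!: AE_I2 intro: order_trans [OF abs_Re_le_cmod])
      then show "integrable cauchy_measure (\<lambda>x. Re (boundary_value (w n) x))"
        by (intro cauchy_bounded_integrable [where c = 1]) auto
      show "AE x in cauchy_measure. indicator A x \<le> Re (boundary_value (w n) x)"
        using AE_cauchy_measure [OF conv] by (rule AE_mp) (auto intro!: AE_I2 pt)
    qed
    also have "\<dots> = pi * Re (w n \<i>)" by (rule mean_value_formula [OF whol wb])
    also have "\<dots> \<le> pi * (cmod (g \<i>) / real (Suc n))"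
    proof (intro mult_left_mono)
      have "Re (w n \<i>) \<le> cmod (w n \<i>)" by (rule complex_Re_le_cmod)
      also have "\<dots> \<le> cmod (g \<i>) / real (Suc n)"
        using damp_bounds(2) [of "real (Suc n)" "g \<i>"] pos [of \<i>]
        unfolding w_def norm_divide norm_of_real by (simp add: divide_right_mono)
      finally show "Re (w n \<i>) \<le> cmod (g \<i>) / real (Suc n)" .
    qed simp
    finally show ?thesis by simp
  qed
  have "measure cauchy_measure A \<le> 0"
  proof (rule LIMSEQ_le_const)
    show "(\<lambda>n. pi * cmod (g \<i>) / real (Suc n)) \<longlonglongrightarrow> 0" by real_asymp
  qed (use le in auto)
  then have "emeasure cauchy_measure A = 0"
    by (simp add: cauchy.emeasure_eq_measure measure_le_0_iff)
  then have "A \<in> null_sets cauchy_measure" by (intro null_setsI) auto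
  then have "AE x in cauchy_measure. x \<notin> A" by (rule AE_not_in)
  then have "AE x in lborel. x \<notin> A" by (rule AE_cauchy_measureD)
  with conv show ?thesis
  proof (rule AE_mp [OF _ AE_mp], intro AE_I2 impI)
    fix x assume c: "\<forall>n. ((\<lambda>e. w n (Complex x e)) \<longlongrightarrow> boundary_value (w n) x) (at_right 0)" and x: "x \<notin> A"
    have c0: "((\<lambda>e. w 0 (Complex x e)) \<longlongrightarrow> boundary_value (w 0) x) (at_right 0)" using c by blast
    have "((\<lambda>e. w 0 (Complex x e) / (1 - w 0 (Complex x e))) \<longlongrightarrow> boundary_value (w 0) x / (1 - boundary_value (w 0) x)) (at_right 0)"
      using x by (intro tendsto_intros c0) (auto simp: A_def)
    moreover have "w 0 z / (1 - w 0 z) = g z" if "Im z > 0" for z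
    proof -
      have "1 - w 0 z = 1 / (1 + g z)" using nz [of z 0] that by (simp add: wg field_simps)
      then show ?thesis using nz [of z 0] that by (simp add: wg)
    qed
    then have "\<forall>\<^sub>F e in at_right 0. w 0 (Complex x e) / (1 - w 0 (Complex x e)) = g (Complex x e)"
      by (intro eventually_mono [OF eventually_at_right_less]) simp
    ultimately have "((\<lambda>e. g (Complex x e)) \<longlongrightarrow> boundary_value (w 0) x / (1 - boundary_value (w 0) x)) (at_right 0)"
      by (rule Lim_transform_eventually)
    then show "((\<lambda>e. g (Complex x e)) \<longlongrightarrow> boundary_value g x) (at_right 0)"
      using boundary_value_eq by metis
  qed
qed

lemma damp_boundary:
  assumes hol: "g holomorphic_on upper_half_plane" and pos: "\<And>z. Im z > 0 \<Longrightarrow> Re (g z) \<ge> 0"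
  shows "AE x in cauchy_measure. 0 \<le> Re (boundary_value g x) \<and>
    (\<forall>B>0. boundary_value (\<lambda>z. damp B (g z)) x = damp B (boundary_value g x))"
proof (rule AE_mp [OF AE_cauchy_measure], rule positive_real_part_boundary [OF hol pos], assumption, intro AE_I2 impI)
  fix x assume c: "((\<lambda>e. g (Complex x e)) \<longlongrightarrow> boundary_value g x) (at_right 0)"
  have "0 \<le> Re (boundary_value g x)" using boundary_Re_nonneg [OF c pos] .
  then show "0 \<le> Re (boundary_value g x) \<and> (\<forall>B>0. boundary_value (\<lambda>z. damp B (g z)) x = damp B (boundary_value g x))"
    using damp_tendsto [OF c] by (auto intro: boundary_value_eq)
qed

lemma damp_mean_value:
  assumes hol: "g holomorphic_on upper_half_plane" and pos: "\<And>z. Im z > 0 \<Longrightarrow> Re (g z) \<ge> 0" and B: "B > 0"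
  shows "integrable cauchy_measure (\<lambda>x. Re (damp B (boundary_value g x)))"
    "(LINT x|cauchy_measure. Re (damp B (boundary_value g x))) = pi * Re (damp B (g \<i>))"
proof -
  have db: "AE x in cauchy_measure. 0 \<le> Re (boundary_value g x) \<and>
    (\<forall>B>0. boundary_value (\<lambda>z. damp B (g z)) x = damp B (boundary_value g x))"
    by (rule damp_boundary [OF hol pos])
  note [measurable] = boundary_value_measurable [OF hol] boundary_value_measurable [OF damp_holomorphic [OF hol pos B]]
  have m [measurable]: "(\<lambda>x. damp B (boundary_value g x)) \<in> borel_measurable borel"
    unfolding damp_def by measurable
  have bd: "AE x in cauchy_measure. norm (Re (damp B (boundary_value g x))) \<le> B"
    using db
    by (rule AE_mp) (auto intro!: AE_I2 intro: order_trans [OF abs_Re_le_cmod] damp_bounds(1) [OF B])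
  show "integrable cauchy_measure (\<lambda>x. Re (damp B (boundary_value g x)))"
    by (rule cauchy_bounded_integrable [OF _ bd]) measurable
  have "(LINT x|cauchy_measure. Re (damp B (boundary_value g x)))
      = (LINT x|cauchy_measure. Re (boundary_value (\<lambda>z. damp B (g z)) x))"
  proof (rule integral_cong_AE)
    show "AE x in cauchy_measure. Re (damp B (boundary_value g x)) = Re (boundary_value (\<lambda>z. damp B (g z)) x)"
      using db by (rule AE_mp) (use B in \<open>auto intro!: AE_I2\<close>)
  qed measurable
  also have "\<dots> = pi * Re (damp B (g \<i>))"
    by (rule mean_value_formula [where M = B], rule damp_holomorphic [OF hol pos B], assumption)
       (rule damp_bounds(1) [OF B pos])
  finally show "(LINT x|cauchy_measure. Re (damp B (boundary_value g x))) = pi * Re (damp B (g \<i>))" .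
qed

lemma damp_at_top:
  "((\<lambda>B. damp B w) \<longlongrightarrow> w) at_top"
proof (cases "w = 0")
  case True then show ?thesis by (simp add: damp_def)
next
  case False
  have l0: "((\<lambda>B. of_real (inverse B) :: complex) \<longlongrightarrow> of_real 0) at_top"
    by (intro tendsto_of_real tendsto_inverse_0_at_top filterlim_ident)
  then have "((\<lambda>B. w / (1 + of_real (inverse B) * w)) \<longlongrightarrow> w / (1 + of_real 0 * w)) at_top"
    by (intro tendsto_divide tendsto_add tendsto_mult tendsto_const l0) simp
  moreover have "\<forall>\<^sub>F B in at_top. w / (1 + of_real (inverse B) * w) = damp B w"
  proof (rule eventually_mono [OF eventually_gt_at_top [of 0]])
    fix B :: real assume "0 < B"
    then show "w / (1 + of_real (inverse B) * w) = damp B w"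
      by (simp add: damp_def field_simps)
  qed
  ultimately show ?thesis by (simp add: Lim_transform_eventually)
qed

text \<open>The difference of the two sides of the inequality is the mass of the singular part of the
  boundary measure. It is obtained here from the lemma of Fatou applied to the damped
  functions.\<close>

lemma positive_real_part_integral:
  assumes hol: "g holomorphic_on upper_half_plane" and pos: "\<And>z. Im z > 0 \<Longrightarrow> Re (g z) \<ge> 0"
  shows "integrable cauchy_measure (\<lambda>x. Re (boundary_value g x))"
    "(LINT x|cauchy_measure. Re (boundary_value g x)) \<le> pi * Re (g \<i>)"
proof -
  have db: "AE x in cauchy_measure. 0 \<le> Re (boundary_value g x) \<and>
    (\<forall>B>0. boundary_value (\<lambda>z. damp B (g z)) x = damp B (boundary_value g x))"
    by (rule damp_boundary [OF hol pos])
  note [measurable] = boundary_value_measurable [OF hol]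
  have m [measurable]: "(\<lambda>x. damp B (boundary_value g x)) \<in> borel_measurable borel" for B
    unfolding damp_def by measurable
  define N where "N n = real (Suc n)" for n
  have N: "N n > 0" for n by (simp add: N_def)
  have Ntop: "filterlim N at_top sequentially"
    unfolding N_def by (rule filterlim_compose [OF filterlim_real_sequentially filterlim_Suc])
  have Nlim: "(\<lambda>n. damp (N n) w) \<longlonglongrightarrow> w" for w
    by (rule filterlim_compose [OF damp_at_top Ntop])
  have "(\<integral>\<^sup>+x. ennreal (Re (boundary_value g x)) \<partial>cauchy_measure)
      = (\<integral>\<^sup>+x. liminf (\<lambda>n. ennreal (Re (damp (N n) (boundary_value g x)))) \<partial>cauchy_measure)"
  proof (rule nn_integral_cong)
    fix x
    have "(\<lambda>n. ennreal (Re (damp (N n) (boundary_value g x)))) \<longlonglongrightarrow> ennreal (Re (boundary_value g x))"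
      by (intro tendsto_ennrealI tendsto_Re Nlim)
    then show "ennreal (Re (boundary_value g x)) = liminf (\<lambda>n. ennreal (Re (damp (N n) (boundary_value g x))))"
      by (rule lim_imp_Liminf [OF sequentially_bot, symmetric])
  qed
  also have "\<dots> \<le> liminf (\<lambda>n. \<integral>\<^sup>+x. ennreal (Re (damp (N n) (boundary_value g x))) \<partial>cauchy_measure)"
    by (rule nn_integral_liminf) measurable
  also have "\<dots> = liminf (\<lambda>n. ennreal (pi * Re (damp (N n) (g \<i>))))"
  proof -
    have "(\<integral>\<^sup>+x. ennreal (Re (damp (N n) (boundary_value g x))) \<partial>cauchy_measure) = ennreal (pi * Re (damp (N n) (g \<i>)))" for n
    proof -
      have mv: "integrable cauchy_measure (\<lambda>x. Re (damp (N n) (boundary_value g x)))"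
        "(LINT x|cauchy_measure. Re (damp (N n) (boundary_value g x))) = pi * Re (damp (N n) (g \<i>))"
        by (rule damp_mean_value [OF hol pos N]; assumption)+
      have "AE x in cauchy_measure. 0 \<le> Re (damp (N n) (boundary_value g x))"
        using db
        by (rule AE_mp, intro AE_I2 impI damp_bounds(7) N) simp
      then show ?thesis using nn_integral_eq_integral [OF mv(1)] mv(2) by simp
    qed
    then show ?thesis by simp
  qed
  also have "\<dots> = ennreal (pi * Re (g \<i>))"
    by (intro lim_imp_Liminf sequentially_bot tendsto_ennrealI tendsto_mult tendsto_const tendsto_Re Nlim)
  finally have nn: "(\<integral>\<^sup>+x. ennreal (Re (boundary_value g x)) \<partial>cauchy_measure) \<le> ennreal (pi * Re (g \<i>))" .
  have pos': "AE x in cauchy_measure. 0 \<le> Re (boundary_value g x)"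
    using db by (rule AE_mp) (auto intro!: AE_I2)
  show int: "integrable cauchy_measure (\<lambda>x. Re (boundary_value g x))"
    using nn by (intro integrableI_nonneg pos') (auto intro: le_less_trans)
  have "ennreal (LINT x|cauchy_measure. Re (boundary_value g x)) \<le> ennreal (pi * Re (g \<i>))"
    using nn nn_integral_eq_integral [OF int pos'] by simp
  then show "(LINT x|cauchy_measure. Re (boundary_value g x)) \<le> pi * Re (g \<i>)"
    using pos [of \<i>] by (subst (asm) ennreal_le_iff) auto
qed

section \<open>Absolutely continuous boundary measures\<close>

text \<open>The assumption \<open>full\<close> says that the positive harmonic function \<open>Re g\<close> is the Poisson
  integral of its boundary values, with no singular part. By the mean value formula the
  integral of \<open>Re (damp B g)\<close> tends to \<open>pi Re (g \<i>)\<close>; its part coming from \<open>Re g\<close> tends to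
  the integral of \<open>Re g\<close>, which is the same number, so nothing remains for the defect.\<close>

lemma defect_integral_tendsto_0:
  assumes hol: "g holomorphic_on upper_half_plane" and pos: "\<And>z. Im z > 0 \<Longrightarrow> Re (g z) \<ge> 0"
    and full: "(LINT x|cauchy_measure. Re (boundary_value g x)) = pi * Re (g \<i>)"
  shows "((\<lambda>B. LINT x|cauchy_measure. defect B (boundary_value g x)) \<longlongrightarrow> 0) at_top"
proof -
  have db: "AE x in cauchy_measure. 0 \<le> Re (boundary_value g x) \<and>
    (\<forall>B>0. boundary_value (\<lambda>z. damp B (g z)) x = damp B (boundary_value g x))"
    by (rule damp_boundary [OF hol pos])
  note [measurable] = boundary_value_measurable [OF hol]
  let ?L = "boundary_value g"
  define r where "r B x = B\<^sup>2 * Re (?L x) / (cmod (of_real B + ?L x))\<^sup>2" for B x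
  have pos': "AE x in cauchy_measure. 0 \<le> Re (?L x)"
    using db by (rule AE_mp) (auto intro!: AE_I2)
  have r_meas [measurable]: "r B \<in> borel_measurable borel" for B unfolding r_def by measurable
  have int: "integrable cauchy_measure (\<lambda>x. Re (?L x))"
    by (rule positive_real_part_integral [OF hol pos])
  have r_bd: "norm (r B x) \<le> Re (?L x)" if "B > 0" "0 \<le> Re (?L x)" for B x
  proof -
    have "B\<^sup>2 / (cmod (of_real B + ?L x))\<^sup>2 \<le> 1"
      using damp_denominator [OF that] that by (simp add: divide_le_eq power_mono)
    then have "B\<^sup>2 / (cmod (of_real B + ?L x))\<^sup>2 * Re (?L x) \<le> 1 * Re (?L x)"
      using that by (intro mult_right_mono) auto
    then show ?thesis using that by (simp add: r_def)
  qed
  have r_lim: "((\<lambda>B. LINT x|cauchy_measure. r B x) \<longlongrightarrow> (LINT x|cauchy_measure. Re (?L x))) at_top"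
  proof (rule integral_dominated_convergence_at_top [where w = "\<lambda>x. Re (?L x)"])
    show "\<forall>\<^sub>F B in at_top. AE x in cauchy_measure. norm (r B x) \<le> Re (?L x)"
      using eventually_gt_at_top [of 0]
    proof (rule eventually_mono)
      fix B :: real assume "0 < B"
      then show "AE x in cauchy_measure. norm (r B x) \<le> Re (?L x)"
        by (intro AE_mp [OF pos', OF AE_I2] impI r_bd)
    qed
    show "AE x in cauchy_measure. ((\<lambda>B. r B x) \<longlongrightarrow> Re (?L x)) at_top"
    proof (rule AE_I2)
      fix x
      have l0: "((\<lambda>B. of_real (inverse B) :: complex) \<longlongrightarrow> of_real 0) at_top"
        by (intro tendsto_of_real tendsto_inverse_0_at_top filterlim_ident)
      then have "((\<lambda>B. Re (?L x) / (cmod (1 + of_real (inverse B) * ?L x))\<^sup>2) \<longlongrightarrow> Re (?L x) / (cmod (1 + of_real 0 * ?L x))\<^sup>2) at_top"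
        by (intro tendsto_divide tendsto_add tendsto_mult tendsto_const tendsto_norm tendsto_power l0) simp
      moreover have "\<forall>\<^sub>F B in at_top. Re (?L x) / (cmod (1 + of_real (inverse B) * ?L x))\<^sup>2 = r B x"
      proof (rule eventually_mono [OF eventually_gt_at_top [of 0]])
        fix B :: real assume B: "0 < B"
        have "of_real B + ?L x = of_real B * (1 + of_real (inverse B) * ?L x)"
          using B by (simp add: field_simps)
        then have "cmod (of_real B + ?L x) = B * cmod (1 + of_real (inverse B) * ?L x)"
          using B by (simp only: norm_mult norm_of_real)
        then show "Re (?L x) / (cmod (1 + of_real (inverse B) * ?L x))\<^sup>2 = r B x"
          using B by (simp add: r_def power_mult_distrib)
      qed
      ultimately show "((\<lambda>B. r B x) \<longlongrightarrow> Re (?L x)) at_top" by (simp add: Lim_transform_eventually)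
    qed
  qed (use int in auto)
  have eq: "(LINT x|cauchy_measure. defect B (?L x)) = pi * Re (damp B (g \<i>)) - (LINT x|cauchy_measure. r B x)" if B: "B > 0" for B
  proof -
    have mv: "integrable cauchy_measure (\<lambda>x. Re (damp B (?L x)))"
      "(LINT x|cauchy_measure. Re (damp B (?L x))) = pi * Re (damp B (g \<i>))"
      by (rule damp_mean_value [OF hol pos B]; assumption)+
    have ir: "integrable cauchy_measure (r B)"
    proof (rule Bochner_Integration.integrable_bound [OF int])
      show "AE x in cauchy_measure. norm (r B x) \<le> norm (Re (?L x))"
        using pos'
      proof (rule AE_mp, intro AE_I2 impI)
        fix x assume "0 \<le> Re (?L x)"
        then show "norm (r B x) \<le> norm (Re (?L x))" using r_bd [OF B, of x] by simp
      qed
    qed simp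
    have dm: "(\<lambda>x. defect B (?L x)) \<in> borel_measurable borel" unfolding defect_def by measurable
    have "(LINT x|cauchy_measure. defect B (?L x)) = (LINT x|cauchy_measure. Re (damp B (?L x)) - r B x)"
    proof (rule integral_cong_AE)
      show "AE x in cauchy_measure. defect B (?L x) = Re (damp B (?L x)) - r B x"
        using pos' by (rule AE_mp) (auto intro!: AE_I2 simp: damp_bounds(4) [OF B] r_def)
      show "(\<lambda>x. Re (damp B (?L x)) - r B x) \<in> borel_measurable cauchy_measure"
        unfolding damp_def by measurable
    qed (use dm in simp)
    also have "\<dots> = (LINT x|cauchy_measure. Re (damp B (?L x))) - (LINT x|cauchy_measure. r B x)"
      by (rule Bochner_Integration.integral_diff [OF mv(1) ir])
    finally show ?thesis unfolding mv(2) .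
  qed
  have "((\<lambda>B. pi * Re (damp B (g \<i>)) - (LINT x|cauchy_measure. r B x)) \<longlongrightarrow> pi * Re (g \<i>) - pi * Re (g \<i>)) at_top"
    using r_lim unfolding full by (intro tendsto_intros damp_at_top)
  moreover have "\<forall>\<^sub>F B in at_top. pi * Re (damp B (g \<i>)) - (LINT x|cauchy_measure. r B x) = (LINT x|cauchy_measure. defect B (?L x))"
    by (rule eventually_mono [OF eventually_gt_at_top [of 0]]) (simp add: eq)
  ultimately show ?thesis by (simp add: Lim_transform_eventually)
qed

section \<open>A-integrals of conjugate functions\<close>

text \<open>\<open>F\<close> stands for a kernel times the imaginary part of \<open>l\<close>, and \<open>G\<close> for the same with
  \<open>damp B l\<close> in place of \<open>l\<close>. If \<open>cmod l > B\<close>, then both terms are at most a multiple of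
  \<open>B\<close>, hence of the defect. If \<open>cmod l \<le> B\<close>, then the difference is quadratic in \<open>l\<close>, except
  when \<open>F\<close> is truncated, and then \<open>cmod l\<close> is of the order of \<open>B\<close>.\<close>

lemma truncation_bound:
  assumes B: "B > 0" and l: "Re l \<ge> 0" and b: "b \<ge> 0" and C: "C \<ge> 0"
    and F: "cmod F \<le> C * cmod l" and G: "cmod G \<le> C * cmod (damp B l)"
    and FG: "cmod (F - G) \<le> C * cmod (l - damp B l)"
  shows "cmod ((if b \<le> cmod F \<and> cmod F \<le> B then F else 0) - G) \<le> b + 4 * (1 + C + C\<^sup>2) * defect B l"
proof -
  note d = damp_bounds [OF B l] and low = defect_lower_bounds [OF B l]
  define q where "q = defect B l"
  have q: "0 \<le> q" using d(5) by (simp add: q_def)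
  have K: "4 * (1 + C + C\<^sup>2) * q = 4 * q + C * (4 * q) + C\<^sup>2 * (4 * q)" by (simp add: algebra_simps)
  have nn: "0 \<le> C * (4 * q)" "0 \<le> C\<^sup>2 * (4 * q)" using q C by auto
  have main: "cmod ((if cmod F \<le> B then F else 0) - G) \<le> 4 * (1 + C + C\<^sup>2) * q"
  proof (cases "B < cmod l")
    case True
    have "cmod G \<le> C * B" using G d(1) C by (meson mult_left_mono order_trans)
    also have "\<dots> \<le> C * (4 * q)" using low(1) [OF True] C by (intro mult_left_mono) (auto simp: q_def)
    finally have "cmod G \<le> C * (4 * q)" .
    moreover have "cmod (if cmod F \<le> B then F else 0) \<le> 4 * q" using low(1) [OF True] q B by (auto simp: q_def)
    ultimately show ?thesis using norm_triangle_ineq4 [of "if cmod F \<le> B then F else 0" G] nn unfolding K by linarith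
  next
    case False
    then have lq: "(cmod l)\<^sup>2 / B \<le> 4 * q" using low(2) by (simp add: q_def)
    show ?thesis
    proof (cases "cmod F \<le> B")
      case True
      have "cmod (F - G) \<le> C * ((cmod l)\<^sup>2 / B)" using FG d(3) C by (meson mult_left_mono order_trans)
      also have "\<dots> \<le> C * (4 * q)" using lq C by (intro mult_left_mono)
      finally have "cmod (F - G) \<le> C * (4 * q)" .
      moreover have eq: "(if cmod F \<le> B then F else 0) - G = F - G" using True by simp
      ultimately show ?thesis using nn q unfolding K eq by linarith
    next
      case F': False
      have "cmod G \<le> C * cmod l" using G d(2) C by (meson mult_left_mono order_trans)
      also have "\<dots> * B \<le> C * cmod l * (C * cmod l)" using F F' C by (intro mult_left_mono) auto
      finally have "cmod G * B \<le> C * cmod l * (C * cmod l)" using B by simp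
      then have "cmod G \<le> C\<^sup>2 * ((cmod l)\<^sup>2 / B)" using B by (simp add: pos_le_divide_eq power2_eq_square mult_ac)
      also have "\<dots> \<le> C\<^sup>2 * (4 * q)" using lq by (intro mult_left_mono) auto
      finally have "cmod G \<le> C\<^sup>2 * (4 * q)" .
      moreover have "cmod ((if cmod F \<le> B then F else 0) - G) = cmod G" using F' by simp
      ultimately show ?thesis using nn q unfolding K by linarith
    qed
  qed
  have "(if b \<le> cmod F \<and> cmod F \<le> B then F else 0) - G
      = ((if cmod F \<le> B then F else 0) - G) - (if \<not> b \<le> cmod F \<and> cmod F \<le> B then F else 0)" by simp
  then have "cmod ((if b \<le> cmod F \<and> cmod F \<le> B then F else 0) - G)
      \<le> cmod ((if cmod F \<le> B then F else 0) - G) + cmod (if \<not> b \<le> cmod F \<and> cmod F \<le> B then F else 0)"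
    by (metis norm_triangle_ineq4)
  moreover have "cmod (if \<not> b \<le> cmod F \<and> cmod F \<le> B then F else 0) \<le> b" using b by auto
  ultimately show ?thesis using main unfolding q_def by linarith
qed

lemma defect_measurable [measurable]:
  assumes [measurable]: "f \<in> borel_measurable M"
  shows "(\<lambda>x. defect B (f x)) \<in> borel_measurable M"
  unfolding defect_def by measurable

lemma damp_measurable [measurable]:
  assumes [measurable]: "f \<in> borel_measurable M"
  shows "(\<lambda>x. damp B (f x)) \<in> borel_measurable M"
  unfolding damp_def by measurable

text \<open>For the bounded function \<open>damp B g\<close> the Schwarz formula holds. Replacing the damped
  integrand by the integrand truncated to \<open>[b, B]\<close> costs at most \<open>b pi\<close> plus a multiple of
  the integral of the defect, which tends to zero. The defect likewise dominates \<open>t\<close> times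
  the indicator of the set where the integrand exceeds \<open>t\<close>, which is the condition of weak
  type.\<close>

lemma A_integral_boundary_Im:
  assumes hol: "g holomorphic_on upper_half_plane" and pos: "\<And>z. Im z > 0 \<Longrightarrow> Re (g z) \<ge> 0"
    and full: "(LINT x|cauchy_measure. Re (boundary_value g x)) = pi * Re (g \<i>)"
    and \<xi> [measurable]: "\<xi> \<in> borel_measurable borel"
    and \<xi>_eq: "AE x in cauchy_measure. \<xi> x = Im (boundary_value g x) / pi"
    and z: "Im z > 0"
  shows "has_A_integral cauchy_measure (\<lambda>t. schwarz_kernel z t * of_real (\<xi> t)) (g z - of_real (Re (g \<i>)))"
proof -
  note [measurable] = boundary_value_measurable [OF hol]
  let ?L = "boundary_value g"
  define F where "F t = schwarz_kernel z t * of_real (\<xi> t)" for t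
  \<comment> \<open>A bound for the kernel, enlarged so that \<open>C \<ge> 1\<close>.\<close>
  define C where "C = 1 + (cmod z + (1 + (cmod z)\<^sup>2) / Im z)"
  have C1: "1 \<le> C" using z by (simp add: C_def)
  have kC: "cmod (schwarz_kernel z t) \<le> C" for t using schwarz_kernel_bound [OF z, of t] by (simp add: C_def)
  define G where "G B t = schwarz_kernel z t * of_real (Im (damp B (?L t)) / pi)" for B t
  define q where "q B t = defect B (?L t)" for B t
  define I where "I B = (LINT x|cauchy_measure. q B x)" for B
  have F_meas [measurable]: "F \<in> borel_measurable borel" unfolding F_def by measurable
  have G_meas [measurable]: "G B \<in> borel_measurable borel" for B unfolding G_def by measurable
  have q_meas [measurable]: "q B \<in> borel_measurable borel" for B unfolding q_def by measurable
  have db: "AE x in cauchy_measure. 0 \<le> Re (?L x) \<and> (\<forall>B>0. boundary_value (\<lambda>z. damp B (g z)) x = damp B (?L x))"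
    by (rule damp_boundary [OF hol pos])
  have I0: "(I \<longlongrightarrow> 0) at_top"
    unfolding I_def q_def by (rule defect_integral_tendsto_0 [OF hol pos full])
  have good: "AE x in cauchy_measure. 0 \<le> Re (?L x) \<and> \<xi> x = Im (?L x) / pi"
    using db \<xi>_eq by (rule AE_mp [OF _ AE_mp]) (auto intro!: AE_I2)
  have pi1: "1 \<le> pi" using pi_gt3 by simp
  have ker: "cmod (schwarz_kernel z t * of_real (u / pi)) \<le> C * cmod w" if "\<bar>u\<bar> \<le> cmod w" for t u w
  proof -
    have "\<bar>u\<bar> / pi \<le> \<bar>u\<bar> / 1" using pi1 by (intro divide_left_mono) auto
    then have "\<bar>u / pi\<bar> \<le> cmod w" using that by simp
    then show ?thesis unfolding norm_mult norm_of_real using kC [of t] C1 by (intro mult_mono) auto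
  qed
  have FL: "cmod (F x) \<le> C * cmod (?L x)" if "\<xi> x = Im (?L x) / pi" for x
    unfolding F_def that by (intro ker abs_Im_le_cmod)
  have GL: "cmod (G B x) \<le> C * cmod (damp B (?L x))" for B x
    unfolding G_def by (intro ker abs_Im_le_cmod)
  have FGL: "cmod (F x - G B x) \<le> C * cmod (?L x - damp B (?L x))" if "\<xi> x = Im (?L x) / pi" for x B
  proof -
    have "F x - G B x = schwarz_kernel z x * of_real (Im (?L x - damp B (?L x)) / pi)"
      unfolding F_def G_def that by (simp add: algebra_simps diff_divide_distrib)
    also have "cmod \<dots> \<le> C * cmod (?L x - damp B (?L x))" by (intro ker abs_Im_le_cmod)
    finally show ?thesis .
  qed
  have q_int: "integrable cauchy_measure (q B)" if "B > 0" for B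
  proof (rule cauchy_bounded_integrable)
    show "AE x in cauchy_measure. norm (q B x) \<le> B"
      using good
    proof (rule AE_mp, intro AE_I2 impI)
      fix x assume "0 \<le> Re (?L x) \<and> \<xi> x = Im (?L x) / pi"
      then show "norm (q B x) \<le> B" using damp_bounds(5,6) [OF that, of "?L x"] by (simp add: q_def)
    qed
  qed measurable
  have tail: "ennreal t * emeasure cauchy_measure {x. t < norm (F x)} \<le> ennreal (4 * C * I (t / C))" if t: "t > 0" for t
  proof -
    define B where "B = t / C"
    have B: "B > 0" using t C1 by (simp add: B_def)
    have "ennreal t * emeasure cauchy_measure {x. t < norm (F x)} = (\<integral>\<^sup>+x. ennreal t * indicator {x. t < norm (F x)} x \<partial>cauchy_measure)"
      by (simp add: nn_integral_cmult)
    also have "\<dots> \<le> (\<integral>\<^sup>+x. ennreal (4 * C * q B x) \<partial>cauchy_measure)"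
    proof (rule nn_integral_mono_AE)
      show "AE x in cauchy_measure. ennreal t * indicator {x. t < norm (F x)} x \<le> ennreal (4 * C * q B x)"
        using good
      proof (rule AE_mp, intro AE_I2 impI)
        fix x assume x: "0 \<le> Re (?L x) \<and> \<xi> x = Im (?L x) / pi"
        show "ennreal t * indicator {x. t < norm (F x)} x \<le> ennreal (4 * C * q B x)"
        proof (cases "t < norm (F x)")
          case True
          then have "t < C * cmod (?L x)" using FL x by (auto intro: less_le_trans)
          then have "B < cmod (?L x)" using C1 by (simp add: B_def pos_divide_less_eq mult.commute)
          then have "B \<le> 4 * q B x" using defect_lower_bounds(1) [OF B] x by (simp add: q_def)
          then have "t \<le> 4 * C * q B x" using C1 by (simp add: B_def pos_divide_le_eq mult_ac)
          then show ?thesis using True by (simp add: ennreal_leI)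
        qed simp
      qed
    qed
    also have "\<dots> = ennreal (LINT x|cauchy_measure. 4 * C * q B x)"
    proof (rule nn_integral_eq_integral)
      show "integrable cauchy_measure (\<lambda>x. 4 * C * q B x)"
        by (intro Bochner_Integration.integrable_mult_right q_int B)
      show "AE x in cauchy_measure. 0 \<le> 4 * C * q B x"
        using good
      proof (rule AE_mp, intro AE_I2 impI)
        fix x assume "0 \<le> Re (?L x) \<and> \<xi> x = Im (?L x) / pi"
        then show "0 \<le> 4 * C * q B x" using damp_bounds(5) [OF B, of "?L x"] C1 by (simp add: q_def)
      qed
    qed
    also have "(LINT x|cauchy_measure. 4 * C * q B x) = 4 * C * I B"
      unfolding I_def by (rule integral_mult_right_zero)
    finally show ?thesis by (simp add: B_def)
  qed
  have "L1_w0 cauchy_measure F"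
    unfolding L1_w0_def
  proof (intro conjI)
    show "F \<in> borel_measurable cauchy_measure" by measurable
    have lim: "((\<lambda>t. ennreal (4 * C * I (t / C))) \<longlongrightarrow> ennreal (4 * C * 0)) at_top"
    proof -
      have "filterlim (\<lambda>t. inverse C * t) at_top at_top"
        by (rule filterlim_tendsto_pos_mult_at_top [OF tendsto_const _ filterlim_ident]) (use C1 in simp)
      then have "((\<lambda>t. I (inverse C * t)) \<longlongrightarrow> 0) at_top" by (rule filterlim_compose [OF I0])
      then have "((\<lambda>t. I (t / C)) \<longlongrightarrow> 0) at_top" by (simp add: field_simps)
      then show ?thesis by (intro tendsto_ennrealI tendsto_mult tendsto_const)
    qed
    show "((\<lambda>t. ennreal t * emeasure cauchy_measure {x \<in> space cauchy_measure. t < norm (F x)}) \<longlongrightarrow> 0) at_top"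
    proof (rule tendsto_sandwich [OF _ _ tendsto_const])
      show "\<forall>\<^sub>F t in at_top. ennreal t * emeasure cauchy_measure {x \<in> space cauchy_measure. t < norm (F x)} \<le> ennreal (4 * C * I (t / C))"
        using tail by (intro eventually_mono [OF eventually_gt_at_top [of 0]]) simp
      show "((\<lambda>t. ennreal (4 * C * I (t / C))) \<longlongrightarrow> 0) at_top" using lim by simp
    qed simp
    show "((\<lambda>t. ennreal t * emeasure cauchy_measure {x \<in> space cauchy_measure. t < norm (F x)}) \<longlongrightarrow> 0) (at_right 0)"
    proof (rule tendsto_sandwich [OF _ _ tendsto_const])
      show "\<forall>\<^sub>F t in at_right 0. ennreal t * emeasure cauchy_measure {x \<in> space cauchy_measure. t < norm (F x)} \<le> ennreal t * ennreal pi"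
        unfolding emeasure_cauchy_measure [symmetric]
        by (intro always_eventually allI mult_left_mono emeasure_mono) auto
      have "((\<lambda>t. ennreal (t * pi)) \<longlongrightarrow> ennreal (0 * pi)) (at_right 0)"
        by (intro tendsto_ennrealI tendsto_intros)
      then have "((\<lambda>t. ennreal (t * pi)) \<longlongrightarrow> 0) (at_right 0)" by simp
      then show "((\<lambda>t. ennreal t * ennreal pi) \<longlongrightarrow> 0) (at_right 0)"
        by (rule Lim_transform_eventually [OF _ eventually_mono [OF eventually_at_right_less]]) (simp_all add: ennreal_mult less_imp_le)
    qed simp
  qed
  moreover have "((\<lambda>(b, B). LINT x:{x \<in> space cauchy_measure. b \<le> norm (F x) \<and> norm (F x) \<le> B}|cauchy_measure. F x)
      \<longlongrightarrow> g z - of_real (Re (g \<i>))) (at_right 0 \<times>\<^sub>F at_top)"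
  proof -
    define K where "K = 4 * (1 + C + C\<^sup>2)"
    define T where "T b B = (LINT x:{x \<in> space cauchy_measure. b \<le> norm (F x) \<and> norm (F x) \<le> B}|cauchy_measure. F x)" for b B
    define H where "H B = damp B (g z) - of_real (Re (damp B (g \<i>)))" for B
    have close: "cmod (T b B - H B) \<le> b * pi + K * I B" if b: "b > 0" and B: "B > 0" for b B
    proof -
      let ?f = "\<lambda>x. if b \<le> norm (F x) \<and> norm (F x) \<le> B then F x else 0"
      have Teq: "T b B = (LINT x|cauchy_measure. ?f x)"
        unfolding T_def set_lebesgue_integral_def by (intro Bochner_Integration.integral_cong) auto
      have i1: "integrable cauchy_measure ?f"
        using B by (intro cauchy_bounded_integrable [where c = B]) (auto intro!: AE_I2)
      have Gb: "AE x in cauchy_measure. norm (G B x) \<le> C * B"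
        using good
      proof (rule AE_mp, intro AE_I2 impI)
        fix x assume "0 \<le> Re (?L x) \<and> \<xi> x = Im (?L x) / pi"
        then have "cmod (damp B (?L x)) \<le> B" using damp_bounds(1) [OF B] by simp
        then have "C * cmod (damp B (?L x)) \<le> C * B" using C1 by (intro mult_left_mono) auto
        then show "norm (G B x) \<le> C * B" using GL by (rule order_trans [rotated])
      qed
      have i2: "integrable cauchy_measure (G B)"
        by (rule cauchy_bounded_integrable [OF _ Gb]) measurable
      have dhol: "(\<lambda>z. damp B (g z)) holomorphic_on upper_half_plane" by (rule damp_holomorphic [OF hol pos B])
      note [measurable] = boundary_value_measurable [OF dhol]
      have sf: "(LINT t|cauchy_measure. schwarz_kernel z t * of_real (Im (boundary_value (\<lambda>z. damp B (g z)) t))) = pi * H B"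
        unfolding H_def by (rule schwarz_formula [OF dhol _ z]) (rule damp_bounds(1) [OF B pos])
      have "(LINT x|cauchy_measure. G B x)
          = (LINT t|cauchy_measure. schwarz_kernel z t * of_real (Im (boundary_value (\<lambda>z. damp B (g z)) t)) / pi)"
      proof (rule integral_cong_AE)
        show "AE x in cauchy_measure. G B x = schwarz_kernel z x * of_real (Im (boundary_value (\<lambda>z. damp B (g z)) x)) / pi"
          using db by (rule AE_mp) (use B in \<open>auto intro!: AE_I2 simp: G_def\<close>)
      qed measurable
      also have "\<dots> = H B" unfolding integral_divide_zero sf by simp
      finally have Heq: "H B = (LINT x|cauchy_measure. G B x)" by simp
      have "cmod (T b B - H B) = cmod (LINT x|cauchy_measure. ?f x - G B x)"
        unfolding Teq Heq by (simp add: Bochner_Integration.integral_diff [OF i1 i2])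
      also have "\<dots> \<le> (LINT x|cauchy_measure. cmod (?f x - G B x))" by (rule integral_norm_bound)
      also have "\<dots> \<le> (LINT x|cauchy_measure. b + K * q B x)"
      proof (rule integral_mono_AE)
        show "integrable cauchy_measure (\<lambda>x. cmod (?f x - G B x))"
          by (intro integrable_norm Bochner_Integration.integrable_diff i1 i2)
        show "integrable cauchy_measure (\<lambda>x. b + K * q B x)"
          by (intro Bochner_Integration.integrable_add Bochner_Integration.integrable_mult_right q_int B) simp
        show "AE x in cauchy_measure. cmod (?f x - G B x) \<le> b + K * q B x"
          using good
        proof (rule AE_mp, intro AE_I2 impI)
          fix x assume x: "0 \<le> Re (?L x) \<and> \<xi> x = Im (?L x) / pi"
          show "cmod (?f x - G B x) \<le> b + K * q B x"
            unfolding K_def q_def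
            by (rule truncation_bound [OF B]) (use x b C1 FL GL FGL in auto)
        qed
      qed
      also have "\<dots> = (LINT x|cauchy_measure. b) + (LINT x|cauchy_measure. K * q B x)"
        by (intro Bochner_Integration.integral_add Bochner_Integration.integrable_mult_right q_int B) simp
      also have "\<dots> = b * pi + K * I B"
        unfolding I_def integral_mult_right_zero LINT_const_cauchy_measure by simp
      finally show ?thesis .
    qed
    have Hlim: "(H \<longlongrightarrow> g z - of_real (Re (g \<i>))) at_top"
      unfolding H_def by (intro tendsto_intros damp_at_top)
    have "((\<lambda>(b, B). T b B - H B) \<longlongrightarrow> 0) (at_right 0 \<times>\<^sub>F at_top)"
    proof (rule Lim_null_comparison)
      show "\<forall>\<^sub>F p in at_right 0 \<times>\<^sub>F at_top. norm (case p of (b, B) \<Rightarrow> T b B - H B) \<le> fst p * pi + K * I (snd p)"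
      proof -
        have "\<forall>\<^sub>F p in at_right (0::real) \<times>\<^sub>F at_top. 0 < fst p \<and> 0 < (snd p :: real)"
          by (rule eventually_prodI [OF eventually_at_right_less eventually_gt_at_top, THEN eventually_mono]) auto
        then show ?thesis by (rule eventually_mono) (auto simp: close)
      qed
      have "((\<lambda>b::real. b) \<longlongrightarrow> 0) (at_right 0)" by (rule tendsto_ident_at)
      then have "((\<lambda>p. fst p) \<longlongrightarrow> 0) (at_right (0::real) \<times>\<^sub>F (at_top :: real filter))"
        by (rule filterlim_compose) (rule filterlim_fst)
      moreover have "((\<lambda>p. I (snd p)) \<longlongrightarrow> 0) (at_right (0::real) \<times>\<^sub>F (at_top :: real filter))"
        by (rule filterlim_compose [OF I0]) (rule filterlim_snd)
      ultimately have "((\<lambda>p. fst p * pi + K * I (snd p)) \<longlongrightarrow> 0 * pi + K * 0) (at_right 0 \<times>\<^sub>F at_top)"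
        by (intro tendsto_intros)
      then show "((\<lambda>p. fst p * pi + K * I (snd p)) \<longlongrightarrow> 0) (at_right 0 \<times>\<^sub>F at_top)" by simp
    qed
    moreover have "((\<lambda>p. H (snd p)) \<longlongrightarrow> g z - of_real (Re (g \<i>))) (at_right (0::real) \<times>\<^sub>F at_top)"
      by (rule filterlim_compose [OF Hlim]) (rule filterlim_snd)
    ultimately have "((\<lambda>p. (case p of (b, B) \<Rightarrow> T b B - H B) + H (snd p)) \<longlongrightarrow> 0 + (g z - of_real (Re (g \<i>)))) (at_right 0 \<times>\<^sub>F at_top)"
      by (rule tendsto_add)
    then show ?thesis by (simp add: T_def case_prod_unfold)
  qed
  ultimately show ?thesis unfolding has_A_integral_def F_def by blast
qed

lemma has_A_integral_unique:
  assumes "has_A_integral M f I" "has_A_integral M f J"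
  shows "I = J"
proof -
  have "at_right (0::real) \<times>\<^sub>F (at_top :: real filter) \<noteq> bot"
    by (simp add: prod_filter_eq_bot)
  then show ?thesis using assms tendsto_unique unfolding has_A_integral_def by blast
qed

lemma A_integral_eq: "has_A_integral M f I \<Longrightarrow> A_integral M f = I"
  unfolding A_integral_def using has_A_integral_unique by (intro the_equality) auto

section \<open>Logarithms of functions with real part at least one\<close>

text \<open>The derivative of the logarithm is bounded by \<open>1\<close> on \<open>Re z \<ge> 1\<close>.\<close>

lemma cmod_Ln_le:
  assumes "1 \<le> Re p"
  shows "cmod (Ln p) \<le> cmod (p - 1)"
proof -
  have "cmod (Ln p - Ln 1) \<le> 1 * cmod (p - 1)"
  proof (rule field_differentiable_bound [where S = "{z. 1 \<le> Re z}" and f' = inverse])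
    show "convex {z. 1 \<le> Re z}" by (rule convex_halfspace_Re_ge)
    fix z assume z: "z \<in> {z. 1 \<le> Re z}"
    then have "z \<notin> \<real>\<^sub>\<le>\<^sub>0" by (auto simp: complex_nonpos_Reals_iff)
    then show "(Ln has_field_derivative inverse z) (at z within {z. 1 \<le> Re z})"
      by (rule has_field_derivative_at_within [OF has_field_derivative_Ln])
    have "1 \<le> cmod z" using z complex_Re_le_cmod [of z] by simp
    then show "cmod (inverse z) \<le> 1" by (simp add: norm_inverse inverse_le_1_iff)
  qed (use assms in auto)
  then show ?thesis by simp
qed

text \<open>The boundary measure of \<open>Re (Ln p)\<close> has no singular part. The function \<open>- Ln (1 / p + \<epsilon>)\<close> is
  bounded because \<open>Re (1 / p) \<ge> 0\<close>, so it satisfies the mean value formula, and its real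
  part is at most that of \<open>Ln p\<close>. As \<open>\<epsilon>\<close> tends to zero its value at \<open>\<i>\<close> tends to that of
  \<open>Ln p\<close>.\<close>

lemma log_full_mean_value:
  assumes hol: "p holomorphic_on upper_half_plane" and p1: "\<And>z. Im z > 0 \<Longrightarrow> 1 \<le> Re (p z)"
  shows "pi * Re (Ln (p \<i>)) \<le> (LINT x|cauchy_measure. Re (boundary_value (\<lambda>z. Ln (p z)) x))"
proof -
  define l where "l z = Ln (p z)" for z
  have nz: "p z \<noteq> 0" "p z \<notin> \<real>\<^sub>\<le>\<^sub>0" if "Im z > 0" for z
    using p1 [OF that] by (auto simp: complex_nonpos_Reals_iff)
  have lhol: "l holomorphic_on upper_half_plane"
    unfolding l_def using nz by (intro holomorphic_on_Ln' hol) (auto simp: upper_half_plane_def)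
  have Rel: "Re (l z) = ln (cmod (p z))" if "Im z > 0" for z using nz [OF that] by (simp add: l_def)
  have pge: "1 \<le> cmod (p z)" if "Im z > 0" for z
    using p1 [OF that] complex_Re_le_cmod [of "p z"] by simp
  have lpos: "0 \<le> Re (l z)" if "Im z > 0" for z using Rel [OF that] pge [OF that] by simp
  define u where "u n z = - Ln (1 / p z + of_real (inverse (real (Suc n))))" for n z
  have e: "0 < inverse (real (Suc n))" "inverse (real (Suc n)) \<le> 1" for n by (simp_all add: inverse_le_1_iff)
  have rp: "0 \<le> Re (1 / p z)" if "Im z > 0" for z
    using p1 [OF that] by (simp add: Re_divide)
  have rq: "inverse (real (Suc n)) \<le> Re (1 / p z + of_real (inverse (real (Suc n))))" if "Im z > 0" for n z
    using rp [OF that] by (simp only: plus_complex.sel Re_complex_of_real)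
  have uhol: "u n holomorphic_on upper_half_plane" for n
    unfolding u_def
  proof (intro holomorphic_on_minus holomorphic_on_Ln' holomorphic_on_add holomorphic_on_divide holomorphic_on_const hol)
    fix z assume "z \<in> upper_half_plane"
    then have z: "Im z > 0" by (simp add: upper_half_plane_def)
    show "p z \<noteq> 0" by (rule nz [OF z])
    show "1 / p z + of_real (inverse (real (Suc n))) \<notin> \<real>\<^sub>\<le>\<^sub>0"
      unfolding complex_nonpos_Reals_iff using less_le_trans [OF e(1) rq [OF z]] by (metis not_less)
  qed
  have ubd: "cmod (u n z) \<le> (ln 2 + ln (real (Suc n))) + pi" if z: "Im z > 0" for n z
  proof -
    define q where "q = 1 / p z + of_real (inverse (real (Suc n)))"
    have q1: "inverse (real (Suc n)) \<le> cmod q"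
      using rq [OF z, of n] complex_Re_le_cmod [of q] by (simp add: q_def)
    have c1: "cmod (1 / p z) \<le> 1" using pge [OF z] by (simp add: norm_divide divide_le_eq)
    have c2: "cmod (of_real (inverse (real (Suc n)))) \<le> 1"
      unfolding norm_of_real using e [of n] by (simp only: abs_of_pos)
    have "cmod q \<le> cmod (1 / p z) + cmod (of_real (inverse (real (Suc n))))"
      unfolding q_def by (rule norm_triangle_ineq)
    also have "\<dots> \<le> 1 + 1"
      using c1 c2 by (rule add_mono)
    finally have q2: "cmod q \<le> 2" by simp
    have qpos: "0 < cmod q" by (rule less_le_trans [OF e(1) q1])
    have "ln (inverse (real (Suc n))) \<le> ln (cmod q)"
      using q1 qpos by (subst ln_le_cancel_iff [OF e(1)])
    then have l1: "- ln (real (Suc n)) \<le> ln (cmod q)" by (simp add: ln_inverse del: of_nat_Suc)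
    have l2: "ln (cmod q) \<le> ln 2" using q2 qpos by (subst ln_le_cancel_iff) auto
    have n0: "0 \<le> ln (real (Suc n))" "0 \<le> ln (2::real)" by (auto intro: ln_ge_zero)
    have "cmod (Ln q) \<le> \<bar>Re (Ln q)\<bar> + \<bar>Im (Ln q)\<bar>" by (rule cmod_le)
    also have "\<bar>Re (Ln q)\<bar> \<le> ln 2 + ln (real (Suc n))"
    proof -
      have "Re (Ln q) = ln (cmod q)" using qpos by simp
      then show ?thesis using l1 l2 n0 by linarith
    qed
    also have "\<bar>Im (Ln q)\<bar> \<le> pi"
      using qpos mpi_less_Im_Ln [of q] Im_Ln_le_pi [of q] by (auto simp: abs_le_iff)
    finally show ?thesis by (simp add: u_def q_def)
  qed
  have ule: "Re (u n z) \<le> Re (l z)" if z: "Im z > 0" for n z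
  proof -
    define q where "q = 1 / p z + of_real (inverse (real (Suc n)))"
    have "0 < Re q" unfolding q_def by (rule less_le_trans [OF e(1) rq [OF z]])
    then have q0: "q \<noteq> 0" by auto
    have "Re (1 / p z) \<le> Re q" "Im q = Im (1 / p z)"
      unfolding q_def plus_complex.sel Re_complex_of_real Im_complex_of_real using e(1) [of n] by linarith+
    then have "(cmod (1 / p z))\<^sup>2 \<le> (cmod q)\<^sup>2"
      unfolding cmod_power2 using rp [OF z] power_mono [of "Re (1 / p z)" "Re q" 2] by simp
    then have "cmod (1 / p z) \<le> cmod q" by (rule power2_le_imp_le) simp
    then have "inverse (cmod (p z)) \<le> cmod q" by (simp add: norm_divide inverse_eq_divide)
    then have "ln (inverse (cmod (p z))) \<le> ln (cmod q)"
      using nz [OF z] by (subst ln_le_cancel_iff) (auto intro: less_le_trans simp: q0)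
    then have "- ln (cmod (p z)) \<le> ln (cmod q)" using nz [OF z] by (simp add: ln_inverse)
    then show ?thesis using q0 by (simp add: u_def q_def Rel [OF z])
  qed
  have lb: "AE x in cauchy_measure. ((\<lambda>e. l (Complex x e)) \<longlongrightarrow> boundary_value l x) (at_right 0)"
    by (rule AE_cauchy_measure, rule positive_real_part_boundary [OF lhol lpos])
  have le: "pi * Re (u n \<i>) \<le> (LINT x|cauchy_measure. Re (boundary_value l x))" for n
  proof -
    have ub: "AE x in cauchy_measure. ((\<lambda>e. u n (Complex x e)) \<longlongrightarrow> boundary_value (u n) x) (at_right 0)"
      by (rule AE_cauchy_measure, rule boundary_value_bounded_AE [OF uhol ubd])
    note [measurable] = boundary_value_measurable [OF uhol [of n]]
    have "pi * Re (u n \<i>) = (LINT x|cauchy_measure. Re (boundary_value (u n) x))"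
      by (rule mean_value_formula [OF uhol ubd, symmetric])
    also have "\<dots> \<le> (LINT x|cauchy_measure. Re (boundary_value l x))"
    proof (rule integral_mono_AE)
      have "AE x in cauchy_measure. norm (Re (boundary_value (u n) x)) \<le> (ln 2 + ln (real (Suc n))) + pi"
        using ub
      proof (rule AE_mp, intro AE_I2 impI)
        fix x assume "((\<lambda>e. u n (Complex x e)) \<longlongrightarrow> boundary_value (u n) x) (at_right 0)"
        then have "cmod (boundary_value (u n) x) \<le> (ln 2 + ln (real (Suc n))) + pi"
          by (rule tendsto_upperbound [OF tendsto_norm eventually_mono [OF eventually_at_right_less]])
             (rule ubd, simp_all)
        then show "norm (Re (boundary_value (u n) x)) \<le> (ln 2 + ln (real (Suc n))) + pi"
          unfolding real_norm_def by (rule order_trans [OF abs_Re_le_cmod])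
      qed
      then show "integrable cauchy_measure (\<lambda>x. Re (boundary_value (u n) x))"
        by (intro cauchy_bounded_integrable) measurable
      show "integrable cauchy_measure (\<lambda>x. Re (boundary_value l x))"
        by (rule positive_real_part_integral(1) [OF lhol lpos])
      show "AE x in cauchy_measure. Re (boundary_value (u n) x) \<le> Re (boundary_value l x)"
        using ub lb
      proof (rule AE_mp [OF _ AE_mp], intro AE_I2 impI)
        fix x assume cu: "((\<lambda>e. u n (Complex x e)) \<longlongrightarrow> boundary_value (u n) x) (at_right 0)"
          and cl: "((\<lambda>e. l (Complex x e)) \<longlongrightarrow> boundary_value l x) (at_right 0)"
        show "Re (boundary_value (u n) x) \<le> Re (boundary_value l x)"
          by (rule tendsto_le [OF trivial_limit_at_right_real tendsto_Re [OF cl] tendsto_Re [OF cu]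
                eventually_mono [OF eventually_at_right_less]])
             (rule ule, simp)
      qed
    qed
    finally show ?thesis .
  qed
  have "(\<lambda>n. pi * Re (u n \<i>)) \<longlonglongrightarrow> pi * Re (- Ln (1 / p \<i> + of_real 0))"
  proof -
    have "1 / p \<i> + of_real 0 \<notin> \<real>\<^sub>\<le>\<^sub>0"
    proof -
      have "0 < Re (1 / p \<i>)" using p1 [of \<i>] by (simp add: Re_divide) (smt (verit) divide_pos_pos sum_power2_gt_zero_iff)
      then show ?thesis by (auto simp: complex_nonpos_Reals_iff)
    qed
    then show ?thesis
      unfolding u_def
      by (intro tendsto_mult tendsto_const tendsto_Re tendsto_minus tendsto_Ln tendsto_add tendsto_of_real LIMSEQ_inverse_real_of_nat)
  qed
  moreover have "Re (- Ln (1 / p \<i> + of_real 0)) = Re (l \<i>)"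
    using nz [of \<i>] Rel [of \<i>] by (simp add: norm_divide ln_div)
  ultimately have "(\<lambda>n. pi * Re (u n \<i>)) \<longlonglongrightarrow> pi * Re (l \<i>)" by (simp only:)
  then have "pi * Re (l \<i>) \<le> (LINT x|cauchy_measure. Re (boundary_value l x))"
    by (rule LIMSEQ_le_const2) (use le in blast)
  then show ?thesis unfolding l_def .
qed

section \<open>Infinite products of functions with real part at least one\<close>

lemma open_upper_half_plane: "open upper_half_plane"
  unfolding upper_half_plane_def by (rule open_halfspace_Im_gt)

lemma convex_upper_half_plane: "convex upper_half_plane"
  unfolding upper_half_plane_def by (rule convex_halfspace_Im_gt)

text \<open>The mean value formula passes from the summands to the sum: all real parts are nonnegative,
  so the boundary value of the sum dominates that of each partial sum, which gives one
  inequality, and the other one holds for every function with nonnegative real part.\<close>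

lemma log_product:
  fixes p :: "nat \<Rightarrow> complex \<Rightarrow> complex"
  assumes hol: "\<And>k. p k holomorphic_on upper_half_plane"
    and p1: "\<And>k z. Im z > 0 \<Longrightarrow> 1 \<le> Re (p k z)"
    and pv: "\<And>k z. Im z > 0 \<Longrightarrow> cmod (p k z - 1) \<le> v k / Im z"
    and v: "summable v"
  defines "L \<equiv> \<lambda>z. \<Sum>k. Ln (p k z)"
  shows log_product_summable: "\<And>z. Im z > 0 \<Longrightarrow> summable (\<lambda>k. Ln (p k z))"
    and log_product_bound: "\<And>z. Im z > 0 \<Longrightarrow> cmod (L z) \<le> suminf v / Im z"
    and log_product_holomorphic: "L holomorphic_on upper_half_plane"
    and log_product_Re_nonneg: "\<And>z. Im z > 0 \<Longrightarrow> 0 \<le> Re (L z)"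
    and log_product_exp: "\<And>z. Im z > 0 \<Longrightarrow> (\<lambda>N. \<Prod>k<N. p k z) \<longlonglongrightarrow> exp (L z)"
    and log_product_mean_value: "(LINT x|cauchy_measure. Re (boundary_value L x)) = pi * Re (L \<i>)"
proof -
  define l where "l k z = Ln (p k z)" for k z
  have lb: "cmod (l k z) \<le> v k / Im z" if "Im z > 0" for k z
    unfolding l_def using cmod_Ln_le [OF p1 [OF that]] pv [OF that] by (rule order_trans)
  have nz: "p k z \<noteq> 0" "p k z \<notin> \<real>\<^sub>\<le>\<^sub>0" if "Im z > 0" for k z
    using p1 [OF that, of k] by (auto simp: complex_nonpos_Reals_iff)
  have lhol: "l k holomorphic_on upper_half_plane" for k
    unfolding l_def using nz by (intro holomorphic_on_Ln' hol) (auto simp: upper_half_plane_def)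
  have lpos: "0 \<le> Re (l k z)" if "Im z > 0" for k z
    using nz [OF that, of k] p1 [OF that, of k] complex_Re_le_cmod [of "p k z"] by (simp add: l_def)
  have vs: "summable (\<lambda>k. v k / y)" for y by (rule summable_divide [OF v])
  have nsum: "summable (\<lambda>k. cmod (l k z))" if "Im z > 0" for z
    by (rule summable_comparison_test' [OF vs [of "Im z"], of 0]) (simp add: lb [OF that])
  show sum: "summable (\<lambda>k. Ln (p k z))" if "Im z > 0" for z
    using nsum [OF that] unfolding l_def by (rule summable_norm_cancel)
  show bound: "cmod (L z) \<le> suminf v / Im z" if "Im z > 0" for z
  proof -
    have "cmod (L z) \<le> (\<Sum>k. cmod (l k z))"
      unfolding L_def l_def [symmetric] by (rule summable_norm [OF nsum [OF that]])
    also have "\<dots> \<le> (\<Sum>k. v k / Im z)"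
      by (rule suminf_le [OF lb [OF that] nsum [OF that] vs])
    also have "\<dots> = suminf v / Im z" by (rule suminf_divide [OF v])
    finally show ?thesis .
  qed
  show Lhol: "L holomorphic_on upper_half_plane"
  proof (rule holomorphic_uniform_sequence [OF open_upper_half_plane])
    show "(\<lambda>z. \<Sum>k<n. l k z) holomorphic_on upper_half_plane" for n
      by (intro holomorphic_on_sum lhol)
    fix z assume "z \<in> upper_half_plane"
    then have z: "Im z > 0" by (simp add: upper_half_plane_def)
    have im: "Im z / 2 \<le> Im w" if "w \<in> cball z (Im z / 2)" for w
    proof -
      have "\<bar>Im (z - w)\<bar> \<le> Im z / 2" using that abs_Im_le_cmod [of "z - w"] by (simp add: dist_norm)
      then show ?thesis unfolding minus_complex.sel by linarith
    qed
    have sub: "cball z (Im z / 2) \<subseteq> upper_half_plane"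
    proof
      fix w assume "w \<in> cball z (Im z / 2)"
      then show "w \<in> upper_half_plane" using im [of w] z by (simp add: upper_half_plane_def)
    qed
    have "uniform_limit (cball z (Im z / 2)) (\<lambda>n x. \<Sum>k<n. l k x) (\<lambda>x. \<Sum>k. l k x) sequentially"
    proof (rule Weierstrass_m_test)
      show "summable (\<lambda>k. v k / (Im z / 2))" by (rule vs)
      fix k w assume w: "w \<in> cball z (Im z / 2)"
      have iw: "0 < Im w" using im [OF w] z by simp
      have v0: "0 \<le> v k" using order_trans [OF norm_ge_zero lb [of \<i> k]] by simp
      have "cmod (l k w) \<le> v k / Im w" by (rule lb [OF iw])
      also have "\<dots> \<le> v k / (Im z / 2)" using im [OF w] z v0 iw by (intro divide_left_mono) auto
      finally show "norm (l k w) \<le> v k / (Im z / 2)" .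
    qed
    then have "uniform_limit (cball z (Im z / 2)) (\<lambda>n x. \<Sum>k<n. l k x) L sequentially"
      unfolding L_def l_def .
    then show "\<exists>d>0. cball z d \<subseteq> upper_half_plane \<and> uniform_limit (cball z d) (\<lambda>n z. \<Sum>k<n. l k z) L sequentially"
      using sub z by (intro exI [of _ "Im z / 2"]) simp
  qed
  have ReL: "Re (L z) = (\<Sum>k. Re (l k z))" "summable (\<lambda>k. Re (l k z))" if "Im z > 0" for z
  proof -
    have s: "(\<lambda>k. l k z) sums L z" unfolding L_def l_def by (rule summable_sums [OF sum [OF that]])
    show "Re (L z) = (\<Sum>k. Re (l k z))" "summable (\<lambda>k. Re (l k z))"
      using sums_Re [OF s] by (auto simp: sums_iff)
  qed
  have part: "(\<Sum>k<N. Re (l k z)) \<le> Re (L z)" if "Im z > 0" for z N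
    unfolding ReL(1) [OF that] using ReL(2) [OF that] lpos [OF that] by (intro sum_le_suminf) auto
  show Lpos: "0 \<le> Re (L z)" if "Im z > 0" for z using part [OF that, of 0] by simp
  show "(\<lambda>N. \<Prod>k<N. p k z) \<longlonglongrightarrow> exp (L z)" if "Im z > 0" for z
  proof -
    have "(\<lambda>N. \<Sum>k<N. l k z) \<longlonglongrightarrow> L z"
      unfolding L_def l_def by (rule summable_LIMSEQ [OF sum [OF that]])
    then have "(\<lambda>N. exp (\<Sum>k<N. l k z)) \<longlonglongrightarrow> exp (L z)" by (rule tendsto_exp)
    moreover have "exp (\<Sum>k<N. l k z) = (\<Prod>k<N. p k z)" for N
      using nz [OF that] by (simp add: exp_sum l_def)
    ultimately show ?thesis by simp
  qed
  have bl: "AE x in cauchy_measure. \<forall>k. ((\<lambda>e. l k (Complex x e)) \<longlongrightarrow> boundary_value (l k) x) (at_right 0)"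
    unfolding AE_all_countable
    by (intro allI AE_cauchy_measure, rule positive_real_part_boundary [OF lhol lpos])
  have bL: "AE x in cauchy_measure. ((\<lambda>e. L (Complex x e)) \<longlongrightarrow> boundary_value L x) (at_right 0)"
    by (rule AE_cauchy_measure, rule positive_real_part_boundary [OF Lhol Lpos])
  have ik: "integrable cauchy_measure (\<lambda>x. Re (boundary_value (l k) x))" for k
    by (rule positive_real_part_integral(1) [OF lhol lpos])
  have iL: "integrable cauchy_measure (\<lambda>x. Re (boundary_value L x))"
    by (rule positive_real_part_integral(1) [OF Lhol Lpos])
  have low: "(\<Sum>k<N. pi * Re (l k \<i>)) \<le> (LINT x|cauchy_measure. Re (boundary_value L x))" for N
  proof -
    have "(\<Sum>k<N. pi * Re (l k \<i>)) \<le> (\<Sum>k<N. LINT x|cauchy_measure. Re (boundary_value (l k) x))"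
      unfolding l_def by (intro sum_mono log_full_mean_value [OF hol p1])
    also have "\<dots> = (LINT x|cauchy_measure. (\<Sum>k<N. Re (boundary_value (l k) x)))"
      by (rule Bochner_Integration.integral_sum [symmetric]) (rule ik)
    also have "\<dots> \<le> (LINT x|cauchy_measure. Re (boundary_value L x))"
    proof (rule integral_mono_AE [OF _ iL])
      show "integrable cauchy_measure (\<lambda>x. \<Sum>k<N. Re (boundary_value (l k) x))"
        by (intro Bochner_Integration.integrable_sum ik)
      show "AE x in cauchy_measure. (\<Sum>k<N. Re (boundary_value (l k) x)) \<le> Re (boundary_value L x)"
        using bl bL
      proof (rule AE_mp [OF _ AE_mp], intro AE_I2 impI)
        fix x assume c: "\<forall>k. ((\<lambda>e. l k (Complex x e)) \<longlongrightarrow> boundary_value (l k) x) (at_right 0)"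
          and cL: "((\<lambda>e. L (Complex x e)) \<longlongrightarrow> boundary_value L x) (at_right 0)"
        have cs: "((\<lambda>e. \<Sum>k<N. Re (l k (Complex x e))) \<longlongrightarrow> (\<Sum>k<N. Re (boundary_value (l k) x))) (at_right 0)"
          using c by (intro tendsto_sum tendsto_Re) blast
        show "(\<Sum>k<N. Re (boundary_value (l k) x)) \<le> Re (boundary_value L x)"
          by (rule tendsto_le [OF trivial_limit_at_right_real tendsto_Re [OF cL] cs
                eventually_mono [OF eventually_at_right_less]])
             (rule part, simp)
      qed
    qed
    finally show ?thesis .
  qed
  have "(\<lambda>N. \<Sum>k<N. pi * Re (l k \<i>)) \<longlonglongrightarrow> pi * Re (L \<i>)"
    unfolding sum_distrib_left [symmetric] ReL(1) [of \<i>, simplified]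
    by (intro tendsto_mult tendsto_const summable_LIMSEQ ReL(2)) simp
  then have "pi * Re (L \<i>) \<le> (LINT x|cauchy_measure. Re (boundary_value L x))"
    by (rule LIMSEQ_le_const2) (use low in blast)
  moreover have "(LINT x|cauchy_measure. Re (boundary_value L x)) \<le> pi * Re (L \<i>)"
    by (rule positive_real_part_integral(2) [OF Lhol Lpos])
  ultimately show "(LINT x|cauchy_measure. Re (boundary_value L x)) = pi * Re (L \<i>)" by simp
qed

text \<open>Two branches differ by a function whose exponential is \<open>1\<close>, so its derivative vanishes; the
  constant is determined at \<open>\<i> \<infinity>\<close>.\<close>

lemma normalized_log_unique:
  assumes L: "is_normalized_log f L" and M: "is_normalized_log f M" and z: "z \<in> upper_half_plane"
  shows "L z = M z"
proof -
  define h where "h z = L z - M z" for z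
  have hhol: "h holomorphic_on upper_half_plane"
    unfolding h_def using L M by (intro holomorphic_on_diff) (auto simp: is_normalized_log_def)
  have e1: "exp (h z) = 1" if "z \<in> upper_half_plane" for z
    using L M that unfolding is_normalized_log_def by (simp add: h_def exp_diff) (metis exp_not_eq_zero divide_self)
  have "\<exists>c. \<forall>z\<in>upper_half_plane. h z = c"
  proof (rule has_field_derivative_zero_constant [OF convex_upper_half_plane])
    fix z assume z: "z \<in> upper_half_plane"
    have hd: "(h has_field_derivative deriv h z) (at z)"
      by (rule holomorphic_derivI [OF hhol open_upper_half_plane z])
    then have "((\<lambda>z. exp (h z)) has_field_derivative exp (h z) * deriv h z) (at z)"
      by (rule DERIV_fun_exp)
    moreover have "((\<lambda>z. exp (h z)) has_field_derivative 0) (at z)"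
    proof (rule has_field_derivative_transform_within_open [OF _ open_upper_half_plane z])
      show "((\<lambda>z. 1) has_field_derivative 0) (at z)" by (rule DERIV_const)
    qed (simp add: e1)
    ultimately have "exp (h z) * deriv h z = 0" by (rule DERIV_unique)
    then have "deriv h z = 0" by simp
    then show "(h has_field_derivative 0) (at z within upper_half_plane)"
      using hd by (simp add: has_field_derivative_at_within)
  qed
  then obtain c where c: "\<And>z. z \<in> upper_half_plane \<Longrightarrow> h z = c" by blast
  have "((\<lambda>y. h (Complex 0 y)) \<longlongrightarrow> 0 - 0) at_top"
    unfolding h_def using L M by (intro tendsto_diff) (auto simp: is_normalized_log_def)
  moreover have "\<forall>\<^sub>F y in at_top. h (Complex 0 y) = c"
    by (rule eventually_mono [OF eventually_gt_at_top [of 0]]) (simp add: c)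
  ultimately have "((\<lambda>y::real. c) \<longlongrightarrow> 0) at_top"
    by (simp add: Lim_transform_eventually tendsto_cong)
  then have "c = 0" by (simp add: tendsto_const_iff)
  then show ?thesis using c [OF z] by (simp add: h_def)
qed

text \<open>The analytic half of the theorem: it holds for every product of holomorphic factors with
  real part at least one that approach \<open>1\<close> summably fast. The normalised logarithm of the
  product is the sum \<open>L\<close> of the principal logarithms, and the constant \<open>cmod (f \<i>)\<close> is
  \<open>exp (Re (L \<i>))\<close>.\<close>

theorem A_integral_representation:
  fixes p :: "nat \<Rightarrow> complex \<Rightarrow> complex"
  assumes hol: "\<And>k. p k holomorphic_on upper_half_plane"
    and p1: "\<And>k z. Im z > 0 \<Longrightarrow> 1 \<le> Re (p k z)"
    and pv: "\<And>k z. Im z > 0 \<Longrightarrow> cmod (p k z - 1) \<le> v k / Im z"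
    and v: "summable v"
    and f: "\<And>z. Im z > 0 \<Longrightarrow> (\<lambda>N. \<Prod>k<N. p k z) \<longlonglongrightarrow> f z"
  shows "(AE x in lborel. \<exists>l. ((\<lambda>e. Im (normalized_log f (Complex x e))) \<longlongrightarrow> l) (at_right 0)) \<and>
    (\<forall>z\<in>upper_half_plane.
      A_integrable cauchy_measure (\<lambda>x. (1 + z * of_real x) / (of_real x - z) * of_real (1 / pi * boundary_arg f x)) \<and>
      f z = of_real (norm (f \<i>)) *
        exp (A_integral cauchy_measure (\<lambda>x. (1 + z * of_real x) / (of_real x - z) * of_real (1 / pi * boundary_arg f x))))"
proof -
  define L where "L z = (\<Sum>k. Ln (p k z))" for z
  note lp = log_product [of p v, OF hol p1 pv v, folded L_def]
  have Lhol: "L holomorphic_on upper_half_plane" by (rule lp(3))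
  have Lpos: "0 \<le> Re (L z)" if "Im z > 0" for z
    by (rule lp(4)) (use that in auto)
  have full: "(LINT x|cauchy_measure. Re (boundary_value L x)) = pi * Re (L \<i>)" by (rule lp(6))
  have fL: "exp (L z) = f z" if "Im z > 0" for z
    by (rule LIMSEQ_unique [OF lp(5) f [OF that]]) (use that in auto)
  have nL: "is_normalized_log f L"
    unfolding is_normalized_log_def
  proof (intro conjI ballI)
    show "exp (L z) = f z" if "z \<in> upper_half_plane" for z
      using fL that by (simp add: upper_half_plane_def)
    show "((\<lambda>y. L (Complex 0 y)) \<longlongrightarrow> 0) at_top"
    proof (rule Lim_null_comparison)
      show "\<forall>\<^sub>F y in at_top. norm (L (Complex 0 y)) \<le> suminf v / y"
      proof (rule eventually_mono [OF eventually_gt_at_top [of 0]])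
        fix y :: real assume "0 < y"
        moreover have "norm (L (Complex 0 y)) \<le> suminf v / Im (Complex 0 y)"
          by (rule lp(2)) (use \<open>0 < y\<close> in auto)
        ultimately show "norm (L (Complex 0 y)) \<le> suminf v / y" by simp
      qed
      show "((\<lambda>y. suminf v / y) \<longlongrightarrow> 0) at_top"
        by (rule tendsto_divide_0 [OF tendsto_const filterlim_at_top_imp_at_infinity [OF filterlim_ident]])
    qed
  qed (rule Lhol)
  define N where "N = normalized_log f"
  have nN: "is_normalized_log f N"
    unfolding N_def normalized_log_def by (rule someI [of "is_normalized_log f"], rule nL)
  have NL: "N z = L z" if "Im z > 0" for z
    using normalized_log_unique [OF nN nL] that by (simp add: upper_half_plane_def)
  have Nhol: "N holomorphic_on upper_half_plane" using nN by (simp add: is_normalized_log_def)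
  have bL: "AE x in lborel. ((\<lambda>e. L (Complex x e)) \<longlongrightarrow> boundary_value L x) (at_right 0)"
    by (rule positive_real_part_boundary [OF Lhol Lpos])
  have lim: "((\<lambda>e. Im (N (Complex x e))) \<longlongrightarrow> Im (boundary_value L x)) (at_right 0)"
    if "((\<lambda>e. L (Complex x e)) \<longlongrightarrow> boundary_value L x) (at_right 0)" for x
  proof (rule Lim_transform_eventually [OF tendsto_Im [OF that]])
    show "\<forall>\<^sub>F e in at_right 0. Im (L (Complex x e)) = Im (N (Complex x e))"
      by (rule eventually_mono [OF eventually_at_right_less]) (simp add: NL)
  qed
  define \<xi> where "\<xi> x = 1 / pi * boundary_arg f x" for x
  have \<xi>_meas: "\<xi> \<in> borel_measurable borel"
  proof -
    have "(\<lambda>x. Lim (at_right 0) (\<lambda>e. Im (N (Complex x e)))) \<in> borel_measurable borel"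
    proof (rule borel_measurable_vertical_Lim)
      show "(\<lambda>x. Im (N (Complex x e))) \<in> borel_measurable borel" if "e > 0" for e
      proof -
        have [measurable]: "(\<lambda>x. N (Complex x e)) \<in> borel_measurable borel"
          using that by (intro holomorphic_line_measurable [OF Nhol]) simp
        show ?thesis by measurable
      qed
      show "continuous_on {0<..} (\<lambda>e. Im (N (Complex x e)))" for x
        by (intro continuous_on_Im continuous_on_vertical Nhol)
    qed
    then show ?thesis unfolding \<xi>_def boundary_arg_def N_def by (intro borel_measurable_times) simp_all
  qed
  have \<xi>_eq: "AE x in cauchy_measure. \<xi> x = Im (boundary_value L x) / pi"
  proof (rule AE_mp [OF AE_cauchy_measure [OF bL]], intro AE_I2 impI)
    fix x assume "((\<lambda>e. L (Complex x e)) \<longlongrightarrow> boundary_value L x) (at_right 0)"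
    then show "\<xi> x = Im (boundary_value L x) / pi"
      unfolding \<xi>_def boundary_arg_def N_def [symmetric]
      by (subst tendsto_Lim [OF trivial_limit_at_right_real lim]) simp_all
  qed
  show ?thesis
  proof (intro conjI ballI)
    show "AE x in lborel. \<exists>l. ((\<lambda>e. Im (normalized_log f (Complex x e))) \<longlongrightarrow> l) (at_right 0)"
      using bL
    proof (rule AE_mp, intro AE_I2 impI)
      fix x assume "((\<lambda>e. L (Complex x e)) \<longlongrightarrow> boundary_value L x) (at_right 0)"
      from lim [OF this] show "\<exists>l. ((\<lambda>e. Im (normalized_log f (Complex x e))) \<longlongrightarrow> l) (at_right 0)"
        unfolding N_def by blast
    qed
    fix z assume "z \<in> upper_half_plane"
    then have z: "Im z > 0" by (simp add: upper_half_plane_def)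
    have A: "has_A_integral cauchy_measure (\<lambda>x. (1 + z * of_real x) / (of_real x - z) * of_real (1 / pi * boundary_arg f x)) (L z - of_real (Re (L \<i>)))"
      using A_integral_boundary_Im [OF Lhol Lpos full \<xi>_meas \<xi>_eq z]
      unfolding schwarz_kernel_def \<xi>_def .
    then show "A_integrable cauchy_measure (\<lambda>x. (1 + z * of_real x) / (of_real x - z) * of_real (1 / pi * boundary_arg f x))"
      unfolding A_integrable_def by blast
    have "norm (f \<i>) = exp (Re (L \<i>))" using fL [of \<i>] by (metis norm_exp_eq_Re imaginary_unit.sel(2) zero_less_one)
    then have "of_real (norm (f \<i>)) * exp (L z - of_real (Re (L \<i>))) = f z"
      using fL [OF z] by (simp add: exp_diff exp_of_real)
    then show "f z = of_real (norm (f \<i>)) *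
        exp (A_integral cauchy_measure (\<lambda>x. (1 + z * of_real x) / (of_real x - z) * of_real (1 / pi * boundary_arg f x)))"
      unfolding A_integral_eq [OF A] by simp
  qed
qed

section \<open>The integral representation of the perturbation determinant\<close>

theorem theorem4p2:
  fixes D :: "'h::complex_hilbert set"
    and H0 H V :: "'h \<Rightarrow> 'h"
  assumes separable: "\<exists>S::'h set. countable S \<and> closure S = UNIV"
    and H0: "maximal_accumulative D H0"
    and V: "positive_op V" "trace_class V"
    and H: "\<And>h. h \<in> D \<Longrightarrow> H h = H0 h - \<i> *\<^sub>C V h"
  shows "(AE lam in lborel. \<exists>l. ((\<lambda>\<epsilon>. Im (normalized_log (perturbation_det D H H0) (Complex lam \<epsilon>)))
            \<longlongrightarrow> l) (at_right 0)) \<and>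
    (\<forall>z\<in>upper_half_plane.
       A_integrable cauchy_measure
         (\<lambda>lam. (1 + z * of_real lam) / (of_real lam - z) * of_real (spectral_shift D H H0 lam)) \<and>
       perturbation_det D H H0 z =
         of_real (norm (perturbation_det D H H0 \<i>)) *
         exp (A_integral cauchy_measure
           (\<lambda>lam. (1 + z * of_real lam) / (of_real lam - z) * of_real (spectral_shift D H H0 lam))))"
proof -
  obtain u :: "nat \<Rightarrow> 'h" where su: "summable (\<lambda>n. (norm (u n))\<^sup>2)"
    and u: "\<And>f. f \<in> some_basis \<Longrightarrow> \<exists>N0. \<forall>N\<ge>N0. \<forall>x. cinner (V x) f = (\<Sum>n<N. cinner x (u n) * cinner (u n) f)"
    using rank_one_decomposition [OF V] by blast
  define R where "R = resolvent_op D H0"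
  have R: "dissipative_resolvent z (R z)" if "Im z > 0" for z
    unfolding R_def by (rule resolvent_properties(4) [OF H0 that])
  have det: "(\<lambda>N. \<Prod>k<N. pivot (R z) u k) \<longlonglongrightarrow> perturbation_det D H H0 z" if z: "Im z > 0" for z
    unfolding perturbation_det_def R_def [symmetric]
  proof (rule fredholm_det_product [OF R [OF z] z su u])
    fix x
    have "H (R z x) = H0 (R z x) - \<i> *\<^sub>C V (R z x)"
      unfolding R_def by (intro H resolvent_properties(1) [OF H0 z])
    moreover have "H0 (R z x) - z *\<^sub>C R z x = x"
      unfolding R_def by (rule resolvent_properties(2) [OF H0 z])
    ultimately show "(H (R z x) - z *\<^sub>C R z x) - x = (- \<i>) *\<^sub>C V (R z x)"
      by (simp add: scaleC_minus_left algebra_simps)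
  qed
  show ?thesis
    unfolding spectral_shift_def
  proof (rule A_integral_representation [where p = "\<lambda>k z. pivot (R z) u k", OF _ _ _ su det])
    show "(\<lambda>z. pivot (R z) u k) holomorphic_on upper_half_plane" for k
      by (rule pivot_holomorphic [OF _ R]) (unfold R_def, rule resolvent_weakly_holomorphic [OF H0])
    show "1 \<le> Re (pivot (R z) u k)" if "Im z > 0" for k z by (rule pivot_properties(1) [OF R [OF that] that])
    show "cmod (pivot (R z) u k - 1) \<le> (norm (u k))\<^sup>2 / Im z" if "Im z > 0" for k z
      by (rule pivot_properties(2) [OF R [OF that] that])
  qed
qed

end
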